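(* Let $\Lambda$ be a self-injective Artin algebra and let $C$ be a finitely generated $\Lambda$-module without projective direct summands. Consider the short exact sequence $0\to C\xrightarrow{e}I\to\Omega^{-1}(C)\to0$ in which $e$ is the injective envelope. Then $\tau_{\mathcal H}(C\xrightarrow{e}I)\simeq(\nu P_1\xrightarrow{\nu(\pi)}\nu\Omega(C))$, where the exact sequence $0\to\Omega^2(C)\to P_1\xrightarrow{\pi}\Omega(C)\to0$ defines the projective cover $\pi$ of $\Omega(C)$. In particular, if $p:P\to\tau\Omega^{-1}(C)$ is the projective cover, then $\tau_{\mathcal H}(C\xrightarrow{e}I)\simeq(P\xrightarrow{p}\tau\Omega^{-1}(C))$.
   Context: $\mathrm{mod}\,\Lambda$ is the category of finitely generated left $\Lambda$-modules; $\tau$ is the Auslander-Reiten translation in $\mathrm{mod}\,\Lambda$, $\nu=D\,\mathrm{Hom}_\Lambda(-,\Lambda)$ the Nakayama functor ($D$ the standard duality), $\Omega^i$ the $i$-th syzygy (kernels of successive projective covers) and $\Omega^{-i}$ the $i$-th cosyzygy (cokernels of successive injective envelopes). The morphism category $\mathcal H=H(\Lambda)$ has as objects the maps $(A\xrightarrow{f}B)$ in $\mathrm{mod}\,\Lambda$; a morphism from $(A\xrightarrow{f}B)$ to $(C\xrightarrow{g}D)$ is a pair $(h_1,h_2)$ with $h_1:A\to C$, $h_2:B\to D$, $gh_1=h_2f$. It is equivalent to the category of finitely generated modules over $T_2(\Lambda)=\begin{pmatrix}\Lambda&\Lambda\\0&\Lambda\end{pmatrix}$, and $\tau_{\mathcal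 H}$ denotes the Auslander-Reiten translation ($D\,\mathrm{Tr}$) of $\mathcal H$, computed from minimal projective presentations in $\mathcal H$. *)

theory Defs
  imports "HOL-Algebra.Module" "HOL-Algebra.Ideal"
begin

section \<open>Modules over a not necessarily commutative ring\<close>

text \<open>
  The library locale \<open>module\<close> requires a commutative ring of scalars. Over a general ring we
  keep the library record and the library notion of submodule; the record fields \<open>mult\<close> and
  \<open>one\<close>, which the record inherits from rings, carry no information for a module.
  Right modules occur only as intermediate objects and use the same record, with \<open>r \<odot> x\<close>
  denoting \<open>x r\<close>; they are left modules over the opposite ring.
\<close>

locale left_module = R?: ring + M?: abelian_group M for M (structure) +
  assumes smult_closed [simp, intro]:
      "\<lbrakk>a \<in> carrier R; x \<in> carrier M\<rbrakk> \<Longrightarrow> a \<odot>\<^bsub>M\<^esub> x \<in> carrier M"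
    and smult_l_distr:
      "\<lbrakk>a \<in> carrier R; b \<in> carrier R; x \<in> carrier M\<rbrakk> \<Longrightarrow>
      (a \<oplus> b) \<odot>\<^bsub>M\<^esub> x = a \<odot>\<^bsub>M\<^esub> x \<oplus>\<^bsub>M\<^esub> b \<odot>\<^bsub>M\<^esub> x"
    and smult_r_distr:
      "\<lbrakk>a \<in> carrier R; x \<in> carrier M; y \<in> carrier M\<rbrakk> \<Longrightarrow>
      a \<odot>\<^bsub>M\<^esub> (x \<oplus>\<^bsub>M\<^esub> y) = a \<odot>\<^bsub>M\<^esub> x \<oplus>\<^bsub>M\<^esub> a \<odot>\<^bsub>M\<^esub> y"
    and smult_assoc1:
      "\<lbrakk>a \<in> carrier R; b \<in> carrier R; x \<in> carrier M\<rbrakk> \<Longrightarrow>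
      (a \<otimes> b) \<odot>\<^bsub>M\<^esub> x = a \<odot>\<^bsub>M\<^esub> (b \<odot>\<^bsub>M\<^esub> x)"
    and smult_one [simp]:
      "x \<in> carrier M \<Longrightarrow> \<one> \<odot>\<^bsub>M\<^esub> x = x"

definition mk_module ::
  "'m set \<Rightarrow> 'm \<Rightarrow> ('m \<Rightarrow> 'm \<Rightarrow> 'm) \<Rightarrow> ('r \<Rightarrow> 'm \<Rightarrow> 'm) \<Rightarrow> ('r, 'm) module" where
  "mk_module X z pl s =
     \<lparr>carrier = X, mult = undefined, one = undefined, zero = z, add = pl, smult = s\<rparr>"

definition regular_module :: "('r, 'x) ring_scheme \<Rightarrow> ('r, 'r) module" where
  "regular_module R = mk_module (carrier R) \<zero>\<^bsub>R\<^esub> (add R) (mult R)"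

definition module_hom ::
  "('r, 'x) ring_scheme \<Rightarrow> ('r, 'm) module \<Rightarrow> ('r, 'n) module \<Rightarrow> ('m \<Rightarrow> 'n) set" where
  "module_hom R M N = {f \<in> carrier M \<rightarrow> carrier N.
     (\<forall>x\<in>carrier M. \<forall>y\<in>carrier M. f (x \<oplus>\<^bsub>M\<^esub> y) = f x \<oplus>\<^bsub>N\<^esub> f y) \<and>
     (\<forall>r\<in>carrier R. \<forall>x\<in>carrier M. f (r \<odot>\<^bsub>M\<^esub> x) = r \<odot>\<^bsub>N\<^esub> f x)}"

definition module_iso ::
  "('r, 'x) ring_scheme \<Rightarrow> ('r, 'm) module \<Rightarrow> ('r, 'n) module \<Rightarrow> ('m \<Rightarrow> 'n) set" where
  "module_iso R M N = {f \<in> module_hom R M N. bij_betw f (carrier M) (carrier N)}"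

definition ker_set :: "('r, 'm) module \<Rightarrow> ('m \<Rightarrow> 'n) \<Rightarrow> ('r, 'n) module \<Rightarrow> 'm set" where
  "ker_set M f N = {x \<in> carrier M. f x = \<zero>\<^bsub>N\<^esub>}"

definition ker_module :: "('r, 'm) module \<Rightarrow> ('m \<Rightarrow> 'n) \<Rightarrow> ('r, 'n) module \<Rightarrow> ('r, 'm) module" where
  "ker_module M f N = M\<lparr>carrier := ker_set M f N\<rparr>"

definition quot_module :: "('r, 'm) module \<Rightarrow> 'm set \<Rightarrow> ('r, 'm set) module" where
  "quot_module M N = mk_module (a_rcosets\<^bsub>M\<^esub> N) N (\<lambda>X Y. X <+>\<^bsub>M\<^esub> Y)
     (\<lambda>r X. \<Union>x\<in>X. N +>\<^bsub>M\<^esub> (r \<odot>\<^bsub>M\<^esub> x))"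

definition fin_gen :: "('r, 'x) ring_scheme \<Rightarrow> ('r, 'm) module \<Rightarrow> bool" where
  "fin_gen R M \<longleftrightarrow> (\<exists>A. finite A \<and> A \<subseteq> carrier M \<and>
     (\<forall>N. submodule N R M \<and> A \<subseteq> N \<longrightarrow> N = carrier M))"

definition fg_module :: "('r, 'x) ring_scheme \<Rightarrow> ('r, 'm) module \<Rightarrow> bool" where
  "fg_module R M \<longleftrightarrow> left_module R M \<and> fin_gen R M"

text \<open>
  Projectivity and injectivity are meant in the category of finitely generated modules. HOL cannot
  quantify over all types inside a definition, so the test modules have carriers of type
  \<open>'r list\<close>. This loses nothing: choosing for each element of a finitely generated module a tuple
  of coefficients with respect to a fixed finite generating family embeds its carrier into
  \<open>'r list\<close>, so every finitely generated module is isomorphic to one of the test modules.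
\<close>

definition projective :: "('r, 'x) ring_scheme \<Rightarrow> ('r, 'm) module \<Rightarrow> bool" where
  "projective R P \<longleftrightarrow> (\<forall>(M :: ('r, 'r list) module) (N :: ('r, 'r list) module) g f.
     fg_module R M \<and> fg_module R N \<and>
     g \<in> module_hom R M N \<and> g ` carrier M = carrier N \<and> f \<in> module_hom R P N \<longrightarrow>
     (\<exists>h\<in>module_hom R P M. \<forall>x\<in>carrier P. g (h x) = f x))"

definition injective :: "('r, 'x) ring_scheme \<Rightarrow> ('r, 'm) module \<Rightarrow> bool" where
  "injective R I \<longleftrightarrow> (\<forall>(M :: ('r, 'r list) module) (N :: ('r, 'r list) module) g f.
     fg_module R M \<and> fg_module R N \<and>
     g \<in> module_hom R M N \<and> inj_on g (carrier M) \<and> f \<in> module_hom R M I \<longrightarrow>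
     (\<exists>h\<in>module_hom R N I. \<forall>x\<in>carrier M. h (g x) = f x))"

definition superfluous :: "('r, 'x) ring_scheme \<Rightarrow> ('r, 'm) module \<Rightarrow> 'm set \<Rightarrow> bool" where
  "superfluous R M K \<longleftrightarrow> submodule K R M \<and>
     (\<forall>N. submodule N R M \<and> N <+>\<^bsub>M\<^esub> K = carrier M \<longrightarrow> N = carrier M)"

definition essential :: "('r, 'x) ring_scheme \<Rightarrow> ('r, 'm) module \<Rightarrow> 'm set \<Rightarrow> bool" where
  "essential R M K \<longleftrightarrow> submodule K R M \<and>
     (\<forall>N. submodule N R M \<and> N \<inter> K = {\<zero>\<^bsub>M\<^esub>} \<longrightarrow> N = {\<zero>\<^bsub>M\<^esub>})"

definition projective_cover ::
  "('r, 'x) ring_scheme \<Rightarrow> ('r, 'p) module \<Rightarrow> ('p \<Rightarrow> 'm) \<Rightarrow> ('r, 'm) module \<Rightarrow> bool" where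
  "projective_cover R P p M \<longleftrightarrow> fg_module R P \<and> projective R P \<and>
     p \<in> module_hom R P M \<and> p ` carrier P = carrier M \<and> superfluous R P (ker_set P p M)"

definition injective_envelope ::
  "('r, 'x) ring_scheme \<Rightarrow> ('r, 'm) module \<Rightarrow> ('m \<Rightarrow> 'i) \<Rightarrow> ('r, 'i) module \<Rightarrow> bool" where
  "injective_envelope R M e I \<longleftrightarrow> fg_module R I \<and> injective R I \<and>
     e \<in> module_hom R M I \<and> inj_on e (carrier M) \<and> essential R I (e ` carrier M)"

definition no_projective_summands :: "('r, 'x) ring_scheme \<Rightarrow> ('r, 'm) module \<Rightarrow> bool" where
  "no_projective_summands R M \<longleftrightarrow> (\<forall>X Y. submodule X R M \<and> submodule Y R M \<and>
     X \<inter> Y = {\<zero>\<^bsub>M\<^esub>} \<and> X <+>\<^bsub>M\<^esub> Y = carrier M \<and> projective R (M\<lparr>carrier := X\<rparr>) \<longrightarrow>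
     X = {\<zero>\<^bsub>M\<^esub>})"

section \<open>Artin algebras and the standard duality\<close>

definition artinian_cring :: "('k, 'x) ring_scheme \<Rightarrow> bool" where
  "artinian_cring k \<longleftrightarrow> cring k \<and>
     (\<forall>I :: nat \<Rightarrow> 'k set. (\<forall>n. ideal (I n) k \<and> I (Suc n) \<subseteq> I n) \<longrightarrow>
        (\<exists>n. \<forall>m\<ge>n. I m = I n))"

text \<open>
  An algebra over \<open>k\<close> is a single record, carrying both the ring structure and the \<open>k\<close>-module
  structure. (The library locale \<open>algebra\<close> is restricted to commutative algebras.)
\<close>

definition artin_algebra :: "('k, 'x) ring_scheme \<Rightarrow> ('k, 'r) module \<Rightarrow> bool" where
  "artin_algebra k \<Lambda> \<longleftrightarrow> artinian_cring k \<and> ring \<Lambda> \<and> module k \<Lambda> \<and> fin_gen k \<Lambda> \<and>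
     (\<forall>c\<in>carrier k. \<forall>x\<in>carrier \<Lambda>. \<forall>y\<in>carrier \<Lambda>.
        (c \<odot>\<^bsub>\<Lambda>\<^esub> x) \<otimes>\<^bsub>\<Lambda>\<^esub> y = c \<odot>\<^bsub>\<Lambda>\<^esub> (x \<otimes>\<^bsub>\<Lambda>\<^esub> y) \<and>
        x \<otimes>\<^bsub>\<Lambda>\<^esub> (c \<odot>\<^bsub>\<Lambda>\<^esub> y) = c \<odot>\<^bsub>\<Lambda>\<^esub> (x \<otimes>\<^bsub>\<Lambda>\<^esub> y))"

definition self_injective :: "('r, 'x) ring_scheme \<Rightarrow> bool" where
  "self_injective \<Lambda> \<longleftrightarrow> injective \<Lambda> (regular_module \<Lambda>)"

definition jacobson_radical :: "('k, 'x) ring_scheme \<Rightarrow> 'k set" where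
  "jacobson_radical k = carrier k \<inter> \<Inter>{I. maximalideal I k}"

definition dualizing_module :: "('k, 'x) ring_scheme \<Rightarrow> ('k, 'j) module \<Rightarrow> bool" where
  "dualizing_module k J \<longleftrightarrow>
     (\<exists>\<iota>. injective_envelope k (quot_module (regular_module k) (jacobson_radical k)) \<iota> J)"

text \<open>A module over a \<open>k\<close>-algebra, left or right, viewed as a \<open>k\<close>-module.\<close>

definition restrict_scalars :: "('k, 'r) module \<Rightarrow> ('r, 'm) module \<Rightarrow> ('k, 'm) module" where
  "restrict_scalars \<Lambda> M =
     mk_module (carrier M) \<zero>\<^bsub>M\<^esub> (add M) (\<lambda>c x. (c \<odot>\<^bsub>\<Lambda>\<^esub> \<one>\<^bsub>\<Lambda>\<^esub>) \<odot>\<^bsub>M\<^esub> x)"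

text \<open>
  The standard duality \<open>Hom\<^sub>k(-, J)\<close>. It turns left modules into right modules and vice versa;
  in both cases the scalar \<open>r\<close> sends \<open>\<phi>\<close> to the map that first applies \<open>r\<close>.
\<close>

definition dual ::
  "('k, 'x) ring_scheme \<Rightarrow> ('k, 'j) module \<Rightarrow> ('k, 'r) module \<Rightarrow> ('r, 'm) module \<Rightarrow>
   ('r, 'm \<Rightarrow> 'j) module" where
  "dual k J \<Lambda> M = mk_module
     (module_hom k (restrict_scalars \<Lambda> M) J \<inter> extensional (carrier M))
     (\<lambda>x\<in>carrier M. \<zero>\<^bsub>J\<^esub>)
     (\<lambda>\<phi> \<psi>. \<lambda>x\<in>carrier M. \<phi> x \<oplus>\<^bsub>J\<^esub> \<psi> x)
     (\<lambda>r \<phi>. \<lambda>x\<in>carrier M. \<phi> (r \<odot>\<^bsub>M\<^esub> x))"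

text \<open>The right module \<open>Hom\<^sub>\<Lambda>(M, \<Lambda>)\<close>, with \<open>(f r) x = (f x) r\<close>.\<close>

definition star :: "('r, 'x) ring_scheme \<Rightarrow> ('r, 'm) module \<Rightarrow> ('r, 'm \<Rightarrow> 'r) module" where
  "star \<Lambda> M = mk_module
     (module_hom \<Lambda> M (regular_module \<Lambda>) \<inter> extensional (carrier M))
     (\<lambda>x\<in>carrier M. \<zero>\<^bsub>\<Lambda>\<^esub>)
     (\<lambda>f g. \<lambda>x\<in>carrier M. f x \<oplus>\<^bsub>\<Lambda>\<^esub> g x)
     (\<lambda>r f. \<lambda>x\<in>carrier M. f x \<otimes>\<^bsub>\<Lambda>\<^esub> r)"

text \<open>
  The map \<open>h \<mapsto> h \<circ> f\<close> induced by \<open>f\<close> from \<open>M\<close>. It is the action on morphisms of both contravariant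
  functors \<open>dual\<close> and \<open>star\<close>; its domain is the module of extensional maps out of the codomain of
  \<open>f\<close>.
\<close>

definition pullback :: "('r, 'm) module \<Rightarrow> ('m \<Rightarrow> 'n) \<Rightarrow> ('n \<Rightarrow> 'y) \<Rightarrow> ('m \<Rightarrow> 'y)" where
  "pullback M f h = (\<lambda>x\<in>carrier M. h (f x))"

definition nakayama ::
  "('k, 'x) ring_scheme \<Rightarrow> ('k, 'j) module \<Rightarrow> ('k, 'r) module \<Rightarrow> ('r, 'm) module \<Rightarrow>
   ('r, ('m \<Rightarrow> 'r) \<Rightarrow> 'j) module" where
  "nakayama k J \<Lambda> M = dual k J \<Lambda> (star \<Lambda> M)"

definition nakayama_map ::
  "('k, 'r) module \<Rightarrow> ('r, 'm) module \<Rightarrow> ('m \<Rightarrow> 'n) \<Rightarrow> ('r, 'n) module \<Rightarrow>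
   (('m \<Rightarrow> 'r) \<Rightarrow> 'j) \<Rightarrow> (('n \<Rightarrow> 'r) \<Rightarrow> 'j)" where
  "nakayama_map \<Lambda> M f N = pullback (star \<Lambda> N) (pullback M f)"

section \<open>The Auslander--Reiten translation\<close>

definition min_proj_presentation ::
  "('r, 'x) ring_scheme \<Rightarrow> ('r, 'p1) module \<Rightarrow> ('p1 \<Rightarrow> 'p0) \<Rightarrow> ('r, 'p0) module \<Rightarrow>
   ('p0 \<Rightarrow> 'm) \<Rightarrow> ('r, 'm) module \<Rightarrow> bool" where
  "min_proj_presentation R P1 d P0 q M \<longleftrightarrow>
     projective_cover R P0 q M \<and> projective_cover R P1 d (ker_module P0 q M)"

text \<open>The cokernel of \<open>Hom\<^sub>\<Lambda>(d, \<Lambda>)\<close> for a map \<open>d\<close> from \<open>P1\<close> to \<open>P0\<close>.\<close>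

definition transpose ::
  "('r, 'x) ring_scheme \<Rightarrow> ('r, 'p1) module \<Rightarrow> ('p1 \<Rightarrow> 'p0) \<Rightarrow> ('r, 'p0) module \<Rightarrow>
   ('r, ('p1 \<Rightarrow> 'r) set) module" where
  "transpose \<Lambda> P1 d P0 = quot_module (star \<Lambda> P1) (pullback P1 d ` carrier (star \<Lambda> P0))"

text \<open>
  \<open>D Tr M\<close>, computed from a chosen minimal projective presentation. By the remark on test modules
  above, the presentation may be taken with carriers in \<open>'r list\<close>; the result does not depend on
  the choice up to isomorphism.
\<close>

definition ar_translate ::
  "('k, 'x) ring_scheme \<Rightarrow> ('k, 'j) module \<Rightarrow> ('k, 'r) module \<Rightarrow> ('r, 'm) module \<Rightarrow>
   ('r, ('r list \<Rightarrow> 'r) set \<Rightarrow> 'j) module" where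
  "ar_translate k J \<Lambda> M =
     (case (SOME (P1 :: ('r, 'r list) module, d, P0 :: ('r, 'r list) module).
              \<exists>q. min_proj_presentation \<Lambda> P1 d P0 q M) of
        (P1, d, P0) \<Rightarrow> dual k J \<Lambda> (transpose \<Lambda> P1 d P0))"

section \<open>The morphism category\<close>

text \<open>\<open>(A, f, B)\<close> stands for the object \<open>f : A \<rightarrow> B\<close>.\<close>

type_synonym ('r, 'a, 'b) mor_obj = "('r, 'a) module \<times> ('a \<Rightarrow> 'b) \<times> ('r, 'b) module"

definition mor_isomorphic ::
  "('r, 'x) ring_scheme \<Rightarrow> ('r, 'a, 'b) mor_obj \<Rightarrow> ('r, 'c, 'd) mor_obj \<Rightarrow> bool" where
  "mor_isomorphic \<Lambda> = (\<lambda>(A, f, B) (C, g, D).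
     \<exists>h1\<in>module_iso \<Lambda> A C. \<exists>h2\<in>module_iso \<Lambda> B D. \<forall>a\<in>carrier A. g (h1 a) = h2 (f a))"

text \<open>The algebra of upper triangular matrices; \<open>(x, y, z)\<close> has first row \<open>x, y\<close> and second row
  \<open>0, z\<close>.\<close>

definition T2 :: "('k, 'r) module \<Rightarrow> ('k, 'r \<times> 'r \<times> 'r) module" where
  "T2 \<Lambda> =
     \<lparr>carrier = carrier \<Lambda> \<times> carrier \<Lambda> \<times> carrier \<Lambda>,
      mult = (\<lambda>(x, y, z) (x', y', z').
        (x \<otimes>\<^bsub>\<Lambda>\<^esub> x', x \<otimes>\<^bsub>\<Lambda>\<^esub> y' \<oplus>\<^bsub>\<Lambda>\<^esub> y \<otimes>\<^bsub>\<Lambda>\<^esub> z', z \<otimes>\<^bsub>\<Lambda>\<^esub> z')),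
      one = (\<one>\<^bsub>\<Lambda>\<^esub>, \<zero>\<^bsub>\<Lambda>\<^esub>, \<one>\<^bsub>\<Lambda>\<^esub>),
      zero = (\<zero>\<^bsub>\<Lambda>\<^esub>, \<zero>\<^bsub>\<Lambda>\<^esub>, \<zero>\<^bsub>\<Lambda>\<^esub>),
      add = (\<lambda>(x, y, z) (x', y', z'). (x \<oplus>\<^bsub>\<Lambda>\<^esub> x', y \<oplus>\<^bsub>\<Lambda>\<^esub> y', z \<oplus>\<^bsub>\<Lambda>\<^esub> z')),
      smult = (\<lambda>c (x, y, z). (c \<odot>\<^bsub>\<Lambda>\<^esub> x, c \<odot>\<^bsub>\<Lambda>\<^esub> y, c \<odot>\<^bsub>\<Lambda>\<^esub> z))\<rparr>"

text \<open>
  The equivalence with modules over the triangular matrix algebra. A morphism \<open>f : A \<rightarrow> B\<close>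
  corresponds to the column vectors with upper entry in \<open>B\<close> and lower entry in \<open>A\<close>; conversely
  \<open>A\<close> and \<open>B\<close> are cut out by the diagonal idempotents, and \<open>f\<close> is the action of the matrix unit
  in the upper right corner.
\<close>

definition mor_to_T2 ::
  "('r, 'a, 'b) mor_obj \<Rightarrow> ('r \<times> 'r \<times> 'r, 'b \<times> 'a) module" where
  "mor_to_T2 = (\<lambda>(A, f, B). mk_module (carrier B \<times> carrier A) (\<zero>\<^bsub>B\<^esub>, \<zero>\<^bsub>A\<^esub>)
     (\<lambda>(b, a) (b', a'). (b \<oplus>\<^bsub>B\<^esub> b', a \<oplus>\<^bsub>A\<^esub> a'))
     (\<lambda>(x, y, z) (b, a). (x \<odot>\<^bsub>B\<^esub> b \<oplus>\<^bsub>B\<^esub> y \<odot>\<^bsub>B\<^esub> f a, z \<odot>\<^bsub>A\<^esub> a)))"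

definition T2_to_mor ::
  "('k, 'r) module \<Rightarrow> ('r \<times> 'r \<times> 'r, 'm) module \<Rightarrow> ('r, 'm, 'm) mor_obj" where
  "T2_to_mor \<Lambda> X =
     (mk_module ((\<lambda>x. (\<zero>\<^bsub>\<Lambda>\<^esub>, \<zero>\<^bsub>\<Lambda>\<^esub>, \<one>\<^bsub>\<Lambda>\<^esub>) \<odot>\<^bsub>X\<^esub> x) ` carrier X) \<zero>\<^bsub>X\<^esub> (add X)
        (\<lambda>r x. (\<zero>\<^bsub>\<Lambda>\<^esub>, \<zero>\<^bsub>\<Lambda>\<^esub>, r) \<odot>\<^bsub>X\<^esub> x),
      (\<lambda>x. (\<zero>\<^bsub>\<Lambda>\<^esub>, \<one>\<^bsub>\<Lambda>\<^esub>, \<zero>\<^bsub>\<Lambda>\<^esub>) \<odot>\<^bsub>X\<^esub> x),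
      mk_module ((\<lambda>x. (\<one>\<^bsub>\<Lambda>\<^esub>, \<zero>\<^bsub>\<Lambda>\<^esub>, \<zero>\<^bsub>\<Lambda>\<^esub>) \<odot>\<^bsub>X\<^esub> x) ` carrier X) \<zero>\<^bsub>X\<^esub> (add X)
        (\<lambda>r x. (r, \<zero>\<^bsub>\<Lambda>\<^esub>, \<zero>\<^bsub>\<Lambda>\<^esub>) \<odot>\<^bsub>X\<^esub> x))"

definition mor_ar_translate ::
  "('k, 'x) ring_scheme \<Rightarrow> ('k, 'j) module \<Rightarrow> ('k, 'r) module \<Rightarrow> ('r, 'a, 'b) mor_obj \<Rightarrow>
   ('r, (('r \<times> 'r \<times> 'r) list \<Rightarrow> 'r \<times> 'r \<times> 'r) set \<Rightarrow> 'j,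
        (('r \<times> 'r \<times> 'r) list \<Rightarrow> 'r \<times> 'r \<times> 'r) set \<Rightarrow> 'j) mor_obj" where
  "mor_ar_translate k J \<Lambda> X = T2_to_mor \<Lambda> (ar_translate k J (T2 \<Lambda>) (mor_to_T2 X))"

end

theory Submission
  imports Defs
begin

text \<open>
  The translate \<open>D Tr\<close> of a module with minimal presentation \<open>d : Q1 \<rightarrow> Q0\<close> consists of the
  functionals on \<open>Hom(Q1, -)\<close> into the algebra that kill all maps factoring through \<open>d\<close>. Since
  \<open>I\<close> is projective and \<open>C\<close> has no projective summands, \<open>e(C)\<close> is superfluous in \<open>I\<close>, so the
  object \<open>C \<rightarrow> I\<close> has a minimal presentation with terms \<open>P1 \<rightarrow> P1 \<oplus> P0\<close> and \<open>P0 \<rightarrow> P0 \<oplus> I\<close>.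
  Comparing matrix entries identifies its translate with \<open>\<nu> P1 \<rightarrow> Ker (\<nu> P0 \<rightarrow> \<nu> I)\<close>, and the kernel
  is \<open>\<nu> \<Omega>(C)\<close> because maps into a self-injective algebra extend along \<open>\<Omega>(C) \<rightarrow> P0\<close> and \<open>C \<rightarrow> I\<close>.
  The same kernel is \<open>\<tau> \<Omega>\<^sup>-\<^sup>1(C)\<close>, as \<open>P0 \<rightarrow> I\<close> is a minimal presentation of \<open>\<Omega>\<^sup>-\<^sup>1(C)\<close>. Finally
  \<open>\<nu>\<close> preserves projective covers: \<open>\<nu> P1\<close> is injective, hence projective, and a submodule of
  \<open>\<nu> P1\<close> that together with the kernel of \<open>\<nu> \<pi>\<close> spans everything has zero annihilator in
  \<open>Hom(P1, \<Lambda>)\<close>. Uniqueness of projective covers gives the second claim.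
\<close>

section \<open>Modules and homomorphisms\<close>

text \<open>Only left injectivity of A is assumed, while nu passes through the right modules
  Hom(-,A). Two facts that bridge the sides have to be earned. First, every simple left module
  embeds into A, so that maps into A separate elements; this rests on a permutation of the primitive
  ideals and is what makes injective modules projective. Secondly, a submodule of a k-dual is
  recovered from its annihilator; this needs that every endomorphism of J is a scalar, hence the
  shape of the socle of J. Both use chain conditions, and artinian modules over k first have to be
  shown noetherian.

  The presentation of C -> I arises by covering the source and the cokernel of a map separately: C
  by P0 and I/e(C) by I. The kernel of this cover is the inclusion Omega(C) -> P0, to which the same
  recipe applies, with source cover P1 and cokernel cover P0 -> C.

  The definition of the translate contains a choice of presentation, so uniqueness of minimal
  presentations up to isomorphism is part of the argument and not a convenience.\<close>

context abelian_group
begin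

lemma diff_zero_iff: "x \<in> carrier G \<Longrightarrow> y \<in> carrier G \<Longrightarrow> x \<ominus> y = \<zero> \<longleftrightarrow> x = y"
  by (metis a_inv_closed minus_equality minus_minus a_minus_def r_neg)

lemma diff_add: "x \<in> carrier G \<Longrightarrow> y \<in> carrier G \<Longrightarrow> (x \<ominus> y) \<oplus> y = x"
  by (simp add: a_minus_def a_assoc l_neg)

lemma add_diff: "x \<in> carrier G \<Longrightarrow> y \<in> carrier G \<Longrightarrow> y \<oplus> (x \<ominus> y) = x"
  by (metis diff_add a_comm minus_closed)

lemma add_eq_iff_diff:
  "x \<in> carrier G \<Longrightarrow> y \<in> carrier G \<Longrightarrow> z \<in> carrier G \<Longrightarrow> x \<oplus> y = z \<longleftrightarrow> x = z \<ominus> y"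
  by (metis diff_add a_closed a_minus_def a_assoc r_neg r_zero a_inv_closed)

end

lemma left_moduleI:
  assumes "ring R"
    and "\<And>x y. x \<in> carrier M \<Longrightarrow> y \<in> carrier M \<Longrightarrow> x \<oplus>\<^bsub>M\<^esub> y \<in> carrier M"
    and "\<zero>\<^bsub>M\<^esub> \<in> carrier M"
    and "\<And>x y z. x \<in> carrier M \<Longrightarrow> y \<in> carrier M \<Longrightarrow> z \<in> carrier M \<Longrightarrow>
      (x \<oplus>\<^bsub>M\<^esub> y) \<oplus>\<^bsub>M\<^esub> z = x \<oplus>\<^bsub>M\<^esub> (y \<oplus>\<^bsub>M\<^esub> z)"
    and "\<And>x y. x \<in> carrier M \<Longrightarrow> y \<in> carrier M \<Longrightarrow> x \<oplus>\<^bsub>M\<^esub> y = y \<oplus>\<^bsub>M\<^esub> x"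
    and "\<And>x. x \<in> carrier M \<Longrightarrow> \<zero>\<^bsub>M\<^esub> \<oplus>\<^bsub>M\<^esub> x = x"
    and "\<And>x. x \<in> carrier M \<Longrightarrow> \<exists>y\<in>carrier M. y \<oplus>\<^bsub>M\<^esub> x = \<zero>\<^bsub>M\<^esub>"
    and "\<And>a x. a \<in> carrier R \<Longrightarrow> x \<in> carrier M \<Longrightarrow> a \<odot>\<^bsub>M\<^esub> x \<in> carrier M"
    and "\<And>a b x. a \<in> carrier R \<Longrightarrow> b \<in> carrier R \<Longrightarrow> x \<in> carrier M \<Longrightarrow>
      (a \<oplus>\<^bsub>R\<^esub> b) \<odot>\<^bsub>M\<^esub> x = a \<odot>\<^bsub>M\<^esub> x \<oplus>\<^bsub>M\<^esub> b \<odot>\<^bsub>M\<^esub> x"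
    and "\<And>a x y. a \<in> carrier R \<Longrightarrow> x \<in> carrier M \<Longrightarrow> y \<in> carrier M \<Longrightarrow>
      a \<odot>\<^bsub>M\<^esub> (x \<oplus>\<^bsub>M\<^esub> y) = a \<odot>\<^bsub>M\<^esub> x \<oplus>\<^bsub>M\<^esub> a \<odot>\<^bsub>M\<^esub> y"
    and "\<And>a b x. a \<in> carrier R \<Longrightarrow> b \<in> carrier R \<Longrightarrow> x \<in> carrier M \<Longrightarrow>
      (a \<otimes>\<^bsub>R\<^esub> b) \<odot>\<^bsub>M\<^esub> x = a \<odot>\<^bsub>M\<^esub> (b \<odot>\<^bsub>M\<^esub> x)"
    and "\<And>x. x \<in> carrier M \<Longrightarrow> \<one>\<^bsub>R\<^esub> \<odot>\<^bsub>M\<^esub> x = x"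
  shows "left_module R M"
  by (intro left_module.intro left_module_axioms.intro abelian_groupI) (use assms in auto)

lemma mk_module_simps [simp]:
  "carrier (mk_module X z p s) = X" "zero (mk_module X z p s) = z"
  "add (mk_module X z p s) = p" "smult (mk_module X z p s) = s"
  by (simp_all add: mk_module_def)

context left_module
begin

lemma smult_l_null [simp]:
  assumes "x \<in> carrier M"
  shows "\<zero> \<odot>\<^bsub>M\<^esub> x = \<zero>\<^bsub>M\<^esub>"
proof -
  have "\<zero> \<odot>\<^bsub>M\<^esub> x \<oplus>\<^bsub>M\<^esub> \<zero> \<odot>\<^bsub>M\<^esub> x = \<zero> \<odot>\<^bsub>M\<^esub> x"
    using smult_l_distr[of \<zero> \<zero> x] assms by simp
  then show ?thesis using assms by (simp add: M.add.r_cancel_one')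
qed

lemma smult_r_null [simp]:
  assumes "a \<in> carrier R"
  shows "a \<odot>\<^bsub>M\<^esub> \<zero>\<^bsub>M\<^esub> = \<zero>\<^bsub>M\<^esub>"
proof -
  have "a \<odot>\<^bsub>M\<^esub> \<zero>\<^bsub>M\<^esub> \<oplus>\<^bsub>M\<^esub> a \<odot>\<^bsub>M\<^esub> \<zero>\<^bsub>M\<^esub> = a \<odot>\<^bsub>M\<^esub> \<zero>\<^bsub>M\<^esub>"
    using smult_r_distr[of a "\<zero>\<^bsub>M\<^esub>" "\<zero>\<^bsub>M\<^esub>"] assms by simp
  then show ?thesis using assms by (simp add: M.add.r_cancel_one')
qed

lemma smult_l_minus:
  assumes "a \<in> carrier R" "x \<in> carrier M"
  shows "(\<ominus> a) \<odot>\<^bsub>M\<^esub> x = \<ominus>\<^bsub>M\<^esub> (a \<odot>\<^bsub>M\<^esub> x)"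
proof -
  have "(\<ominus> a) \<odot>\<^bsub>M\<^esub> x \<oplus>\<^bsub>M\<^esub> a \<odot>\<^bsub>M\<^esub> x = \<zero>\<^bsub>M\<^esub>"
    using smult_l_distr[of "\<ominus> a" a x] assms by (simp add: R.l_neg)
  then show ?thesis using assms by (simp add: M.minus_equality)
qed

lemma smult_r_minus:
  assumes "a \<in> carrier R" "x \<in> carrier M"
  shows "a \<odot>\<^bsub>M\<^esub> (\<ominus>\<^bsub>M\<^esub> x) = \<ominus>\<^bsub>M\<^esub> (a \<odot>\<^bsub>M\<^esub> x)"
proof -
  have "a \<odot>\<^bsub>M\<^esub> (\<ominus>\<^bsub>M\<^esub> x) \<oplus>\<^bsub>M\<^esub> a \<odot>\<^bsub>M\<^esub> x = \<zero>\<^bsub>M\<^esub>"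
    using smult_r_distr[of a "\<ominus>\<^bsub>M\<^esub> x" x] assms by (simp add: M.l_neg)
  then show ?thesis using assms by (simp add: M.minus_equality)
qed

lemma submoduleI:
  assumes "H \<subseteq> carrier M" "\<zero>\<^bsub>M\<^esub> \<in> H"
    and add: "\<And>a b. a \<in> H \<Longrightarrow> b \<in> H \<Longrightarrow> a \<oplus>\<^bsub>M\<^esub> b \<in> H"
    and smult: "\<And>a x. a \<in> carrier R \<Longrightarrow> x \<in> H \<Longrightarrow> a \<odot>\<^bsub>M\<^esub> x \<in> H"
  shows "submodule H R M"
proof -
  \<comment> \<open>Negatives come for free, as they are multiples by minus one.\<close>
  have "\<ominus>\<^bsub>M\<^esub> x \<in> H" if "x \<in> H" for x
    using smult[of "\<ominus> \<one>" x] that assms(1) by (auto simp: smult_l_minus subset_iff)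
  then show ?thesis
    using assms by (intro submodule.intro subgroup.intro submodule_axioms.intro)
      (auto simp: a_inv_def)
qed

lemma submodule_carrier [simp]: "submodule (carrier M) R M"
  by (rule submoduleI) auto

lemma submodule_zero [simp]: "submodule {\<zero>\<^bsub>M\<^esub>} R M"
  by (rule submoduleI) auto

end

lemma submodule_subset: "submodule N R M \<Longrightarrow> N \<subseteq> carrier M"
  and submodule_mem: "submodule N R M \<Longrightarrow> x \<in> N \<Longrightarrow> x \<in> carrier M"
  and submodule_zero_mem: "submodule N R M \<Longrightarrow> \<zero>\<^bsub>M\<^esub> \<in> N"
  and submodule_add: "submodule N R M \<Longrightarrow> x \<in> N \<Longrightarrow> y \<in> N \<Longrightarrow> x \<oplus>\<^bsub>M\<^esub> y \<in> N"
  and submodule_minus: "submodule N R M \<Longrightarrow> x \<in> N \<Longrightarrow> \<ominus>\<^bsub>M\<^esub> x \<in> N"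
  and submodule_smult: "submodule N R M \<Longrightarrow> a \<in> carrier R \<Longrightarrow> x \<in> N \<Longrightarrow> a \<odot>\<^bsub>M\<^esub> x \<in> N"
proof -
  assume N: "submodule N R M"
  then interpret subgroup N "add_monoid M" by (rule submodule.axioms(1))
  show "N \<subseteq> carrier M" using subset by simp
  then show "x \<in> N \<Longrightarrow> x \<in> carrier M" by auto
  show "\<zero>\<^bsub>M\<^esub> \<in> N" using one_closed by simp
  show "x \<in> N \<Longrightarrow> y \<in> N \<Longrightarrow> x \<oplus>\<^bsub>M\<^esub> y \<in> N" using m_closed by simp
  show "x \<in> N \<Longrightarrow> \<ominus>\<^bsub>M\<^esub> x \<in> N" using m_inv_closed by (simp add: a_inv_def)
  show "a \<in> carrier R \<Longrightarrow> x \<in> N \<Longrightarrow> a \<odot>\<^bsub>M\<^esub> x \<in> N"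
    using N by (rule submodule.smult_closed)
qed

lemmas submodule_facts = submodule_mem submodule_zero_mem submodule_add submodule_minus submodule_smult

lemma submodule_diff:
  "submodule N R M \<Longrightarrow> x \<in> N \<Longrightarrow> y \<in> N \<Longrightarrow> x \<ominus>\<^bsub>M\<^esub> y \<in> N"
  by (simp add: a_minus_def submodule_add submodule_minus)

lemma (in left_module) submodule_int:
  "submodule N R M \<Longrightarrow> submodule N' R M \<Longrightarrow> submodule (N \<inter> N') R M"
  by (rule submoduleI) (auto intro: submodule_facts)

text \<open>Intersecting with the carrier makes the empty family give the whole module, the starting
  point of the finite intersections in \<open>dcc_finite_Inter\<close>.\<close>

lemma (in left_module) submodule_INT:
  assumes "\<And>i. i \<in> S \<Longrightarrow> submodule (N i) R M"
  shows "submodule (carrier M \<inter> (\<Inter>i\<in>S. N i)) R M"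
  by (rule submoduleI) (use assms in \<open>auto intro: submodule_facts\<close>)

lemma mem_set_add: "z \<in> X <+>\<^bsub>M\<^esub> Y \<longleftrightarrow> (\<exists>x\<in>X. \<exists>y\<in>Y. z = x \<oplus>\<^bsub>M\<^esub> y)"
  by (auto simp: set_add_def')

lemma (in left_module) submodule_sum:
  assumes N: "submodule N R M" and N': "submodule N' R M"
  shows "submodule (N <+>\<^bsub>M\<^esub> N') R M"
proof (rule submoduleI)
  note [simp] = submodule_mem[OF N] submodule_mem[OF N']
  show "N <+>\<^bsub>M\<^esub> N' \<subseteq> carrier M" by (auto simp: mem_set_add)
  show "\<zero>\<^bsub>M\<^esub> \<in> N <+>\<^bsub>M\<^esub> N'"
    using submodule_zero_mem[OF N] submodule_zero_mem[OF N'] by (force simp: mem_set_add)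
  show "a \<oplus>\<^bsub>M\<^esub> b \<in> N <+>\<^bsub>M\<^esub> N'" if ab: "a \<in> N <+>\<^bsub>M\<^esub> N'" "b \<in> N <+>\<^bsub>M\<^esub> N'" for a b
  proof -
    obtain x y x' y' where "x \<in> N" "y \<in> N'" "a = x \<oplus>\<^bsub>M\<^esub> y" "x' \<in> N" "y' \<in> N'" "b = x' \<oplus>\<^bsub>M\<^esub> y'"
      using ab unfolding mem_set_add by blast
    moreover from this have "a \<oplus>\<^bsub>M\<^esub> b = (x \<oplus>\<^bsub>M\<^esub> x') \<oplus>\<^bsub>M\<^esub> (y \<oplus>\<^bsub>M\<^esub> y')"
      by (simp add: M.a_ac)
    ultimately show ?thesis
      unfolding mem_set_add using submodule_add[OF N] submodule_add[OF N'] by blast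
  qed
  show "a \<odot>\<^bsub>M\<^esub> x \<in> N <+>\<^bsub>M\<^esub> N'" if ax: "a \<in> carrier R" "x \<in> N <+>\<^bsub>M\<^esub> N'" for a x
  proof -
    obtain y z where "y \<in> N" "z \<in> N'" "x = y \<oplus>\<^bsub>M\<^esub> z" using ax unfolding mem_set_add by blast
    moreover from this have "a \<odot>\<^bsub>M\<^esub> x = a \<odot>\<^bsub>M\<^esub> y \<oplus>\<^bsub>M\<^esub> a \<odot>\<^bsub>M\<^esub> z"
      using ax by (simp add: smult_r_distr)
    ultimately show ?thesis
      unfolding mem_set_add using submodule_smult[OF N] submodule_smult[OF N'] ax by blast
  qed
qed

lemma (in left_module) submodule_UN_chain:
  assumes "\<And>n. submodule (N n) R M" "\<And>n. N n \<subseteq> N (Suc n)"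
  shows "submodule (\<Union>n. N n) R M"
proof (rule submoduleI)
  have mono: "N m \<subseteq> N n" if "m \<le> n" for m n
    using assms(2) that by (rule lift_Suc_mono_le)
  show "(\<Union>n. N n) \<subseteq> carrier M" using submodule_subset[OF assms(1)] by blast
  show "\<zero>\<^bsub>M\<^esub> \<in> (\<Union>n. N n)" using submodule_zero_mem[OF assms(1)] by blast
  show "a \<oplus>\<^bsub>M\<^esub> b \<in> (\<Union>n. N n)" if "a \<in> (\<Union>n. N n)" "b \<in> (\<Union>n. N n)" for a b
  proof -
    obtain m n where "a \<in> N m" "b \<in> N n" using \<open>a \<in> _\<close> \<open>b \<in> _\<close> by auto
    then have "a \<in> N (max m n)" "b \<in> N (max m n)"
      using mono[of m "max m n"] mono[of n "max m n"] by auto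
    then show ?thesis using submodule_add[OF assms(1)] by blast
  qed
  show "a \<odot>\<^bsub>M\<^esub> x \<in> (\<Union>n. N n)" if "a \<in> carrier R" "x \<in> (\<Union>n. N n)" for a x
    using that submodule_smult[OF assms(1)] by blast
qed

lemma left_module_submodule:
  assumes "left_module R M" "submodule N R M"
  shows "left_module R (M\<lparr>carrier := N\<rparr>)"
proof -
  interpret M: left_module R M by fact
  note [simp] = submodule_facts[OF assms(2)]
  show ?thesis
    by (rule left_moduleI)
      (auto simp: M.M.a_ac M.smult_l_distr M.smult_r_distr M.smult_assoc1 M.R.ring_axioms
        intro!: bexI[of _ "\<ominus>\<^bsub>M\<^esub> _"] M.M.r_neg)
qed

lemma submodule_trans:
  assumes "left_module R M" "submodule N R M" "submodule K R (M\<lparr>carrier := N\<rparr>)"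
  shows "submodule K R M"
proof -
  interpret left_module R M by fact
  show ?thesis
    using submodule_facts[OF assms(3)] submodule_subset[OF assms(2)]
    by (intro submoduleI) auto
qed

lemma submodule_restrict:
  assumes "left_module R M" "submodule N R M" "submodule K R M" "K \<subseteq> N"
  shows "submodule K R (M\<lparr>carrier := N\<rparr>)"
proof -
  interpret left_module R "M\<lparr>carrier := N\<rparr>" using assms by (intro left_module_submodule)
  show ?thesis using submodule_facts[OF assms(3)] assms(4) by (intro submoduleI) auto
qed

section \<open>Homomorphisms, kernels, isomorphisms\<close>

lemma module_homI:
  assumes "\<And>x. x \<in> carrier M \<Longrightarrow> f x \<in> carrier N"
    and "\<And>x y. x \<in> carrier M \<Longrightarrow> y \<in> carrier M \<Longrightarrow> f (x \<oplus>\<^bsub>M\<^esub> y) = f x \<oplus>\<^bsub>N\<^esub> f y"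
    and "\<And>r x. r \<in> carrier R \<Longrightarrow> x \<in> carrier M \<Longrightarrow> f (r \<odot>\<^bsub>M\<^esub> x) = r \<odot>\<^bsub>N\<^esub> f x"
  shows "f \<in> module_hom R M N"
  using assms by (auto simp: module_hom_def)

lemma hom_closed: "f \<in> module_hom R M N \<Longrightarrow> x \<in> carrier M \<Longrightarrow> f x \<in> carrier N"
  and hom_add: "f \<in> module_hom R M N \<Longrightarrow> x \<in> carrier M \<Longrightarrow> y \<in> carrier M \<Longrightarrow>
    f (x \<oplus>\<^bsub>M\<^esub> y) = f x \<oplus>\<^bsub>N\<^esub> f y"
  and hom_smult: "f \<in> module_hom R M N \<Longrightarrow> r \<in> carrier R \<Longrightarrow> x \<in> carrier M \<Longrightarrow>
    f (r \<odot>\<^bsub>M\<^esub> x) = r \<odot>\<^bsub>N\<^esub> f x"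
  by (auto simp: module_hom_def)

lemmas hom_facts = hom_closed hom_add hom_smult

lemma hom_zero:
  assumes "left_module R M" "left_module R N" "f \<in> module_hom R M N"
  shows "f \<zero>\<^bsub>M\<^esub> = \<zero>\<^bsub>N\<^esub>"
proof -
  interpret M: left_module R M by fact
  interpret N: left_module R N by fact
  show ?thesis using hom_smult[OF assms(3), of "\<zero>\<^bsub>R\<^esub>" "\<zero>\<^bsub>M\<^esub>"] hom_closed[OF assms(3)] by simp
qed

lemma hom_minus:
  assumes "left_module R M" "left_module R N" "f \<in> module_hom R M N" "x \<in> carrier M"
  shows "f (\<ominus>\<^bsub>M\<^esub> x) = \<ominus>\<^bsub>N\<^esub> f x"
proof -
  interpret M: left_module R M by fact
  interpret N: left_module R N by fact
  show ?thesis
    using hom_smult[OF assms(3), of "\<ominus>\<^bsub>R\<^esub> \<one>\<^bsub>R\<^esub>" x] hom_closed[OF assms(3)] assms(4)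
    by (simp add: M.smult_l_minus N.smult_l_minus)
qed

lemma hom_diff:
  assumes "left_module R M" "left_module R N" "f \<in> module_hom R M N"
    "x \<in> carrier M" "y \<in> carrier M"
  shows "f (x \<ominus>\<^bsub>M\<^esub> y) = f x \<ominus>\<^bsub>N\<^esub> f y"
proof -
  interpret M: left_module R M by fact
  show ?thesis
    using assms by (simp add: a_minus_def hom_add[OF assms(3)] hom_minus[OF assms(1-3)])
qed

lemma hom_compose:
  "f \<in> module_hom R M N \<Longrightarrow> g \<in> module_hom R N L \<Longrightarrow> (\<lambda>x. g (f x)) \<in> module_hom R M L"
  by (auto simp: module_hom_def Pi_iff)

lemma hom_ident: "(\<lambda>x. x) \<in> module_hom R M M"
  by (auto simp: module_hom_def)

lemma hom_const_zero:
  "left_module R N \<Longrightarrow> (\<lambda>x. \<zero>\<^bsub>N\<^esub>) \<in> module_hom R M N"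
proof -
  assume "left_module R N"
  then interpret N: left_module R N .
  show ?thesis by (auto simp: module_hom_def)
qed

text \<open>\<open>module_hom\<close> says nothing about values outside the carrier. This is the
  bridge between a plain map and its extensional restriction, which is what \<open>star\<close> and
  \<open>dual\<close> contain.\<close>

lemma hom_cong:
  assumes "left_module R M" "f \<in> module_hom R M N" "\<And>x. x \<in> carrier M \<Longrightarrow> f x = g x"
  shows "g \<in> module_hom R M N"
proof -
  interpret M: left_module R M by fact
  show ?thesis using assms(2)
    by (intro module_homI) (auto simp: hom_facts simp flip: assms(3))
qed

lemma hom_sum:
  assumes "left_module R N" "f \<in> module_hom R M N" "g \<in> module_hom R M N"
  shows "(\<lambda>x. f x \<oplus>\<^bsub>N\<^esub> g x) \<in> module_hom R M N"
proof -
  interpret N: left_module R N by fact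
  show ?thesis
    using hom_facts[OF assms(2)] hom_facts[OF assms(3)]
    by (intro module_homI) (auto simp: N.M.a_ac N.smult_r_distr)
qed

lemma hom_uminus:
  assumes "left_module R N" "f \<in> module_hom R M N"
  shows "(\<lambda>x. \<ominus>\<^bsub>N\<^esub> f x) \<in> module_hom R M N"
proof -
  interpret N: left_module R N by fact
  show ?thesis
    using hom_facts[OF assms(2)]
    by (intro module_homI) (auto simp: N.M.minus_add N.smult_r_minus)
qed

lemma hom_restrict_dom:
  "N \<subseteq> carrier M \<Longrightarrow> f \<in> module_hom R M L \<Longrightarrow> f \<in> module_hom R (M\<lparr>carrier := N\<rparr>) L"
  by (rule module_homI) (auto simp: hom_facts subset_iff)

lemma hom_restrict_cod:
  "f \<in> module_hom R M L \<Longrightarrow> f ` carrier M \<subseteq> N \<Longrightarrow> f \<in> module_hom R M (L\<lparr>carrier := N\<rparr>)"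
  by (auto simp: module_hom_def)

lemma hom_incl: "f \<in> module_hom R M (L\<lparr>carrier := N\<rparr>) \<Longrightarrow> N \<subseteq> carrier L \<Longrightarrow> f \<in> module_hom R M L"
  by (auto simp: module_hom_def)

lemma hom_image_submodule:
  assumes "left_module R M" "left_module R N" "f \<in> module_hom R M N" "submodule K R M"
  shows "submodule (f ` K) R N"
proof -
  interpret M: left_module R M by fact
  interpret N: left_module R N by fact
  note K = submodule_facts[OF assms(4)]
  show ?thesis
  proof (rule N.submoduleI)
    show "f ` K \<subseteq> carrier N" using K hom_closed[OF assms(3)] by auto
    show "\<zero>\<^bsub>N\<^esub> \<in> f ` K" using K hom_zero[OF assms(1-3)] by force
    show "a \<oplus>\<^bsub>N\<^esub> b \<in> f ` K" if "a \<in> f ` K" "b \<in> f ` K" for a b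
      using that K(1,3) hom_add[OF assms(3)] by (auto simp: image_iff) metis
    show "a \<odot>\<^bsub>N\<^esub> b \<in> f ` K" if "a \<in> carrier R" "b \<in> f ` K" for a b
      using that K(1,5) hom_smult[OF assms(3)] by (auto simp: image_iff) metis
  qed
qed

lemma hom_vimage_submodule:
  assumes "left_module R M" "left_module R N" "f \<in> module_hom R M N" "submodule K R N"
  shows "submodule {x \<in> carrier M. f x \<in> K} R M"
proof -
  interpret M: left_module R M by fact
  show ?thesis
    using submodule_facts[OF assms(4)] hom_facts[OF assms(3)] hom_zero[OF assms(1-3)]
    by (intro M.submoduleI) auto
qed

lemma ker_set_submodule:
  assumes "left_module R M" "left_module R N" "f \<in> module_hom R M N"
  shows "submodule (ker_set M f N) R M"
proof -
  interpret N: left_module R N by fact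
  show ?thesis using hom_vimage_submodule[OF assms N.submodule_zero] by (simp add: ker_set_def)
qed

lemma left_module_ker:
  assumes "left_module R M" "left_module R N" "f \<in> module_hom R M N"
  shows "left_module R (ker_module M f N)"
  unfolding ker_module_def
  by (intro left_module_submodule ker_set_submodule[OF assms] assms(1))

lemma hom_inj_iff:
  assumes "left_module R M" "left_module R N" "f \<in> module_hom R M N"
  shows "inj_on f (carrier M) \<longleftrightarrow> (\<forall>x\<in>carrier M. f x = \<zero>\<^bsub>N\<^esub> \<longrightarrow> x = \<zero>\<^bsub>M\<^esub>)"
proof -
  interpret M: left_module R M by fact
  interpret N: left_module R N by fact
  note f = hom_facts[OF assms(3)] hom_zero[OF assms] hom_diff[OF assms]
  show ?thesis
  proof
    show "inj_on f (carrier M) \<Longrightarrow> \<forall>x\<in>carrier M. f x = \<zero>\<^bsub>N\<^esub> \<longrightarrow> x = \<zero>\<^bsub>M\<^esub>"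
      using f(4) by (metis M.M.zero_closed inj_onD)
    assume *: "\<forall>x\<in>carrier M. f x = \<zero>\<^bsub>N\<^esub> \<longrightarrow> x = \<zero>\<^bsub>M\<^esub>"
    show "inj_on f (carrier M)"
    proof (rule inj_onI)
      fix x y assume "x \<in> carrier M" "y \<in> carrier M" "f x = f y"
      then have "f (x \<ominus>\<^bsub>M\<^esub> y) = \<zero>\<^bsub>N\<^esub>" using f by (simp add: a_minus_def N.M.r_neg)
      then have "x \<ominus>\<^bsub>M\<^esub> y = \<zero>\<^bsub>M\<^esub>" using * \<open>x \<in> _\<close> \<open>y \<in> _\<close> by blast
      then show "x = y" using \<open>x \<in> _\<close> \<open>y \<in> _\<close> by (simp add: M.M.diff_zero_iff)
    qed
  qed
qed

lemma iso_hom: "f \<in> module_iso R M N \<Longrightarrow> f \<in> module_hom R M N"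
  and iso_inj: "f \<in> module_iso R M N \<Longrightarrow> inj_on f (carrier M)"
  and iso_surj: "f \<in> module_iso R M N \<Longrightarrow> f ` carrier M = carrier N"
  by (auto simp: module_iso_def bij_betw_def)

lemma module_isoI:
  "f \<in> module_hom R M N \<Longrightarrow> inj_on f (carrier M) \<Longrightarrow> f ` carrier M = carrier N \<Longrightarrow>
    f \<in> module_iso R M N"
  by (auto simp: module_iso_def bij_betw_def)

lemma module_isoI':
  assumes "f \<in> module_hom R M N"
    and "\<And>y. y \<in> carrier N \<Longrightarrow> g y \<in> carrier M" "\<And>y. y \<in> carrier N \<Longrightarrow> f (g y) = y"
    and "\<And>x. x \<in> carrier M \<Longrightarrow> g (f x) = x"
  shows "f \<in> module_iso R M N"
  unfolding module_iso_def
  by (simp add: assms(1)) (rule bij_betw_byWitness[where f' = g], use assms hom_closed[OF assms(1)] in auto)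

lemma iso_ident: "(\<lambda>x. x) \<in> module_iso R M M"
  by (auto intro: module_isoI hom_ident)

lemma iso_compose:
  "f \<in> module_iso R M N \<Longrightarrow> g \<in> module_iso R N L \<Longrightarrow> (\<lambda>x. g (f x)) \<in> module_iso R M L"
  unfolding module_iso_def
  using bij_betw_trans[of f "carrier M" "carrier N" g "carrier L"]
  by (auto intro: hom_compose simp: o_def)

lemma iso_inverse:
  assumes "left_module R M" "f \<in> module_iso R M N"
  shows "inv_into (carrier M) f \<in> module_iso R N M"
proof (rule module_isoI')
  interpret M: left_module R M by fact
  let ?g = "inv_into (carrier M) f"
  have b: "bij_betw f (carrier M) (carrier N)" using assms(2) by (simp add: module_iso_def)
  have g: "?g y \<in> carrier M" "f (?g y) = y" if "y \<in> carrier N" for y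
    using that b by (auto simp: bij_betw_def inv_into_into f_inv_into_f)
  have gf: "?g (f x) = x" if "x \<in> carrier M" for x
    using that b by (simp add: bij_betw_def)
  note f = hom_facts[OF iso_hom[OF assms(2)]]
  show "?g \<in> module_hom R N M"
  proof (rule module_homI)
    show "?g y \<in> carrier M" if "y \<in> carrier N" for y using g that by simp
    show "?g (x \<oplus>\<^bsub>N\<^esub> y) = ?g x \<oplus>\<^bsub>M\<^esub> ?g y" if "x \<in> carrier N" "y \<in> carrier N" for x y
      using gf[of "?g x \<oplus>\<^bsub>M\<^esub> ?g y"] g that by (simp add: f)
    show "?g (r \<odot>\<^bsub>N\<^esub> y) = r \<odot>\<^bsub>M\<^esub> ?g y" if "r \<in> carrier R" "y \<in> carrier N" for r y
      using gf[of "r \<odot>\<^bsub>M\<^esub> ?g y"] g that by (simp add: f)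
  qed
  show "f y \<in> carrier N" if "y \<in> carrier M" for y using f that by simp
  show "?g (f y) = y" if "y \<in> carrier M" for y using gf that by simp
  show "f (?g x) = x" if "x \<in> carrier N" for x using g that by simp
qed

lemma iso_inverseE:
  assumes "left_module R M" "f \<in> module_iso R M N"
  shows "\<exists>g\<in>module_iso R N M. (\<forall>x\<in>carrier M. g (f x) = x) \<and> (\<forall>y\<in>carrier N. f (g y) = y)"
proof (rule bexI[OF _ iso_inverse[OF assms]], intro conjI ballI)
  show "inv_into (carrier M) f (f x) = x" if "x \<in> carrier M" for x
    using that iso_inj[OF assms(2)] by simp
  show "f (inv_into (carrier M) f y) = y" if "y \<in> carrier N" for y
    using that iso_surj[OF assms(2)] by (simp add: f_inv_into_f)
qed

text \<open>The target of \<open>f\<close> is an arbitrary type without structure;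
  \<open>fg_list_copy\<close> takes it to be a type of lists.\<close>

lemma module_transport:
  assumes "left_module R M" "inj_on f (carrier M)"
  defines "g \<equiv> inv_into (carrier M) f"
  defines "N \<equiv> mk_module (f ` carrier M) (f \<zero>\<^bsub>M\<^esub>) (\<lambda>x y. f (g x \<oplus>\<^bsub>M\<^esub> g y)) (\<lambda>r x. f (r \<odot>\<^bsub>M\<^esub> g x))"
  shows "left_module R N" "f \<in> module_iso R M N"
proof -
  interpret M: left_module R M by fact
  have g [simp]: "g (f x) = x" if "x \<in> carrier M" for x
    using that assms(2) by (simp add: g_def)
  show "left_module R N"
    unfolding N_def
    by (rule left_moduleI)
      (auto simp: M.M.a_ac M.smult_l_distr M.smult_r_distr M.smult_assoc1 M.R.ring_axioms
        intro!: bexI[of _ "\<ominus>\<^bsub>M\<^esub> _"] arg_cong[of _ _ f] M.M.l_neg)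
  show "f \<in> module_iso R M N"
    by (rule module_isoI) (auto intro!: module_homI simp: N_def assms(2))
qed

section \<open>Generating sets and finite generation\<close>

definition generates :: "('r, 'x) ring_scheme \<Rightarrow> ('r, 'm) module \<Rightarrow> 'm set \<Rightarrow> bool" where
  "generates R M A \<longleftrightarrow> A \<subseteq> carrier M \<and> (\<forall>N. submodule N R M \<and> A \<subseteq> N \<longrightarrow> N = carrier M)"

lemma generates_subset: "generates R M A \<Longrightarrow> A \<subseteq> carrier M"
  and generatesD: "generates R M A \<Longrightarrow> submodule N R M \<Longrightarrow> A \<subseteq> N \<Longrightarrow> N = carrier M"
  by (auto simp: generates_def)

lemma generatesI:
  "A \<subseteq> carrier M \<Longrightarrow> (\<And>N x. submodule N R M \<Longrightarrow> A \<subseteq> N \<Longrightarrow> x \<in> carrier M \<Longrightarrow> x \<in> N) \<Longrightarrow>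
    generates R M A"
  unfolding generates_def using submodule_subset by blast

lemma submodule_eqI:
  "submodule N R M \<Longrightarrow> (\<And>x. x \<in> carrier M \<Longrightarrow> x \<in> N) \<Longrightarrow> N = carrier M"
  using submodule_subset by blast

lemma fin_gen_iff: "fin_gen R M \<longleftrightarrow> (\<exists>A. finite A \<and> generates R M A)"
  by (auto simp: fin_gen_def generates_def)

lemma fin_gen_surj:
  assumes "left_module R M" "left_module R N" "f \<in> module_hom R M N" "f ` carrier M = carrier N"
    "fin_gen R M"
  shows "fin_gen R N"
proof -
  obtain A where A: "finite A" "generates R M A" using assms(5) by (auto simp: fin_gen_iff)
  have "generates R N (f ` A)"
  proof (rule generatesI)
    show "f ` A \<subseteq> carrier N" using generates_subset[OF A(2)] assms(4) by auto
    fix K y assume K: "submodule K R N" "f ` A \<subseteq> K" "y \<in> carrier N"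
    then have "{x \<in> carrier M. f x \<in> K} = carrier M"
      using generates_subset[OF A(2)]
      by (intro generatesD[OF A(2)] hom_vimage_submodule[OF assms(1-3)]) auto
    moreover obtain x where "x \<in> carrier M" "y = f x" using K(3) assms(4) by blast
    ultimately have "x \<in> {x \<in> carrier M. f x \<in> K}" by blast
    then show "y \<in> K" using \<open>y = f x\<close> by simp
  qed
  then show ?thesis using A(1) by (auto simp: fin_gen_iff)
qed

lemma fg_surj:
  "fg_module R M \<Longrightarrow> left_module R N \<Longrightarrow> f \<in> module_hom R M N \<Longrightarrow> f ` carrier M = carrier N \<Longrightarrow>
    fg_module R N"
  using fin_gen_surj unfolding fg_module_def by blast

lemma fg_left_module: "fg_module R M \<Longrightarrow> left_module R M"
  by (simp add: fg_module_def)

lemma hom_zero_on_generators: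
  assumes "left_module R M" "left_module R N" "f \<in> module_hom R M N" "generates R M A"
    "\<And>a. a \<in> A \<Longrightarrow> f a = \<zero>\<^bsub>N\<^esub>" "x \<in> carrier M"
  shows "f x = \<zero>\<^bsub>N\<^esub>"
proof -
  have "ker_set M f N = carrier M"
    using assms(5) generates_subset[OF assms(4)]
    by (intro generatesD[OF assms(4)] ker_set_submodule[OF assms(1-3)]) (auto simp: ker_set_def)
  then show ?thesis using assms(6) by (auto simp: ker_set_def)
qed

section \<open>Powers of modules, free covers and test modules\<close>

lemma hom_finsum:
  assumes "left_module R M" "left_module R N" "f \<in> module_hom R M N" "g \<in> S \<rightarrow> carrier M"
  shows "f (finsum M g S) = (\<Oplus>\<^bsub>N\<^esub>s\<in>S. f (g s))"
proof -
  interpret M: left_module R M by fact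
  interpret N: left_module R N by fact
  show ?thesis
  proof (cases "finite S")
    case True
    then show ?thesis using assms(4)
    proof (induction S)
      case empty
      then show ?case by (simp add: hom_zero[OF assms(1-3)])
    next
      case (insert s S)
      have "(\<lambda>s. f (g s)) \<in> insert s S \<rightarrow> carrier N"
        using insert.prems hom_closed[OF assms(3)] by (auto simp: Pi_iff)
      moreover have "f (finsum M g S) = (\<Oplus>\<^bsub>N\<^esub>s\<in>S. f (g s))"
        using insert by auto
      ultimately show ?case
        using insert.prems insert.hyps
        by (simp add: M.M.finsum_insert N.M.finsum_insert Pi_iff hom_add[OF assms(3)])
    qed
  next
    case False
    then show ?thesis
      by (simp add: M.M.finsum_infinite N.M.finsum_infinite hom_zero[OF assms(1-3)])
  qed
qed

lemma submodule_finsum: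
  assumes "left_module R M" "submodule N R M" "g \<in> S \<rightarrow> N"
  shows "finsum M g S \<in> N"
proof -
  interpret M: left_module R M by fact
  show ?thesis
  proof (cases "finite S")
    case True
    then show ?thesis using assms(3)
    proof (induction S)
      case empty
      then show ?case by (simp add: submodule_zero_mem[OF assms(2)])
    next
      case (insert s S)
      then have "g \<in> insert s S \<rightarrow> carrier M" using submodule_mem[OF assms(2)] by auto
      then show ?case
        using insert by (simp add: M.M.finsum_insert Pi_iff submodule_add[OF assms(2)])
    qed
  next
    case False
    then show ?thesis by (simp add: M.M.finsum_infinite submodule_zero_mem[OF assms(2)])
  qed
qed

lemma (in left_module) finsum_smult:
  assumes "a \<in> carrier R" "g \<in> S \<rightarrow> carrier M"
  shows "a \<odot>\<^bsub>M\<^esub> finsum M g S = (\<Oplus>\<^bsub>M\<^esub>s\<in>S. a \<odot>\<^bsub>M\<^esub> g s)"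
proof (cases "finite S")
  case True
  then show ?thesis using assms(2)
  proof (induction S)
    case empty
    then show ?case using assms(1) by simp
  next
    case (insert s S)
    then show ?case
      using assms(1) by (simp add: M.finsum_insert Pi_iff smult_r_distr)
  qed
next
  case False
  then show ?thesis using assms(1) by (simp add: M.finsum_infinite)
qed

text \<open>Extensional functions, so that tuples with equal components are equal. For finite
  \<open>S\<close> the power is also the direct sum, and over the regular module it is the free
  module on \<open>S\<close>.\<close>

definition pow_module :: "'s set \<Rightarrow> ('r, 'm) module \<Rightarrow> ('r, 's \<Rightarrow> 'm) module" where
  "pow_module S M = mk_module (S \<rightarrow>\<^sub>E carrier M) (\<lambda>s\<in>S. \<zero>\<^bsub>M\<^esub>)
     (\<lambda>v w. \<lambda>s\<in>S. v s \<oplus>\<^bsub>M\<^esub> w s) (\<lambda>r v. \<lambda>s\<in>S. r \<odot>\<^bsub>M\<^esub> v s)"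

lemma pow_module_simps [simp]:
  "carrier (pow_module S M) = S \<rightarrow>\<^sub>E carrier M"
  "\<zero>\<^bsub>pow_module S M\<^esub> = (\<lambda>s\<in>S. \<zero>\<^bsub>M\<^esub>)"
  "v \<oplus>\<^bsub>pow_module S M\<^esub> w = (\<lambda>s\<in>S. v s \<oplus>\<^bsub>M\<^esub> w s)"
  "r \<odot>\<^bsub>pow_module S M\<^esub> v = (\<lambda>s\<in>S. r \<odot>\<^bsub>M\<^esub> v s)"
  by (simp_all add: pow_module_def)

lemma restrict_eqI:
  "x \<in> extensional S \<Longrightarrow> (\<And>s. s \<in> S \<Longrightarrow> h s = x s) \<Longrightarrow> (\<lambda>s\<in>S. h s) = x"
  by (intro extensionalityI[of _ S]) auto

lemma left_module_pow:
  assumes "left_module R M"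
  shows "left_module R (pow_module S M)"
proof -
  interpret M: left_module R M by fact
  note [simp] = M.M.a_ac M.smult_l_distr M.smult_r_distr M.smult_assoc1 PiE_iff
  show ?thesis
  proof (rule left_moduleI)
    fix x assume x: "x \<in> carrier (pow_module S M)"
    show "\<zero>\<^bsub>pow_module S M\<^esub> \<oplus>\<^bsub>pow_module S M\<^esub> x = x"
      unfolding pow_module_simps by (rule restrict_eqI) (use x in auto)
    show "\<exists>y\<in>carrier (pow_module S M). y \<oplus>\<^bsub>pow_module S M\<^esub> x = \<zero>\<^bsub>pow_module S M\<^esub>"
    proof (rule bexI)
      show "(\<lambda>s\<in>S. \<ominus>\<^bsub>M\<^esub> x s) \<oplus>\<^bsub>pow_module S M\<^esub> x = \<zero>\<^bsub>pow_module S M\<^esub>"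
        unfolding pow_module_simps
        by (rule restrict_ext) (use x in \<open>simp add: PiE_iff M.M.l_neg del: M.M.a_ac\<close>)
    qed (use x in \<open>simp add: PiE_iff\<close>)
    show "\<one>\<^bsub>R\<^esub> \<odot>\<^bsub>pow_module S M\<^esub> x = x"
      unfolding pow_module_simps by (rule restrict_eqI) (use x in auto)
  qed (auto simp: M.R.ring_axioms fun_eq_iff)
qed

lemma left_module_regular:
  assumes "ring R"
  shows "left_module R (regular_module R)"
proof -
  interpret ring R by fact
  show ?thesis
    unfolding regular_module_def
    by (rule left_moduleI) (auto simp: ring_axioms a_ac l_distr r_distr m_assoc intro!: bexI[of _ "\<ominus>\<^bsub>R\<^esub> _"] r_neg)
qed

lemma regular_module_simps [simp]:
  "carrier (regular_module R) = carrier R" "\<zero>\<^bsub>regular_module R\<^esub> = \<zero>\<^bsub>R\<^esub>"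
  "add (regular_module R) = add R" "smult (regular_module R) = mult R"
  by (simp_all add: regular_module_def)

lemma a_inv_regular [simp]:
  assumes "ring R" "x \<in> carrier R"
  shows "\<ominus>\<^bsub>regular_module R\<^esub> x = \<ominus>\<^bsub>R\<^esub> x"
proof -
  interpret ring R by fact
  interpret M: left_module R "regular_module R" using assms(1) by (rule left_module_regular)
  show ?thesis using M.M.minus_equality[of "\<ominus>\<^bsub>R\<^esub> x" x] assms(2) by (simp add: l_neg)
qed

lemma hom_pow:
  assumes "\<And>s. s \<in> S \<Longrightarrow> f s \<in> module_hom R M N" "left_module R M"
  shows "(\<lambda>x. \<lambda>s\<in>S. f s x) \<in> module_hom R M (pow_module S N)"
  using hom_facts[OF assms(1)]
  by (intro module_homI) (auto simp: fun_eq_iff)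

lemma hom_proj: "s \<in> S \<Longrightarrow> (\<lambda>v. v s) \<in> module_hom R (pow_module S N) N"
  by (rule module_homI) (auto simp: PiE_iff)

definition unit_vec :: "'s set \<Rightarrow> ('r, 'm) module \<Rightarrow> 's \<Rightarrow> 'm \<Rightarrow> 's \<Rightarrow> 'm" where
  "unit_vec S M s x = (\<lambda>t\<in>S. if t = s then x else \<zero>\<^bsub>M\<^esub>)"

lemma unit_vec_hom:
  assumes "left_module R M"
  shows "unit_vec S M s \<in> module_hom R M (pow_module S M)"
proof -
  interpret M: left_module R M by fact
  show ?thesis by (rule module_homI) (auto simp: unit_vec_def fun_eq_iff)
qed

lemma pow_sum_unit_vec:
  assumes "left_module R M" "finite S" "v \<in> S \<rightarrow>\<^sub>E carrier M"
  shows "(\<Oplus>\<^bsub>pow_module S M\<^esub>s\<in>S. unit_vec S M s (v s)) = v"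
proof -
  interpret M: left_module R M by fact
  interpret P: left_module R "pow_module S M" using assms(1) by (rule left_module_pow)
  have uv: "(\<lambda>s. unit_vec S M s (v s)) \<in> S \<rightarrow> carrier (pow_module S M)"
  proof (rule funcsetI)
    fix s assume "s \<in> S"
    then have "v s \<in> carrier M" using assms(3) by (rule PiE_mem[rotated])
    then show "unit_vec S M s (v s) \<in> carrier (pow_module S M)"
      by (rule hom_closed[OF unit_vec_hom[OF assms(1)]])
  qed
  have "(\<Oplus>\<^bsub>pow_module S M\<^esub>s\<in>S. unit_vec S M s (v s)) t = v t" if "t \<in> S" for t
  proof -
    have "(\<Oplus>\<^bsub>pow_module S M\<^esub>s\<in>S. unit_vec S M s (v s)) t = (\<Oplus>\<^bsub>M\<^esub>s\<in>S. unit_vec S M s (v s) t)"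
      by (rule hom_finsum[OF P.left_module_axioms assms(1) hom_proj[OF that] uv])
    also have "\<dots> = (\<Oplus>\<^bsub>M\<^esub>s\<in>S. if t = s then v s else \<zero>\<^bsub>M\<^esub>)"
      using assms(3) that by (intro M.M.finsum_cong') (auto simp: unit_vec_def PiE_iff)
    also have "\<dots> = v t"
      using assms(2,3) that by (intro M.M.finsum_singleton) (auto simp: PiE_iff)
    finally show ?thesis .
  qed
  moreover have "(\<Oplus>\<^bsub>pow_module S M\<^esub>s\<in>S. unit_vec S M s (v s)) \<in> S \<rightarrow>\<^sub>E carrier M"
    using P.M.finsum_closed[OF uv] by simp
  ultimately show ?thesis using assms(3) by (intro PiE_ext) auto
qed

lemma fin_gen_pow:
  assumes "left_module R M" "finite S" "fin_gen R M"
  shows "fin_gen R (pow_module S M)"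
proof -
  interpret P: left_module R "pow_module S M" using assms(1) by (rule left_module_pow)
  obtain A where A: "finite A" "generates R M A" using assms(3) by (auto simp: fin_gen_iff)
  note u = unit_vec_hom[OF assms(1), of S]
  let ?B = "\<Union>s\<in>S. unit_vec S M s ` A"
  have "generates R (pow_module S M) ?B"
  proof (rule generatesI)
    show "?B \<subseteq> carrier (pow_module S M)"
      using hom_closed[OF u] generates_subset[OF A(2)] by blast
    fix N v assume N: "submodule N R (pow_module S M)" "?B \<subseteq> N" "v \<in> carrier (pow_module S M)"
    have "unit_vec S M s x \<in> N" if "s \<in> S" "x \<in> carrier M" for s x
    proof -
      have "{x \<in> carrier M. unit_vec S M s x \<in> N} = carrier M"
        using N(2) that generates_subset[OF A(2)]
        by (intro generatesD[OF A(2)] hom_vimage_submodule[OF assms(1) P.left_module_axioms u N(1)]) auto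
      then have "x \<in> {x \<in> carrier M. unit_vec S M s x \<in> N}" using that by blast
      then show ?thesis by simp
    qed
    then have "(\<Oplus>\<^bsub>pow_module S M\<^esub>s\<in>S. unit_vec S M s (v s)) \<in> N"
      using N(3) by (intro submodule_finsum[OF P.left_module_axioms N(1)]) (auto simp: PiE_iff)
    then show "v \<in> N" using pow_sum_unit_vec[OF assms(1,2)] N(3) by simp
  qed
  moreover have "finite ?B" using A(1) assms(2) by blast
  ultimately show ?thesis by (auto simp: fin_gen_iff)
qed

lemma fin_gen_regular:
  assumes "ring R"
  shows "fin_gen R (regular_module R)"
proof -
  interpret ring R by fact
  have "generates R (regular_module R) {\<one>\<^bsub>R\<^esub>}"
  proof (rule generatesI)
    fix N x assume N: "submodule N R (regular_module R)" "{\<one>\<^bsub>R\<^esub>} \<subseteq> N" "x \<in> carrier (regular_module R)"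
    then have "x \<odot>\<^bsub>regular_module R\<^esub> \<one>\<^bsub>R\<^esub> \<in> N" by (intro submodule_smult[OF N(1)]) auto
    then show "x \<in> N" using N(3) by simp
  qed simp
  then show ?thesis unfolding fin_gen_iff by blast
qed

lemma fg_free: "ring R \<Longrightarrow> finite S \<Longrightarrow> fg_module R (pow_module S (regular_module R))"
  by (simp add: fg_module_def left_module_pow left_module_regular fin_gen_pow fin_gen_regular)

lemma lincomb_hom:
  fixes M (structure)
  assumes "left_module R M" "finite S" "a \<in> S \<rightarrow> carrier M"
  shows "(\<lambda>v. \<Oplus>s\<in>S. v s \<odot> a s) \<in> module_hom R (pow_module S (regular_module R)) M"
proof -
  interpret M: left_module R M by fact
  have a: "a s \<in> carrier M" if "s \<in> S" for s using assms(3) that by auto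
  show ?thesis
  proof (rule module_homI)
    fix v assume v: "v \<in> carrier (pow_module S (regular_module R))"
    then have va: "(\<lambda>s. v s \<odot> a s) \<in> S \<rightarrow> carrier M" using a by (auto simp: PiE_iff)
    then show "(\<Oplus>s\<in>S. v s \<odot> a s) \<in> carrier M" by (rule M.M.finsum_closed)
    show "(\<Oplus>s\<in>S. (v \<oplus>\<^bsub>pow_module S (regular_module R)\<^esub> w) s \<odot> a s) =
        (\<Oplus>s\<in>S. v s \<odot> a s) \<oplus> (\<Oplus>s\<in>S. w s \<odot> a s)"
      if w: "w \<in> carrier (pow_module S (regular_module R))" for w
    proof -
      have wa: "(\<lambda>s. w s \<odot> a s) \<in> S \<rightarrow> carrier M" using a w by (auto simp: PiE_iff)
      have "(\<Oplus>s\<in>S. (v \<oplus>\<^bsub>pow_module S (regular_module R)\<^esub> w) s \<odot> a s) =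
          (\<Oplus>s\<in>S. v s \<odot> a s \<oplus> w s \<odot> a s)"
        using v w a by (intro M.M.finsum_cong') (auto simp: PiE_iff M.smult_l_distr)
      then show ?thesis using M.M.finsum_addf[OF va wa] by simp
    qed
    show "(\<Oplus>s\<in>S. (r \<odot>\<^bsub>pow_module S (regular_module R)\<^esub> v) s \<odot> a s) =
        r \<odot> (\<Oplus>s\<in>S. v s \<odot> a s)" if r: "r \<in> carrier R" for r
    proof -
      have "(\<Oplus>s\<in>S. (r \<odot>\<^bsub>pow_module S (regular_module R)\<^esub> v) s \<odot> a s) =
          (\<Oplus>s\<in>S. r \<odot> (v s \<odot> a s))"
        using v r a by (intro M.M.finsum_cong') (auto simp: PiE_iff M.smult_assoc1)
      then show ?thesis using M.finsum_smult[OF r va] by simp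
    qed
  qed
qed

lemma lincomb_unit_vec:
  fixes M (structure)
  assumes "left_module R M" "finite S" "a \<in> S \<rightarrow> carrier M" "s \<in> S" "r \<in> carrier R"
  shows "(\<Oplus>t\<in>S. unit_vec S (regular_module R) s r t \<odot> a t) = r \<odot> a s"
proof -
  interpret M: left_module R M by fact
  have a: "a s \<in> carrier M" if "s \<in> S" for s using assms(3) that by auto
  have "(\<Oplus>t\<in>S. unit_vec S (regular_module R) s r t \<odot> a t) =
      (\<Oplus>t\<in>S. if s = t then r \<odot> a t else \<zero>)"
    using assms(4,5) a by (intro M.M.finsum_cong') (auto simp: unit_vec_def)
  also have "\<dots> = r \<odot> a s"
    using assms a by (intro M.M.finsum_singleton) auto
  finally show ?thesis .
qed

lemma lincomb_surj:
  assumes "left_module R M" "finite A" "generates R M A"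
  shows "(\<lambda>v. \<Oplus>\<^bsub>M\<^esub>a\<in>A. v a \<odot>\<^bsub>M\<^esub> a) ` carrier (pow_module A (regular_module R)) = carrier M"
    (is "?f ` carrier ?F = _")
proof (rule generatesD[OF assms(3)])
  interpret M: left_module R M by fact
  have A: "(\<lambda>a. a) \<in> A \<rightarrow> carrier M" using generates_subset[OF assms(3)] by auto
  have F: "left_module R ?F" by (intro left_module_pow left_module_regular M.R.ring_axioms)
  then interpret F: left_module R ?F .
  show "submodule (?f ` carrier ?F) R M"
    by (intro hom_image_submodule[OF F assms(1) lincomb_hom[OF assms(1,2) A]] F.submodule_carrier)
  show "A \<subseteq> ?f ` carrier ?F"
  proof
    fix a assume a: "a \<in> A"
    let ?v = "unit_vec A (regular_module R) a \<one>\<^bsub>R\<^esub>"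
    have "?f ?v = a"
      using lincomb_unit_vec[OF assms(1,2) A a M.R.one_closed] funcset_mem[OF A a] by simp
    moreover have "?v \<in> carrier ?F"
      by (rule hom_closed[OF unit_vec_hom[OF left_module_regular[OF M.R.ring_axioms]]]) simp
    ultimately show "a \<in> ?f ` carrier ?F" by (rule image_eqI[OF sym])
  qed
qed

text \<open>Coefficient tuples embed a finitely generated module into lists of scalars; this is what makes
  the test modules in the definitions of projectivity and injectivity sufficient.\<close>

lemma fg_list_copy:
  assumes "fg_module R M"
  obtains N :: "('r, 'r list) module" and f where "fg_module R N" "f \<in> module_iso R M N"
proof -
  have lm: "left_module R M" using assms by (rule fg_left_module)
  then interpret M: left_module R M .
  obtain A where A: "finite A" "generates R M A"
    using assms by (auto simp: fg_module_def fin_gen_iff)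
  obtain as where as: "set as = A" using A(1) finite_list by blast
  have "\<forall>x\<in>carrier M. \<exists>v. v \<in> A \<rightarrow>\<^sub>E carrier R \<and> (\<Oplus>\<^bsub>M\<^esub>a\<in>A. v a \<odot>\<^bsub>M\<^esub> a) = x"
  proof
    fix x assume "x \<in> carrier M"
    then have "x \<in> (\<lambda>v. \<Oplus>\<^bsub>M\<^esub>a\<in>A. v a \<odot>\<^bsub>M\<^esub> a) ` carrier (pow_module A (regular_module R))"
      using lincomb_surj[OF lm A] by simp
    then show "\<exists>v. v \<in> A \<rightarrow>\<^sub>E carrier R \<and> (\<Oplus>\<^bsub>M\<^esub>a\<in>A. v a \<odot>\<^bsub>M\<^esub> a) = x" by auto
  qed
  then obtain c where c: "\<And>x. x \<in> carrier M \<Longrightarrow> c x \<in> A \<rightarrow>\<^sub>E carrier R"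
      "\<And>x. x \<in> carrier M \<Longrightarrow> (\<Oplus>\<^bsub>M\<^esub>a\<in>A. c x a \<odot>\<^bsub>M\<^esub> a) = x" by metis
  \<comment> \<open>An element is recovered from its coefficients. The choice \<open>c\<close> need
    not be additive, since the operations are transported afterwards.\<close>
  have "inj_on (\<lambda>x. map (c x) as) (carrier M)"
  proof (rule inj_onI)
    fix x y assume xy: "x \<in> carrier M" "y \<in> carrier M" "map (c x) as = map (c y) as"
    have "c x = c y"
    proof (rule PiE_ext[OF c(1)[OF xy(1)] c(1)[OF xy(2)]])
      show "c x a = c y a" if "a \<in> A" for a using that xy(3) unfolding as[symmetric] by simp
    qed
    have "x = (\<Oplus>\<^bsub>M\<^esub>a\<in>A. c x a \<odot>\<^bsub>M\<^esub> a)" by (rule c(2)[OF xy(1), symmetric])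
    also have "\<dots> = (\<Oplus>\<^bsub>M\<^esub>a\<in>A. c y a \<odot>\<^bsub>M\<^esub> a)" by (simp only: \<open>c x = c y\<close>)
    also have "\<dots> = y" by (rule c(2)[OF xy(2)])
    finally show "x = y" .
  qed
  note t = module_transport[OF lm this]
  show thesis
    by (rule that[OF fg_surj[OF assms t(1) iso_hom[OF t(2)] iso_surj[OF t(2)]] t(2)])
qed

text \<open>\<open>projective\<close> tests only modules with list carriers. Both \<open>M\<close>
  and \<open>N\<close> are replaced by list copies, and the lift found there is carried back to
  \<open>M\<close>.\<close>

lemma projective_lift:
  assumes "projective R P" "fg_module R M" "fg_module R N"
    "g \<in> module_hom R M N" "g ` carrier M = carrier N" "f \<in> module_hom R P N"
  shows "\<exists>h\<in>module_hom R P M. \<forall>x\<in>carrier P. g (h x) = f x"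
proof -
  note lm = assms(2,3)[THEN fg_left_module]
  obtain M' :: "('a, 'a list) module" and m where M': "fg_module R M'" "m \<in> module_iso R M M'"
    using assms(2) by (rule fg_list_copy)
  obtain N' :: "('a, 'a list) module" and n where N': "fg_module R N'" "n \<in> module_iso R N N'"
    using assms(3) by (rule fg_list_copy)
  obtain m' where m': "m' \<in> module_iso R M' M" "\<forall>x\<in>carrier M. m' (m x) = x"
    using iso_inverseE[OF lm(1) M'(2)] by blast
  have "(\<lambda>x. n (g (m' x))) \<in> module_hom R M' N'"
    by (intro hom_compose[of "\<lambda>x. g (m' x)" R M' N n] hom_compose[of m' R M' M g] iso_hom m' N' assms(4))
  moreover have "(\<lambda>x. n (g (m' x))) ` carrier M' = carrier N'"
    using iso_surj[OF m'(1)] iso_surj[OF N'(2)] assms(5)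
    by (metis (no_types, lifting) image_image image_cong)
  moreover have "(\<lambda>x. n (f x)) \<in> module_hom R P N'"
    by (rule hom_compose[OF assms(6) iso_hom[OF N'(2)]])
  ultimately obtain h where h: "h \<in> module_hom R P M'"
      "\<And>x. x \<in> carrier P \<Longrightarrow> n (g (m' (h x))) = n (f x)"
    using assms(1) M'(1) N'(1) unfolding projective_def by metis
  have hom: "(\<lambda>x. m' (h x)) \<in> module_hom R P M" by (rule hom_compose[OF h(1) iso_hom[OF m'(1)]])
  have "g (m' (h x)) = f x" if x: "x \<in> carrier P" for x
    by (rule inj_onD[OF iso_inj[OF N'(2)] h(2)[OF x]])
      (rule hom_closed[OF assms(4)] hom_closed[OF assms(6)] hom_closed[OF hom] x)+
  with hom show ?thesis by (intro bexI[of _ "\<lambda>x. m' (h x)"]) auto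
qed

text \<open>Frees the test modules from their list carriers, as \<open>projective_lift\<close> does;
  the extension is composed with the isomorphism from \<open>N\<close> to its copy.\<close>

lemma injective_extend:
  assumes "injective R I" "fg_module R M" "fg_module R N"
    "g \<in> module_hom R M N" "inj_on g (carrier M)" "f \<in> module_hom R M I"
  shows "\<exists>h\<in>module_hom R N I. \<forall>x\<in>carrier M. h (g x) = f x"
proof -
  note lm = assms(2,3)[THEN fg_left_module]
  obtain M' :: "('a, 'a list) module" and m where M': "fg_module R M'" "m \<in> module_iso R M M'"
    using assms(2) by (rule fg_list_copy)
  obtain N' :: "('a, 'a list) module" and n where N': "fg_module R N'" "n \<in> module_iso R N N'"
    using assms(3) by (rule fg_list_copy)
  obtain m' where m': "m' \<in> module_iso R M' M" "\<forall>x\<in>carrier M. m' (m x) = x"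
    using iso_inverseE[OF lm(1) M'(2)] by blast
  have "(\<lambda>x. n (g (m' x))) \<in> module_hom R M' N'"
    by (intro hom_compose[of "\<lambda>x. g (m' x)" R M' N n] hom_compose[of m' R M' M g] iso_hom m' N' assms(4))
  moreover have "inj_on (\<lambda>x. n (g (m' x))) (carrier M')"
    using iso_inj[OF m'(1)] iso_inj[OF N'(2)] assms(5) hom_closed[OF iso_hom[OF m'(1)]]
      hom_closed[OF assms(4)] by (auto simp: inj_on_def)
  moreover have "(\<lambda>x. f (m' x)) \<in> module_hom R M' I"
    by (rule hom_compose[OF iso_hom[OF m'(1)] assms(6)])
  ultimately obtain h where h: "h \<in> module_hom R N' I"
      "\<And>x. x \<in> carrier M' \<Longrightarrow> h (n (g (m' x))) = f (m' x)"
    using assms(1) M'(1) N'(1) unfolding injective_def by metis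
  have hom: "(\<lambda>x. h (n x)) \<in> module_hom R N I" by (rule hom_compose[OF iso_hom[OF N'(2)] h(1)])
  have "h (n (g x)) = f x" if "x \<in> carrier M" for x
    using h(2)[of "m x"] that m'(2) hom_closed[OF iso_hom[OF M'(2)]] by simp
  with hom show ?thesis by (intro bexI[of _ "\<lambda>x. h (n x)"]) auto
qed

lemma projective_iso:
  assumes "projective R P" "left_module R P" "u \<in> module_iso R P Q"
  shows "projective R Q"
  unfolding projective_def
proof (intro allI impI, elim conjE)
  fix M N :: "('a, 'a list) module" and g f
  assume *: "fg_module R M" "fg_module R N" "g \<in> module_hom R M N" "g ` carrier M = carrier N"
    "f \<in> module_hom R Q N"
  obtain v where v: "v \<in> module_iso R Q P" "\<forall>x\<in>carrier Q. u (v x) = x"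
    using iso_inverseE[OF assms(2,3)] by blast
  obtain h where h: "h \<in> module_hom R P M" "\<forall>x\<in>carrier P. g (h x) = f (u x)"
    using projective_lift[OF assms(1) *(1-4) hom_compose[OF iso_hom[OF assms(3)] *(5)]] by blast
  show "\<exists>h\<in>module_hom R Q M. \<forall>x\<in>carrier Q. g (h x) = f x"
    using hom_compose[OF iso_hom[OF v(1)] h(1)] h(2) v(2) hom_closed[OF iso_hom[OF v(1)]]
    by (intro bexI[of _ "\<lambda>x. h (v x)"]) auto
qed

text \<open>The index set is kept apart from the elements \<open>a s\<close>, so that bases can be
  indexed by a disjoint sum (\<open>proj_mor_projective\<close>) or by the functionals themselves
  (\<open>injective_imp_projective\<close>).\<close>

definition dual_basis ::
  "('r, 'x) ring_scheme \<Rightarrow> ('r, 'm) module \<Rightarrow> 's set \<Rightarrow> ('s \<Rightarrow> 'm) \<Rightarrow> ('s \<Rightarrow> 'm \<Rightarrow> 'r) \<Rightarrow> bool" where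
  "dual_basis R P S a f \<longleftrightarrow> finite S \<and> a \<in> S \<rightarrow> carrier P \<and>
     (\<forall>s\<in>S. f s \<in> module_hom R P (regular_module R)) \<and>
     (\<forall>x\<in>carrier P. (\<Oplus>\<^bsub>P\<^esub>s\<in>S. f s x \<odot>\<^bsub>P\<^esub> a s) = x)"

text \<open>The free cover on a finite generating set splits, and the coordinates of the splitting
  are the functionals.\<close>

lemma projective_dual_basis:
  assumes "fg_module R P" "projective R P"
  obtains A f where "dual_basis R P A (\<lambda>a. a) f"
proof -
  have lm: "left_module R P" using assms(1) by (rule fg_left_module)
  then interpret P: left_module R P .
  obtain A where A: "finite A" "generates R P A"
    using assms(1) by (auto simp: fg_module_def fin_gen_iff)
  have Ai: "(\<lambda>a. a) \<in> A \<rightarrow> carrier P" using generates_subset[OF A(2)] by auto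
  obtain h where h: "h \<in> module_hom R P (pow_module A (regular_module R))"
    "\<forall>x\<in>carrier P. (\<Oplus>\<^bsub>P\<^esub>a\<in>A. h x a \<odot>\<^bsub>P\<^esub> a) = x"
    using projective_lift[OF assms(2) fg_free[OF P.R.ring_axioms A(1)] assms(1)
        lincomb_hom[OF lm A(1) Ai] lincomb_surj[OF lm A] hom_ident] by blast
  have "dual_basis R P A (\<lambda>a. a) (\<lambda>a x. h x a)"
    unfolding dual_basis_def using A(1) Ai h(2) hom_compose[OF h(1) hom_proj] by auto
  then show thesis by (rule that)
qed

lemma dual_basis_fg:
  assumes "left_module R P" "dual_basis R P S a f"
  shows "fg_module R P"
proof -
  interpret P: left_module R P by fact
  have S: "finite S" "a \<in> S \<rightarrow> carrier P" "\<And>s. s \<in> S \<Longrightarrow> f s \<in> module_hom R P (regular_module R)"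
    "\<And>x. x \<in> carrier P \<Longrightarrow> (\<Oplus>\<^bsub>P\<^esub>s\<in>S. f s x \<odot>\<^bsub>P\<^esub> a s) = x"
    using assms(2) by (auto simp: dual_basis_def)
  have "generates R P (a ` S)"
  proof (rule generatesI)
    show "a ` S \<subseteq> carrier P" using S by auto
    fix N x assume N: "submodule N R P" "a ` S \<subseteq> N" "x \<in> carrier P"
    have "(\<Oplus>\<^bsub>P\<^esub>s\<in>S. f s x \<odot>\<^bsub>P\<^esub> a s) \<in> N"
      using N S(3)[THEN hom_closed] by (intro submodule_finsum[OF assms(1) N(1)]) (auto intro!: submodule_smult[OF N(1)])
    then show "x \<in> N" using S(4) N(3) by simp
  qed
  then show ?thesis using S(1) assms(1) unfolding fg_module_def fin_gen_iff by blast
qed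

lemma dual_basis_projective:
  assumes "left_module R P" "dual_basis R P S a f"
  shows "projective R P"
  unfolding projective_def
proof (intro allI impI, elim conjE)
  fix M N :: "('a, 'a list) module" and g q
  assume *: "fg_module R M" "fg_module R N" "g \<in> module_hom R M N" "g ` carrier M = carrier N"
    "q \<in> module_hom R P N"
  have S: "finite S" "a \<in> S \<rightarrow> carrier P" "\<And>s. s \<in> S \<Longrightarrow> f s \<in> module_hom R P (regular_module R)"
    "\<And>x. x \<in> carrier P \<Longrightarrow> (\<Oplus>\<^bsub>P\<^esub>s\<in>S. f s x \<odot>\<^bsub>P\<^esub> a s) = x"
    using assms(2) by (auto simp: dual_basis_def)
  interpret P: left_module R P by fact
  interpret M: left_module R M using *(1) by (rule fg_left_module)
  interpret N: left_module R N using *(2) by (rule fg_left_module)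
  have a: "a s \<in> carrier P" if "s \<in> S" for s using S(2) that by auto
  \<comment> \<open>Only the values at the basis elements are lifted by choice; the functionals
    extend the choice linearly.\<close>
  have "\<forall>s\<in>S. \<exists>m\<in>carrier M. g m = q (a s)"
    using *(4) hom_closed[OF *(5) a] by (metis imageE)
  then obtain m where m: "\<And>s. s \<in> S \<Longrightarrow> m s \<in> carrier M" "\<And>s. s \<in> S \<Longrightarrow> g (m s) = q (a s)" by metis
  have fc: "f s x \<in> carrier R" if "s \<in> S" "x \<in> carrier P" for s x
    using hom_closed[OF S(3)] that by simp
  let ?h = "\<lambda>x. \<Oplus>\<^bsub>M\<^esub>s\<in>S. f s x \<odot>\<^bsub>M\<^esub> m s"
  have "(\<lambda>x. \<Oplus>\<^bsub>M\<^esub>s\<in>S. (\<lambda>s\<in>S. f s x) s \<odot>\<^bsub>M\<^esub> m s) \<in> module_hom R P M"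
    using m S by (intro hom_compose[OF hom_pow[OF S(3) assms(1)] lincomb_hom[OF M.left_module_axioms S(1)]]) auto
  \<comment> \<open>\<open>hom_pow\<close> yields tuples restricted to \<open>S\<close>; a sum over
    \<open>S\<close> does not see the restriction.\<close>
  also have "(\<lambda>x. \<Oplus>\<^bsub>M\<^esub>s\<in>S. (\<lambda>s\<in>S. f s x) s \<odot>\<^bsub>M\<^esub> m s) \<in> module_hom R P M \<longleftrightarrow> ?h \<in> module_hom R P M"
  proof (intro iffI; elim hom_cong[OF assms(1)])
    fix x assume "x \<in> carrier P"
    then show "(\<Oplus>\<^bsub>M\<^esub>s\<in>S. (\<lambda>s\<in>S. f s x) s \<odot>\<^bsub>M\<^esub> m s) = ?h x" "?h x = (\<Oplus>\<^bsub>M\<^esub>s\<in>S. (\<lambda>s\<in>S. f s x) s \<odot>\<^bsub>M\<^esub> m s)"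
      by (auto intro!: M.M.finsum_cong' simp: fc m)
  qed
  finally have h: "?h \<in> module_hom R P M" .
  moreover have "g (?h x) = q x" if x: "x \<in> carrier P" for x
  proof -
    have "g (?h x) = (\<Oplus>\<^bsub>N\<^esub>s\<in>S. g (f s x \<odot>\<^bsub>M\<^esub> m s))"
      using x fc m by (intro hom_finsum[OF M.left_module_axioms N.left_module_axioms *(3)]) auto
    also have "\<dots> = (\<Oplus>\<^bsub>N\<^esub>s\<in>S. q (f s x \<odot>\<^bsub>P\<^esub> a s))"
      using x fc m a hom_closed[OF *(5)]
      by (intro N.M.finsum_cong') (auto simp: hom_smult[OF *(3)] hom_smult[OF *(5)])
    also have "\<dots> = q (\<Oplus>\<^bsub>P\<^esub>s\<in>S. f s x \<odot>\<^bsub>P\<^esub> a s)"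
      using x fc a by (intro hom_finsum[OF P.left_module_axioms N.left_module_axioms *(5), symmetric]) auto
    finally show ?thesis using S(4) x by simp
  qed
  ultimately show "\<exists>h\<in>module_hom R P M. \<forall>x\<in>carrier P. g (h x) = q x"
    by (intro bexI[of _ ?h] ballI)
qed

section \<open>Projective covers\<close>

context abelian_group
begin

lemma diff_diff_add:
  assumes "x \<in> carrier G" "y \<in> carrier G" "z \<in> carrier G"
  shows "(x \<ominus> y) \<oplus> (y \<ominus> z) = x \<ominus> z"
proof -
  have "(x \<ominus> y) \<oplus> (y \<ominus> z) = ((x \<ominus> y) \<oplus> y) \<oplus> \<ominus> z"
    unfolding a_minus_def[of _ y z] using assms by (simp add: a_assoc)
  then show ?thesis using assms by (simp add: diff_add a_minus_def[of _ x z])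
qed

lemma minus_diff:
  assumes "x \<in> carrier G" "y \<in> carrier G"
  shows "\<ominus> (x \<ominus> y) = y \<ominus> x"
  using assms by (simp add: a_minus_def minus_add a_comm)

lemma diff_zero_right: "x \<in> carrier G \<Longrightarrow> x \<ominus> \<zero> = x"
  using diff_add[of x \<zero>] by simp

end

lemma superfluousI:
  assumes "submodule K R M"
    and "\<And>N x. submodule N R M \<Longrightarrow>
      (\<And>y. y \<in> carrier M \<Longrightarrow> \<exists>n\<in>N. \<exists>z\<in>K. y = n \<oplus>\<^bsub>M\<^esub> z) \<Longrightarrow> x \<in> carrier M \<Longrightarrow> x \<in> N"
  shows "superfluous R M K"
  unfolding superfluous_def
proof (intro conjI allI impI)
  fix N assume N: "submodule N R M \<and> N <+>\<^bsub>M\<^esub> K = carrier M"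
  have "\<exists>n\<in>N. \<exists>z\<in>K. y = n \<oplus>\<^bsub>M\<^esub> z" if "y \<in> carrier M" for y
    using that N mem_set_add[of y M N K] by simp
  then show "N = carrier M" using N assms(2)[of N] by (intro submodule_eqI) auto
qed (fact assms(1))

lemma superfluousD:
  assumes "superfluous R M K" "left_module R M" "submodule N R M"
    "\<And>y. y \<in> carrier M \<Longrightarrow> \<exists>n\<in>N. \<exists>z\<in>K. y = n \<oplus>\<^bsub>M\<^esub> z"
  shows "N = carrier M"
proof -
  interpret M: left_module R M by fact
  have K: "submodule K R M" using assms(1) by (simp add: superfluous_def)
  have "N <+>\<^bsub>M\<^esub> K = carrier M"
  proof (rule submodule_eqI[OF M.submodule_sum[OF assms(3) K]])
    show "x \<in> N <+>\<^bsub>M\<^esub> K" if "x \<in> carrier M" for x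
      using assms(4)[OF that] by (simp add: mem_set_add)
  qed
  then show ?thesis using assms(1,3) by (simp add: superfluous_def)
qed

lemma superfluous_submodule: "superfluous R M K \<Longrightarrow> submodule K R M"
  by (simp add: superfluous_def)

lemma superfluous_iso:
  assumes "left_module R M" "left_module R M'" "u \<in> module_iso R M M'" "superfluous R M K"
  shows "superfluous R M' (u ` K)"
proof (rule superfluousI)
  note u = iso_hom[OF assms(3)]
  have K: "submodule K R M" using assms(4) by (rule superfluous_submodule)
  show "submodule (u ` K) R M'" by (rule hom_image_submodule[OF assms(1,2) u K])
  fix N x assume N: "submodule N R M'" and x: "x \<in> carrier M'"
    and sum: "\<And>y. y \<in> carrier M' \<Longrightarrow> \<exists>n\<in>N. \<exists>z\<in>u ` K. y = n \<oplus>\<^bsub>M'\<^esub> z"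
  interpret M: left_module R M by fact
  interpret M': left_module R M' by fact
  let ?N = "{x \<in> carrier M. u x \<in> N}"
  have "?N = carrier M"
  proof (rule superfluousD[OF assms(4,1) hom_vimage_submodule[OF assms(1,2) u N]])
    fix y assume y: "y \<in> carrier M"
    obtain n z where nz: "n \<in> N" "z \<in> K" "u y = n \<oplus>\<^bsub>M'\<^esub> u z"
      using sum[OF hom_closed[OF u y]] by blast
    have z: "z \<in> carrier M" using submodule_mem[OF K nz(2)] .
    have "n = u y \<ominus>\<^bsub>M'\<^esub> u z"
      using nz(3) M'.M.add_eq_iff_diff[of n "u z" "u y"] submodule_mem[OF N nz(1)]
        hom_closed[OF u z] hom_closed[OF u y] by simp
    then have "n = u (y \<ominus>\<^bsub>M\<^esub> z)" using y z by (simp add: hom_diff[OF assms(1,2) u])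
    then have "y \<ominus>\<^bsub>M\<^esub> z \<in> ?N" using nz(1) y z by simp
    then show "\<exists>n\<in>?N. \<exists>z\<in>K. y = n \<oplus>\<^bsub>M\<^esub> z"
      using nz(2) M.M.diff_add[OF y z] by (intro bexI[of _ "y \<ominus>\<^bsub>M\<^esub> z"] bexI[of _ z]) auto
  qed
  moreover obtain y where "y \<in> carrier M" "x = u y" using x iso_surj[OF assms(3)] by blast
  ultimately have "y \<in> ?N" by blast
  then show "x \<in> N" using \<open>x = u y\<close> by simp
qed

lemma projective_coverD:
  assumes "projective_cover R P p M"
  shows "fg_module R P" "projective R P" "p \<in> module_hom R P M" "p ` carrier P = carrier M"
    "superfluous R P (ker_set P p M)" "left_module R P"
  using assms by (auto simp: projective_cover_def fg_module_def)

lemma projective_cover_fg: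
  assumes "projective_cover R P p M" "left_module R M"
  shows "fg_module R M"
  using projective_coverD[OF assms(1)] assms(2) by (intro fg_surj[of R P M p])

text \<open>Lift \<open>i\<close> after \<open>p\<close> to a map \<open>u\<close>. Its image
  together with the kernel of \<open>p'\<close> is everything, so \<open>u\<close> is onto and has a
  section \<open>v\<close>, as \<open>P'\<close> is projective. The same argument shows that
  \<open>v\<close> is onto, hence a two-sided inverse. The covered modules may differ by an
  isomorphism because the second claim compares covers of two differently built modules.\<close>

lemma projective_cover_unique:
  assumes "projective_cover R P p M" "projective_cover R P' p' M'"
    "left_module R M" "left_module R M'" "i \<in> module_iso R M M'"
  shows "\<exists>u\<in>module_iso R P P'. \<forall>x\<in>carrier P. p' (u x) = i (p x)"
proof -
  note P = projective_coverD[OF assms(1)] and P' = projective_coverD[OF assms(2)]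
  interpret P: left_module R P by (rule P(6))
  interpret P': left_module R P' by (rule P'(6))
  interpret M: left_module R M by fact
  interpret M': left_module R M' by fact
  have ip: "(\<lambda>x. i (p x)) \<in> module_hom R P M'" by (rule hom_compose[OF P(3) iso_hom[OF assms(5)]])
  have ip_surj: "(\<lambda>x. i (p x)) ` carrier P = carrier M'"
    using P(4) iso_surj[OF assms(5)] by (simp flip: image_image)
  obtain u where u: "u \<in> module_hom R P P'" "\<forall>x\<in>carrier P. p' (u x) = i (p x)"
    using projective_lift[OF P(2) P'(1) projective_cover_fg[OF assms(2,4)] P'(3,4) ip] by blast
  have "u ` carrier P = carrier P'"
  proof (rule superfluousD[OF P'(5,6) hom_image_submodule[OF P(6) P'(6) u(1) P.submodule_carrier]])
    fix y assume y: "y \<in> carrier P'"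
    obtain x where x: "x \<in> carrier P" "p' y = i (p x)"
      using hom_closed[OF P'(3) y] unfolding ip_surj[symmetric] by blast
    have "p' (y \<ominus>\<^bsub>P'\<^esub> u x) = \<zero>\<^bsub>M'\<^esub>"
      using x y u hom_closed[OF u(1)] hom_closed[OF ip]
      by (simp add: hom_diff[OF P'(6) assms(4) P'(3)] M'.M.diff_zero_iff)
    then have "y \<ominus>\<^bsub>P'\<^esub> u x \<in> ker_set P' p' M'"
      using x y hom_closed[OF u(1)] by (simp add: ker_set_def)
    moreover have "y = u x \<oplus>\<^bsub>P'\<^esub> (y \<ominus>\<^bsub>P'\<^esub> u x)"
      using x y hom_closed[OF u(1)] by (simp add: P'.M.add_diff)
    ultimately show "\<exists>n\<in>u ` carrier P. \<exists>z\<in>ker_set P' p' M'. y = n \<oplus>\<^bsub>P'\<^esub> z"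
      using x(1) by blast
  qed
  then obtain v where v: "v \<in> module_hom R P' P" "\<forall>x\<in>carrier P'. u (v x) = x"
    using projective_lift[OF P'(2) P(1) P'(1) u(1) _ hom_ident] by blast
  have "v ` carrier P' = carrier P"
  proof (rule superfluousD[OF P(5,6) hom_image_submodule[OF P'(6) P(6) v(1) P'.submodule_carrier]])
    fix x assume x: "x \<in> carrier P"
    have vux: "v (u x) \<in> carrier P" using x hom_closed[OF u(1)] hom_closed[OF v(1)] by simp
    have "i (p (v (u x))) = i (p x)" using u(2) v(2) x vux hom_closed[OF u(1)] by metis
    then have "p (v (u x)) = p x"
      using inj_onD[OF iso_inj[OF assms(5)]] hom_closed[OF P(3)] x vux by blast
    then have "x \<ominus>\<^bsub>P\<^esub> v (u x) \<in> ker_set P p M"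
      using x vux hom_closed[OF P(3)]
      by (simp add: ker_set_def hom_diff[OF P(6) assms(3) P(3)] M.M.diff_zero_iff)
    moreover have "x = v (u x) \<oplus>\<^bsub>P\<^esub> (x \<ominus>\<^bsub>P\<^esub> v (u x))" using x vux by (simp add: P.M.add_diff)
    ultimately show "\<exists>n\<in>v ` carrier P'. \<exists>z\<in>ker_set P p M. x = n \<oplus>\<^bsub>P\<^esub> z"
      using hom_closed[OF u(1) x] by blast
  qed
  moreover have "v (u (v y)) = v y" if "y \<in> carrier P'" for y using v(2) that by simp
  ultimately have "v (u x) = x" if "x \<in> carrier P" for x using that by (metis imageE)
  then have "u \<in> module_iso R P P'"
    using v hom_closed[OF v(1)] by (intro module_isoI'[OF u(1), of v]) auto
  with u(2) show ?thesis by blast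
qed

lemma projective_cover_cong:
  assumes "projective_cover R P p M" "\<And>x. x \<in> carrier P \<Longrightarrow> p' x = p x"
  shows "projective_cover R P p' M"
proof -
  note P = projective_coverD[OF assms(1)]
  have "ker_set P p' M = ker_set P p M" using assms(2) by (auto simp: ker_set_def)
  then show ?thesis
    using P hom_cong[OF P(6,3), of p'] assms(2) by (simp add: projective_cover_def)
qed

lemma projective_cover_target:
  assumes "projective_cover R P p M" "left_module R M" "left_module R M'" "i \<in> module_iso R M M'"
  shows "projective_cover R P (\<lambda>x. i (p x)) M'"
proof -
  note P = projective_coverD[OF assms(1)] and i = iso_hom[OF assms(4)]
  interpret M: left_module R M by fact
  have "i y = \<zero>\<^bsub>M'\<^esub> \<longleftrightarrow> y = \<zero>\<^bsub>M\<^esub>" if "y \<in> carrier M" for y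
    using that iso_inj[OF assms(4)] hom_inj_iff[OF assms(2,3) i] hom_zero[OF assms(2,3) i] by blast
  then have "ker_set P (\<lambda>x. i (p x)) M' = ker_set P p M"
    using hom_closed[OF P(3)] by (auto simp: ker_set_def)
  moreover have "(\<lambda>x. i (p x)) ` carrier P = carrier M'"
    using P(4) iso_surj[OF assms(4)] by (simp flip: image_image)
  ultimately show ?thesis
    using P hom_compose[OF P(3) i] by (simp add: projective_cover_def)
qed

lemma projective_cover_source:
  assumes "projective_cover R P p M" "left_module R M" "left_module R P'" "v \<in> module_iso R P' P"
  shows "projective_cover R P' (\<lambda>x. p (v x)) M"
proof -
  note P = projective_coverD[OF assms(1)] and v = iso_hom[OF assms(4)]
  obtain u where u: "u \<in> module_iso R P P'" "\<forall>x\<in>carrier P'. u (v x) = x" "\<forall>x\<in>carrier P. v (u x) = x"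
    using iso_inverseE[OF assms(3,4)] by blast
  have "ker_set P' (\<lambda>x. p (v x)) M = u ` ker_set P p M"
  proof (intro equalityI subsetI)
    fix x assume "x \<in> ker_set P' (\<lambda>x. p (v x)) M"
    then show "x \<in> u ` ker_set P p M"
      using u(2) hom_closed[OF v] by (intro image_eqI[of _ _ "v x"]) (auto simp: ker_set_def)
  next
    fix x assume "x \<in> u ` ker_set P p M"
    then show "x \<in> ker_set P' (\<lambda>x. p (v x)) M"
      using u(3) hom_closed[OF iso_hom[OF u(1)]] by (auto simp: ker_set_def)
  qed
  moreover have "(\<lambda>x. p (v x)) ` carrier P' = carrier M"
    using P(4) iso_surj[OF assms(4)] by (simp flip: image_image)
  ultimately show ?thesis
    using P hom_compose[OF v P(3)] superfluous_iso[OF P(6) assms(3) u(1) P(5)]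
      projective_iso[OF P(2,6) u(1)] fg_surj[OF P(1) assms(3) iso_hom[OF u(1)] iso_surj[OF u(1)]]
    by (simp add: projective_cover_def)
qed

lemma ker_module_carrier [simp]: "carrier (ker_module M f N) = ker_set M f N"
  and ker_module_ops [simp]: "add (ker_module M f N) = add M" "smult (ker_module M f N) = smult M"
    "zero (ker_module M f N) = zero M"
  by (simp_all add: ker_module_def)

lemma ker_module_iso:
  assumes "left_module R P" "u \<in> module_iso R P P'"
    "\<And>x. x \<in> carrier P \<Longrightarrow> q x = \<zero>\<^bsub>M\<^esub> \<longleftrightarrow> q' (u x) = \<zero>\<^bsub>M'\<^esub>"
  shows "u \<in> module_iso R (ker_module P q M) (ker_module P' q' M')"
proof (rule module_isoI)
  note u = iso_hom[OF assms(2)]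
  show "u \<in> module_hom R (ker_module P q M) (ker_module P' q' M')"
    using hom_facts[OF u] assms(3) by (intro module_homI) (auto simp: ker_set_def)
  show "inj_on u (carrier (ker_module P q M))"
    using iso_inj[OF assms(2)] by (auto simp: inj_on_def ker_set_def)
  show "u ` carrier (ker_module P q M) = carrier (ker_module P' q' M')"
  proof (intro equalityI subsetI)
    fix y assume y: "y \<in> carrier (ker_module P' q' M')"
    then have "y \<in> carrier P'" by (simp add: ker_set_def)
    then obtain x where "x \<in> carrier P" "y = u x" using iso_surj[OF assms(2)] by blast
    then show "y \<in> u ` carrier (ker_module P q M)" using y assms(3) by (auto simp: ker_set_def)
  qed (use hom_closed[OF u] assms(3) in \<open>auto simp: ker_set_def\<close>)
qed

section \<open>Uniqueness of minimal presentations and their list copies\<close>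

lemma min_proj_presentationD:
  assumes "min_proj_presentation R P1 d P0 q M"
  shows "projective_cover R P0 q M" "projective_cover R P1 d (ker_module P0 q M)"
  using assms by (auto simp: min_proj_presentation_def)

lemma min_proj_presentation_unique:
  assumes "min_proj_presentation R P1 d P0 q M" "min_proj_presentation R P1' d' P0' q' M"
    "left_module R M"
  shows "\<exists>u1\<in>module_iso R P1 P1'. \<exists>u0\<in>module_iso R P0 P0'. \<forall>x\<in>carrier P1. d' (u1 x) = u0 (d x)"
proof -
  note a = min_proj_presentationD[OF assms(1)] and b = min_proj_presentationD[OF assms(2)]
  note P0 = projective_coverD[OF a(1)] and P0' = projective_coverD[OF b(1)]
  obtain u0 where u0: "u0 \<in> module_iso R P0 P0'" "\<forall>x\<in>carrier P0. q' (u0 x) = q x"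
    using projective_cover_unique[OF a(1) b(1) assms(3,3) iso_ident] by blast
  have "u0 \<in> module_iso R (ker_module P0 q M) (ker_module P0' q' M)"
    using u0(2) by (intro ker_module_iso[OF P0(6) u0(1)]) simp
  then obtain u1 where "u1 \<in> module_iso R P1 P1'" "\<forall>x\<in>carrier P1. d' (u1 x) = u0 (d x)"
    using projective_cover_unique[OF a(2) b(2) left_module_ker[OF P0(6) assms(3) P0(3)]
        left_module_ker[OF P0'(6) assms(3) P0'(3)]] by blast
  with u0(1) show ?thesis by blast
qed

text \<open>Guarantees that the choice made in \<open>ar_translate\<close>, which ranges over
  presentations with list carriers, is not vacuous.\<close>

lemma min_proj_presentation_list_copy:
  fixes R :: "('r, 'x) ring_scheme"
  assumes "min_proj_presentation R P1 d P0 q M" "left_module R M"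
  shows "\<exists>(P1' :: ('r, 'r list) module) d' (P0' :: ('r, 'r list) module) q'.
    min_proj_presentation R P1' d' P0' q' M"
proof -
  note a = min_proj_presentationD[OF assms(1)]
  note P0 = projective_coverD[OF a(1)] and P1 = projective_coverD[OF a(2)]
  obtain P0' :: "('r, 'r list) module" and u0 where u0: "fg_module R P0'" "u0 \<in> module_iso R P0 P0'"
    using P0(1) by (rule fg_list_copy)
  obtain v0 where v0: "v0 \<in> module_iso R P0' P0" "\<forall>x\<in>carrier P0. v0 (u0 x) = x"
    using iso_inverseE[OF P0(6) u0(2)] by blast
  obtain P1' :: "('r, 'r list) module" and u1 where u1: "fg_module R P1'" "u1 \<in> module_iso R P1 P1'"
    using P1(1) by (rule fg_list_copy)
  obtain v1 where v1: "v1 \<in> module_iso R P1' P1"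
    using iso_inverseE[OF P1(6) u1(2)] by blast
  note lm0 = fg_left_module[OF u0(1)] and lm1 = fg_left_module[OF u1(1)]
  note kl = left_module_ker[OF P0(6) assms(2) P0(3)]
  have c0: "projective_cover R P0' (\<lambda>x. q (v0 x)) M"
    by (rule projective_cover_source[OF a(1) assms(2) lm0 v0(1)])
  have "u0 \<in> module_iso R (ker_module P0 q M) (ker_module P0' (\<lambda>x. q (v0 x)) M)"
    using v0(2) by (intro ker_module_iso[OF P0(6) u0(2)]) simp
  from projective_cover_target[OF projective_cover_source[OF a(2) kl lm1 v1] kl
      left_module_ker[OF lm0 assms(2) projective_coverD(3)[OF c0]] this] c0
  show ?thesis unfolding min_proj_presentation_def by blast
qed

section \<open>Quotient modules\<close>

lemma submodule_abelian_subgroup: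
  assumes "left_module R M" "submodule N R M"
  shows "abelian_subgroup N M"
proof -
  interpret M: left_module R M by fact
  show ?thesis
    using submodule.axioms(1)[OF assms(2)] M.M.a_comm_group
    by (intro abelian_subgroupI3 additive_subgroup.intro M.M.abelian_group_axioms)
qed

lemma
  fixes M (structure)
  assumes "left_module R M" "submodule N R M"
  shows coset_eq_iff: "\<And>x y. x \<in> carrier M \<Longrightarrow> y \<in> carrier M \<Longrightarrow>
      N +>\<^bsub>M\<^esub> x = N +>\<^bsub>M\<^esub> y \<longleftrightarrow> x \<ominus> y \<in> N"
    and coset_zero: "N +>\<^bsub>M\<^esub> \<zero> = N"
    and coset_hom: "(\<lambda>x. N +>\<^bsub>M\<^esub> x) \<in> module_hom R M (quot_module M N)"
    and coset_surj: "(\<lambda>x. N +>\<^bsub>M\<^esub> x) ` carrier M = carrier (quot_module M N)"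
    and left_module_quot: "left_module R (quot_module M N)"
proof -
  interpret M: left_module R M by fact
  interpret N: abelian_subgroup N M by (rule submodule_abelian_subgroup[OF assms])
  note Nf = submodule_facts[OF assms(2)]
  have mem: "z \<in> N +>\<^bsub>M\<^esub> x \<longleftrightarrow> z \<in> carrier M \<and> z \<ominus> x \<in> N" if x: "x \<in> carrier M" for x z
  proof
    assume "z \<in> N +>\<^bsub>M\<^esub> x"
    then obtain n where "n \<in> N" "z = n \<oplus> x" by (auto simp: a_r_coset_def')
    then show "z \<in> carrier M \<and> z \<ominus> x \<in> N"
      using x Nf(1) by (simp add: a_minus_def M.M.a_assoc M.M.r_neg)
  next
    assume "z \<in> carrier M \<and> z \<ominus> x \<in> N"
    then show "z \<in> N +>\<^bsub>M\<^esub> x"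
      unfolding a_r_coset_def' using M.M.diff_add[of z x] x by (metis UN_iff singletonI)
  qed
  show eq: "N +>\<^bsub>M\<^esub> x = N +>\<^bsub>M\<^esub> y \<longleftrightarrow> x \<ominus> y \<in> N" if xy: "x \<in> carrier M" "y \<in> carrier M" for x y
  proof
    assume "N +>\<^bsub>M\<^esub> x = N +>\<^bsub>M\<^esub> y"
    moreover have "x \<in> N +>\<^bsub>M\<^esub> x"
      using mem[OF xy(1)] xy Nf(2) by (simp add: a_minus_def M.M.r_neg)
    ultimately show "x \<ominus> y \<in> N" using mem[OF xy(2)] by simp
  next
    assume d: "x \<ominus> y \<in> N"
    have "z \<ominus> x \<in> N \<longleftrightarrow> z \<ominus> y \<in> N" if z: "z \<in> carrier M" for z
    proof
      assume "z \<ominus> x \<in> N"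
      from Nf(3)[OF this d] show "z \<ominus> y \<in> N" using M.M.diff_diff_add xy z by simp
    next
      assume "z \<ominus> y \<in> N"
      moreover have "y \<ominus> x \<in> N" using Nf(4)[OF d] M.M.minus_diff xy by simp
      ultimately show "z \<ominus> x \<in> N" using Nf(3) M.M.diff_diff_add xy z by metis
    qed
    then have "z \<in> N +>\<^bsub>M\<^esub> x \<longleftrightarrow> z \<in> N +>\<^bsub>M\<^esub> y" for z
      by (auto simp: mem[OF xy(1)] mem[OF xy(2)])
    then show "N +>\<^bsub>M\<^esub> x = N +>\<^bsub>M\<^esub> y" by blast
  qed
  show z: "N +>\<^bsub>M\<^esub> \<zero> = N" using M.M.a_coset_add_zero[OF submodule_subset[OF assms(2)]] .
  have car: "carrier (quot_module M N) = (\<lambda>x. N +>\<^bsub>M\<^esub> x) ` carrier M"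
    by (auto simp: quot_module_def A_RCOSETS_def')
  then show surj: "(\<lambda>x. N +>\<^bsub>M\<^esub> x) ` carrier M = carrier (quot_module M N)" by simp
  have add: "(N +>\<^bsub>M\<^esub> x) \<oplus>\<^bsub>quot_module M N\<^esub> (N +>\<^bsub>M\<^esub> y) = N +>\<^bsub>M\<^esub> (x \<oplus> y)"
    if "x \<in> carrier M" "y \<in> carrier M" for x y
    using N.a_rcos_sum[OF that] by (simp add: quot_module_def)
  have smult: "r \<odot>\<^bsub>quot_module M N\<^esub> (N +>\<^bsub>M\<^esub> x) = N +>\<^bsub>M\<^esub> (r \<odot> x)"
    if r: "r \<in> carrier R" and x: "x \<in> carrier M" for r x
  proof -
    \<comment> \<open>Every representative contributes the same coset, so the union defining the
      scalar multiple collapses to that coset.\<close>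
    have "N +>\<^bsub>M\<^esub> (r \<odot> y) = N +>\<^bsub>M\<^esub> (r \<odot> x)" if "y \<in> N +>\<^bsub>M\<^esub> x" for y
    proof -
      have y: "y \<in> carrier M" "y \<ominus> x \<in> N" using mem[OF x] that by auto
      then have "r \<odot> y \<ominus> r \<odot> x \<in> N"
        using Nf(5)[OF r y(2)] r x by (simp add: a_minus_def M.smult_r_distr M.smult_r_minus)
      then show ?thesis using eq r x y(1) by simp
    qed
    moreover have "x \<in> N +>\<^bsub>M\<^esub> x" using mem[OF x] x Nf(2) by (simp add: a_minus_def M.M.r_neg)
    ultimately have "(\<Union>y\<in>N +>\<^bsub>M\<^esub> x. N +>\<^bsub>M\<^esub> (r \<odot> y)) = N +>\<^bsub>M\<^esub> (r \<odot> x)"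
      by (intro SUP_eq_const) blast+
    then show ?thesis by (simp add: quot_module_def)
  qed
  have zero: "\<zero>\<^bsub>quot_module M N\<^esub> = N +>\<^bsub>M\<^esub> \<zero>" by (simp only: z) (simp add: quot_module_def)
  show "(\<lambda>x. N +>\<^bsub>M\<^esub> x) \<in> module_hom R M (quot_module M N)"
    by (rule module_homI) (auto simp: add smult car)
  show "left_module R (quot_module M N)"
    by (rule left_moduleI)
      (auto simp: car add smult zero M.R.ring_axioms M.M.a_ac M.smult_l_distr M.smult_r_distr
        M.smult_assoc1 M.M.r_neg intro!: bexI[of _ "\<ominus> _"])
qed

lemma coset_zero_iff:
  assumes "left_module R M" "submodule N R M" "x \<in> carrier M"
  shows "N +>\<^bsub>M\<^esub> x = \<zero>\<^bsub>quot_module M N\<^esub> \<longleftrightarrow> x \<in> N"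
proof -
  interpret M: left_module R M by fact
  show ?thesis
    using coset_eq_iff[OF assms(1,2,3) M.M.zero_closed] coset_zero[OF assms(1,2)] assms(3)
      M.M.diff_zero_right[OF assms(3)]
    by (simp add: quot_module_def)
qed

section \<open>Algebras, duals and the Nakayama functor\<close>

text \<open>Right modules such as \<open>star A M\<close> are treated as left modules over this
  ring, so that all facts about left modules apply to them.\<close>

definition opp :: "('r, 'x) ring_scheme \<Rightarrow> ('r, 'x) ring_scheme" where
  "opp R = R\<lparr>mult := \<lambda>x y. y \<otimes>\<^bsub>R\<^esub> x\<rparr>"

lemma opp_simps [simp]:
  "carrier (opp R) = carrier R" "\<one>\<^bsub>opp R\<^esub> = \<one>\<^bsub>R\<^esub>" "\<zero>\<^bsub>opp R\<^esub> = \<zero>\<^bsub>R\<^esub>"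
  "x \<oplus>\<^bsub>opp R\<^esub> y = x \<oplus>\<^bsub>R\<^esub> y" "x \<otimes>\<^bsub>opp R\<^esub> y = y \<otimes>\<^bsub>R\<^esub> x"
  by (simp_all add: opp_def)

lemma ring_opp: "ring R \<Longrightarrow> ring (opp R)"
proof -
  assume "ring R"
  then interpret ring R .
  show ?thesis
    by (rule ringI, rule abelian_groupI)
      (auto intro!: monoidI simp: a_ac m_assoc l_distr r_distr
        intro!: bexI[of _ "\<ominus>\<^bsub>R\<^esub> _"] l_neg)
qed

text \<open>Finiteness is left out on purpose: the locale is interpreted both for A and for
  \<open>T2 A\<close>, and the duals and the translate need only these identities.\<close>

locale k_algebra =
  fixes k :: "('k, 'x) ring_scheme" and A :: "('k, 'r) module" (structure)
  assumes cring_k: "cring k" and ring_A: "ring A" and module_A: "module k A"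
    and smult_mult: "\<And>c x y. c \<in> carrier k \<Longrightarrow> x \<in> carrier A \<Longrightarrow> y \<in> carrier A \<Longrightarrow>
      (c \<odot> x) \<otimes> y = c \<odot> (x \<otimes> y)"
    and mult_smult: "\<And>c x y. c \<in> carrier k \<Longrightarrow> x \<in> carrier A \<Longrightarrow> y \<in> carrier A \<Longrightarrow>
      x \<otimes> (c \<odot> y) = c \<odot> (x \<otimes> y)"
begin

sublocale k: cring k by (rule cring_k)
sublocale A: ring A by (rule ring_A)
sublocale kA: module k A by (rule module_A)

abbreviation reg :: "('r, 'r) module" where "reg \<equiv> regular_module A"

abbreviation res :: "('r, 'm) module \<Rightarrow> ('k, 'm) module" where "res \<equiv> restrict_scalars A"

abbreviation scal :: "'k \<Rightarrow> 'r" where "scal c \<equiv> c \<odot> \<one>"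

lemma scal_mult: "c \<in> carrier k \<Longrightarrow> x \<in> carrier A \<Longrightarrow> scal c \<otimes> x = c \<odot> x"
  by (simp add: smult_mult)

lemma mult_scal: "c \<in> carrier k \<Longrightarrow> x \<in> carrier A \<Longrightarrow> x \<otimes> scal c = c \<odot> x"
  by (simp add: mult_smult)

lemma scal_scal: "c \<in> carrier k \<Longrightarrow> d \<in> carrier k \<Longrightarrow> scal (c \<otimes>\<^bsub>k\<^esub> d) = scal c \<otimes> scal d"
  by (simp add: scal_mult kA.smult_assoc1)

text \<open>Scalars from k are central in A. The reversed product is the one that associativity over
  \<open>opp A\<close> asks for in \<open>restrict_right\<close>.\<close>

lemma scal_scal': "c \<in> carrier k \<Longrightarrow> d \<in> carrier k \<Longrightarrow> scal (c \<otimes>\<^bsub>k\<^esub> d) = scal d \<otimes> scal c"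
  by (simp add: mult_scal kA.smult_assoc1)

end

lemma restrict_scalars_simps [simp]:
  "carrier (restrict_scalars A M) = carrier M" "\<zero>\<^bsub>restrict_scalars A M\<^esub> = \<zero>\<^bsub>M\<^esub>"
  "add (restrict_scalars A M) = add M"
  "c \<odot>\<^bsub>restrict_scalars A M\<^esub> x = (c \<odot>\<^bsub>A\<^esub> \<one>\<^bsub>A\<^esub>) \<odot>\<^bsub>M\<^esub> x"
  by (simp_all add: restrict_scalars_def)

context k_algebra
begin

lemma restrict_left:
  assumes "left_module A M"
  shows "left_module k (res M)"
proof -
  interpret M: left_module A M by fact
  show ?thesis
    by (rule left_moduleI)
      (auto simp: k.ring_axioms M.M.a_ac M.smult_r_distr kA.smult_l_distr M.smult_l_distr
        scal_scal M.smult_assoc1 M.M.r_neg intro!: bexI[of _ "\<ominus>\<^bsub>M\<^esub> _"])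
qed

lemma restrict_right:
  assumes "left_module (opp A) M"
  shows "left_module k (res M)"
proof -
  interpret M: left_module "opp A" M by fact
  show ?thesis
    by (rule left_moduleI)
      (use M.smult_l_distr M.smult_assoc1 M.smult_one M.smult_closed M.smult_r_distr in
        \<open>auto simp: k.ring_axioms M.M.a_ac kA.smult_l_distr scal_scal' M.M.r_neg
          intro!: bexI[of _ "\<ominus>\<^bsub>M\<^esub> _"]\<close>)
qed

lemma hom_restrict_scalars:
  "f \<in> module_hom A M N \<Longrightarrow> f \<in> module_hom k (res M) (res N)"
  by (auto simp: module_hom_def)

lemma hom_restrict_scalars_opp:
  "f \<in> module_hom (opp A) M N \<Longrightarrow> f \<in> module_hom k (res M) (res N)"
  by (auto simp: module_hom_def)

lemma submodule_restrict_scalars: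
  assumes "left_module A M" "submodule N A M"
  shows "submodule N k (res M)"
  using submodule_facts[OF assms(2)]
  by (intro left_module.submoduleI[OF restrict_left[OF assms(1)]]) auto

end

lemma star_simps [simp]:
  "carrier (star A M) = module_hom A M (regular_module A) \<inter> extensional (carrier M)"
  "\<zero>\<^bsub>star A M\<^esub> = (\<lambda>x\<in>carrier M. \<zero>\<^bsub>A\<^esub>)"
  "f \<oplus>\<^bsub>star A M\<^esub> g = (\<lambda>x\<in>carrier M. f x \<oplus>\<^bsub>A\<^esub> g x)"
  "r \<odot>\<^bsub>star A M\<^esub> f = (\<lambda>x\<in>carrier M. f x \<otimes>\<^bsub>A\<^esub> r)"
  by (simp_all add: star_def)

lemma starI:
  assumes "left_module A M" "f \<in> module_hom A M (regular_module A)"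
  shows "(\<lambda>x\<in>carrier M. f x) \<in> carrier (star A M)"
proof -
  interpret M: left_module A M by fact
  have "(\<lambda>x\<in>carrier M. f x) \<in> module_hom A M (regular_module A)"
    by (rule hom_cong[OF assms]) simp
  then show ?thesis by simp
qed

lemma starD:
  assumes "f \<in> carrier (star A M)"
  shows "f \<in> module_hom A M (regular_module A)" "f \<in> extensional (carrier M)"
  using assms by simp_all

lemma star_eqI:
  assumes "f \<in> carrier (star A M)" "g \<in> carrier (star A M)" "\<And>x. x \<in> carrier M \<Longrightarrow> f x = g x"
  shows "f = g"
  using assms by (intro extensionalityI[of _ "carrier M"]) auto

lemma hom_mult_right:
  assumes "ring A" "f \<in> module_hom A M (regular_module A)" "r \<in> carrier A"
  shows "(\<lambda>x. f x \<otimes>\<^bsub>A\<^esub> r) \<in> module_hom A M (regular_module A)"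
proof -
  interpret ring A by fact
  show ?thesis
    using hom_facts[OF assms(2)] assms(3) by (intro module_homI) (auto simp: l_distr m_assoc)
qed

lemma left_module_star:
  assumes "left_module A M"
  shows "left_module (opp A) (star A M)"
proof -
  interpret M: left_module A M by fact
  note reg = left_module_regular[OF M.R.ring_axioms]
  note [simp] = M.R.a_ac M.R.r_distr M.R.m_assoc M.R.l_distr
  have closed: "f x \<in> carrier A" if "f \<in> carrier (star A M)" "x \<in> carrier M" for f x
    using hom_closed[OF starD(1)[OF that(1)] that(2)] by simp
  have add: "f \<oplus>\<^bsub>star A M\<^esub> g \<in> carrier (star A M)"
    if "f \<in> carrier (star A M)" "g \<in> carrier (star A M)" for f g
    using starI[OF assms hom_sum[OF reg starD(1)[OF that(1)] starD(1)[OF that(2)]]] by simp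
  have zero: "\<zero>\<^bsub>star A M\<^esub> \<in> carrier (star A M)"
    using starI[OF assms hom_const_zero[OF reg]] by simp
  have minus: "(\<lambda>x\<in>carrier M. \<ominus>\<^bsub>regular_module A\<^esub> f x) \<in> carrier (star A M)"
    if "f \<in> carrier (star A M)" for f
    by (rule starI[OF assms hom_uminus[OF reg starD(1)[OF that]]])
  have smult: "r \<odot>\<^bsub>star A M\<^esub> f \<in> carrier (star A M)"
    if "r \<in> carrier A" "f \<in> carrier (star A M)" for r f
    using starI[OF assms hom_mult_right[OF M.R.ring_axioms starD(1)[OF that(2)] that(1)]] by simp
  show ?thesis
  proof (rule left_moduleI)
    fix f assume f: "f \<in> carrier (star A M)"
    note fc = closed[OF f] and fe = starD(2)[OF f]
    show "\<zero>\<^bsub>star A M\<^esub> \<oplus>\<^bsub>star A M\<^esub> f = f"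
      unfolding star_simps by (rule restrict_eqI[OF fe]) (simp add: fc)
    show "\<one>\<^bsub>opp A\<^esub> \<odot>\<^bsub>star A M\<^esub> f = f"
      unfolding star_simps by (rule restrict_eqI[OF fe]) (simp add: fc)
    show "\<exists>g\<in>carrier (star A M). g \<oplus>\<^bsub>star A M\<^esub> f = \<zero>\<^bsub>star A M\<^esub>"
      by (rule bexI[OF _ minus[OF f]]) (auto simp: fc M.R.ring_axioms M.R.r_neg intro!: restrict_ext)
    show "a \<odot>\<^bsub>star A M\<^esub> f \<in> carrier (star A M)" if "a \<in> carrier (opp A)" for a
      using smult[OF _ f] that by (simp only: opp_simps)
    fix a assume "a \<in> carrier (opp A)"
    then have a: "a \<in> carrier A" by simp
    {
      fix b assume "b \<in> carrier (opp A)"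
      then have b: "b \<in> carrier A" by simp
      show "(a \<oplus>\<^bsub>opp A\<^esub> b) \<odot>\<^bsub>star A M\<^esub> f = a \<odot>\<^bsub>star A M\<^esub> f \<oplus>\<^bsub>star A M\<^esub> b \<odot>\<^bsub>star A M\<^esub> f"
        unfolding star_simps by (rule restrict_ext) (simp add: fc a b)
      show "(a \<otimes>\<^bsub>opp A\<^esub> b) \<odot>\<^bsub>star A M\<^esub> f = a \<odot>\<^bsub>star A M\<^esub> (b \<odot>\<^bsub>star A M\<^esub> f)"
        unfolding star_simps by (rule restrict_ext) (simp add: fc a b)
    }
    fix g assume g: "g \<in> carrier (star A M)"
    show "a \<odot>\<^bsub>star A M\<^esub> (f \<oplus>\<^bsub>star A M\<^esub> g) = a \<odot>\<^bsub>star A M\<^esub> f \<oplus>\<^bsub>star A M\<^esub> a \<odot>\<^bsub>star A M\<^esub> g"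
      unfolding star_simps by (rule restrict_ext) (simp add: fc closed[OF g] a)
  next
    fix f g h assume "f \<in> carrier (star A M)" "g \<in> carrier (star A M)" "h \<in> carrier (star A M)"
    note c = closed[OF this(1)] closed[OF this(2)] closed[OF this(3)]
    show "f \<oplus>\<^bsub>star A M\<^esub> g \<oplus>\<^bsub>star A M\<^esub> h = f \<oplus>\<^bsub>star A M\<^esub> (g \<oplus>\<^bsub>star A M\<^esub> h)"
      unfolding star_simps by (rule restrict_ext) (simp add: c)
  next
    fix f g assume "f \<in> carrier (star A M)" "g \<in> carrier (star A M)"
    note c = closed[OF this(1)] closed[OF this(2)]
    show "f \<oplus>\<^bsub>star A M\<^esub> g = g \<oplus>\<^bsub>star A M\<^esub> f"
      unfolding star_simps by (rule restrict_ext) (simp add: c)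
  qed (use add zero M.R.ring_axioms ring_opp in \<open>auto simp del: star_simps\<close>)
qed

lemma dual_simps [simp]:
  "carrier (dual k J A V) = module_hom k (restrict_scalars A V) J \<inter> extensional (carrier V)"
  "\<zero>\<^bsub>dual k J A V\<^esub> = (\<lambda>x\<in>carrier V. \<zero>\<^bsub>J\<^esub>)"
  "\<phi> \<oplus>\<^bsub>dual k J A V\<^esub> \<psi> = (\<lambda>x\<in>carrier V. \<phi> x \<oplus>\<^bsub>J\<^esub> \<psi> x)"
  "r \<odot>\<^bsub>dual k J A V\<^esub> \<phi> = (\<lambda>x\<in>carrier V. \<phi> (r \<odot>\<^bsub>V\<^esub> x))"
  by (simp_all add: dual_def)

lemma dualD:
  assumes "\<phi> \<in> carrier (dual k J A V)"
  shows "\<phi> \<in> module_hom k (restrict_scalars A V) J" "\<phi> \<in> extensional (carrier V)"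
  using assms by simp_all

lemma dual_eqI:
  assumes "\<phi> \<in> carrier (dual k J A V)" "\<psi> \<in> carrier (dual k J A V)" "\<And>x. x \<in> carrier V \<Longrightarrow> \<phi> x = \<psi> x"
  shows "\<phi> = \<psi>"
  using assms by (intro extensionalityI[of _ "carrier V"]) auto

context k_algebra
begin

lemma dualI:
  assumes "left_module (opp A) V" "\<phi> \<in> module_hom k (res V) J"
  shows "(\<lambda>x\<in>carrier V. \<phi> x) \<in> carrier (dual k J A V)"
proof -
  have "(\<lambda>x\<in>carrier V. \<phi> x) \<in> module_hom k (res V) J"
    by (rule hom_cong[OF restrict_right[OF assms(1)] assms(2)]) simp
  then show ?thesis by simp
qed

text \<open>Holds because the image of k in A is central; it makes the action of A on k-linear
  functionals well defined.\<close>

lemma smult_hom_k: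
  assumes "left_module (opp A) V" "r \<in> carrier A"
  shows "(\<lambda>x. r \<odot>\<^bsub>V\<^esub> x) \<in> module_hom k (res V) (res V)"
proof -
  interpret V: left_module "opp A" V by fact
  show ?thesis
  proof (rule module_homI)
    fix x c assume x: "x \<in> carrier (res V)" and c: "c \<in> carrier k"
    have "r \<odot>\<^bsub>V\<^esub> (scal c \<odot>\<^bsub>V\<^esub> x) = (scal c \<otimes> r) \<odot>\<^bsub>V\<^esub> x"
      using V.smult_assoc1[of r "scal c" x] assms(2) x c by simp
    also have "scal c \<otimes> r = r \<otimes> scal c" using assms(2) c by (simp only: scal_mult mult_scal)
    also have "\<dots> \<odot>\<^bsub>V\<^esub> x = scal c \<odot>\<^bsub>V\<^esub> (r \<odot>\<^bsub>V\<^esub> x)"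
      using V.smult_assoc1[of "scal c" r x] assms(2) x c by simp
    finally show "r \<odot>\<^bsub>V\<^esub> (c \<odot>\<^bsub>res V\<^esub> x) = c \<odot>\<^bsub>res V\<^esub> (r \<odot>\<^bsub>V\<^esub> x)"
      by simp
  qed (use assms(2) V.smult_closed V.smult_r_distr in auto)
qed

text \<open>The scalar acts on the argument, which reverses products once more: a module over
  \<open>opp A\<close> therefore yields a module over A.\<close>

lemma left_module_dual:
  assumes "left_module (opp A) V" "left_module k J"
  shows "left_module A (dual k J A V)"
proof -
  interpret V: left_module "opp A" V by fact
  interpret J: left_module k J by fact
  note V = assms(1)
  have Vs: "r \<odot>\<^bsub>V\<^esub> x \<in> carrier V" if "r \<in> carrier A" "x \<in> carrier V" for r x
    using V.smult_closed that by simp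
  have closed: "\<phi> x \<in> carrier J" if "\<phi> \<in> carrier (dual k J A V)" "x \<in> carrier V" for \<phi> x
    using hom_closed[OF dualD(1)[OF that(1)]] that(2) by simp
  have add: "\<phi> \<oplus>\<^bsub>dual k J A V\<^esub> \<psi> \<in> carrier (dual k J A V)"
    if "\<phi> \<in> carrier (dual k J A V)" "\<psi> \<in> carrier (dual k J A V)" for \<phi> \<psi>
    using dualI[OF V hom_sum[OF assms(2) dualD(1)[OF that(1)] dualD(1)[OF that(2)]]] by simp
  have zero: "\<zero>\<^bsub>dual k J A V\<^esub> \<in> carrier (dual k J A V)"
    using dualI[OF V hom_const_zero[OF assms(2)]] by simp
  have minus: "(\<lambda>x\<in>carrier V. \<ominus>\<^bsub>J\<^esub> \<phi> x) \<in> carrier (dual k J A V)"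
    if "\<phi> \<in> carrier (dual k J A V)" for \<phi>
    by (rule dualI[OF V hom_uminus[OF assms(2) dualD(1)[OF that]]])
  have smult: "r \<odot>\<^bsub>dual k J A V\<^esub> \<phi> \<in> carrier (dual k J A V)"
    if "r \<in> carrier A" "\<phi> \<in> carrier (dual k J A V)" for r \<phi>
    using dualI[OF V hom_compose[OF smult_hom_k[OF V that(1)] dualD(1)[OF that(2)]]] by simp
  show ?thesis
  proof (rule left_moduleI)
    fix f assume f: "f \<in> carrier (dual k J A V)"
    note fc = closed[OF f] and fe = dualD(2)[OF f] and fh = dualD(1)[OF f]
    have fa: "f (x \<oplus>\<^bsub>V\<^esub> y) = f x \<oplus>\<^bsub>J\<^esub> f y" if "x \<in> carrier V" "y \<in> carrier V" for x y
      using hom_add[OF fh] that by simp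
    show "\<zero>\<^bsub>dual k J A V\<^esub> \<oplus>\<^bsub>dual k J A V\<^esub> f = f"
      unfolding dual_simps by (rule restrict_eqI[OF fe]) (simp add: fc)
    show "\<one> \<odot>\<^bsub>dual k J A V\<^esub> f = f"
      unfolding dual_simps using V.smult_one by (intro restrict_eqI[OF fe]) simp
    show "\<exists>g\<in>carrier (dual k J A V). g \<oplus>\<^bsub>dual k J A V\<^esub> f = \<zero>\<^bsub>dual k J A V\<^esub>"
      by (rule bexI[OF _ minus[OF f]]) (auto simp: fc J.M.l_neg intro!: restrict_ext)
    show "a \<odot>\<^bsub>dual k J A V\<^esub> f \<in> carrier (dual k J A V)" if "a \<in> carrier A" for a
      using smult[OF that f] .
    fix a assume a: "a \<in> carrier A"
    {
      fix b assume b: "b \<in> carrier A"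
      show "(a \<oplus> b) \<odot>\<^bsub>dual k J A V\<^esub> f = a \<odot>\<^bsub>dual k J A V\<^esub> f \<oplus>\<^bsub>dual k J A V\<^esub> b \<odot>\<^bsub>dual k J A V\<^esub> f"
        unfolding dual_simps
        using V.smult_l_distr[of a b] a b by (intro restrict_ext) (simp add: fa Vs)
      show "(a \<otimes> b) \<odot>\<^bsub>dual k J A V\<^esub> f = a \<odot>\<^bsub>dual k J A V\<^esub> (b \<odot>\<^bsub>dual k J A V\<^esub> f)"
        unfolding dual_simps
        using V.smult_assoc1[of b a] a b by (intro restrict_ext) (simp add: Vs)
    }
    fix g assume g: "g \<in> carrier (dual k J A V)"
    show "a \<odot>\<^bsub>dual k J A V\<^esub> (f \<oplus>\<^bsub>dual k J A V\<^esub> g) =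
        a \<odot>\<^bsub>dual k J A V\<^esub> f \<oplus>\<^bsub>dual k J A V\<^esub> a \<odot>\<^bsub>dual k J A V\<^esub> g"
      unfolding dual_simps using a by (intro restrict_ext) (simp add: Vs)
  next
    fix f g h assume "f \<in> carrier (dual k J A V)" "g \<in> carrier (dual k J A V)" "h \<in> carrier (dual k J A V)"
    note c = closed[OF this(1)] closed[OF this(2)] closed[OF this(3)]
    show "f \<oplus>\<^bsub>dual k J A V\<^esub> g \<oplus>\<^bsub>dual k J A V\<^esub> h = f \<oplus>\<^bsub>dual k J A V\<^esub> (g \<oplus>\<^bsub>dual k J A V\<^esub> h)"
      unfolding dual_simps by (rule restrict_ext) (simp add: c J.M.a_assoc)
  next
    fix f g assume "f \<in> carrier (dual k J A V)" "g \<in> carrier (dual k J A V)"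
    note c = closed[OF this(1)] closed[OF this(2)]
    show "f \<oplus>\<^bsub>dual k J A V\<^esub> g = g \<oplus>\<^bsub>dual k J A V\<^esub> f"
      unfolding dual_simps by (rule restrict_ext) (simp add: c J.M.a_comm)
  qed (use add zero ring_A in \<open>auto simp del: dual_simps\<close>)
qed

lemma left_module_nakayama:
  "left_module A M \<Longrightarrow> left_module k J \<Longrightarrow> left_module A (nakayama k J A M)"
  unfolding nakayama_def by (intro left_module_dual left_module_star)

end

section \<open>Functoriality of \<open>star\<close>, \<open>dual\<close> and
  \<open>nakayama\<close>\<close>

lemma pullback_star_hom:
  assumes "left_module A M" "left_module A N" "f \<in> module_hom A M N"
  shows "pullback M f \<in> module_hom (opp A) (star A N) (star A M)"
proof (rule module_homI)
  note f = hom_closed[OF assms(3)]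
  fix g assume "g \<in> carrier (star A N)"
  then have g: "g \<in> module_hom A N (regular_module A)" by (rule starD)
  show "pullback M f g \<in> carrier (star A M)"
    unfolding pullback_def by (rule starI[OF assms(1) hom_compose[OF assms(3) g]])
  show "pullback M f (g \<oplus>\<^bsub>star A N\<^esub> h) = pullback M f g \<oplus>\<^bsub>star A M\<^esub> pullback M f h" for h
    by (auto simp: pullback_def f intro!: restrict_ext)
  show "pullback M f (r \<odot>\<^bsub>star A N\<^esub> g) = r \<odot>\<^bsub>star A M\<^esub> pullback M f g" for r
    by (auto simp: pullback_def f intro!: restrict_ext)
qed

context k_algebra
begin

lemma pullback_dual_hom:
  assumes "left_module (opp A) V" "left_module (opp A) W" "f \<in> module_hom (opp A) V W"
  shows "pullback V f \<in> module_hom A (dual k J A W) (dual k J A V)"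
proof (rule module_homI)
  interpret V: left_module "opp A" V by fact
  note f = hom_closed[OF assms(3)]
  fix g assume "g \<in> carrier (dual k J A W)"
  then have g: "g \<in> module_hom k (res W) J" by (rule dualD)
  show "pullback V f g \<in> carrier (dual k J A V)"
    unfolding pullback_def
    by (rule dualI[OF assms(1) hom_compose[OF hom_restrict_scalars_opp[OF assms(3)] g]])
  show "pullback V f (g \<oplus>\<^bsub>dual k J A W\<^esub> h) = pullback V f g \<oplus>\<^bsub>dual k J A V\<^esub> pullback V f h" for h
    by (auto simp: pullback_def f intro!: restrict_ext)
  show "pullback V f (r \<odot>\<^bsub>dual k J A W\<^esub> g) = r \<odot>\<^bsub>dual k J A V\<^esub> pullback V f g" if "r \<in> carrier A" for r
    using that V.smult_closed hom_smult[OF assms(3)]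
    by (auto simp: pullback_def f intro!: restrict_ext)
qed

lemma nakayama_map_hom:
  assumes "left_module A M" "left_module A N" "f \<in> module_hom A M N"
  shows "nakayama_map A M f N \<in> module_hom A (nakayama k J A M) (nakayama k J A N)"
  unfolding nakayama_map_def nakayama_def
  by (intro pullback_dual_hom left_module_star assms pullback_star_hom)

text \<open>This is the dual of the transpose of \<open>d\<close>.\<close>

definition ar_ker where
  "ar_ker J P1 d P0 = (nakayama k J A P1)\<lparr>carrier :=
     {\<phi> \<in> carrier (nakayama k J A P1). \<forall>f\<in>carrier (star A P0). \<phi> (pullback P1 d f) = \<zero>\<^bsub>J\<^esub>}\<rparr>"

lemma ar_ker_mem:
  "\<phi> \<in> carrier (ar_ker J P1 d P0) \<longleftrightarrow> \<phi> \<in> carrier (nakayama k J A P1) \<and>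
    (\<forall>f\<in>carrier (star A P0). \<phi> (pullback P1 d f) = \<zero>\<^bsub>J\<^esub>)"
  by (simp add: ar_ker_def)

text \<open>A scalar moves from the functional to its argument, and the maps that factor through
  \<open>d\<close> are stable under scalars.\<close>

lemma left_module_ar_ker:
  assumes "left_module A P1" "left_module A P0" "d \<in> module_hom A P1 P0" "left_module k J"
  shows "left_module A (ar_ker J P1 d P0)"
proof -
  interpret \<nu>: left_module A "nakayama k J A P1" by (rule left_module_nakayama[OF assms(1,4)])
  interpret J: left_module k J by fact
  interpret S: left_module "opp A" "star A P0" by (rule left_module_star[OF assms(2)])
  note pb = pullback_star_hom[OF assms(1-3)]
  have "submodule {\<phi> \<in> carrier (nakayama k J A P1). \<forall>f\<in>carrier (star A P0). \<phi> (pullback P1 d f) = \<zero>\<^bsub>J\<^esub>}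
    A (nakayama k J A P1)"
  proof (rule \<nu>.submoduleI)
    let ?K = "{\<phi> \<in> carrier (nakayama k J A P1). \<forall>f\<in>carrier (star A P0). \<phi> (pullback P1 d f) = \<zero>\<^bsub>J\<^esub>}"
    note pbc = hom_closed[OF pb]
    show "?K \<subseteq> carrier (nakayama k J A P1)" by auto
    show "\<zero>\<^bsub>nakayama k J A P1\<^esub> \<in> ?K"
      using \<nu>.M.zero_closed pbc by (simp add: nakayama_def del: star_simps)
    show "\<phi> \<oplus>\<^bsub>nakayama k J A P1\<^esub> \<psi> \<in> ?K" if "\<phi> \<in> ?K" "\<psi> \<in> ?K" for \<phi> \<psi>
    proof -
      have "\<phi> \<oplus>\<^bsub>nakayama k J A P1\<^esub> \<psi> \<in> carrier (nakayama k J A P1)" using that by simp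
      then show ?thesis using that pbc by (simp add: nakayama_def del: star_simps)
    qed
    show "r \<odot>\<^bsub>nakayama k J A P1\<^esub> \<phi> \<in> ?K" if r: "r \<in> carrier A" and "\<phi> \<in> ?K" for r \<phi>
    proof -
      have c: "r \<odot>\<^bsub>nakayama k J A P1\<^esub> \<phi> \<in> carrier (nakayama k J A P1)" using that by simp
      have "r \<odot>\<^bsub>star A P1\<^esub> pullback P1 d f = pullback P1 d (r \<odot>\<^bsub>star A P0\<^esub> f)"
        "r \<odot>\<^bsub>star A P0\<^esub> f \<in> carrier (star A P0)"
        if "f \<in> carrier (star A P0)" for f
        using hom_smult[OF pb] that r S.smult_closed[of r f] by simp_all
      then show ?thesis using that pbc c by (simp add: nakayama_def del: star_simps)
    qed
  qed
  then show ?thesis unfolding ar_ker_def by (rule left_module_submodule[OF \<nu>.left_module_axioms])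
qed

text \<open>Trades cosets for an annihilation condition: a functional on V/W is a functional on V
  that kills W. With W the image of a pullback this removes \<open>transpose\<close> from all later
  arguments.\<close>

lemma dual_quot_iso:
  assumes "left_module (opp A) V" "submodule W (opp A) V" "left_module k J"
  shows "(\<lambda>\<psi>. \<lambda>f\<in>carrier V. \<psi> (W +>\<^bsub>V\<^esub> f)) \<in>
    module_iso A (dual k J A (quot_module V W))
      ((dual k J A V)\<lparr>carrier := {\<phi> \<in> carrier (dual k J A V). \<forall>w\<in>W. \<phi> w = \<zero>\<^bsub>J\<^esub>}\<rparr>)"
    (is "?F \<in> module_iso A (dual k J A ?Q) ?D")
proof (rule module_isoI)
  interpret V: left_module "opp A" V by fact
  interpret J: left_module k J by fact
  note cf = coset_eq_iff[OF assms(1,2)] coset_surj[OF assms(1,2)]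
  note ch = coset_hom[OF assms(1,2)] and chk = hom_restrict_scalars_opp[OF coset_hom[OF assms(1,2)]]
  note lq = left_module_quot[OF assms(1,2)]
  note cz = coset_zero_iff[OF assms(1,2)]
  have cc: "W +>\<^bsub>V\<^esub> f \<in> carrier ?Q" if "f \<in> carrier V" for f using hom_closed[OF ch that] .
  have F: "?F \<psi> \<in> carrier ?D" if "\<psi> \<in> carrier (dual k J A ?Q)" for \<psi>
  proof -
    note h = dualD(1)[OF that]
    have "\<psi> (W +>\<^bsub>V\<^esub> w) = \<zero>\<^bsub>J\<^esub>" if "w \<in> W" for w
      using cz[OF submodule_mem[OF assms(2) that]] that
        hom_zero[OF restrict_right[OF lq] assms(3) h] by simp
    then show ?thesis
      using dualI[OF assms(1) hom_compose[OF chk h]] submodule_mem[OF assms(2)] by simp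
  qed
  show "?F \<in> module_hom A (dual k J A ?Q) ?D"
  proof (rule module_homI)
    fix \<psi> assume "\<psi> \<in> carrier (dual k J A ?Q)"
    then show "?F \<psi> \<in> carrier ?D" by (rule F)
    show "?F (\<psi> \<oplus>\<^bsub>dual k J A ?Q\<^esub> \<psi>') = ?F \<psi> \<oplus>\<^bsub>?D\<^esub> ?F \<psi>'" for \<psi>'
    proof -
      have "?F (\<psi> \<oplus>\<^bsub>dual k J A ?Q\<^esub> \<psi>') = (\<lambda>f\<in>carrier V. \<psi> (W +>\<^bsub>V\<^esub> f) \<oplus>\<^bsub>J\<^esub> \<psi>' (W +>\<^bsub>V\<^esub> f))"
        by (rule restrict_ext) (simp only: dual_simps restrict_apply' cc)
      also have "\<dots> = ?F \<psi> \<oplus>\<^bsub>dual k J A V\<^esub> ?F \<psi>'"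
        unfolding dual_simps by (rule restrict_ext) (simp only: restrict_apply')
      finally show ?thesis by simp
    qed
    show "?F (r \<odot>\<^bsub>dual k J A ?Q\<^esub> \<psi>) = r \<odot>\<^bsub>?D\<^esub> ?F \<psi>" if r: "r \<in> carrier A" for r
    proof -
      have "?F (r \<odot>\<^bsub>dual k J A ?Q\<^esub> \<psi>) = (\<lambda>f\<in>carrier V. \<psi> (r \<odot>\<^bsub>?Q\<^esub> (W +>\<^bsub>V\<^esub> f)))"
        by (rule restrict_ext) (simp only: dual_simps restrict_apply' cc)
      also have "\<dots> = (\<lambda>f\<in>carrier V. \<psi> (W +>\<^bsub>V\<^esub> (r \<odot>\<^bsub>V\<^esub> f)))"
        by (rule restrict_ext) (use hom_smult[OF ch, of r] r in simp)
      also have "\<dots> = r \<odot>\<^bsub>dual k J A V\<^esub> ?F \<psi>"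
        unfolding dual_simps by (rule restrict_ext) (use V.smult_closed r in \<open>simp only: restrict_apply' opp_simps\<close>)
      finally show ?thesis by simp
    qed
  qed
  show "inj_on ?F (carrier (dual k J A ?Q))"
  proof (rule inj_onI)
    fix \<psi> \<psi>' assume *: "\<psi> \<in> carrier (dual k J A ?Q)" "\<psi>' \<in> carrier (dual k J A ?Q)" "?F \<psi> = ?F \<psi>'"
    show "\<psi> = \<psi>'"
    proof (rule dual_eqI[OF *(1,2)])
      fix X assume "X \<in> carrier ?Q"
      then obtain f where f: "f \<in> carrier V" "X = W +>\<^bsub>V\<^esub> f" using cf(2) by blast
      then show "\<psi> X = \<psi>' X" using restrict_apply'[OF f(1)] fun_cong[OF *(3), of f] by simp
    qed
  qed
  have "carrier ?D \<subseteq> ?F ` carrier (dual k J A ?Q)"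
  proof
    fix \<phi> assume \<phi>: "\<phi> \<in> carrier ?D"
    then have d: "\<phi> \<in> carrier (dual k J A V)" and w: "\<And>w. w \<in> W \<Longrightarrow> \<phi> w = \<zero>\<^bsub>J\<^esub>" by simp_all
    note h = dualD(1)[OF d]
    \<comment> \<open>An arbitrary choice of representatives. It matters only through
      \<open>\<phi>\<close>, which is insensitive to it because it kills \<open>W\<close>.\<close>
    define s where "s = inv_into (carrier V) (\<lambda>f. W +>\<^bsub>V\<^esub> f)"
    have s: "s X \<in> carrier V" "W +>\<^bsub>V\<^esub> s X = X" if "X \<in> carrier ?Q" for X
      using that unfolding s_def cf(2)[symmetric]
      by (rule inv_into_into) (rule f_inv_into_f[of _ "\<lambda>f. W +>\<^bsub>V\<^esub> f", OF that[unfolded cf(2)[symmetric]]])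
    have \<phi>s: "\<phi> (s (W +>\<^bsub>V\<^esub> f)) = \<phi> f" if f: "f \<in> carrier V" for f
    proof -
      let ?g = "s (W +>\<^bsub>V\<^esub> f)"
      have g: "?g \<in> carrier V" "?g \<ominus>\<^bsub>V\<^esub> f \<in> W"
        using s[OF cc[OF f]] cf(1)[of ?g f] f by auto
      have "\<phi> ?g = \<phi> ((?g \<ominus>\<^bsub>V\<^esub> f) \<oplus>\<^bsub>V\<^esub> f)" using g f by (simp add: V.M.diff_add)
      also have "\<dots> = \<phi> (?g \<ominus>\<^bsub>V\<^esub> f) \<oplus>\<^bsub>J\<^esub> \<phi> f" using hom_add[OF h, of "?g \<ominus>\<^bsub>V\<^esub> f" f] g f by simp
      also have "\<dots> = \<phi> f" using w[OF g(2)] hom_closed[OF h] f by simp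
      finally show ?thesis .
    qed
    let ?\<psi> = "\<lambda>X\<in>carrier ?Q. \<phi> (s X)"
    have "(\<lambda>X. \<phi> (s X)) \<in> module_hom k (res ?Q) J"
    proof (rule module_homI)
      fix X assume "X \<in> carrier (res ?Q)"
      then obtain f where f: "f \<in> carrier V" "X = W +>\<^bsub>V\<^esub> f" using cf(2) by auto
      show "\<phi> (s X) \<in> carrier J" using hom_closed[OF h] f \<phi>s by simp
      show "\<phi> (s (X \<oplus>\<^bsub>res ?Q\<^esub> Y)) = \<phi> (s X) \<oplus>\<^bsub>J\<^esub> \<phi> (s Y)"
        if Y: "Y \<in> carrier (res ?Q)" for Y
      proof -
        obtain g where g: "g \<in> carrier V" "Y = W +>\<^bsub>V\<^esub> g" using cf(2) Y by auto
        then show ?thesis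
          using f \<phi>s hom_add[OF ch f(1) g(1), symmetric] hom_add[OF h, of f g] by simp
      qed
      show "\<phi> (s (c \<odot>\<^bsub>res ?Q\<^esub> X)) = c \<odot>\<^bsub>J\<^esub> \<phi> (s X)" if c: "c \<in> carrier k" for c
        using f \<phi>s hom_smult[OF ch _ f(1), of "scal c", symmetric] hom_smult[OF h c, of f] c
          V.smult_closed[of "scal c" f] by simp
    qed
    then have "?\<psi> \<in> carrier (dual k J A ?Q)" by (rule dualI[OF lq])
    moreover have "?F ?\<psi> = \<phi>"
      by (rule restrict_eqI[OF dualD(2)[OF d]]) (simp add: cc \<phi>s)
    ultimately show "\<phi> \<in> ?F ` carrier (dual k J A ?Q)" by (intro image_eqI[of _ _ ?\<psi>]) simp_all
  qed
  then show "?F ` carrier (dual k J A ?Q) = carrier ?D" using F by blast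
qed

lemma dual_transpose_iso:
  assumes "left_module A P1" "left_module A P0" "d \<in> module_hom A P1 P0" "left_module k J"
  shows "\<exists>u. u \<in> module_iso A (dual k J A (transpose A P1 d P0)) (ar_ker J P1 d P0)"
proof -
  note s1 = left_module_star[OF assms(1)] and s0 = left_module_star[OF assms(2)]
  interpret S0: left_module "opp A" "star A P0" by (rule s0)
  have "submodule (pullback P1 d ` carrier (star A P0)) (opp A) (star A P1)"
    by (rule hom_image_submodule[OF s0 s1 pullback_star_hom[OF assms(1-3)] S0.submodule_carrier])
  from dual_quot_iso[OF s1 this assms(4)] show ?thesis
    unfolding transpose_def ar_ker_def nakayama_def by auto
qed

text \<open>The commuting square rewrites a map pulled back along \<open>d'\<close> and then
  \<open>u\<close> as one pulled back along \<open>w\<close> and then \<open>d\<close>, and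
  \<open>\<phi>\<close> kills the latter.\<close>

lemma nakayama_map_ar_ker:
  assumes \<phi>: "\<phi> \<in> carrier (ar_ker J P d Q)" and "left_module A P" "left_module A P'" "u \<in> module_hom A P P'"
    "w \<in> module_hom A Q Q'" "left_module A Q" "left_module A Q'" "d' \<in> module_hom A P' Q'" "d \<in> module_hom A P Q"
    "\<forall>x\<in>carrier P. d' (u x) = w (d x)"
  shows "nakayama_map A P u P' \<phi> \<in> carrier (ar_ker J P' d' Q')"
proof -
  have "nakayama_map A P u P' \<phi> \<in> carrier (nakayama k J A P')"
    using \<phi> by (intro hom_closed[OF nakayama_map_hom[OF assms(2-4)]]) (simp add: ar_ker_mem)
  moreover have "nakayama_map A P u P' \<phi> (pullback P' d' f) = \<zero>\<^bsub>J\<^esub>" if f: "f \<in> carrier (star A Q')" for f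
  proof -
    have "pullback P' d' f \<in> carrier (star A P')"
      by (rule hom_closed[OF pullback_star_hom f]) fact+
    then have "nakayama_map A P u P' \<phi> (pullback P' d' f) = \<phi> (pullback P u (pullback P' d' f))"
      unfolding nakayama_map_def pullback_def[of "star A P'"] by simp
    also have "pullback P u (pullback P' d' f) = pullback P d (pullback Q w f)"
      unfolding pullback_def
      using hom_closed[OF \<open>u \<in> _\<close>] hom_closed[OF \<open>d \<in> _\<close>] \<open>\<forall>x\<in>carrier P. d' (u x) = w (d x)\<close>
      by (intro restrict_ext) simp
    also have "\<phi> \<dots> = \<zero>\<^bsub>J\<^esub>"
      using \<phi> hom_closed[OF pullback_star_hom[OF \<open>left_module A Q\<close> \<open>left_module A Q'\<close> \<open>w \<in> _\<close>] f]
      by (simp only: ar_ker_mem)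
    finally show ?thesis .
  qed
  ultimately show ?thesis by (simp add: ar_ker_mem)
qed

lemma nakayama_map_inverse:
  assumes \<phi>: "\<phi> \<in> carrier (nakayama k J A P)" and "left_module A P" "left_module A P'" "u \<in> module_hom A P P'"
    "v \<in> module_hom A P' P" "\<forall>x\<in>carrier P. v (u x) = x"
  shows "nakayama_map A P' v P (nakayama_map A P u P' \<phi>) = \<phi>"
proof -
  have "nakayama_map A P' v P (nakayama_map A P u P' \<phi>) = (\<lambda>f\<in>carrier (star A P). \<phi> f)"
    unfolding nakayama_map_def pullback_def[of "star A P"] pullback_def[of "star A P'"]
  proof (rule restrict_ext)
    fix f assume f: "f \<in> carrier (star A P)"
    have "pullback P' v f \<in> carrier (star A P')"
      by (rule hom_closed[OF pullback_star_hom f]) fact+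
    moreover have "pullback P u (pullback P' v f) = f"
      unfolding pullback_def using hom_closed[OF \<open>u \<in> _\<close>] \<open>\<forall>x\<in>carrier P. v (u x) = x\<close>
      by (intro restrict_eqI[OF starD(2)[OF f]]) simp
    ultimately show "(\<lambda>x\<in>carrier (star A P'). \<phi> (pullback P u x)) (pullback P' v f) = \<phi> f" by simp
  qed
  also have "\<dots> = \<phi>" using \<phi> by (intro restrict_eqI) (auto simp: nakayama_def)
  finally show ?thesis .
qed

lemma ar_ker_iso:
  assumes P: "left_module A P1" "left_module A P0" and P': "left_module A P1'" "left_module A P0'"
    and "d \<in> module_hom A P1 P0" "d' \<in> module_hom A P1' P0'" "left_module k J"
    and u: "u1 \<in> module_iso A P1 P1'" "u0 \<in> module_iso A P0 P0'"
      "\<forall>x\<in>carrier P1. d' (u1 x) = u0 (d x)"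
  shows "\<exists>u. u \<in> module_iso A (ar_ker J P1 d P0) (ar_ker J P1' d' P0')"
proof -
  obtain v1 where v1: "v1 \<in> module_iso A P1' P1" "\<forall>x\<in>carrier P1. v1 (u1 x) = x" "\<forall>x\<in>carrier P1'. u1 (v1 x) = x"
    using iso_inverseE[OF P(1) u(1)] by blast
  obtain v0 where v0: "v0 \<in> module_iso A P0' P0" "\<forall>x\<in>carrier P0. v0 (u0 x) = x" "\<forall>x\<in>carrier P0'. u0 (v0 x) = x"
    using iso_inverseE[OF P(2) u(2)] by blast
  note hu1 = iso_hom[OF u(1)] and hu0 = iso_hom[OF u(2)] and hv1 = iso_hom[OF v1(1)] and hv0 = iso_hom[OF v0(1)]
  have vd: "v0 (d' x) = d (v1 x)" if "x \<in> carrier P1'" for x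
    using u(3) v1(3) v0(2) that hom_closed[OF hv1] hom_closed[OF assms(5)] by metis
  have "nakayama_map A P1 u1 P1' \<in> module_iso A (ar_ker J P1 d P0) (ar_ker J P1' d' P0')"
  proof (rule module_isoI'[where g = "nakayama_map A P1' v1 P1"])
    show "nakayama_map A P1 u1 P1' \<in> module_hom A (ar_ker J P1 d P0) (ar_ker J P1' d' P0')"
      unfolding ar_ker_def
    proof (rule hom_restrict_cod[OF hom_restrict_dom[OF _ nakayama_map_hom[OF P(1) P'(1) hu1]]])
      show "{\<phi> \<in> carrier (nakayama k J A P1). \<forall>f\<in>carrier (star A P0). \<phi> (pullback P1 d f) = \<zero>\<^bsub>J\<^esub>} \<subseteq>
        carrier (nakayama k J A P1)" by blast
      show "nakayama_map A P1 u1 P1' ` carrier (nakayama k J A P1\<lparr>carrier := {\<phi> \<in> carrier (nakayama k J A P1).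
          \<forall>f\<in>carrier (star A P0). \<phi> (pullback P1 d f) = \<zero>\<^bsub>J\<^esub>}\<rparr>)
        \<subseteq> {\<phi> \<in> carrier (nakayama k J A P1'). \<forall>f\<in>carrier (star A P0'). \<phi> (pullback P1' d' f) = \<zero>\<^bsub>J\<^esub>}"
        using nakayama_map_ar_ker[OF _ P(1) P'(1) hu1 hu0 P(2) P'(2) assms(6,5) u(3)] unfolding ar_ker_def
        by (intro image_subsetI) simp
    qed
    show "\<phi> \<in> carrier (ar_ker J P1' d' P0') \<Longrightarrow> nakayama_map A P1' v1 P1 \<phi> \<in> carrier (ar_ker J P1 d P0)" for \<phi>
      using nakayama_map_ar_ker[OF _ P'(1) P(1) hv1 hv0 P'(2) P(2) assms(5,6)] vd by simp
    show "\<phi> \<in> carrier (ar_ker J P1' d' P0') \<Longrightarrow> nakayama_map A P1 u1 P1' (nakayama_map A P1' v1 P1 \<phi>) = \<phi>" for \<phi>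
      by (rule nakayama_map_inverse[OF _ P'(1) P(1) hv1 hu1 v1(3), where J = J]) (simp only: ar_ker_mem)
    show "\<phi> \<in> carrier (ar_ker J P1 d P0) \<Longrightarrow> nakayama_map A P1' v1 P1 (nakayama_map A P1 u1 P1' \<phi>) = \<phi>" for \<phi>
      by (rule nakayama_map_inverse[OF _ P(1) P'(1) hu1 hv1 v1(2), where J = J]) (simp only: ar_ker_mem)
  qed
  then show ?thesis by blast
qed

text \<open>Replaces the chosen presentation by any minimal one, with carriers of any types. All
  later computations of a translate enter through this isomorphism.\<close>

lemma
  assumes "min_proj_presentation A P1 d P0 q M" "left_module A M" "left_module k J"
  shows ar_translate_iso: "\<exists>u. u \<in> module_iso A (ar_ker J P1 d P0) (ar_translate k J A M)"
    and left_module_ar_translate: "left_module A (ar_translate k J A M)"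
proof -
  let ?P = "\<lambda>(P1 :: ('r, 'r list) module, d, P0 :: ('r, 'r list) module). \<exists>q. min_proj_presentation A P1 d P0 q M"
  obtain P1' d' P0' where s: "(SOME x. ?P x) = (P1', d', P0')" by (cases "SOME x. ?P x")
  have "\<exists>x. ?P x" using min_proj_presentation_list_copy[OF assms(1,2)] by auto
  then have "?P (SOME x. ?P x)" by (rule someI_ex)
  then obtain q' where q': "min_proj_presentation A P1' d' P0' q' M" unfolding s by auto
  have ar: "ar_translate k J A M = dual k J A (transpose A P1' d' P0')"
    using s by (simp add: ar_translate_def)
  note a = min_proj_presentationD[OF assms(1)] and b = min_proj_presentationD[OF q']
  note P0 = projective_coverD[OF a(1)] and P1 = projective_coverD[OF a(2)]
  note P0' = projective_coverD[OF b(1)] and P1' = projective_coverD[OF b(2)]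
  have d: "d \<in> module_hom A P1 P0"
    using P1(3) unfolding ker_module_def by (rule hom_incl) (auto simp: ker_set_def)
  have d': "d' \<in> module_hom A P1' P0'"
    using P1'(3) unfolding ker_module_def by (rule hom_incl) (auto simp: ker_set_def)
  obtain u1 u0 where u: "u1 \<in> module_iso A P1 P1'" "u0 \<in> module_iso A P0 P0'" "\<forall>x\<in>carrier P1. d' (u1 x) = u0 (d x)"
    using min_proj_presentation_unique[OF assms(1) q' assms(2)] by blast
  obtain w where w: "w \<in> module_iso A (ar_ker J P1 d P0) (ar_ker J P1' d' P0')"
    using ar_ker_iso[OF P1(6) P0(6) P1'(6) P0'(6) d d' assms(3) u] by blast
  obtain t where t: "t \<in> module_iso A (dual k J A (transpose A P1' d' P0')) (ar_ker J P1' d' P0')"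
    using dual_transpose_iso[OF P1'(6) P0'(6) d' assms(3)] by blast
  show lm: "left_module A (ar_translate k J A M)"
    unfolding ar transpose_def
    by (intro left_module_dual left_module_quot left_module_star P1'(6) assms(3)
        hom_image_submodule[OF left_module_star[OF P0'(6)] left_module_star[OF P1'(6)]
          pullback_star_hom[OF P1'(6) P0'(6) d']] left_module.submodule_carrier P0'(6))
  from iso_inverseE[OF lm[unfolded ar] t] obtain t' where
    "t' \<in> module_iso A (ar_ker J P1' d' P0') (dual k J A (transpose A P1' d' P0'))" by blast
  from iso_compose[OF w this] show "\<exists>u. u \<in> module_iso A (ar_ker J P1 d P0) (ar_translate k J A M)"
    unfolding ar by blast
qed

end

section \<open>Chain conditions\<close>

definition dcc :: "('r, 'x) ring_scheme \<Rightarrow> ('r, 'm) module \<Rightarrow> bool" where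
  "dcc R M \<longleftrightarrow> (\<forall>I :: nat \<Rightarrow> 'm set. (\<forall>n. submodule (I n) R M \<and> I (Suc n) \<subseteq> I n) \<longrightarrow>
     (\<exists>n. \<forall>m\<ge>n. I m = I n))"

lemma dcc_minimal:
  assumes "dcc R M" "S \<noteq> {}" "\<And>N. N \<in> S \<Longrightarrow> submodule N R M"
  shows "\<exists>N\<in>S. \<forall>N'\<in>S. N' \<subseteq> N \<longrightarrow> N' = N"
proof (rule ccontr)
  assume "\<not> ?thesis"
  then have step: "\<forall>N\<in>S. \<exists>N'\<in>S. N' \<subset> N" by blast
  obtain N0 where "N0 \<in> S" using assms(2) by blast
  have "\<exists>f. \<forall>n. f n \<in> S \<and> f (Suc n) \<subset> f n"
    by (rule dependent_nat_choice) (use \<open>N0 \<in> S\<close> step in auto)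
  then obtain f where f: "\<And>n. f n \<in> S" "\<And>n. f (Suc n) \<subset> f n" by blast
  have "\<forall>n. submodule (f n) R M \<and> f (Suc n) \<subseteq> f n"     by (intro allI conjI assms(3) f(1) less_imp_le[OF f(2)])
  then have "\<exists>n. \<forall>m\<ge>n. f m = f n" by (rule assms(1)[unfolded dcc_def, THEN spec, THEN mp])
  then obtain n where n: "\<forall>m\<ge>n. f m = f n" by (rule exE)
  have "f (Suc n) = f n" by (rule n[rule_format]) simp
  then show False using f(2) by blast
qed

text \<open>A smallest finite intersection cannot shrink when one more member is added, so it lies
  in every member. This is the device that replaces an infinite family of maps or ideals by finitely
  many.\<close>

lemma dcc_finite_Inter:
  assumes "dcc R M" "left_module R M" "\<And>i. i \<in> S \<Longrightarrow> submodule (N i) R M"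
  shows "\<exists>F. finite F \<and> F \<subseteq> S \<and> (\<forall>x\<in>carrier M. (\<forall>i\<in>F. x \<in> N i) \<longrightarrow> (\<forall>i\<in>S. x \<in> N i))"
proof -
  interpret M: left_module R M by fact
  let ?I = "\<lambda>F. carrier M \<inter> (\<Inter>i\<in>F. N i)"
  let ?T = "?I ` {F. finite F \<and> F \<subseteq> S}"
  have "\<exists>K\<in>?T. \<forall>K'\<in>?T. K' \<subseteq> K \<longrightarrow> K' = K"
  proof (rule dcc_minimal[OF assms(1)])
    show "?T \<noteq> {}" by blast
    fix K assume "K \<in> ?T"
    then obtain F where "F \<subseteq> S" "K = ?I F" by blast
    then show "submodule K R M" using assms(3) by (auto intro!: M.submodule_INT)
  qed
  then obtain K where K: "K \<in> ?T" "\<forall>K'\<in>?T. K' \<subseteq> K \<longrightarrow> K' = K" by (elim bexE)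
  from K(1) obtain F where F0: "K = ?I F" "F \<in> {F. finite F \<and> F \<subseteq> S}" by (rule imageE)
  then have F: "finite F" "F \<subseteq> S" "K = ?I F" by simp_all
  have min: "?I F' = ?I F" if "finite F'" "F' \<subseteq> S" "?I F' \<subseteq> ?I F" for F'
    using K(2)[rule_format, of "?I F'"] that F(3) by simp
  have "x \<in> N i" if "i \<in> S" "x \<in> carrier M" "\<forall>i\<in>F. x \<in> N i" for x i
  proof -
    have "?I (insert i F) = ?I F"
      by (rule min) (use F(1,2) that(1) in \<open>simp_all only: finite_insert insert_subset, blast\<close>)
    moreover have "x \<in> ?I F" using that(2,3) by blast
    ultimately show ?thesis by blast
  qed
  then show ?thesis using F(1,2) by (intro exI[of _ F] conjI ballI impI)
qed

lemma submodule_Union: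
  assumes "left_module R M" "C \<noteq> {}" "\<And>N. N \<in> C \<Longrightarrow> submodule N R M" "subset.chain X C"
  shows "submodule (\<Union>C) R M"
proof -
  interpret M: left_module R M by fact
  show ?thesis
  proof (rule M.submoduleI)
    show "\<Union>C \<subseteq> carrier M" using assms(3) submodule_subset by blast
    show "\<zero>\<^bsub>M\<^esub> \<in> \<Union>C" using assms(2,3) submodule_zero_mem by blast
    show "a \<oplus>\<^bsub>M\<^esub> b \<in> \<Union>C" if ab: "a \<in> \<Union>C" "b \<in> \<Union>C" for a b
    proof -
      obtain N N' where N: "N \<in> C" "a \<in> N" "N' \<in> C" "b \<in> N'" using ab by blast
      then have "N \<subseteq> N' \<or> N' \<subseteq> N" using assms(4) by (auto simp: subset.chain_def)
      then obtain K where "K \<in> C" "a \<in> K" "b \<in> K" using N by blast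
      then show ?thesis using submodule_add[OF assms(3)] by blast
    qed
    show "a \<odot>\<^bsub>M\<^esub> x \<in> \<Union>C" if "a \<in> carrier R" "x \<in> \<Union>C" for a x
      using that submodule_smult[OF assms(3)] by blast
  qed
qed

text \<open>Zorn applies because the union of a chain still misses \<open>x\<close>. Used with
  \<open>x\<close> the unit of the ring, for maximal left ideals, and in \<open>noetherian\<close>,
  for a hyperplane.\<close>

lemma maximal_submodule_avoiding:
  assumes "left_module R M" "submodule N R M" "x \<notin> N"
  shows "\<exists>W. submodule W R M \<and> N \<subseteq> W \<and> x \<notin> W \<and>
    (\<forall>W'. submodule W' R M \<and> W \<subseteq> W' \<and> x \<notin> W' \<longrightarrow> W' = W)"
proof -
  let ?S = "{W. submodule W R M \<and> N \<subseteq> W \<and> x \<notin> W}"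
  have "\<exists>W\<in>?S. \<forall>X\<in>?S. W \<subseteq> X \<longrightarrow> X = W"
  proof (rule subset_Zorn_nonempty)
    show "?S \<noteq> {}" using assms(2,3) by blast
    fix C assume C: "C \<noteq> {}" "subset.chain ?S C"
    then have "C \<subseteq> ?S" by (simp add: subset.chain_def)
    then show "\<Union>C \<in> ?S" using submodule_Union[OF assms(1) C(1) _ C(2)] C(1) by blast
  qed
  then obtain W where W: "W \<in> ?S" "\<forall>X\<in>?S. W \<subseteq> X \<longrightarrow> X = W" by (rule bexE)
  show ?thesis
  proof (intro exI[of _ W] conjI allI impI)
    fix X assume "submodule X R M \<and> W \<subseteq> X \<and> x \<notin> X"
    then show "X = W" using W(1) by (intro W(2)[rule_format]) auto
  qed (use W(1) in auto)
qed

definition cyclic :: "('r, 'x) ring_scheme \<Rightarrow> ('r, 'm) module \<Rightarrow> 'm \<Rightarrow> 'm set" where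
  "cyclic R M x = (\<lambda>r. r \<odot>\<^bsub>M\<^esub> x) ` carrier R"

lemma smult_right_hom:
  assumes "left_module R M" "x \<in> carrier M"
  shows "(\<lambda>r. r \<odot>\<^bsub>M\<^esub> x) \<in> module_hom R (regular_module R) M"
proof -
  interpret M: left_module R M by fact
  show ?thesis using assms(2) by (intro module_homI) (auto simp: M.smult_l_distr M.smult_assoc1)
qed

lemma submodule_cyclic:
  assumes "left_module R M" "x \<in> carrier M"
  shows "submodule (cyclic R M x) R M" "x \<in> cyclic R M x"
proof -
  interpret M: left_module R M by fact
  have reg: "left_module R (regular_module R)" by (rule left_module_regular[OF M.R.ring_axioms])
  then interpret reg: left_module R "regular_module R" .
  show "submodule (cyclic R M x) R M"
    using hom_image_submodule[OF reg assms(1) smult_right_hom[OF assms] reg.submodule_carrier]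
    by (simp add: cyclic_def)
  show "x \<in> cyclic R M x" unfolding cyclic_def using assms(2) by (intro image_eqI[of _ _ "\<one>\<^bsub>R\<^esub>"]) auto
qed

lemma cyclic_subset: "submodule N R M \<Longrightarrow> x \<in> N \<Longrightarrow> cyclic R M x \<subseteq> N"
  by (auto simp: cyclic_def submodule_smult)

lemma fg_cyclic:
  assumes "left_module R M" "x \<in> carrier M"
  shows "fg_module R (M\<lparr>carrier := cyclic R M x\<rparr>)"
proof -
  interpret M: left_module R M by fact
  have l: "left_module R (M\<lparr>carrier := cyclic R M x\<rparr>)"
    by (intro left_module_submodule[OF assms(1)] submodule_cyclic assms)
  have "generates R (M\<lparr>carrier := cyclic R M x\<rparr>) {x}"
  proof (rule generatesI)
    fix N y assume "submodule N R (M\<lparr>carrier := cyclic R M x\<rparr>)" "{x} \<subseteq> N"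
      "y \<in> carrier (M\<lparr>carrier := cyclic R M x\<rparr>)"
    then show "y \<in> N" using submodule_smult[of N R "M\<lparr>carrier := cyclic R M x\<rparr>" _ x]
      by (auto simp: cyclic_def)
  qed (use submodule_cyclic[OF assms] in auto)
  then show ?thesis using l unfolding fg_module_def fin_gen_iff by blast
qed

text \<open>The factor lives on the image of \<open>g\<close> only; where \<open>g\<close> is not
  onto, the extension to the whole target is left to injectivity of some module.\<close>

lemma hom_factor:
  assumes "left_module R V" "left_module R W" "left_module R X"
    "g \<in> module_hom R V W" "f \<in> module_hom R V X"
    "\<And>v. v \<in> carrier V \<Longrightarrow> g v = \<zero>\<^bsub>W\<^esub> \<Longrightarrow> f v = \<zero>\<^bsub>X\<^esub>"
  shows "\<exists>h\<in>module_hom R (W\<lparr>carrier := g ` carrier V\<rparr>) X. \<forall>v\<in>carrier V. h (g v) = f v"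
proof -
  interpret V: left_module R V by fact
  interpret W: left_module R W by fact
  interpret X: left_module R X by fact
  let ?h = "\<lambda>y. f (inv_into (carrier V) g y)"
  have h: "?h (g v) = f v" if v: "v \<in> carrier V" for v
  proof -
    let ?v = "inv_into (carrier V) g (g v)"
    have v': "?v \<in> carrier V" "g ?v = g v"
      using v by (auto intro: inv_into_into f_inv_into_f)
    then have "g (?v \<ominus>\<^bsub>V\<^esub> v) = \<zero>\<^bsub>W\<^esub>"
      using v hom_closed[OF assms(4)] by (simp add: hom_diff[OF assms(1,2,4)] W.M.diff_zero_iff)
    then have "f (?v \<ominus>\<^bsub>V\<^esub> v) = \<zero>\<^bsub>X\<^esub>" using v v'(1) by (intro assms(6)) auto
    then show ?thesis
      using v v'(1) hom_closed[OF assms(5)] by (simp add: hom_diff[OF assms(1,3,5)] X.M.diff_zero_iff)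
  qed
  have "?h \<in> module_hom R (W\<lparr>carrier := g ` carrier V\<rparr>) X"
  proof (rule module_homI)
    fix y assume "y \<in> carrier (W\<lparr>carrier := g ` carrier V\<rparr>)"
    then obtain v where v: "v \<in> carrier V" "y = g v" by auto
    show "?h y \<in> carrier X" using v h hom_closed[OF assms(5)] by simp
    show "?h (r \<odot>\<^bsub>W\<lparr>carrier := g ` carrier V\<rparr>\<^esub> y) = r \<odot>\<^bsub>X\<^esub> ?h y" if "r \<in> carrier R" for r
      using that v h[of v] h[of "r \<odot>\<^bsub>V\<^esub> v"] by (simp add: hom_smult[OF assms(4)] hom_smult[OF assms(5)])
    fix z assume "z \<in> carrier (W\<lparr>carrier := g ` carrier V\<rparr>)"
    then obtain w where w: "w \<in> carrier V" "z = g w" by auto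
    show "?h (y \<oplus>\<^bsub>W\<lparr>carrier := g ` carrier V\<rparr>\<^esub> z) = ?h y \<oplus>\<^bsub>X\<^esub> ?h z"
      using v w h[of v] h[of w] h[of "v \<oplus>\<^bsub>V\<^esub> w"] by (simp add: hom_add[OF assms(4)] hom_add[OF assms(5)])
  qed
  then show ?thesis by (intro bexI[of _ ?h] ballI h)
qed

text \<open>Factor the map taking \<open>r\<close> to \<open>r x\<close> through the orbit map of
  \<open>v\<close>; the inclusion of annihilators is exactly what \<open>hom_factor\<close>
  demands.\<close>

lemma cyclic_hom:
  assumes "left_module R V" "v \<in> carrier V" "left_module R X" "x \<in> carrier X"
    "\<And>r. r \<in> carrier R \<Longrightarrow> r \<odot>\<^bsub>V\<^esub> v = \<zero>\<^bsub>V\<^esub> \<Longrightarrow> r \<odot>\<^bsub>X\<^esub> x = \<zero>\<^bsub>X\<^esub>"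
  shows "\<exists>h\<in>module_hom R (V\<lparr>carrier := cyclic R V v\<rparr>) X. h v = x"
proof -
  interpret V: left_module R V by fact
  interpret X: left_module R X by fact
  have reg: "left_module R (regular_module R)" by (rule left_module_regular[OF V.R.ring_axioms])
  obtain h where h: "h \<in> module_hom R (V\<lparr>carrier := cyclic R V v\<rparr>) X"
      "\<forall>r\<in>carrier R. h (r \<odot>\<^bsub>V\<^esub> v) = r \<odot>\<^bsub>X\<^esub> x"
    using hom_factor[OF reg assms(1,3) smult_right_hom[OF assms(1,2)] smult_right_hom[OF assms(3,4)]] assms(5)
    unfolding cyclic_def by auto
  have "h v = x" using h(2) assms(2,4) V.R.one_closed by (metis V.smult_one X.smult_one)
  with h(1) show ?thesis by blast
qed

lemma submodule_add_cyclic: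
  fixes M (structure)
  assumes "left_module R M" "submodule U R M" "a \<in> carrier M"
  shows "submodule (U <+>\<^bsub>M\<^esub> cyclic R M a) R M" "U \<subseteq> U <+>\<^bsub>M\<^esub> cyclic R M a" "a \<in> U <+>\<^bsub>M\<^esub> cyclic R M a"
proof -
  interpret M: left_module R M by fact
  note c = submodule_cyclic[OF assms(1,3)]
  show "submodule (U <+>\<^bsub>M\<^esub> cyclic R M a) R M" by (rule M.submodule_sum[OF assms(2) c(1)])
  show "U \<subseteq> U <+>\<^bsub>M\<^esub> cyclic R M a"
  proof
    fix u assume u: "u \<in> U"
    then have "u = u \<oplus> \<zero>" using submodule_mem[OF assms(2)] by simp
    then show "u \<in> U <+>\<^bsub>M\<^esub> cyclic R M a"
      unfolding mem_set_add using u submodule_zero_mem[OF c(1)] by blast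
  qed
  show "a \<in> U <+>\<^bsub>M\<^esub> cyclic R M a"
  proof -
    have "a = \<zero> \<oplus> a" using assms(3) by simp
    then show ?thesis unfolding mem_set_add using c(2) submodule_zero_mem[OF assms(2)] by blast
  qed
qed

lemma mem_add_cyclic: "x \<in> U <+>\<^bsub>M\<^esub> cyclic R M a \<longleftrightarrow> (\<exists>u\<in>U. \<exists>r\<in>carrier R. x = u \<oplus>\<^bsub>M\<^esub> r \<odot>\<^bsub>M\<^esub> a)"
  by (auto simp: mem_set_add cyclic_def)

lemma ideal_iff_submodule:
  assumes "cring k"
  shows "ideal I k \<longleftrightarrow> submodule I k (regular_module k)"
proof -
  interpret cring k by fact
  interpret reg: left_module k "regular_module k" by (rule left_module_regular[OF ring_axioms])
  show ?thesis
  proof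
    assume I: "ideal I k"
    then interpret I: ideal I k .
    show "submodule I k (regular_module k)"
      by (rule reg.submoduleI) (auto intro: I.I_l_closed dest: I.a_Hcarr)
  next
    assume "submodule I k (regular_module k)"
    note I = submodule_facts[OF this]
    show "ideal I k"
    proof (rule idealI)
      show "subgroup I (add_monoid k)"
        using I by (intro add.subgroupI) (auto simp: ring_axioms simp flip: a_inv_def)
      show l: "a \<in> I \<Longrightarrow> x \<in> carrier k \<Longrightarrow> x \<otimes>\<^bsub>k\<^esub> a \<in> I" for a x using I(5)[of x a] by simp
      show "a \<in> I \<Longrightarrow> x \<in> carrier k \<Longrightarrow> a \<otimes>\<^bsub>k\<^esub> x \<in> I" for a x
        using I(1)[of a] l[of a x] by (simp add: m_comm)
    qed (rule ring_axioms)
  qed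
qed

lemma dcc_artinian_cring: "artinian_cring k \<Longrightarrow> dcc k (regular_module k)"
  unfolding artinian_cring_def dcc_def by (metis (no_types) ideal_iff_submodule)

text \<open>Generators are added one at a time. Along a descending chain, the part inside the old
  submodule becomes stationary by induction, and the coefficients of the new generator by the chain
  condition on ideals of k.\<close>

lemma dcc_fg:
  fixes M :: "('k, 'm) module" (structure)
  assumes "dcc k (regular_module k)" "fg_module k M"
  shows "dcc k M"
proof -
  have lm: "left_module k M" using assms(2) by (rule fg_left_module)
  then interpret M: left_module k M .
  have reg: "left_module k (regular_module k)" by (rule left_module_regular[OF M.R.ring_axioms])
  then interpret reg: left_module k "regular_module k" .
  \<comment> \<open>Chains are intersected with \<open>U\<close> instead of being taken inside
    \<open>U\<close>, so that the carrier stays fixed during the induction.\<close>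
  define stab where "stab U \<longleftrightarrow> (\<forall>I :: nat \<Rightarrow> 'm set. (\<forall>n. submodule (I n) k M \<and> I (Suc n) \<subseteq> I n) \<longrightarrow>
     (\<exists>n. \<forall>m\<ge>n. I m \<inter> U = I n \<inter> U))" for U
  have step: "stab (U <+>\<^bsub>M\<^esub> cyclic k M a)" if U: "submodule U k M" "stab U" and a: "a \<in> carrier M" for U a
    unfolding stab_def
  proof (intro allI impI)
    fix I :: "nat \<Rightarrow> 'm set" assume I: "\<forall>n. submodule (I n) k M \<and> I (Suc n) \<subseteq> I n"
    have Is: "submodule (I n) k M" and dec: "I (Suc n) \<subseteq> I n" for n using I by simp_all
    have anti: "I m \<subseteq> I n" if "n \<le> m" for m n
      using lift_Suc_antimono_le[of I, OF dec that] .
    \<comment> \<open>The ideal of coefficients of \<open>a\<close> that occur in \<open>I n\<close>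
      modulo \<open>U\<close>.\<close>
    define L where "L n = {c \<in> carrier k. \<exists>u\<in>U. u \<oplus> c \<odot> a \<in> I n}" for n
    have "submodule (L n) k (regular_module k)" for n
    proof (rule reg.submoduleI)
      show "L n \<subseteq> carrier (regular_module k)" by (auto simp: L_def)
      show "\<zero>\<^bsub>regular_module k\<^esub> \<in> L n"
        using a submodule_zero_mem[OF U(1)] submodule_zero_mem[OF Is] by (auto simp: L_def intro!: bexI[of _ "\<zero>"])
      show "c \<oplus>\<^bsub>regular_module k\<^esub> d \<in> L n" if cd: "c \<in> L n" "d \<in> L n" for c d
      proof -
        obtain u v where uv: "u \<in> U" "v \<in> U" "u \<oplus> c \<odot> a \<in> I n" "v \<oplus> d \<odot> a \<in> I n"
          and c: "c \<in> carrier k" "d \<in> carrier k" using cd by (auto simp: L_def)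
        have "(u \<oplus> v) \<oplus> (c \<oplus>\<^bsub>k\<^esub> d) \<odot> a = (u \<oplus> c \<odot> a) \<oplus> (v \<oplus> d \<odot> a)"
          using uv(1,2) c a submodule_mem[OF U(1)] by (simp add: M.smult_l_distr M.M.a_ac)
        then show ?thesis
          using submodule_add[OF Is uv(3,4)] submodule_add[OF U(1) uv(1,2)] c
          by (auto simp: L_def intro!: bexI[of _ "u \<oplus> v"])
      qed
      show "d \<odot>\<^bsub>regular_module k\<^esub> c \<in> L n" if dc: "d \<in> carrier k" "c \<in> L n" for c d
      proof -
        obtain u where u: "u \<in> U" "u \<oplus> c \<odot> a \<in> I n" and c: "c \<in> carrier k" using dc by (auto simp: L_def)
        have "d \<odot> u \<oplus> (d \<otimes>\<^bsub>k\<^esub> c) \<odot> a = d \<odot> (u \<oplus> c \<odot> a)"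
          using u(1) dc c a submodule_mem[OF U(1)] by (simp add: M.smult_r_distr M.smult_assoc1)
        then show ?thesis
          using submodule_smult[OF Is dc(1) u(2)] submodule_smult[OF U(1) dc(1) u(1)] dc(1) c
          by (auto simp: L_def intro!: bexI[of _ "d \<odot> u"])
      qed
    qed
    moreover have "L (Suc n) \<subseteq> L n" for n using dec[of n] unfolding L_def by blast
    ultimately have "\<forall>n. submodule (L n) k (regular_module k) \<and> L (Suc n) \<subseteq> L n"
      by (intro allI conjI)
    then have "\<exists>n. \<forall>m\<ge>n. L m = L n" by (rule assms(1)[unfolded dcc_def, THEN spec, THEN mp])
    then obtain n1 where n1: "\<forall>m\<ge>n1. L m = L n1" by (rule exE)
    obtain n2 where n2: "\<forall>m\<ge>n2. I m \<inter> U = I n2 \<inter> U"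
      using U(2)[unfolded stab_def, THEN spec, THEN mp, OF I] by (rule exE)
    let ?n = "max n1 n2"
    \<comment> \<open>Some element of \<open>I m\<close> has the same coefficient at
      \<open>a\<close> as \<open>x\<close>; the two differ by an element of \<open>U\<close>, where
      the chain is already stationary.\<close>
    have up: "x \<in> I m" if m: "m \<ge> ?n" and x: "x \<in> I ?n" "x \<in> U <+>\<^bsub>M\<^esub> cyclic k M a" for m x
    proof -
      obtain u c where uc: "u \<in> U" "c \<in> carrier k" "x = u \<oplus> c \<odot> a"
        using x(2) unfolding mem_add_cyclic by blast
      then have "c \<in> L ?n" using x(1) by (auto simp: L_def)
      then have "c \<in> L m" using n1[rule_format, of m] n1[rule_format, of ?n] m by simp
      then obtain v where v: "v \<in> U" "v \<oplus> c \<odot> a \<in> I m" by (auto simp: L_def)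
      have uM: "u \<in> carrier M" "v \<in> carrier M" using submodule_mem[OF U(1)] uc v by auto
      have "u \<ominus> v = x \<ominus> (v \<oplus> c \<odot> a)"
      proof -
        have "u \<ominus> v \<oplus> (v \<oplus> c \<odot> a) = x"
          using M.M.diff_add[OF uM] uM uc a by (simp flip: M.M.a_assoc)
        then show ?thesis using M.M.add_eq_iff_diff[of "u \<ominus> v" "v \<oplus> c \<odot> a" x] uM uc a by simp
      qed
      also have "\<dots> \<in> I ?n" using v(2) anti[OF m] by (intro submodule_diff[OF Is x(1)]) blast
      finally have "u \<ominus> v \<in> I ?n \<inter> U" using submodule_diff[OF U(1) uc(1) v(1)] by blast
      also have "I ?n \<inter> U = I m \<inter> U" using n2[rule_format, of m] n2[rule_format, of ?n] m by simp
      finally have "(u \<ominus> v) \<oplus> (v \<oplus> c \<odot> a) \<in> I m" using v(2) submodule_add[OF Is] by blast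
      then show ?thesis using uc a uM M.M.diff_add[OF uM] by (simp flip: M.M.a_assoc)
    qed
    have "I m \<inter> (U <+>\<^bsub>M\<^esub> cyclic k M a) = I ?n \<inter> (U <+>\<^bsub>M\<^esub> cyclic k M a)" if "m \<ge> ?n" for m
      using up[OF that] anti[OF that] by (intro equalityI subsetI IntI) (simp_all only: Int_iff subset_iff)
    then show "\<exists>n. \<forall>m\<ge>n. I m \<inter> (U <+>\<^bsub>M\<^esub> cyclic k M a) = I n \<inter> (U <+>\<^bsub>M\<^esub> cyclic k M a)"
      by (intro exI[of _ ?n] allI impI)
  qed
  have "fin_gen k M" using assms(2) unfolding fg_module_def by (rule conjunct2)
  then obtain A where A: "finite A" "generates k M A" unfolding fin_gen_iff by (elim exE conjE)
  have "\<exists>U. submodule U k M \<and> A \<subseteq> U \<and> stab U"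
    using A(1) generates_subset[OF A(2)]
  proof (induction A)
    case empty
    have "stab {\<zero>}"
      unfolding stab_def
    proof (intro allI impI exI)
      fix I :: "nat \<Rightarrow> 'm set" and m :: nat
      assume "\<forall>n. submodule (I n) k M \<and> I (Suc n) \<subseteq> I n"
      then have "submodule (I m) k M" "submodule (I 0) k M" by simp_all
      then have "\<zero> \<in> I m" "\<zero> \<in> I 0" by (blast intro: submodule_zero_mem)+
      then show "I m \<inter> {\<zero>} = I 0 \<inter> {\<zero>}" by blast
    qed
    then show ?case using M.submodule_zero by (intro exI[of _ "{\<zero>}"] conjI empty_subsetI)
  next
    case (insert a A)
    have a: "a \<in> carrier M" "A \<subseteq> carrier M" using insert.prems by simp_all
    obtain U where U: "submodule U k M" "A \<subseteq> U" "stab U" using insert.IH[OF a(2)] by (elim exE conjE)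
    note s = submodule_add_cyclic[OF lm U(1) a(1)]
    have "insert a A \<subseteq> U <+>\<^bsub>M\<^esub> cyclic k M a" using s(2,3) U(2) by blast
    with s(1) step[OF U(1,3) a(1)] show ?case by (intro exI[of _ "U <+>\<^bsub>M\<^esub> cyclic k M a"] conjI)
  qed
  then obtain U where U: "submodule U k M" "A \<subseteq> U" "stab U" by blast
  then have "U = carrier M" using generatesD[OF A(2)] by blast
  show ?thesis
    unfolding dcc_def
  proof (intro allI impI)
    fix I :: "nat \<Rightarrow> 'm set" assume I: "\<forall>n. submodule (I n) k M \<and> I (Suc n) \<subseteq> I n"
    obtain n where n: "\<forall>m\<ge>n. I m \<inter> U = I n \<inter> U"
      using U(3)[unfolded stab_def, THEN spec, THEN mp, OF I] by (rule exE)
    have "I m \<subseteq> U" for m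
      unfolding \<open>U = carrier M\<close> using I by (intro submodule_subset[of "I m" k M]) simp
    then have IU: "I m \<inter> U = I m" for m by (rule Int_absorb2)
    have "I m = I n" if "n \<le> m" for m using n[rule_format, OF that] unfolding IU .
    then show "\<exists>n. \<forall>m\<ge>n. I m = I n" by (intro exI[of _ n] allI impI)
  qed
qed

text \<open>Tests \<open>N\<close> against submodules of the ambient module, so that no carrier has
  to be changed until \<open>fg_sub_fg_module\<close>.\<close>

definition fg_sub :: "('r, 'x) ring_scheme \<Rightarrow> ('r, 'm) module \<Rightarrow> 'm set \<Rightarrow> bool" where
  "fg_sub R M N \<longleftrightarrow> (\<exists>A. finite A \<and> A \<subseteq> N \<and> (\<forall>K. submodule K R M \<and> A \<subseteq> K \<longrightarrow> N \<subseteq> K))"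

lemma fg_sub_fg_module:
  assumes "left_module R M" "submodule N R M" "fg_sub R M N"
  shows "fg_module R (M\<lparr>carrier := N\<rparr>)"
proof -
  obtain A where A: "finite A" "A \<subseteq> N" "\<forall>K. submodule K R M \<and> A \<subseteq> K \<longrightarrow> N \<subseteq> K"
    using assms(3) by (auto simp: fg_sub_def)
  have "generates R (M\<lparr>carrier := N\<rparr>) A"
    using A(2,3) submodule_trans[OF assms(1,2)] by (intro generatesI) auto
  then show ?thesis
    using A(1) left_module_submodule[OF assms(1,2)] unfolding fg_module_def fin_gen_iff by blast
qed

lemma fg_sub_extend:
  assumes "left_module R M" "submodule N R M" "fg_sub R M W" "x \<in> N" "W \<subseteq> N"
    "N \<subseteq> W <+>\<^bsub>M\<^esub> cyclic R M x"
  shows "fg_sub R M N"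
proof -
  interpret M: left_module R M by fact
  obtain A where A: "finite A" "A \<subseteq> W" "\<forall>K. submodule K R M \<and> A \<subseteq> K \<longrightarrow> W \<subseteq> K"
    using assms(3) by (auto simp: fg_sub_def)
  show ?thesis
    unfolding fg_sub_def
  proof (intro exI conjI allI impI)
    show "finite (insert x A)" "insert x A \<subseteq> N" using A assms by auto
    fix K assume K: "submodule K R M \<and> insert x A \<subseteq> K"
    then have "W \<subseteq> K" using A(3) by blast
    then have "W <+>\<^bsub>M\<^esub> cyclic R M x \<subseteq> K"
      using submodule_add[of K R M] submodule_smult[of K R M] K
      by (auto simp: mem_add_cyclic subset_iff)
    then show "N \<subseteq> K" using assms(6) by blast
  qed
qed

lemma fg_subI:
  "finite A \<Longrightarrow> A \<subseteq> N \<Longrightarrow> (\<And>K. submodule K R M \<Longrightarrow> A \<subseteq> K \<Longrightarrow> N \<subseteq> K) \<Longrightarrow> fg_sub R M N"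
  unfolding fg_sub_def by (intro exI[of _ A] conjI allI impI) auto

lemma fg_subE:
  assumes "fg_sub R M N"
  shows "\<exists>A. finite A \<and> A \<subseteq> N \<and> (\<forall>K. submodule K R M \<and> A \<subseteq> K \<longrightarrow> N \<subseteq> K)"
  using assms by (simp only: fg_sub_def)

text \<open>In a minimal counterexample \<open>N\<close> every scalar acts as zero or as a surjection. The scalars
  acting as zero form a prime ideal of an artinian ring, so the surjective ones act invertibly and \<open>N\<close>
  is a vector space all of whose proper subspaces are finitely generated.\<close>

lemma noetherian:
  fixes M :: "('k, 'm) module" (structure)
  assumes "cring k" "dcc k (regular_module k)" "left_module k M" "dcc k M" "submodule N0 k M"
  shows "fg_sub k M N0"
proof (rule ccontr)
  assume notfg: "\<not> fg_sub k M N0"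
  interpret k: cring k by fact
  interpret M: left_module k M by fact
  let ?S = "{N. submodule N k M \<and> \<not> fg_sub k M N}"
  have "\<exists>N\<in>?S. \<forall>N'\<in>?S. N' \<subseteq> N \<longrightarrow> N' = N"
    by (rule dcc_minimal[OF assms(4)]) (use assms(5) notfg in auto)
  then obtain N where N0: "N \<in> ?S" "\<forall>N'\<in>?S. N' \<subseteq> N \<longrightarrow> N' = N" by (rule bexE)
  have N: "submodule N k M" "\<not> fg_sub k M N" using N0(1) by simp_all
  have small: "fg_sub k M K" if "submodule K k M" "K \<subseteq> N" "K \<noteq> N" for K
    using N0(2)[rule_format, of K] that by auto
  note Nf = submodule_facts[OF N(1)]
  \<comment> \<open>If \<open>c\<close> neither kills \<open>N\<close> nor maps onto it, then kernel
    and image of \<open>c\<close> on \<open>N\<close> are proper, hence finitely generated by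
    minimality; generators of the kernel and preimages of generators of the image generate
    \<open>N\<close>.\<close>
  have dich: "(\<forall>x\<in>N. c \<odot> x = \<zero>) \<or> (\<lambda>x. c \<odot> x) ` N = N" if c: "c \<in> carrier k" for c
  proof (rule ccontr)
    assume neg: "\<not> ?thesis"
    have chom: "(\<lambda>x. c \<odot> x) \<in> module_hom k M M"
      using c by (intro module_homI)
        (auto simp: M.smult_r_distr k.m_comm simp flip: M.smult_assoc1)
    let ?Z = "N \<inter> ker_set M (\<lambda>x. c \<odot> x) M" and ?I = "(\<lambda>x. c \<odot> x) ` N"
    have Z: "submodule ?Z k M"
      by (intro M.submodule_int N(1) ker_set_submodule[OF assms(3,3) chom])
    have I: "submodule ?I k M" by (rule hom_image_submodule[OF assms(3,3) chom N(1)])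
    have "?Z \<noteq> N" using neg by (auto simp: ker_set_def)
    then have "fg_sub k M ?Z" by (rule small[OF Z Int_lower1])
    from fg_subE[OF this] obtain A where A: "finite A" "A \<subseteq> ?Z"
      "\<forall>K. submodule K k M \<and> A \<subseteq> K \<longrightarrow> ?Z \<subseteq> K" by (elim exE conjE)
    have "?I \<subseteq> N" using Nf(5)[OF c] by auto
    moreover have "?I \<noteq> N" using neg by simp
    ultimately have "fg_sub k M ?I" by (rule small[OF I])
    from fg_subE[OF this] obtain B where B: "finite B" "B \<subseteq> ?I"
      "\<forall>K. submodule K k M \<and> B \<subseteq> K \<longrightarrow> ?I \<subseteq> K" by (elim exE conjE)
    obtain B' where B': "B' \<subseteq> N" "finite B'" "B = (\<lambda>x. c \<odot> x) ` B'"
      using finite_subset_image[OF B(1,2)] by (elim exE conjE)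
    have "fg_sub k M N"
    proof (rule fg_subI)
      show "finite (A \<union> B')" using A(1) B'(2) by simp
      show "A \<union> B' \<subseteq> N" using A(2) B'(1) by blast
      fix K assume K: "submodule K k M" "A \<union> B' \<subseteq> K"
      have ZK: "?Z \<subseteq> K" using A(3) K by simp
      have "submodule ((\<lambda>x. c \<odot> x) ` (N \<inter> K)) k M"
        by (intro hom_image_submodule[OF assms(3,3) chom] M.submodule_int N(1) K(1))
      moreover have "B \<subseteq> (\<lambda>x. c \<odot> x) ` (N \<inter> K)" using B'(1,3) K(2) by blast
      ultimately have IK: "?I \<subseteq> (\<lambda>x. c \<odot> x) ` (N \<inter> K)" using B(3) by simp
      show "N \<subseteq> K"
      proof
        fix x assume x: "x \<in> N"
        then have "c \<odot> x \<in> (\<lambda>x. c \<odot> x) ` (N \<inter> K)" using IK by blast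
        then obtain y where y: "y \<in> N" "y \<in> K" "c \<odot> x = c \<odot> y" by blast
        have xy: "x \<in> carrier M" "y \<in> carrier M" using x y Nf(1) by blast+
        have "c \<odot> (x \<ominus> y) = \<zero>"
          using hom_diff[OF assms(3,3) chom xy] y(3) xy c by (simp add: M.M.diff_zero_iff)
        then have "x \<ominus> y \<in> ?Z" using submodule_diff[OF N(1) x y(1)] xy by (simp add: ker_set_def)
        then have "(x \<ominus> y) \<oplus> y \<in> K" using ZK y(2) submodule_add[OF K(1)] by blast
        then show "x \<in> K" using M.M.diff_add[OF xy] by simp
      qed
    qed
    then show False using N(2) by simp
  qed
  \<comment> \<open>The ideals generated by the powers of \<open>c\<close> become stationary, so
    some power of \<open>c\<close> equals \<open>d\<close> times the next one. As every element of
    \<open>N\<close> is divisible by that power of \<open>c\<close>, the scalar \<open>d\<close>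
    inverts \<open>c\<close> on \<open>N\<close>.\<close>
  have inv: "\<exists>d\<in>carrier k. \<forall>y\<in>N. c \<odot> (d \<odot> y) = y"
    if c: "c \<in> carrier k" and onto: "(\<lambda>x. c \<odot> x) ` N = N" for c
  proof -
    have reg: "left_module k (regular_module k)" by (rule left_module_regular[OF k.ring_axioms])
    let ?I = "\<lambda>n::nat. cyclic k (regular_module k) (c [^]\<^bsub>k\<^esub> n)"
    have "\<forall>n. submodule (?I n) k (regular_module k) \<and> ?I (Suc n) \<subseteq> ?I n"
    proof (intro allI conjI)
      fix n
      show s: "submodule (?I n) k (regular_module k)" using c by (intro submodule_cyclic[OF reg]) simp
      have "c [^]\<^bsub>k\<^esub> Suc n = c \<odot>\<^bsub>regular_module k\<^esub> c [^]\<^bsub>k\<^esub> n" using c by (simp add: k.m_comm)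
      then have "c [^]\<^bsub>k\<^esub> Suc n \<in> ?I n" unfolding cyclic_def using c by blast
      then show "?I (Suc n) \<subseteq> ?I n" by (rule cyclic_subset[OF s])
    qed
    then have "\<exists>n. \<forall>m\<ge>n. ?I m = ?I n" by (rule assms(2)[unfolded dcc_def, THEN spec, THEN mp])
    then obtain n where n: "\<forall>m\<ge>n. ?I m = ?I n" by (rule exE)
    have "c [^]\<^bsub>k\<^esub> n \<in> ?I n" using c by (intro submodule_cyclic(2)[OF reg]) simp
    moreover have "?I (Suc n) = ?I n" by (rule n[rule_format]) simp
    ultimately have "c [^]\<^bsub>k\<^esub> n \<in> ?I (Suc n)" by (simp only:)
    then obtain d where d: "d \<in> carrier k" "c [^]\<^bsub>k\<^esub> n = d \<otimes>\<^bsub>k\<^esub> c [^]\<^bsub>k\<^esub> Suc n"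
      unfolding cyclic_def by auto
    have pow: "\<exists>z\<in>N. y = c [^]\<^bsub>k\<^esub> m \<odot> z" if y: "y \<in> N" for y and m :: nat
      using y
    proof (induction m arbitrary: y)
      case 0
      then show ?case using Nf(1) by (intro bexI[of _ y]) auto
    next
      case (Suc m)
      obtain z where z: "z \<in> N" "y = c [^]\<^bsub>k\<^esub> m \<odot> z" using Suc.IH[OF Suc.prems] by (elim bexE)
      have "z \<in> (\<lambda>x. c \<odot> x) ` N" using z(1) onto by simp
      then obtain w where w: "w \<in> N" "z = c \<odot> w" by blast
      have "y = c [^]\<^bsub>k\<^esub> Suc m \<odot> w" using z(2) w c Nf(1) by (simp add: M.smult_assoc1)
      then show ?case using w(1) by (intro bexI[of _ w])
    qed
    have "c \<odot> (d \<odot> y) = y" if y: "y \<in> N" for y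
    proof -
      obtain z where z: "z \<in> N" "y = c [^]\<^bsub>k\<^esub> n \<odot> z" using pow[OF y, of n] by (elim bexE)
      have zM: "z \<in> carrier M" using z(1) Nf(1) by blast
      have "c \<odot> (d \<odot> y) = (c \<otimes>\<^bsub>k\<^esub> (d \<otimes>\<^bsub>k\<^esub> c [^]\<^bsub>k\<^esub> n)) \<odot> z"
        using z(2) zM c d(1) by (simp add: M.smult_assoc1)
      also have "c \<otimes>\<^bsub>k\<^esub> (d \<otimes>\<^bsub>k\<^esub> c [^]\<^bsub>k\<^esub> n) = d \<otimes>\<^bsub>k\<^esub> c [^]\<^bsub>k\<^esub> Suc n"
        using c d(1) by (simp add: k.m_ac)
      also have "\<dots> \<odot> z = y" using d(2) z(2) by simp
      finally show ?thesis .
    qed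
    then show ?thesis using d(1) by (intro bexI[of _ d]) auto
  qed
  have "\<exists>x\<in>N. x \<noteq> \<zero>"
  proof (rule ccontr)
    assume "\<not> ?thesis"
    then have "N \<subseteq> {\<zero>}" by blast
    then have "fg_sub k M N" using submodule_zero_mem by (intro fg_subI[of "{}"]) blast+
    then show False using N(2) by simp
  qed
  then obtain x where x: "x \<in> N" "x \<noteq> \<zero>" by (elim bexE)
  have lN: "left_module k (M\<lparr>carrier := N\<rparr>)" by (rule left_module_submodule[OF assms(3) N(1)])
  have "submodule {\<zero>} k (M\<lparr>carrier := N\<rparr>)"
    using Nf(2) by (intro submodule_restrict[OF assms(3) N(1)]) auto
  then have "\<exists>W. submodule W k (M\<lparr>carrier := N\<rparr>) \<and> {\<zero>} \<subseteq> W \<and> x \<notin> W \<and>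
      (\<forall>W'. submodule W' k (M\<lparr>carrier := N\<rparr>) \<and> W \<subseteq> W' \<and> x \<notin> W' \<longrightarrow> W' = W)"
    by (rule maximal_submodule_avoiding[OF lN]) (use x(2) in simp)
  \<comment> \<open>\<open>W\<close> is a hyperplane: maximal among the submodules of
    \<open>N\<close> that miss a fixed nonzero \<open>x\<close>.\<close>
  then obtain W where W0: "submodule W k (M\<lparr>carrier := N\<rparr>)" and xW: "x \<notin> W"
    and Wmax: "\<forall>W'. submodule W' k (M\<lparr>carrier := N\<rparr>) \<and> W \<subseteq> W' \<and> x \<notin> W' \<longrightarrow> W' = W"
    by (elim exE conjE)
  have W: "submodule W k M" by (rule submodule_trans[OF assms(3) N(1) W0])
  have WN: "W \<subseteq> N" using submodule_subset[OF W0] by simp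
  \<comment> \<open>For \<open>y\<close> outside \<open>W\<close> maximality puts \<open>x\<close>
    into \<open>W\<close> plus the multiples of \<open>y\<close>. The coefficient of
    \<open>y\<close> cannot act as zero, so it is invertible on \<open>N\<close> and the relation
    can be solved for \<open>y\<close>.\<close>
  have "y \<in> W <+>\<^bsub>M\<^esub> cyclic k M x" if y: "y \<in> N" for y
  proof (cases "y \<in> W")
    case True
    have xM: "x \<in> carrier M" using x(1) Nf(1) by blast
    show ?thesis using True submodule_add_cyclic(2)[OF assms(3) W xM] by blast
  next
    case False
    have xM: "x \<in> carrier M" "y \<in> carrier M" using x(1) y Nf(1) by blast+
    let ?W = "W <+>\<^bsub>M\<^esub> cyclic k M y"
    note s = submodule_add_cyclic[OF assms(3) W xM(2)]
    have sub: "?W \<subseteq> N"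
      using Nf(3) Nf(5)[OF _ y] WN by (auto simp: mem_add_cyclic subset_iff)
    have "x \<in> ?W"
    proof (rule ccontr)
      assume "x \<notin> ?W"
      then have "?W = W"
        by (intro Wmax[THEN spec, THEN mp] conjI s(2) submodule_restrict[OF assms(3) N(1) s(1) sub])
      then show False using s(3) False by blast
    qed
    then obtain w c where wc: "w \<in> W" "c \<in> carrier k" "x = w \<oplus> c \<odot> y"
      unfolding mem_add_cyclic by (elim bexE)
    have wM: "w \<in> carrier M" using wc(1) WN Nf(1) by blast
    have "(\<lambda>x. c \<odot> x) ` N = N"
    proof (rule ccontr)
      assume "\<not> ?thesis"
      then have "c \<odot> y = \<zero>" using dich[OF wc(2)] y by blast
      then show False using wc wM xW by simp
    qed
    from inv[OF wc(2) this] obtain d where d: "d \<in> carrier k" "\<forall>y\<in>N. c \<odot> (d \<odot> y) = y"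
      by (elim bexE)
    have "d \<odot> (c \<odot> y) = c \<odot> (d \<odot> y)"
      using d(1) wc(2) xM by (simp add: k.m_comm flip: M.smult_assoc1)
    then have dcy: "d \<odot> (c \<odot> y) = y" using d(2) y by simp
    have "d \<odot> x = d \<odot> w \<oplus> y"
      using wc d(1) wM xM dcy by (simp add: M.smult_r_distr)
    then have "y = \<ominus> (d \<odot> w) \<oplus> d \<odot> x"
      using d(1) wM xM by (simp add: M.M.r_neg1)
    moreover have "\<ominus> (d \<odot> w) \<in> W"
      by (intro submodule_minus[OF W] submodule_smult[OF W] d(1) wc(1))
    ultimately show ?thesis unfolding mem_add_cyclic using d(1) by blast
  qed
  then have "N \<subseteq> W <+>\<^bsub>M\<^esub> cyclic k M x" by (rule subsetI)
  moreover have "W \<noteq> N" using x(1) xW by blast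
  ultimately have "fg_sub k M N" by (intro fg_sub_extend[OF assms(3) N(1) small[OF W WN] x(1) WN])
  then show False using N(2) by simp
qed

lemma fg_submodule:
  fixes M :: "('k, 'm) module"
  assumes "cring k" "dcc k (regular_module k)" "fg_module k M" "submodule N k M"
  shows "fg_module k (M\<lparr>carrier := N\<rparr>)"
  by (rule fg_sub_fg_module[OF fg_left_module[OF assms(3)] assms(4)
      noetherian[OF assms(1,2) fg_left_module[OF assms(3)] dcc_fg[OF assms(2,3)] assms(4)]])

text \<open>Finite generation of Hom modules and duals is proved below by embedding them into a
  finite power.\<close>

lemma fg_embed:
  fixes M :: "('k, 'm) module" and N :: "('k, 'n) module"
  assumes "cring k" "dcc k (regular_module k)" "fg_module k N" "left_module k M"
    "f \<in> module_hom k M N" "inj_on f (carrier M)"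
  shows "fg_module k M"
proof -
  interpret M: left_module k M by fact
  note lN = fg_left_module[OF assms(3)]
  let ?I = "N\<lparr>carrier := f ` carrier M\<rparr>"
  have I: "fg_module k ?I"
    by (rule fg_submodule[OF assms(1-3) hom_image_submodule[OF assms(4) lN assms(5) M.submodule_carrier]])
  have f: "f \<in> module_iso k M ?I"
    using assms(5,6) by (intro module_isoI hom_restrict_cod) auto
  note g = iso_inverse[OF assms(4) f]
  show ?thesis by (rule fg_surj[OF I assms(4) iso_hom[OF g] iso_surj[OF g]])
qed

text \<open>The union of the chain is a finitely generated submodule, and its finitely many
  generators already lie in one member.\<close>

lemma acc_submodules:
  fixes M :: "('k, 'm) module"
  assumes "cring k" "dcc k (regular_module k)" "fg_module k M"
    "\<And>n::nat. submodule (I n) k M" "\<And>n. I n \<subseteq> I (Suc n)"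
  shows "\<exists>n. \<forall>m. I m \<subseteq> I n"
proof -
  note lM = fg_left_module[OF assms(3)]
  interpret M: left_module k M by (rule lM)
  have mono: "I m \<subseteq> I n" if "m \<le> n" for m n
    using assms(5) that by (rule lift_Suc_mono_le)
  have "submodule (\<Union>n. I n) k M" by (rule M.submodule_UN_chain[of I, OF assms(4,5)])
  then have "fg_sub k M (\<Union>n. I n)" by (rule noetherian[OF assms(1,2) lM dcc_fg[OF assms(2,3)]])
  from fg_subE[OF this] obtain A where A: "finite A" "A \<subseteq> (\<Union>n. I n)"
    "\<forall>K. submodule K k M \<and> A \<subseteq> K \<longrightarrow> (\<Union>n. I n) \<subseteq> K" by (elim exE conjE)
  have "\<exists>n. A \<subseteq> I n"
    using A(1,2)
  proof (induction A)
    case (insert a A)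
    have "A \<subseteq> (\<Union>n. I n)" using insert.prems by blast
    then obtain n where n: "A \<subseteq> I n" using insert.IH by blast
    obtain m where m: "a \<in> I m" using insert.prems by blast
    have "insert a A \<subseteq> I (max m n)" using m n mono[of m "max m n"] mono[of n "max m n"] by auto
    then show ?case by (rule exI)
  qed simp
  then obtain n where "A \<subseteq> I n" by (rule exE)
  then have "(\<Union>n. I n) \<subseteq> I n" using A(3) assms(4) by simp
  then show ?thesis by (intro exI[of _ n] allI) blast
qed

text \<open>The maximum condition, obtained from the ascending chain condition.
  \<open>endomorphism_scalar\<close> applies it to ideals of k.\<close>

lemma maximal_ideal_exists:
  fixes M :: "('k, 'm) module"
  assumes "cring k" "dcc k (regular_module k)" "fg_module k M" "S \<noteq> {}" "\<And>N. N \<in> S \<Longrightarrow> submodule N k M"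
  shows "\<exists>N\<in>S. \<forall>N'\<in>S. N \<subseteq> N' \<longrightarrow> N' = N"
proof (rule ccontr)
  assume "\<not> ?thesis"
  then have step: "\<forall>N\<in>S. \<exists>N'\<in>S. N \<subset> N'" by blast
  obtain N0 where N0: "N0 \<in> S" using assms(4) by blast
  have "\<exists>f. \<forall>n. f n \<in> S \<and> f n \<subset> f (Suc n)"
    by (rule dependent_nat_choice) (use N0 step in auto)
  then obtain f where f: "\<forall>n. f n \<in> S \<and> f n \<subset> f (Suc n)" by (rule exE)
  have f1: "f n \<in> S" and f2: "f n \<subset> f (Suc n)" for n using f[THEN spec, of n] by simp_all
  have "\<exists>n. \<forall>m. f m \<subseteq> f n"
    by (rule acc_submodules[OF assms(1-3)]) (use assms(5)[OF f1] less_imp_le[OF f2] in auto)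
  then obtain n where "\<forall>m. f m \<subseteq> f n" by (rule exE)
  from this[THEN spec, of "Suc n"] f2[of n] show False by blast
qed

section \<open>The dualizing module\<close>

text \<open>Maximality is recorded as left invertibility modulo \<open>W\<close> of everything
  outside \<open>W\<close>, because \<open>W\<close> enlarged by such an element contains the unit.
  This form is easier to compute with than maximality for inclusion.\<close>

lemma maximal_left_ideal_exists:
  fixes R (structure)
  assumes "ring R" "submodule I R (regular_module R)" "\<one> \<notin> I"
  shows "\<exists>W. submodule W R (regular_module R) \<and> I \<subseteq> W \<and> \<one> \<notin> W \<and>
    (\<forall>c\<in>carrier R. c \<notin> W \<longrightarrow> (\<exists>d\<in>carrier R. \<one> \<ominus> d \<otimes> c \<in> W))"
proof -
  interpret R: ring R by fact
  have reg: "left_module R (regular_module R)" by (rule left_module_regular[OF assms(1)])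
  obtain W where W: "submodule W R (regular_module R)" "I \<subseteq> W" "\<one> \<notin> W"
    and max: "\<forall>W'. submodule W' R (regular_module R) \<and> W \<subseteq> W' \<and> \<one> \<notin> W' \<longrightarrow> W' = W"
    using maximal_submodule_avoiding[OF reg assms(2,3)] by (elim exE conjE)
  have "\<exists>d\<in>carrier R. \<one> \<ominus> d \<otimes> c \<in> W" if c: "c \<in> carrier R" "c \<notin> W" for c
  proof -
    let ?W = "W <+>\<^bsub>regular_module R\<^esub> cyclic R (regular_module R) c"
    have c': "c \<in> carrier (regular_module R)" using c by simp
    note s = submodule_add_cyclic[OF reg W(1) c']
    have "\<one> \<in> ?W"
    proof (rule ccontr)
      assume "\<one> \<notin> ?W"
      then have "?W = W" by (intro max[THEN spec, THEN mp] conjI s)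
      then show False using s(3) c(2) by blast
    qed
    then obtain u d where ud: "u \<in> W" "d \<in> carrier R" "\<one> = u \<oplus> d \<otimes> c"
      unfolding mem_add_cyclic regular_module_simps by (elim bexE)
    have "u \<in> carrier R" using submodule_mem[OF W(1) ud(1)] by simp
    then have "u = \<one> \<ominus> d \<otimes> c"
      using R.add_eq_iff_diff[of u "d \<otimes> c" "\<one>"] ud c by simp
    then show ?thesis using ud(1,2) by (intro bexI[of _ d]) simp_all
  qed
  then show ?thesis using W by (intro exI[of _ W] conjI ballI impI)
qed

context cring
begin

text \<open>With \<open>maximalideal_intro\<close> this translates between maximality for inclusion
  and invertibility modulo the ideal.\<close>

lemma maximalideal_inverse:
  assumes "maximalideal m R" "c \<in> carrier R" "c \<notin> m"
  shows "\<exists>d\<in>carrier R. \<one> \<ominus> d \<otimes> c \<in> m"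
proof -
  interpret m: maximalideal m R by fact
  have sm: "submodule m R (regular_module R)"
    using m.is_ideal ideal_iff_submodule[OF is_cring] by simp
  have "\<one> \<notin> m" using m.one_imp_carrier m.I_notcarr by blast
  from maximal_left_ideal_exists[OF ring_axioms sm this]
  obtain W where W: "submodule W R (regular_module R)" "m \<subseteq> W" "\<one> \<notin> W"
    "\<forall>c\<in>carrier R. c \<notin> W \<longrightarrow> (\<exists>d\<in>carrier R. \<one> \<ominus> d \<otimes> c \<in> W)"
    by (elim exE conjE)
  have "ideal W R" using W(1) ideal_iff_submodule[OF is_cring] by simp
  moreover have "W \<subseteq> carrier R" using submodule_subset[OF W(1)] by simp
  moreover have "W \<noteq> carrier R" using W(3) by blast
  ultimately have "W = m" using m.I_maximal[of W] W(2) by blast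
  then show ?thesis using W(4) assms(2,3) by simp
qed

lemma maximalideal_intro:
  assumes "submodule m R (regular_module R)" "\<one> \<notin> m"
    "\<And>c. c \<in> carrier R \<Longrightarrow> c \<notin> m \<Longrightarrow> \<exists>d\<in>carrier R. \<one> \<ominus> d \<otimes> c \<in> m"
  shows "maximalideal m R"
proof (rule maximalidealI)
  show "ideal m R" using assms(1) ideal_iff_submodule[OF is_cring] by simp
  show "carrier R \<noteq> m" using assms(2) by blast
  fix J assume J: "ideal J R" "m \<subseteq> J" "J \<subseteq> carrier R"
  interpret J: ideal J R by fact
  show "J = m \<or> J = carrier R"
  proof (cases "J = m")
    case False
    then obtain c where c: "c \<in> J" "c \<notin> m" using J(2) by blast
    then obtain d where d: "d \<in> carrier R" "\<one> \<ominus> d \<otimes> c \<in> m" using assms(3)[of c] J(3) by blast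
    have cR: "c \<in> carrier R" using c J(3) by blast
    have "(\<one> \<ominus> d \<otimes> c) \<oplus> d \<otimes> c \<in> J"
      using d(2) J(2) J.I_l_closed[OF c(1) d(1)] by (intro J.a_closed) blast+
    then have "\<one> \<in> J" using diff_add[of \<one> "d \<otimes> c"] d(1) cR by simp
    then show ?thesis using J.one_imp_carrier by blast
  qed simp
qed

lemma maximalideal_exists:
  assumes "submodule I R (regular_module R)" "\<one> \<notin> I"
  shows "\<exists>m. maximalideal m R \<and> I \<subseteq> m"
proof -
  obtain W where W: "submodule W R (regular_module R)" "I \<subseteq> W" "\<one> \<notin> W"
    "\<forall>c\<in>carrier R. c \<notin> W \<longrightarrow> (\<exists>d\<in>carrier R. \<one> \<ominus> d \<otimes> c \<in> W)"
    using maximal_left_ideal_exists[OF ring_axioms assms] by (elim exE conjE)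
  have "maximalideal W R" by (rule maximalideal_intro[OF W(1,3)]) (use W(4) in simp)
  then show ?thesis using W(2) by (intro exI[of _ W] conjI)
qed

end

section \<open>Matlis duality over the base ring\<close>

locale artin_dual =
  fixes k :: "('k, 'x) ring_scheme" and J :: "('k, 'j) module" (structure)
  assumes artinian_k: "artinian_cring k" and dualizing_J: "dualizing_module k J"
begin

sublocale k: cring k using artinian_k by (simp add: artinian_cring_def)

lemma dcc_k: "dcc k (regular_module k)"
  by (rule dcc_artinian_cring[OF artinian_k])

lemma reg_k: "left_module k (regular_module k)"
  by (rule left_module_regular[OF k.ring_axioms])

abbreviation rad where "rad \<equiv> jacobson_radical k"

abbreviation k_top where "k_top \<equiv> quot_module (regular_module k) rad"

lemma rad_submodule: "submodule rad k (regular_module k)"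
proof -
  interpret reg: left_module k "regular_module k" by (rule reg_k)
  have "submodule (carrier (regular_module k) \<inter> (\<Inter>I\<in>{I. maximalideal I k}. I)) k (regular_module k)"
  proof (rule reg.submodule_INT)
    fix I assume "I \<in> {I. maximalideal I k}"
    then have "ideal I k" by (simp add: maximalideal.axioms(1))
    then show "submodule I k (regular_module k)" using ideal_iff_submodule[OF k.is_cring] by simp
  qed
  then show ?thesis by (simp add: jacobson_radical_def)
qed

lemma rad_iff: "x \<in> rad \<longleftrightarrow> x \<in> carrier k \<and> (\<forall>m. maximalideal m k \<longrightarrow> x \<in> m)"
  by (auto simp: jacobson_radical_def)

lemma envelope:
  obtains \<iota> where "\<iota> \<in> module_hom k k_top J" "inj_on \<iota> (carrier k_top)" "essential k J (\<iota> ` carrier k_top)"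
    "fg_module k J" "injective k J"
  using dualizing_J unfolding dualizing_module_def injective_envelope_def by (elim exE conjE)

lemma fg_J: "fg_module k J" and injective_J: "injective k J" and left_module_J: "left_module k J"
  by (rule envelope, simp_all add: fg_left_module)+

text \<open>Finitely many of the other maximal ideals suffice by \<open>dcc_finite_Inter\<close>.
  Each contains an element outside \<open>m\<close>, and the product of these stays outside
  \<open>m\<close> because \<open>m\<close> is prime. The class of such an element spans the summand
  k/m of k modulo its radical.\<close>

lemma max_separating:
  assumes "maximalideal m k"
  shows "\<exists>t\<in>carrier k. t \<notin> m \<and> (\<forall>m'. maximalideal m' k \<longrightarrow> m' \<noteq> m \<longrightarrow> t \<in> m')"
proof -
  interpret m: maximalideal m k by fact
  interpret mp: primeideal m k by (rule k.maximalideal_prime[OF assms])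
  let ?S = "{m'. maximalideal m' k \<and> m' \<noteq> m}"
  have sub: "submodule i k (regular_module k)" if "i \<in> ?S" for i
  proof -
    have "ideal i k" using that by (intro maximalideal.axioms(1)) simp
    then show ?thesis using ideal_iff_submodule[OF k.is_cring] by simp
  qed
  have "\<exists>F. finite F \<and> F \<subseteq> ?S \<and>
      (\<forall>x\<in>carrier (regular_module k). (\<forall>i\<in>F. x \<in> i) \<longrightarrow> (\<forall>i\<in>?S. x \<in> i))"
    by (rule dcc_finite_Inter[where N = "\<lambda>i. i", OF dcc_k reg_k]) (rule sub)
  then obtain F where F: "finite F" "F \<subseteq> ?S"
    "\<forall>x\<in>carrier (regular_module k). (\<forall>i\<in>F. x \<in> i) \<longrightarrow> (\<forall>i\<in>?S. x \<in> i)" by (elim exE conjE)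
  have "\<exists>t\<in>carrier k. t \<notin> m \<and> (\<forall>i\<in>F. t \<in> i)"
    using F(1,2)
  proof (induction F)
    case empty
    have "\<one>\<^bsub>k\<^esub> \<notin> m" using m.one_imp_carrier m.I_notcarr by blast
    then show ?case by (intro bexI[of _ "\<one>\<^bsub>k\<^esub>"]) auto
  next
    case (insert i F)
    have "F \<subseteq> ?S" using insert.prems by blast
    from insert.IH[OF this] obtain t where t: "t \<in> carrier k" "t \<notin> m" "\<forall>i\<in>F. t \<in> i"
      by (elim bexE conjE)
    have i: "maximalideal i k" "i \<noteq> m" using insert.prems by auto
    interpret i: maximalideal i k by (rule i(1))
    have "\<not> i \<subseteq> m"
      using i.I_maximal[OF m.is_ideal _ m.a_subset] i(2) m.I_notcarr by blast
    then obtain s where s: "s \<in> i" "s \<notin> m" by blast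
    have sk: "s \<in> carrier k" using s(1) i.a_subset by blast
    have "t \<otimes>\<^bsub>k\<^esub> s \<notin> m" using mp.I_prime[OF t(1) sk] t(2) s(2) by blast
    moreover have "t \<otimes>\<^bsub>k\<^esub> s \<in> i" by (rule i.I_l_closed[OF s(1) t(1)])
    moreover have "t \<otimes>\<^bsub>k\<^esub> s \<in> j" if "j \<in> F" for j
    proof -
      have "maximalideal j k" using insert.prems that by blast
      then interpret j: maximalideal j k .
      show ?thesis using t(3) that sk by (intro j.I_r_closed) auto
    qed
    ultimately show ?case using t(1) sk by (intro bexI[of _ "t \<otimes>\<^bsub>k\<^esub> s"]) auto
  qed
  then obtain t where t: "t \<in> carrier k" "t \<notin> m" "\<forall>i\<in>F. t \<in> i" by (elim bexE conjE)
  have "t \<in> carrier (regular_module k)" using t(1) by simp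
  from F(3)[THEN bspec, THEN mp, OF this t(3)] have "\<forall>i\<in>?S. t \<in> i" .
  then show ?thesis using t(1,2) by (intro bexI[of _ t] conjI allI impI) simp_all
qed

text \<open>Take the image under the envelope of the class of a separating element \<open>t\<close>:
  multiplying \<open>t\<close> by an element of \<open>m\<close> gives an element of every maximal
  ideal.\<close>

lemma max_socle_nonzero:
  assumes "maximalideal m k"
  shows "\<exists>x\<in>carrier J. x \<noteq> \<zero> \<and> (\<forall>c\<in>m. c \<odot> x = \<zero>)"
proof -
  interpret m: maximalideal m k by fact
  obtain t where t: "t \<in> carrier k" "t \<notin> m" "\<forall>m'. maximalideal m' k \<longrightarrow> m' \<noteq> m \<longrightarrow> t \<in> m'"
    using max_separating[OF assms] by (elim bexE conjE)
  obtain \<iota> where \<iota>: "\<iota> \<in> module_hom k k_top J" "inj_on \<iota> (carrier k_top)" by (rule envelope)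
  note lQ = left_module_quot[OF reg_k rad_submodule] and ch = coset_hom[OF reg_k rad_submodule]
  have tr: "t \<in> carrier (regular_module k)" using t(1) by simp
  let ?q = "rad +>\<^bsub>regular_module k\<^esub> t"
  have q: "?q \<in> carrier k_top" by (rule hom_closed[OF ch tr])
  have "?q \<noteq> \<zero>\<^bsub>k_top\<^esub>"
    using coset_zero_iff[OF reg_k rad_submodule tr] t(2) assms by (auto simp: rad_iff)
  then have nz: "\<iota> ?q \<noteq> \<zero>" using \<iota>(2) hom_inj_iff[OF lQ left_module_J \<iota>(1)] q by blast
  have "c \<odot> \<iota> ?q = \<zero>" if c: "c \<in> m" for c
  proof -
    have ck: "c \<in> carrier k" using c m.a_subset by blast
    have "c \<otimes>\<^bsub>k\<^esub> t \<in> m'" if m': "maximalideal m' k" for m'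
    proof -
      interpret m': maximalideal m' k by fact
      show ?thesis
      proof (cases "m' = m")
        case True then show ?thesis using m.I_r_closed[OF c t(1)] by simp
      next
        case False then show ?thesis using t(3) m' by (intro m'.I_l_closed[OF _ ck]) simp
      qed
    qed
    then have "c \<odot>\<^bsub>regular_module k\<^esub> t \<in> rad" using ck t(1) by (simp add: rad_iff)
    then have "rad +>\<^bsub>regular_module k\<^esub> (c \<odot>\<^bsub>regular_module k\<^esub> t) = \<zero>\<^bsub>k_top\<^esub>"
      by (subst coset_zero_iff[OF reg_k rad_submodule]) (use ck t(1) in simp_all)
    then have "c \<odot>\<^bsub>k_top\<^esub> ?q = \<zero>\<^bsub>k_top\<^esub>" using hom_smult[OF ch ck tr] by simp
    then show ?thesis using hom_smult[OF \<iota>(1) ck q] hom_zero[OF lQ left_module_J \<iota>(1)] by simp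
  qed
  then show ?thesis using nz hom_closed[OF \<iota>(1) q] by (intro bexI[of _ "\<iota> ?q"] conjI ballI)
qed

text \<open>The part of J killed by \<open>m\<close> lies in the embedded copy of k modulo its
  radical, since that copy is essential; there it is the single summand k/m.\<close>

lemma max_socle_line:
  assumes m: "maximalideal m k" and x: "x \<in> carrier J" "x \<noteq> \<zero>" "\<forall>c\<in>m. c \<odot> x = \<zero>"
    and y: "y \<in> carrier J" "\<forall>c\<in>m. c \<odot> y = \<zero>"
  shows "\<exists>c\<in>carrier k. y = c \<odot> x"
proof (cases "y = \<zero>")
  interpret J: left_module k J by (rule left_module_J)
  case True
  then show ?thesis using x(1) by (intro bexI[of _ "\<zero>\<^bsub>k\<^esub>"]) auto
next
  case False
  interpret J: left_module k J by (rule left_module_J)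
  interpret m: maximalideal m k by fact
  interpret mp: primeideal m k by (rule k.maximalideal_prime[OF m])
  obtain \<iota> where \<iota>: "\<iota> \<in> module_hom k k_top J" "inj_on \<iota> (carrier k_top)" "essential k J (\<iota> ` carrier k_top)"
    by (rule envelope)
  note lQ = left_module_quot[OF reg_k rad_submodule] and ch = coset_hom[OF reg_k rad_submodule]
  interpret lQ: left_module k k_top by (rule lQ)
  have inv: "z = d \<odot> (c \<odot> z)"
    if z: "z \<in> carrier J" "\<forall>c\<in>m. c \<odot> z = \<zero>" and cd: "c \<in> carrier k" "d \<in> carrier k" "\<one>\<^bsub>k\<^esub> \<ominus>\<^bsub>k\<^esub> d \<otimes>\<^bsub>k\<^esub> c \<in> m" for z c d
  proof -
    have "z = ((\<one>\<^bsub>k\<^esub> \<ominus>\<^bsub>k\<^esub> d \<otimes>\<^bsub>k\<^esub> c) \<oplus>\<^bsub>k\<^esub> d \<otimes>\<^bsub>k\<^esub> c) \<odot> z"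
      using z cd by (simp add: k.diff_add)
    also have "\<dots> = (\<one>\<^bsub>k\<^esub> \<ominus>\<^bsub>k\<^esub> d \<otimes>\<^bsub>k\<^esub> c) \<odot> z \<oplus> (d \<otimes>\<^bsub>k\<^esub> c) \<odot> z"
      using z cd by (intro J.smult_l_distr) auto
    also have "\<dots> = d \<odot> (c \<odot> z)" using z cd by (simp add: J.smult_assoc1)
    finally show ?thesis .
  qed
  \<comment> \<open>By essentiality some nonzero multiple of \<open>z\<close> lies in the image of
    the envelope. The multiplier is outside \<open>m\<close>, hence invertible modulo
    \<open>m\<close>, and \<open>m\<close> kills \<open>z\<close>; so \<open>z\<close> itself lies
    in the image.\<close>
  have img: "\<exists>a\<in>carrier k. z = \<iota> (rad +>\<^bsub>regular_module k\<^esub> a) \<and> a \<notin> m \<and> (\<forall>c\<in>m. c \<otimes>\<^bsub>k\<^esub> a \<in> rad)"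
    if z: "z \<in> carrier J" "z \<noteq> \<zero>" "\<forall>c\<in>m. c \<odot> z = \<zero>" for z
  proof -
    note cz = submodule_cyclic[OF left_module_J z(1)]
    have im: "submodule (\<iota> ` carrier k_top) k J" using \<iota>(3) by (simp add: essential_def)
    have "cyclic k J z \<noteq> {\<zero>}" using cz(2) z(2) by blast
    then have "cyclic k J z \<inter> \<iota> ` carrier k_top \<noteq> {\<zero>}" using \<iota>(3) cz(1) by (auto simp: essential_def)
    moreover have "\<zero> \<in> cyclic k J z \<inter> \<iota> ` carrier k_top"
      using submodule_zero_mem[OF cz(1)] submodule_zero_mem[OF im] by blast
    ultimately obtain w where w: "w \<in> cyclic k J z" "w \<in> \<iota> ` carrier k_top" "w \<noteq> \<zero>" by blast
    then obtain c where c: "c \<in> carrier k" "w = c \<odot> z" unfolding cyclic_def by blast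
    then have "c \<notin> m" using w(3) z(3) by blast
    then obtain d where d: "d \<in> carrier k" "\<one>\<^bsub>k\<^esub> \<ominus>\<^bsub>k\<^esub> d \<otimes>\<^bsub>k\<^esub> c \<in> m"
      using k.maximalideal_inverse[OF m c(1)] by blast
    have "z = d \<odot> w" using inv[OF z(1,3) c(1) d] c(2) by simp
    then have "z \<in> \<iota> ` carrier k_top" using submodule_smult[OF im d(1) w(2)] by simp
    then obtain q where zq: "q \<in> carrier k_top" "z = \<iota> q" by blast
    then have "q \<in> (\<lambda>x. rad +>\<^bsub>regular_module k\<^esub> x) ` carrier (regular_module k)"
      using coset_surj[OF reg_k rad_submodule] by simp
    then obtain a where a: "a \<in> carrier k" "z = \<iota> (rad +>\<^bsub>regular_module k\<^esub> a)"
      using zq(2) by auto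
    have ar: "a \<in> carrier (regular_module k)" using a(1) by simp
    have q: "rad +>\<^bsub>regular_module k\<^esub> a \<in> carrier k_top" by (rule hom_closed[OF ch ar])
    have ma: "c \<otimes>\<^bsub>k\<^esub> a \<in> rad" if c: "c \<in> m" for c
    proof -
      have ck: "c \<in> carrier k" using c m.a_subset by blast
      have "\<iota> (c \<odot>\<^bsub>k_top\<^esub> (rad +>\<^bsub>regular_module k\<^esub> a)) = \<zero>"
        using hom_smult[OF \<iota>(1) ck q] z(3) c a(2) by simp
      then have "c \<odot>\<^bsub>k_top\<^esub> (rad +>\<^bsub>regular_module k\<^esub> a) = \<zero>\<^bsub>k_top\<^esub>"
        using \<iota>(2) hom_inj_iff[OF lQ left_module_J \<iota>(1)] q ck by simp
      then have "rad +>\<^bsub>regular_module k\<^esub> (c \<odot>\<^bsub>regular_module k\<^esub> a) = \<zero>\<^bsub>k_top\<^esub>"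
        using hom_smult[OF ch ck ar] by simp
      then show ?thesis
        using coset_zero_iff[OF reg_k rad_submodule, of "c \<odot>\<^bsub>regular_module k\<^esub> a"] ck a(1) by simp
    qed
    \<comment> \<open>Otherwise the square of \<open>a\<close> lies in every maximal ideal, these
      are prime, and \<open>a\<close> represents zero.\<close>
    have "a \<notin> m"
    proof
      assume am: "a \<in> m"
      have "a \<in> m'" if "maximalideal m' k" for m'
      proof -
        interpret m': primeideal m' k by (rule k.maximalideal_prime[OF that])
        have "a \<otimes>\<^bsub>k\<^esub> a \<in> m'" using ma[OF am] that by (simp add: rad_iff)
        then show ?thesis using m'.I_prime[OF a(1) a(1)] by blast
      qed
      then have "a \<in> rad" using a(1) by (simp add: rad_iff)
      then have "rad +>\<^bsub>regular_module k\<^esub> a = \<zero>\<^bsub>k_top\<^esub>" using coset_zero_iff[OF reg_k rad_submodule ar] by simp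
      then show False using a(2) z(2) hom_zero[OF lQ left_module_J \<iota>(1)] by simp
    qed
    with a ma show ?thesis by (intro bexI[of _ a] conjI ballI)
  qed
  obtain a where a: "a \<in> carrier k" "x = \<iota> (rad +>\<^bsub>regular_module k\<^esub> a)" "a \<notin> m"
    using img[OF x] by (elim bexE conjE)
  obtain b where b: "b \<in> carrier k" "y = \<iota> (rad +>\<^bsub>regular_module k\<^esub> b)" "\<forall>c\<in>m. c \<otimes>\<^bsub>k\<^esub> b \<in> rad"
    using img[OF y(1) False y(2)] by (elim bexE conjE)
  obtain d where d: "d \<in> carrier k" "\<one>\<^bsub>k\<^esub> \<ominus>\<^bsub>k\<^esub> d \<otimes>\<^bsub>k\<^esub> a \<in> m"
    using k.maximalideal_inverse[OF m a(1,3)] by blast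
  let ?c = "d \<otimes>\<^bsub>k\<^esub> b"
  have c: "?c \<in> carrier k" using d b by simp
  have ar: "a \<in> carrier (regular_module k)" "b \<in> carrier (regular_module k)" using a b by simp_all
  have car: "?c \<otimes>\<^bsub>k\<^esub> a \<in> carrier (regular_module k)" using a c by simp
  \<comment> \<open>Modulo \<open>m\<close> the scalar \<open>d\<close> inverts \<open>a\<close>,
    and \<open>m\<close> times \<open>b\<close> lies in the radical; so \<open>b\<close> and
    \<open>d b a\<close> have the same class.\<close>
  have "b \<ominus>\<^bsub>k\<^esub> ?c \<otimes>\<^bsub>k\<^esub> a = (\<one>\<^bsub>k\<^esub> \<ominus>\<^bsub>k\<^esub> d \<otimes>\<^bsub>k\<^esub> a) \<otimes>\<^bsub>k\<^esub> b"
    using a b d by (simp add: a_minus_def k.r_distr k.l_distr k.r_minus k.l_minus k.m_ac)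
  then have "b \<ominus>\<^bsub>k\<^esub> ?c \<otimes>\<^bsub>k\<^esub> a \<in> rad" using b(3) d(2) by simp
  then have "b \<ominus>\<^bsub>regular_module k\<^esub> ?c \<otimes>\<^bsub>k\<^esub> a \<in> rad"
    using car by (simp add: a_minus_def k.ring_axioms)
  then have "rad +>\<^bsub>regular_module k\<^esub> b = rad +>\<^bsub>regular_module k\<^esub> (?c \<odot>\<^bsub>regular_module k\<^esub> a)"
    using coset_eq_iff[OF reg_k rad_submodule ar(2) car] by simp
  also have "\<dots> = ?c \<odot>\<^bsub>k_top\<^esub> (rad +>\<^bsub>regular_module k\<^esub> a)" by (rule hom_smult[OF ch c ar(1)])
  finally have "y = ?c \<odot> x"
    using hom_smult[OF \<iota>(1) c hom_closed[OF ch ar(1)]] a(2) b(2) by simp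
  then show ?thesis using c by (intro bexI[of _ ?c])
qed

text \<open>Noetherian descent: among the ideals whose annihilator in J does not see
  \<open>\<theta>\<close> as a scalar take a largest one, \<open>I\<close>, and pass to a minimal
  ideal \<open>K\<close> above it. On the annihilator of \<open>K\<close> the map is a scalar, and
  the discrepancy on the annihilator of \<open>I\<close> takes place in a socle line, where it is
  again given by a scalar.\<close>

lemma endomorphism_scalar:
  assumes \<theta>: "\<theta> \<in> module_hom k J J"
  shows "\<exists>c\<in>carrier k. \<forall>x\<in>carrier J. \<theta> x = c \<odot> x"
proof (rule ccontr)
  assume neg: "\<not> ?thesis"
  interpret J: left_module k J by (rule left_module_J)
  interpret reg: left_module k "regular_module k" by (rule reg_k)
  note \<theta>f = hom_facts[OF \<theta>]
  define kill where "kill I x \<longleftrightarrow> x \<in> carrier J \<and> (\<forall>c\<in>I. c \<odot> x = \<zero>)" for I x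
  have killJ: "x \<in> carrier J" if "kill I x" for I x using that unfolding kill_def by (rule conjunct1)
  have killD: "c \<odot> x = \<zero>" if "kill I x" "c \<in> I" for I x c
    using that(1) unfolding kill_def by (elim conjE) (erule bspec, rule that(2))
  have kill0: "kill {\<zero>\<^bsub>k\<^esub>} x" if "x \<in> carrier J" for x
    using that unfolding kill_def by (intro conjI ballI) auto
  \<comment> \<open>If no scalar works on all of J, then the zero ideal is not \<open>good\<close>,
    as everything is killed by it.\<close>
  define good where "good I \<longleftrightarrow> (\<exists>c\<in>carrier k. \<forall>x. kill I x \<longrightarrow> \<theta> x = c \<odot> x)" for I
  let ?S = "{I. submodule I k (regular_module k) \<and> \<not> good I}"
  have "\<not> good {\<zero>\<^bsub>k\<^esub>}"
  proof
    assume "good {\<zero>\<^bsub>k\<^esub>}"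
    then obtain c where c: "c \<in> carrier k" "\<forall>x. kill {\<zero>\<^bsub>k\<^esub>} x \<longrightarrow> \<theta> x = c \<odot> x"
      unfolding good_def by (elim bexE)
    have "\<theta> x = c \<odot> x" if "x \<in> carrier J" for x
      using c(2) kill0 that by blast
    then show False using neg c(1) by blast
  qed
  moreover have "submodule {\<zero>\<^bsub>k\<^esub>} k (regular_module k)" using reg.submodule_zero by simp
  ultimately have ne: "?S \<noteq> {}" by blast
  have fgr: "fg_module k (regular_module k)"
    using reg_k fin_gen_regular[OF k.ring_axioms] by (simp add: fg_module_def)
  have "\<exists>N\<in>?S. \<forall>N'\<in>?S. N \<subseteq> N' \<longrightarrow> N' = N"
    by (rule maximal_ideal_exists[OF k.is_cring dcc_k fgr ne]) simp
  then obtain I where I0: "I \<in> ?S" "\<forall>N'\<in>?S. I \<subseteq> N' \<longrightarrow> N' = I" by (elim bexE)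
  have I: "submodule I k (regular_module k)" "\<not> good I" using I0(1) by simp_all
  have Imax: "good K" if "submodule K k (regular_module k)" "I \<subseteq> K" "K \<noteq> I" for K
    using I0(2)[rule_format, of K] that by auto
  have "good (carrier k)"
  proof -
    have "\<theta> x = \<zero>\<^bsub>k\<^esub> \<odot> x" if "kill (carrier k) x" for x
    proof -
      have x: "x \<in> carrier J" "\<one>\<^bsub>k\<^esub> \<odot> x = \<zero>" using killJ[OF that] killD[OF that k.one_closed] by simp_all
      then have "x = \<zero>" by simp
      then show ?thesis using hom_zero[OF left_module_J left_module_J \<theta>] by simp
    qed
    then show ?thesis unfolding good_def by (intro bexI[of _ "\<zero>\<^bsub>k\<^esub>"]) auto
  qed
  then have Ine: "I \<noteq> carrier k" using I(2) by blast
  let ?T = "{K. submodule K k (regular_module k) \<and> I \<subset> K}"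
  have "carrier k \<in> ?T" using Ine submodule_subset[OF I(1)] reg.submodule_carrier by auto
  then have Tne: "?T \<noteq> {}" by blast
  have "\<exists>K\<in>?T. \<forall>K'\<in>?T. K' \<subseteq> K \<longrightarrow> K' = K" by (rule dcc_minimal[OF dcc_k Tne]) simp
  then obtain K where K0: "K \<in> ?T" "\<forall>K'\<in>?T. K' \<subseteq> K \<longrightarrow> K' = K" by (elim bexE)
  have K: "submodule K k (regular_module k)" "I \<subset> K" using K0(1) by simp_all
  obtain b where b: "b \<in> K" "b \<notin> I" using K(2) by blast
  have bk: "b \<in> carrier k" using submodule_mem[OF K(1) b(1)] by simp
  have Keq: "K = I <+>\<^bsub>regular_module k\<^esub> cyclic k (regular_module k) c" if c: "c \<in> K" "c \<notin> I" for c
  proof -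
    have ck: "c \<in> carrier (regular_module k)" by (rule submodule_mem[OF K(1) c(1)])
    note s = submodule_add_cyclic[OF reg_k I(1) ck]
    have "I <+>\<^bsub>regular_module k\<^esub> cyclic k (regular_module k) c \<subseteq> K"
      using K(2) submodule_add[OF K(1)] submodule_smult[OF K(1) _ c(1)]
      by (auto simp: mem_add_cyclic subset_iff simp del: regular_module_simps)
    moreover have "I \<subset> I <+>\<^bsub>regular_module k\<^esub> cyclic k (regular_module k) c" using s(2,3) c(2) by blast
    ultimately show ?thesis
      using K0(2)[rule_format, of "I <+>\<^bsub>regular_module k\<^esub> cyclic k (regular_module k) c"] s(1) by simp
  qed
  \<comment> \<open>K/I is simple and generated by \<open>b\<close>, hence isomorphic to k/m for
    this ideal.\<close>
  define m where "m = {c \<in> carrier k. c \<otimes>\<^bsub>k\<^esub> b \<in> I}"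
  have ms: "submodule m k (regular_module k)"
  proof -
    have "submodule {c \<in> carrier (regular_module k). c \<odot>\<^bsub>regular_module k\<^esub> b \<in> I} k (regular_module k)"
      by (rule hom_vimage_submodule[OF reg_k reg_k smult_right_hom[OF reg_k] I(1)]) (simp add: bk)
    then show ?thesis by (simp add: m_def)
  qed
  have m: "maximalideal m k"
  proof (rule k.maximalideal_intro[OF ms])
    show "\<one>\<^bsub>k\<^esub> \<notin> m" using b(2) bk by (simp add: m_def)
    fix c assume c: "c \<in> carrier k" "c \<notin> m"
    then have cb: "c \<otimes>\<^bsub>k\<^esub> b \<in> K" "c \<otimes>\<^bsub>k\<^esub> b \<notin> I"
      using submodule_smult[OF K(1) c(1) b(1)] by (simp_all add: m_def)
    have "b \<in> I <+>\<^bsub>regular_module k\<^esub> cyclic k (regular_module k) (c \<otimes>\<^bsub>k\<^esub> b)" using Keq[OF cb] b(1) by simp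
    then obtain a d where ad: "a \<in> I" "d \<in> carrier k" "b = a \<oplus>\<^bsub>k\<^esub> d \<otimes>\<^bsub>k\<^esub> (c \<otimes>\<^bsub>k\<^esub> b)"
      unfolding mem_add_cyclic regular_module_simps by (elim bexE)
    have ak: "a \<in> carrier k" using submodule_mem[OF I(1) ad(1)] by simp
    have "a = b \<ominus>\<^bsub>k\<^esub> d \<otimes>\<^bsub>k\<^esub> (c \<otimes>\<^bsub>k\<^esub> b)"
      using k.add_eq_iff_diff[of a "d \<otimes>\<^bsub>k\<^esub> (c \<otimes>\<^bsub>k\<^esub> b)" b] ad ak bk c(1) by simp
    also have "\<dots> = (\<one>\<^bsub>k\<^esub> \<ominus>\<^bsub>k\<^esub> d \<otimes>\<^bsub>k\<^esub> c) \<otimes>\<^bsub>k\<^esub> b"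
      using bk c(1) ad(2) by (simp add: a_minus_def k.l_distr k.l_minus k.m_assoc)
    finally have "\<one>\<^bsub>k\<^esub> \<ominus>\<^bsub>k\<^esub> d \<otimes>\<^bsub>k\<^esub> c \<in> m" using ad(1,2) c(1) by (simp add: m_def)
    then show "\<exists>d\<in>carrier k. \<one>\<^bsub>k\<^esub> \<ominus>\<^bsub>k\<^esub> d \<otimes>\<^bsub>k\<^esub> c \<in> m" using ad(2) by blast
  qed
  interpret m: maximalideal m k by (rule m)
  have "good K" using K by (intro Imax) auto
  then obtain c0 where c0: "c0 \<in> carrier k" "\<forall>x. kill K x \<longrightarrow> \<theta> x = c0 \<odot> x"
    unfolding good_def by (elim bexE)
  have killK: "kill K x" if x: "kill I x" "b \<odot> x = \<zero>" for x
    unfolding kill_def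
  proof (intro conjI ballI)
    show xJ: "x \<in> carrier J" by (rule killJ[OF x(1)])
    fix c assume "c \<in> K"
    then have "c \<in> I <+>\<^bsub>regular_module k\<^esub> cyclic k (regular_module k) b" using Keq[OF b] by simp
    then obtain a d where ad: "a \<in> I" "d \<in> carrier k" "c = a \<oplus>\<^bsub>k\<^esub> d \<otimes>\<^bsub>k\<^esub> b"
      unfolding mem_add_cyclic regular_module_simps by (elim bexE)
    have ak: "a \<in> carrier k" using submodule_mem[OF I(1) ad(1)] by simp
    have a0: "a \<odot> x = \<zero>" by (rule killD[OF x(1) ad(1)])
    have "c \<odot> x = a \<odot> x \<oplus> d \<odot> (b \<odot> x)"
      unfolding ad(3) using ak ad(2) bk xJ by (simp add: J.smult_l_distr J.smult_assoc1)
    then show "c \<odot> x = \<zero>" using a0 x(2) ad(2) by simp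
  qed
  have bm: "\<forall>c\<in>m. c \<odot> (b \<odot> x) = \<zero>" if x: "kill I x" for x
  proof
    fix c assume "c \<in> m"
    then have c: "c \<in> carrier k" "c \<otimes>\<^bsub>k\<^esub> b \<in> I" unfolding m_def by blast+
    have "c \<odot> (b \<odot> x) = (c \<otimes>\<^bsub>k\<^esub> b) \<odot> x"
      by (rule J.smult_assoc1[OF c(1) bk killJ[OF x], symmetric])
    also have "\<dots> = \<zero>" by (rule killD[OF x c(2)])
    finally show "c \<odot> (b \<odot> x) = \<zero>" .
  qed
  \<comment> \<open>Otherwise \<open>I\<close> and \<open>K\<close> kill the same elements and the
    scalar \<open>c0\<close> would already serve for \<open>I\<close>.\<close>
  have "\<exists>j. kill I j \<and> b \<odot> j \<noteq> \<zero>"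
  proof (rule ccontr)
    assume "\<not> ?thesis"
    then have kk: "kill K x" if "kill I x" for x using killK[OF that] that by blast
    have "good I" unfolding good_def
      by (intro bexI[of _ c0] allI impI c0(2)[THEN spec, THEN mp] kk c0(1))
    then show False using I(2) by simp
  qed
  then obtain j where j: "kill I j" "b \<odot> j \<noteq> \<zero>" by (elim exE conjE)
  have jJ: "j \<in> carrier J" by (rule killJ[OF j(1)])
  define t where "t = (\<lambda>x. \<theta> x \<ominus> c0 \<odot> x)"
  have "(\<lambda>x. c0 \<odot> x) \<in> module_hom k J J"
    using c0(1) by (intro module_homI)
      (auto simp: J.smult_r_distr k.m_comm simp flip: J.smult_assoc1)
  then have t: "t \<in> module_hom k J J"
    unfolding t_def a_minus_def by (intro hom_sum[OF left_module_J \<theta>] hom_uminus[OF left_module_J])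
  note tf = hom_facts[OF t]
  have tK: "t x = \<zero>" if "kill K x" for x
    using c0(1) c0(2)[THEN spec, THEN mp, OF that] killJ[OF that] by (simp add: t_def a_minus_def J.M.r_neg)
  \<comment> \<open>Multiplying \<open>j\<close> by an element of \<open>m\<close> lands among the
    elements killed by \<open>K\<close>, where \<open>t\<close> vanishes. So \<open>t j\<close> lies
    in the same socle line as \<open>b j\<close>.\<close>
  have "\<forall>c\<in>m. c \<odot> t j = \<zero>"
  proof
    fix c assume c: "c \<in> m"
    then have ck: "c \<in> carrier k" unfolding m_def by blast
    have "kill I (c \<odot> j)"
      unfolding kill_def
    proof (intro conjI ballI)
      show "c \<odot> j \<in> carrier J" using ck jJ by simp
      fix a assume a: "a \<in> I"
      have ak: "a \<in> carrier k" using submodule_mem[OF I(1) a] by simp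
      have "a \<odot> (c \<odot> j) = c \<odot> (a \<odot> j)"
        using ak ck jJ by (simp add: k.m_comm flip: J.smult_assoc1)
      then show "a \<odot> (c \<odot> j) = \<zero>" using killD[OF j(1) a] ck by simp
    qed
    moreover have "b \<odot> (c \<odot> j) = c \<odot> (b \<odot> j)"
      using bk ck jJ by (simp add: k.m_comm flip: J.smult_assoc1)
    moreover have "c \<odot> (b \<odot> j) = \<zero>" by (rule bspec[OF bm[OF j(1)] c])
    ultimately have "kill K (c \<odot> j)" by (intro killK) (simp_all only:)
    from tK[OF this] show "c \<odot> t j = \<zero>" using tf(3)[OF ck jJ] by simp
  qed
  from max_socle_line[OF m J.smult_closed[OF bk jJ] j(2) bm[OF j(1)] tf(1)[OF jJ] this]
  obtain l where l: "l \<in> carrier k" "t j = l \<odot> (b \<odot> j)" by (elim bexE)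
  have "\<theta> x = (c0 \<oplus>\<^bsub>k\<^esub> l \<otimes>\<^bsub>k\<^esub> b) \<odot> x" if x: "kill I x" for x
  proof -
    have xJ: "x \<in> carrier J" by (rule killJ[OF x])
    from max_socle_line[OF m J.smult_closed[OF bk jJ] j(2) bm[OF j(1)] J.smult_closed[OF bk xJ] bm[OF x]]
    obtain r where r: "r \<in> carrier k" "b \<odot> x = r \<odot> (b \<odot> j)" by (elim bexE)
    \<comment> \<open>Subtracting the multiple of \<open>j\<close> with the same image under
      \<open>b\<close> gives an element killed by \<open>K\<close>, hence by \<open>t\<close>. So
      the scalar \<open>l b\<close> found for \<open>j\<close> describes \<open>t\<close> at
      \<open>x\<close> as well.\<close>
    let ?y = "x \<ominus> r \<odot> j"
    have "kill I ?y"
      unfolding kill_def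
    proof (intro conjI ballI)
      show "?y \<in> carrier J" using xJ jJ r by simp
      fix a assume a: "a \<in> I"
      have ak: "a \<in> carrier k" using submodule_mem[OF I(1) a] by simp
      have "a \<odot> (r \<odot> j) = r \<odot> (a \<odot> j)"
        using ak r jJ by (simp add: k.m_comm flip: J.smult_assoc1)
      then have "a \<odot> (r \<odot> j) = \<zero>" "a \<odot> x = \<zero>"
        using killD[OF j(1) a] killD[OF x a] r by simp_all
      then show "a \<odot> ?y = \<zero>"
        using ak xJ jJ r by (simp add: a_minus_def J.smult_r_distr J.smult_r_minus)
    qed
    moreover have "b \<odot> ?y = \<zero>"
    proof -
      have "b \<odot> (r \<odot> j) = r \<odot> (b \<odot> j)"
        using bk r jJ by (simp add: k.m_comm flip: J.smult_assoc1)
      then show ?thesis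
        using bk xJ jJ r by (simp add: a_minus_def J.smult_r_distr J.smult_r_minus J.M.r_neg)
    qed
    ultimately have "t ?y = \<zero>" by (intro tK killK)
    then have "t x = r \<odot> t j"
      using hom_diff[OF left_module_J left_module_J t xJ, of "r \<odot> j"] tf xJ jJ r
      by (simp add: J.M.diff_zero_iff)
    also have "\<dots> = l \<odot> (r \<odot> (b \<odot> j))"
      using l r bk jJ by (simp add: k.m_comm flip: J.smult_assoc1) (simp add: k.m_ac)
    also have "\<dots> = (l \<otimes>\<^bsub>k\<^esub> b) \<odot> x" using r l bk xJ by (simp add: J.smult_assoc1)
    finally have "\<theta> x \<ominus> c0 \<odot> x = (l \<otimes>\<^bsub>k\<^esub> b) \<odot> x" by (simp add: t_def)
    then have "c0 \<odot> x \<oplus> (l \<otimes>\<^bsub>k\<^esub> b) \<odot> x = \<theta> x"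
      using J.M.add_diff[of "\<theta> x" "c0 \<odot> x"] xJ c0(1) \<theta>f by simp
    then show ?thesis using c0(1) l(1) bk xJ by (simp add: J.smult_l_distr)
  qed
  then have "good I" unfolding good_def
    by (intro bexI[of _ "c0 \<oplus>\<^bsub>k\<^esub> l \<otimes>\<^bsub>k\<^esub> b"] allI impI) (use c0(1) l(1) bk in simp_all)
  then show False using I(2) by simp
qed

text \<open>The annihilator of \<open>v\<close> lies in a maximal ideal \<open>m\<close>; send
  \<open>v\<close> to a nonzero element of J killed by \<open>m\<close> and extend by injectivity of
  J.\<close>

lemma cogenerator:
  assumes V: "fg_module k V" and v: "v \<in> carrier V" "v \<noteq> \<zero>\<^bsub>V\<^esub>"
  shows "\<exists>\<phi>\<in>module_hom k V J. \<phi> v \<noteq> \<zero>"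
proof -
  note lV = fg_left_module[OF V]
  interpret V: left_module k V by (rule lV)
  interpret J: left_module k J by (rule left_module_J)
  let ?A = "{c \<in> carrier (regular_module k). c \<odot>\<^bsub>V\<^esub> v \<in> {\<zero>\<^bsub>V\<^esub>}}"
  have A: "submodule ?A k (regular_module k)"
    by (rule hom_vimage_submodule[OF reg_k lV smult_right_hom[OF lV v(1)] V.submodule_zero])
  have "\<one>\<^bsub>k\<^esub> \<notin> ?A" using v by simp
  from k.maximalideal_exists[OF A this] obtain m where m: "maximalideal m k" "?A \<subseteq> m" by (elim exE conjE)
  obtain x where x: "x \<in> carrier J" "x \<noteq> \<zero>" "\<forall>c\<in>m. c \<odot> x = \<zero>"
    using max_socle_nonzero[OF m(1)] by (elim bexE conjE)
  have "\<exists>h\<in>module_hom k (V\<lparr>carrier := cyclic k V v\<rparr>) J. h v = x"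
  proof (rule cyclic_hom[OF lV v(1) left_module_J x(1)])
    fix r assume "r \<in> carrier k" "r \<odot>\<^bsub>V\<^esub> v = \<zero>\<^bsub>V\<^esub>"
    then have "r \<in> ?A" by simp
    then have "r \<in> m" using m(2) by (rule rev_subsetD)
    then show "r \<odot> x = \<zero>" by (rule bspec[OF x(3)])
  qed
  then obtain h where h: "h \<in> module_hom k (V\<lparr>carrier := cyclic k V v\<rparr>) J" "h v = x" by (elim bexE)
  note c = submodule_cyclic[OF lV v(1)]
  have "\<exists>h'\<in>module_hom k V J. \<forall>x\<in>carrier (V\<lparr>carrier := cyclic k V v\<rparr>). h' x = h x"
    by (rule injective_extend[OF injective_J fg_cyclic[OF lV v(1)] V
        hom_restrict_dom[OF submodule_subset[OF c(1)] hom_ident] inj_on_id2 h(1)])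
  then obtain h' where h': "h' \<in> module_hom k V J" "\<forall>x\<in>carrier (V\<lparr>carrier := cyclic k V v\<rparr>). h' x = h x"
    by (elim bexE)
  have "h' v = x" using h'(2) h(2) c(2) by simp
  then show ?thesis using h'(1) x(2) by (intro bexI[of _ h']) simp
qed

text \<open>A homomorphism vanishing on the common kernel of \<open>\<Phi>\<close> factors
  through finitely many members of \<open>\<Phi>\<close> and extends from their joint image to a power of \<open>J\<close>; the
  components of the extension are scalars.\<close>

lemma double_annihilator:
  assumes V: "fg_module k V" and hom: "\<And>\<psi>. \<psi> \<in> \<Phi> \<Longrightarrow> \<psi> \<in> module_hom k V J"
    and \<phi>: "\<phi> \<in> module_hom k V J"
    and ann: "\<And>v. v \<in> carrier V \<Longrightarrow> (\<forall>\<psi>\<in>\<Phi>. \<psi> v = \<zero>) \<Longrightarrow> \<phi> v = \<zero>"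
  shows "\<exists>F c. finite F \<and> F \<subseteq> \<Phi> \<and> c \<in> F \<rightarrow> carrier k \<and>
    (\<forall>v\<in>carrier V. \<phi> v = (\<Oplus>\<psi>\<in>F. c \<psi> \<odot> \<psi> v))"
proof -
  note lV = fg_left_module[OF V]
  interpret V: left_module k V by (rule lV)
  interpret J: left_module k J by (rule left_module_J)
  have sub: "submodule (ker_set V \<psi> J) k V" if "\<psi> \<in> \<Phi>" for \<psi>
    by (rule ker_set_submodule[OF lV left_module_J hom[OF that]])
  have "\<exists>F. finite F \<and> F \<subseteq> \<Phi> \<and>
      (\<forall>x\<in>carrier V. (\<forall>i\<in>F. x \<in> ker_set V i J) \<longrightarrow> (\<forall>i\<in>\<Phi>. x \<in> ker_set V i J))"
    by (rule dcc_finite_Inter[where N = "\<lambda>\<psi>. ker_set V \<psi> J", OF dcc_fg[OF dcc_k V] lV]) (rule sub)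
  then obtain F where F: "finite F" "F \<subseteq> \<Phi>"
    "\<forall>x\<in>carrier V. (\<forall>i\<in>F. x \<in> ker_set V i J) \<longrightarrow> (\<forall>i\<in>\<Phi>. x \<in> ker_set V i J)" by (elim exE conjE)
  have lP: "left_module k (pow_module F J)" by (rule left_module_pow[OF left_module_J])
  have fgP: "fg_module k (pow_module F J)"
    using lP fin_gen_pow[OF left_module_J F(1)] fg_J by (simp add: fg_module_def)
  let ?g = "\<lambda>v. \<lambda>\<psi>\<in>F. \<psi> v"
  have homF: "\<psi> \<in> module_hom k V J" if "\<psi> \<in> F" for \<psi> using that F(2) hom by blast
  have g: "?g \<in> module_hom k V (pow_module F J)"
    by (rule hom_pow[of F "\<lambda>\<psi>. \<psi>", OF homF lV])
  have "\<exists>h\<in>module_hom k ((pow_module F J)\<lparr>carrier := ?g ` carrier V\<rparr>) J. \<forall>v\<in>carrier V. h (?g v) = \<phi> v"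
  proof (rule hom_factor[OF lV lP left_module_J g \<phi>])
    fix v assume v: "v \<in> carrier V" "?g v = \<zero>\<^bsub>pow_module F J\<^esub>"
    have "\<psi> v = \<zero>" if "\<psi> \<in> F" for \<psi> using fun_cong[OF v(2), of \<psi>] that by simp
    then have "\<forall>i\<in>F. v \<in> ker_set V i J" using v(1) by (simp add: ker_set_def)
    from F(3)[THEN bspec, THEN mp, OF v(1) this] have "\<forall>i\<in>\<Phi>. v \<in> ker_set V i J" .
    then show "\<phi> v = \<zero>" by (intro ann v(1)) (simp add: ker_set_def)
  qed
  then obtain h where h: "h \<in> module_hom k ((pow_module F J)\<lparr>carrier := ?g ` carrier V\<rparr>) J"
    "\<forall>v\<in>carrier V. h (?g v) = \<phi> v" by (elim bexE)
  have im: "submodule (?g ` carrier V) k (pow_module F J)"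
    by (rule hom_image_submodule[OF lV lP g V.submodule_carrier])
  have "\<exists>h'\<in>module_hom k (pow_module F J) J. \<forall>x\<in>carrier ((pow_module F J)\<lparr>carrier := ?g ` carrier V\<rparr>). h' x = h x"
    by (rule injective_extend[OF injective_J fg_submodule[OF k.is_cring dcc_k fgP im] fgP
        hom_restrict_dom[OF submodule_subset[OF im] hom_ident] inj_on_id2 h(1)])
  then obtain h' where h': "h' \<in> module_hom k (pow_module F J) J"
    "\<forall>x\<in>carrier ((pow_module F J)\<lparr>carrier := ?g ` carrier V\<rparr>). h' x = h x" by (elim bexE)
  \<comment> \<open>A map from a power of J to J is, in each coordinate, an endomorphism of
    J.\<close>
  have "\<forall>\<psi>\<in>F. \<exists>c\<in>carrier k. \<forall>x\<in>carrier J. h' (unit_vec F J \<psi> x) = c \<odot> x"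
    by (intro ballI endomorphism_scalar hom_compose[OF unit_vec_hom[OF left_module_J] h'(1)])
  then have "\<exists>c. \<forall>\<psi>\<in>F. c \<psi> \<in> carrier k \<and> (\<forall>x\<in>carrier J. h' (unit_vec F J \<psi> x) = c \<psi> \<odot> x)"
    unfolding Bex_def by (rule bchoice)
  then obtain c where c: "\<forall>\<psi>\<in>F. c \<psi> \<in> carrier k \<and> (\<forall>x\<in>carrier J. h' (unit_vec F J \<psi> x) = c \<psi> \<odot> x)"
    by (rule exE)
  have "\<phi> v = (\<Oplus>\<psi>\<in>F. c \<psi> \<odot> \<psi> v)" if v: "v \<in> carrier V" for v
  proof -
    have gv: "?g v \<in> F \<rightarrow>\<^sub>E carrier J" using hom_closed[OF g v] by simp
    have uv: "(\<lambda>\<psi>. unit_vec F J \<psi> (?g v \<psi>)) \<in> F \<rightarrow> carrier (pow_module F J)"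
    proof
      fix \<psi> assume "\<psi> \<in> F"
      then have "?g v \<psi> \<in> carrier J" using gv by (rule PiE_mem[rotated])
      then show "unit_vec F J \<psi> (?g v \<psi>) \<in> carrier (pow_module F J)"
        by (rule hom_closed[OF unit_vec_hom[OF left_module_J]])
    qed
    have "\<phi> v = h' (?g v)" using h'(2) h(2) v by simp
    also have "?g v = (\<Oplus>\<^bsub>pow_module F J\<^esub>\<psi>\<in>F. unit_vec F J \<psi> (?g v \<psi>))"
      by (rule pow_sum_unit_vec[OF left_module_J F(1) gv, symmetric])
    also have "h' \<dots> = (\<Oplus>\<psi>\<in>F. h' (unit_vec F J \<psi> (?g v \<psi>)))"
      by (rule hom_finsum[OF lP left_module_J h'(1) uv])
    also have "\<dots> = (\<Oplus>\<psi>\<in>F. c \<psi> \<odot> \<psi> v)"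
    proof (rule J.M.finsum_cong')
      show "(\<lambda>\<psi>. c \<psi> \<odot> \<psi> v) \<in> F \<rightarrow> carrier J"
        by (intro funcsetI J.smult_closed hom_closed[OF homF v]) (use c in simp)
      fix \<psi> assume \<psi>: "\<psi> \<in> F"
      then show "h' (unit_vec F J \<psi> (?g v \<psi>)) = c \<psi> \<odot> \<psi> v"
        using c[THEN bspec, OF \<psi>] hom_closed[OF homF[OF \<psi>] v] by simp
    qed simp
    finally show ?thesis .
  qed
  moreover have "c \<in> F \<rightarrow> carrier k" using c by (intro funcsetI) simp
  ultimately show ?thesis using F(1,2) by (intro exI[of _ F] exI[of _ c] conjI ballI)
qed

end

section \<open>Self-injective Artin algebras\<close>

lemma projective_retract:
  assumes "projective R P" "i \<in> module_hom R X P" "r \<in> module_hom R P X"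
    "\<And>x. x \<in> carrier X \<Longrightarrow> r (i x) = x"
  shows "projective R X"
  unfolding projective_def
proof (intro allI impI, elim conjE)
  fix M N :: "('a, 'a list) module" and g f
  assume *: "fg_module R M" "fg_module R N" "g \<in> module_hom R M N" "g ` carrier M = carrier N"
    "f \<in> module_hom R X N"
  obtain h where h: "h \<in> module_hom R P M" "\<forall>x\<in>carrier P. g (h x) = f (r x)"
    using projective_lift[OF assms(1) *(1-4) hom_compose[OF assms(3) *(5)]] by (elim bexE)
  show "\<exists>h\<in>module_hom R X M. \<forall>x\<in>carrier X. g (h x) = f x"
  proof (rule bexI[OF _ hom_compose[OF assms(2) h(1)]], rule ballI)
    fix x assume x: "x \<in> carrier X"
    show "g (h (i x)) = f x" using h(2)[THEN bspec, OF hom_closed[OF assms(2) x]] assms(4)[OF x] by simp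
  qed
qed

text \<open>Maximal left ideals, in the computational form of
  \<open>maximal_left_ideal_exists\<close>. Their cores are the primitive ideals studied
  here.\<close>

definition maxl :: "('r, 'x) ring_scheme \<Rightarrow> 'r set \<Rightarrow> bool" where
  "maxl R m \<longleftrightarrow> submodule m R (regular_module R) \<and> \<one>\<^bsub>R\<^esub> \<notin> m \<and>
     (\<forall>c\<in>carrier R. c \<notin> m \<longrightarrow> (\<exists>d\<in>carrier R. \<one>\<^bsub>R\<^esub> \<ominus>\<^bsub>R\<^esub> d \<otimes>\<^bsub>R\<^esub> c \<in> m))"

text \<open>The annihilator of the simple module \<open>R/m\<close>.\<close>

definition core :: "('r, 'x) ring_scheme \<Rightarrow> 'r set \<Rightarrow> 'r set" where
  "core R m = {a \<in> carrier R. \<forall>r\<in>carrier R. a \<otimes>\<^bsub>R\<^esub> r \<in> m}"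

definition lann :: "('r, 'x) ring_scheme \<Rightarrow> ('r, 'm) module \<Rightarrow> 'm \<Rightarrow> 'r set" where
  "lann R M x = {r \<in> carrier R. r \<odot>\<^bsub>M\<^esub> x = \<zero>\<^bsub>M\<^esub>}"

lemma lann_iff: "r \<in> lann R M x \<longleftrightarrow> r \<in> carrier R \<and> r \<odot>\<^bsub>M\<^esub> x = \<zero>\<^bsub>M\<^esub>"
  by (simp add: lann_def)

lemma maxlD:
  assumes "maxl R m"
  shows "submodule m R (regular_module R)" "\<one>\<^bsub>R\<^esub> \<notin> m"
    "\<And>c. c \<in> carrier R \<Longrightarrow> c \<notin> m \<Longrightarrow> \<exists>d\<in>carrier R. \<one>\<^bsub>R\<^esub> \<ominus>\<^bsub>R\<^esub> d \<otimes>\<^bsub>R\<^esub> c \<in> m"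
  using assms unfolding maxl_def by blast+

lemma (in ring) left_idealD:
  assumes "submodule m R (regular_module R)"
  shows "x \<in> m \<Longrightarrow> x \<in> carrier R" "x \<in> m \<Longrightarrow> y \<in> m \<Longrightarrow> x \<oplus> y \<in> m"
    "x \<in> m \<Longrightarrow> y \<in> m \<Longrightarrow> x \<ominus> y \<in> m" "a \<in> carrier R \<Longrightarrow> x \<in> m \<Longrightarrow> a \<otimes> x \<in> m"
    "\<zero> \<in> m"
proof -
  show c: "x \<in> m \<Longrightarrow> x \<in> carrier R" for x using submodule_mem[OF assms, of x] by simp
  show a: "x \<in> m \<Longrightarrow> y \<in> m \<Longrightarrow> x \<oplus> y \<in> m" for x y using submodule_add[OF assms, of x y] by simp
  show "a \<in> carrier R \<Longrightarrow> x \<in> m \<Longrightarrow> a \<otimes> x \<in> m" using submodule_smult[OF assms, of a x] by simp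
  show "\<zero> \<in> m" using submodule_zero_mem[OF assms] by simp
  show "x \<in> m \<Longrightarrow> y \<in> m \<Longrightarrow> x \<ominus> y \<in> m"
    unfolding a_minus_def using a submodule_minus[OF assms, of y] c[of y] ring_axioms by simp
qed

lemma submodule_lann:
  assumes "left_module R M" "x \<in> carrier M"
  shows "submodule (lann R M x) R (regular_module R)"
proof -
  interpret M: left_module R M by fact
  have "submodule {r \<in> carrier (regular_module R). r \<odot>\<^bsub>M\<^esub> x \<in> {\<zero>\<^bsub>M\<^esub>}} R (regular_module R)"
    by (rule hom_vimage_submodule[OF left_module_regular[OF M.R.ring_axioms] assms(1)
        smult_right_hom[OF assms] M.submodule_zero])
  then show ?thesis by (simp add: lann_def)
qed

lemma core_sub: "ring R \<Longrightarrow> a \<in> core R m \<Longrightarrow> a \<in> m"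
proof -
  assume "ring R" and a: "a \<in> core R m"
  then interpret ring R by simp
  have "a \<in> carrier R" "a \<otimes>\<^bsub>R\<^esub> \<one>\<^bsub>R\<^esub> \<in> m" using a one_closed unfolding core_def by blast+
  then show ?thesis by simp
qed

context ring
begin

lemma core_ideal:
  assumes "submodule m R (regular_module R)"
  shows "submodule (core R m) R (regular_module R)"
    "\<And>a r. a \<in> core R m \<Longrightarrow> r \<in> carrier R \<Longrightarrow> a \<otimes> r \<in> core R m"
proof -
  note m = left_idealD[OF assms]
  interpret reg: left_module R "regular_module R" by (rule left_module_regular[OF ring_axioms])
  show "submodule (core R m) R (regular_module R)"
    by (rule reg.submoduleI) (auto simp: core_def l_distr m_assoc intro: m)
  show "a \<otimes> r \<in> core R m" if "a \<in> core R m" "r \<in> carrier R" for a r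
    using that by (simp add: core_def m_assoc)
qed

text \<open>A nonzero element killed by the annihilator of the simple module \<open>R/m\<close> generates a module
  containing a copy of \<open>R/m\<close>: by the descending chain condition \<open>core R m\<close> is a finite intersection
  of ideals \<open>{c. c a \<in> m}\<close>, and one shrinks this family as far as possible.\<close>

lemma simple_in_cyclic:
  assumes dcc: "dcc R (regular_module R)" and m: "maxl R m" and M: "left_module R M"
    and x: "x \<in> carrier M" "x \<noteq> \<zero>\<^bsub>M\<^esub>" "\<And>a. a \<in> core R m \<Longrightarrow> a \<odot>\<^bsub>M\<^esub> x = \<zero>\<^bsub>M\<^esub>"
  shows "\<exists>u\<in>carrier R. u \<odot>\<^bsub>M\<^esub> x \<noteq> \<zero>\<^bsub>M\<^esub> \<and> (\<forall>c\<in>m. c \<odot>\<^bsub>M\<^esub> (u \<odot>\<^bsub>M\<^esub> x) = \<zero>\<^bsub>M\<^esub>)"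
proof -
  interpret M: left_module R M by fact
  have reg: "left_module R (regular_module R)" by (rule left_module_regular[OF ring_axioms])
  note ml = left_idealD[OF maxlD(1)[OF m]]
  have sub: "submodule {c \<in> carrier R. c \<otimes> a \<in> m} R (regular_module R)" if a: "a \<in> carrier R" for a
  proof -
    have "a \<in> carrier (regular_module R)" using a by simp
    from hom_vimage_submodule[OF reg reg smult_right_hom[OF reg this] maxlD(1)[OF m]]
    show ?thesis by simp
  qed
  have "\<exists>F. finite F \<and> F \<subseteq> carrier R \<and> (\<forall>x\<in>carrier (regular_module R).
      (\<forall>i\<in>F. x \<in> {c \<in> carrier R. c \<otimes> i \<in> m}) \<longrightarrow> (\<forall>i\<in>carrier R. x \<in> {c \<in> carrier R. c \<otimes> i \<in> m}))"
    by (rule dcc_finite_Inter[where N = "\<lambda>a. {c \<in> carrier R. c \<otimes> a \<in> m}", OF dcc reg]) (rule sub)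
  then obtain F where F: "finite F" "F \<subseteq> carrier R" "\<forall>x\<in>carrier (regular_module R).
      (\<forall>i\<in>F. x \<in> {c \<in> carrier R. c \<otimes> i \<in> m}) \<longrightarrow> (\<forall>i\<in>carrier R. x \<in> {c \<in> carrier R. c \<otimes> i \<in> m})"
    by (elim exE conjE)
  \<comment> \<open>The induction removes members of \<open>F\<close> as long as the remaining
    conditions still force \<open>c\<close> to kill \<open>x\<close>. With \<open>F\<close> empty
    they would force \<open>x\<close> to be zero.\<close>
  have main: "\<exists>u\<in>carrier R. u \<odot>\<^bsub>M\<^esub> x \<noteq> \<zero>\<^bsub>M\<^esub> \<and> (\<forall>c\<in>m. c \<odot>\<^bsub>M\<^esub> (u \<odot>\<^bsub>M\<^esub> x) = \<zero>\<^bsub>M\<^esub>)"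
    if "finite F" "F \<subseteq> carrier R" "\<And>c. c \<in> carrier R \<Longrightarrow> \<forall>a\<in>F. c \<otimes> a \<in> m \<Longrightarrow> c \<odot>\<^bsub>M\<^esub> x = \<zero>\<^bsub>M\<^esub>" for F
    using that
  proof (induction F)
    case empty
    have "\<one> \<odot>\<^bsub>M\<^esub> x = \<zero>\<^bsub>M\<^esub>" by (rule empty.prems(2)) simp_all
    then show ?case using x(1,2) by simp
  next
    case (insert a F)
    have a: "a \<in> carrier R" "F \<subseteq> carrier R" using insert.prems(1) by simp_all
    show ?case
    proof (cases "\<forall>c\<in>carrier R. (\<forall>a\<in>F. c \<otimes> a \<in> m) \<longrightarrow> c \<odot>\<^bsub>M\<^esub> x = \<zero>\<^bsub>M\<^esub>")
      case True
      show ?thesis by (rule insert.IH[OF a(2)]) (rule True[THEN bspec, THEN mp])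
    next
      case False
      then obtain b where b: "b \<in> carrier R" "\<forall>a\<in>F. b \<otimes> a \<in> m" "b \<odot>\<^bsub>M\<^esub> x \<noteq> \<zero>\<^bsub>M\<^esub>"
        by blast
      \<comment> \<open>Now \<open>b\<close> satisfies the conditions for \<open>F\<close> but does
        not kill \<open>x\<close>, so the only remaining condition for \<open>c\<close> to kill
        \<open>b x\<close> is that \<open>c (b a)\<close> lies in \<open>m\<close>. Thus the module
        generated by \<open>b x\<close> is a quotient of the one generated by the class of
        \<open>b a\<close> in R/m.\<close>
      let ?y = "b \<odot>\<^bsub>M\<^esub> x" and ?t = "b \<otimes> a"
      have y: "?y \<in> carrier M" and t: "?t \<in> carrier R" using b(1) x(1) a(1) by simp_all
      have kill: "c \<odot>\<^bsub>M\<^esub> ?y = \<zero>\<^bsub>M\<^esub>" if c: "c \<in> carrier R" "c \<otimes> ?t \<in> m" for c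
      proof -
        have "\<forall>a'\<in>insert a F. (c \<otimes> b) \<otimes> a' \<in> m"
        proof
          fix a' assume "a' \<in> insert a F"
          then consider "a' = a" | "a' \<in> F" by blast
          then show "(c \<otimes> b) \<otimes> a' \<in> m"
          proof cases
            case 1 then show ?thesis using c b(1) a(1) by (simp add: m_assoc)
          next
            case 2
            then have "c \<otimes> (b \<otimes> a') \<in> m" using b(2) by (intro ml(4)[OF c(1)]) simp
            then show ?thesis using c(1) b(1) a(2) 2 by (simp add: m_assoc subset_iff)
          qed
        qed
        then have "(c \<otimes> b) \<odot>\<^bsub>M\<^esub> x = \<zero>\<^bsub>M\<^esub>" using c(1) b(1) by (intro insert.prems(2)) simp_all
        then show ?thesis using c(1) b(1) x(1) by (simp add: M.smult_assoc1)
      qed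
      have tm: "?t \<notin> m"
      proof
        assume "?t \<in> m"
        then have "\<one> \<odot>\<^bsub>M\<^esub> ?y = \<zero>\<^bsub>M\<^esub>" using t by (intro kill) simp_all
        then show False using b(3) y by simp
      qed
      obtain u where u: "u \<in> carrier R" "\<one> \<ominus> u \<otimes> ?t \<in> m" using maxlD(3)[OF m t tm] by (elim bexE)
      have "c \<odot>\<^bsub>M\<^esub> (u \<odot>\<^bsub>M\<^esub> ?y) = \<zero>\<^bsub>M\<^esub>" if c: "c \<in> m" for c
      proof -
        have ck: "c \<in> carrier R" by (rule ml(1)[OF c])
        have "c \<ominus> c \<otimes> (\<one> \<ominus> u \<otimes> ?t) \<in> m" by (intro ml(3) ml(4) c ck u(2))
        moreover have "(c \<otimes> u) \<otimes> ?t = c \<ominus> c \<otimes> (\<one> \<ominus> u \<otimes> ?t)"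
          using ck u(1) t by (simp add: a_minus_def r_distr r_minus minus_add m_assoc r_neg1 r_neg2 del: m_assoc)
            (simp add: m_assoc r_neg1 r_neg2)
        ultimately have "(c \<otimes> u) \<odot>\<^bsub>M\<^esub> ?y = \<zero>\<^bsub>M\<^esub>" using ck u(1) by (intro kill) simp_all
        then show ?thesis using ck u(1) y by (simp add: M.smult_assoc1)
      qed
      \<comment> \<open>With \<open>t = b a\<close> and \<open>u\<close> inverse to \<open>t\<close>
        modulo \<open>m\<close>, the element \<open>t u\<close> fixes \<open>y = b x\<close>; so
        \<open>u y\<close> cannot vanish.\<close>
      moreover have "u \<odot>\<^bsub>M\<^esub> ?y \<noteq> \<zero>\<^bsub>M\<^esub>"
      proof
        assume z: "u \<odot>\<^bsub>M\<^esub> ?y = \<zero>\<^bsub>M\<^esub>"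
        have "(\<one> \<ominus> ?t \<otimes> u) \<otimes> ?t = ?t \<otimes> (\<one> \<ominus> u \<otimes> ?t)"
          using t u(1) by (simp add: a_minus_def l_distr r_distr l_minus r_minus m_assoc)
        moreover have "?t \<otimes> (\<one> \<ominus> u \<otimes> ?t) \<in> m" by (rule ml(4)[OF t u(2)])
        ultimately have "(\<one> \<ominus> ?t \<otimes> u) \<odot>\<^bsub>M\<^esub> ?y = \<zero>\<^bsub>M\<^esub>" using t u(1) by (intro kill) simp_all
        then have "?y \<ominus>\<^bsub>M\<^esub> ?t \<odot>\<^bsub>M\<^esub> (u \<odot>\<^bsub>M\<^esub> ?y) = \<zero>\<^bsub>M\<^esub>"
          using t u(1) y by (simp only: a_minus_def) (simp add: M.smult_l_distr M.smult_l_minus M.smult_assoc1)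
        then have "?y \<ominus>\<^bsub>M\<^esub> \<zero>\<^bsub>M\<^esub> = \<zero>\<^bsub>M\<^esub>" using z t by simp
        then show False using b(3) y by (simp add: M.M.diff_zero_right)
      qed
      ultimately show ?thesis
        using u(1) b(1) x(1) by (intro bexI[of _ "u \<otimes> b"]) (simp_all add: M.smult_assoc1)
    qed
  qed
  show ?thesis
  proof (rule main[OF F(1,2)])
    fix c assume c: "c \<in> carrier R" "\<forall>a\<in>F. c \<otimes> a \<in> m"
    have "c \<in> carrier (regular_module R)" using c by simp
    moreover have "\<forall>i\<in>F. c \<in> {c \<in> carrier R. c \<otimes> i \<in> m}" using c by simp
    ultimately have "\<forall>i\<in>carrier R. c \<in> {c \<in> carrier R. c \<otimes> i \<in> m}" by (rule F(3)[THEN bspec, THEN mp])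
    then have "c \<in> core R m" using c(1) unfolding core_def by blast
    then show "c \<odot>\<^bsub>M\<^esub> x = \<zero>\<^bsub>M\<^esub>" by (rule x(3))
  qed
qed

text \<open>Primitive ideals of a left artinian ring are incomparable: the simple module R/m' is
  killed by the core of \<open>m\<close>, so by \<open>simple_in_cyclic\<close> it contains a copy
  of R/m, and the two simple modules have the same annihilator.\<close>

lemma core_mono_eq:
  assumes dcc: "dcc R (regular_module R)" and m: "maxl R m" and m': "maxl R m'" and "core R m \<subseteq> core R m'"
  shows "core R m = core R m'"
proof
  have reg: "left_module R (regular_module R)" by (rule left_module_regular[OF ring_axioms])
  note ml = left_idealD[OF maxlD(1)[OF m]] and ml' = left_idealD[OF maxlD(1)[OF m']]
  let ?Q = "quot_module (regular_module R) m'"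
  note lQ = left_module_quot[OF reg maxlD(1)[OF m']] and ch = coset_hom[OF reg maxlD(1)[OF m']]
  let ?x = "m' +>\<^bsub>regular_module R\<^esub> \<one>"
  have one: "\<one> \<in> carrier (regular_module R)" by simp
  have act: "a \<odot>\<^bsub>?Q\<^esub> ?x = \<zero>\<^bsub>?Q\<^esub> \<longleftrightarrow> a \<in> m'" if a: "a \<in> carrier R" for a
    using hom_smult[OF ch a one] coset_zero_iff[OF reg maxlD(1)[OF m'], of a] a by simp
  have "\<exists>u\<in>carrier R. u \<odot>\<^bsub>?Q\<^esub> ?x \<noteq> \<zero>\<^bsub>?Q\<^esub> \<and> (\<forall>c\<in>m. c \<odot>\<^bsub>?Q\<^esub> (u \<odot>\<^bsub>?Q\<^esub> ?x) = \<zero>\<^bsub>?Q\<^esub>)"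
  proof (rule simple_in_cyclic[OF dcc m lQ])
    show "?x \<in> carrier ?Q" by (rule hom_closed[OF ch one])
    show "?x \<noteq> \<zero>\<^bsub>?Q\<^esub>" using coset_zero_iff[OF reg maxlD(1)[OF m'] one] maxlD(2)[OF m'] by simp
    fix a assume "a \<in> core R m"
    then have "a \<in> core R m'" using assms(4) by blast
    then show "a \<odot>\<^bsub>?Q\<^esub> ?x = \<zero>\<^bsub>?Q\<^esub>"
      using act[of a] core_sub[OF ring_axioms, of a m'] by (simp add: core_def)
  qed
  then obtain u where u: "u \<in> carrier R" "u \<odot>\<^bsub>?Q\<^esub> ?x \<noteq> \<zero>\<^bsub>?Q\<^esub>" "\<forall>c\<in>m. c \<odot>\<^bsub>?Q\<^esub> (u \<odot>\<^bsub>?Q\<^esub> ?x) = \<zero>\<^bsub>?Q\<^esub>"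
    by (elim bexE conjE)
  interpret Q: left_module R ?Q by (rule lQ)
  have xQ: "?x \<in> carrier ?Q" by (rule hom_closed[OF ch one])
  have um: "u \<notin> m'" using u(1,2) act by blast
  have mu: "c \<otimes> u \<in> m'" if c: "c \<in> m" for c
  proof -
    have "(c \<otimes> u) \<odot>\<^bsub>?Q\<^esub> ?x = \<zero>\<^bsub>?Q\<^esub>" using u(3)[THEN bspec, OF c] Q.smult_assoc1[OF ml(1)[OF c] u(1) xQ] by simp
    then show ?thesis using act[of "c \<otimes> u"] ml(1)[OF c] u(1) by simp
  qed
  show "core R m' \<subseteq> core R m"
  proof
    fix a assume a: "a \<in> core R m'"
    then have ak: "a \<in> carrier R" by (simp add: core_def)
    \<comment> \<open>Otherwise \<open>d a r\<close> is one modulo \<open>m\<close> for some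
      \<open>d\<close>. Right multiplication by \<open>u\<close> carries \<open>m\<close> into
      \<open>m'\<close>, and \<open>a\<close> lies in the core of \<open>m'\<close>, so both parts
      of \<open>u\<close> fall into \<open>m'\<close>.\<close>
    have "a \<otimes> r \<in> m" if r: "r \<in> carrier R" for r
    proof (rule ccontr)
      assume "a \<otimes> r \<notin> m"
      moreover have "a \<otimes> r \<in> carrier R" using ak r by simp
      ultimately obtain d where d: "d \<in> carrier R" "\<one> \<ominus> d \<otimes> (a \<otimes> r) \<in> m" using maxlD(3)[OF m] by blast
      have 1: "(\<one> \<ominus> d \<otimes> (a \<otimes> r)) \<otimes> u \<in> m'" by (rule mu[OF d(2)])
      have "a \<otimes> (r \<otimes> u) \<in> m'" using a r u(1) by (simp add: core_def)
      then have 2: "d \<otimes> (a \<otimes> (r \<otimes> u)) \<in> m'" by (rule ml'(4)[OF d(1)])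
      have "(\<one> \<ominus> d \<otimes> (a \<otimes> r)) \<otimes> u \<oplus> d \<otimes> (a \<otimes> (r \<otimes> u)) = ((\<one> \<ominus> d \<otimes> (a \<otimes> r)) \<oplus> d \<otimes> (a \<otimes> r)) \<otimes> u"
        using d(1) ak r u(1) by (simp add: l_distr m_assoc)
      also have "\<dots> = u" using d(1) ak r u(1) by (simp add: diff_add)
      finally have "u \<in> m'" using ml'(2)[OF 1 2] by simp
      then show False using um by simp
    qed
    then show "a \<in> core R m" using ak by (simp add: core_def)
  qed
qed (fact assms(4))

text \<open>If the sum of the two cores were proper it would lie in a maximal left ideal. Being
  stable under right multiplication, both cores would lie in its core and so coincide.\<close>

lemma core_comaximal:
  assumes dcc: "dcc R (regular_module R)" and m: "maxl R m" and m': "maxl R m'" and ne: "core R m \<noteq> core R m'"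
  shows "\<exists>p\<in>core R m. \<exists>q\<in>core R m'. \<one> = p \<oplus> q"
proof (rule ccontr)
  assume neg: "\<not> ?thesis"
  interpret reg: left_module R "regular_module R" by (rule left_module_regular[OF ring_axioms])
  note c = core_ideal[OF maxlD(1)[OF m]] and c' = core_ideal[OF maxlD(1)[OF m']]
  let ?S = "core R m <+>\<^bsub>regular_module R\<^esub> core R m'"
  have S: "submodule ?S R (regular_module R)" by (rule reg.submodule_sum[OF c(1) c'(1)])
  have "\<one> \<notin> ?S" using neg by (simp add: mem_set_add)
  from maximal_left_ideal_exists[OF ring_axioms S this] obtain n where n: "submodule n R (regular_module R)"
    "?S \<subseteq> n" "\<one> \<notin> n" "\<forall>c\<in>carrier R. c \<notin> n \<longrightarrow> (\<exists>d\<in>carrier R. \<one> \<ominus> d \<otimes> c \<in> n)" by (elim exE conjE)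
  have nm: "maxl R n" using n unfolding maxl_def by blast
  have inS: "a \<in> ?S" if "a \<in> core R m \<or> a \<in> core R m'" for a
  proof -
    have "a \<in> carrier R" using that by (auto simp: core_def)
    then have "a = a \<oplus> \<zero>" "a = \<zero> \<oplus> a" by simp_all
    moreover have "\<zero> \<in> core R m" "\<zero> \<in> core R m'"
      using submodule_zero_mem[OF c(1)] submodule_zero_mem[OF c'(1)] by simp_all
    ultimately show ?thesis unfolding mem_set_add regular_module_simps using that by blast
  qed
  have "core R m \<subseteq> core R n"
  proof
    fix a assume a: "a \<in> core R m"
    have "a \<otimes> r \<in> n" if "r \<in> carrier R" for r using inS[of "a \<otimes> r"] c(2)[OF a that] n(2) by blast
    then show "a \<in> core R n" using a by (simp add: core_def)
  qed
  moreover have "core R m' \<subseteq> core R n"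
  proof
    fix a assume a: "a \<in> core R m'"
    have "a \<otimes> r \<in> n" if "r \<in> carrier R" for r using inS[of "a \<otimes> r"] c'(2)[OF a that] n(2) by blast
    then show "a \<in> core R n" using a by (simp add: core_def)
  qed
  ultimately show False using core_mono_eq[OF dcc m nm] core_mono_eq[OF dcc m' nm] ne by simp
qed

text \<open>Finitely many cores already have their intersection inside all the others. A further one
  would contain that intersection and at the same time be comaximal with it.\<close>

lemma finite_cores:
  assumes dcc: "dcc R (regular_module R)"
  shows "finite (core R ` {m. maxl R m})"
proof -
  have reg: "left_module R (regular_module R)" by (rule left_module_regular[OF ring_axioms])
  let ?S = "core R ` {m. maxl R m}"
  have sub: "submodule i R (regular_module R)" if "i \<in> ?S" for i
    using that core_ideal(1)[OF maxlD(1)] by auto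
  have "\<exists>F. finite F \<and> F \<subseteq> ?S \<and>
      (\<forall>x\<in>carrier (regular_module R). (\<forall>i\<in>F. x \<in> i) \<longrightarrow> (\<forall>i\<in>?S. x \<in> i))"
    by (rule dcc_finite_Inter[where N = "\<lambda>i. i", OF dcc reg]) (rule sub)
  then obtain F where F: "finite F" "F \<subseteq> ?S"
    "\<forall>x\<in>carrier (regular_module R). (\<forall>i\<in>F. x \<in> i) \<longrightarrow> (\<forall>i\<in>?S. x \<in> i)" by (elim exE conjE)
  have "?S \<subseteq> F"
  proof (rule subsetI, rule ccontr)
    fix P assume P: "P \<in> ?S" "P \<notin> F"
    obtain m where m: "maxl R m" "P = core R m" using P(1) by blast
    note Pl = left_idealD[OF sub[OF P(1)]]
    \<comment> \<open>As in the Chinese remainder theorem, the witness is a product of elements that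
      lie in one core each and are one modulo \<open>P\<close>.\<close>
    have "\<exists>t\<in>carrier R. (\<forall>i\<in>F'. t \<in> i) \<and> \<one> \<ominus> t \<in> P" if "finite F'" "F' \<subseteq> F" for F'
      using that
    proof (induction F')
      case empty
      have "\<one> \<ominus> \<one> \<in> P" using Pl(5) by (simp add: a_minus_def r_neg)
      then show ?case by (intro bexI[of _ \<one>] conjI) simp_all
    next
      case (insert i F')
      have sub': "F' \<subseteq> F" "i \<in> F" using insert.prems by simp_all
      from insert.IH[OF sub'(1)] obtain t where t: "t \<in> carrier R" "\<forall>j\<in>F'. t \<in> j" "\<one> \<ominus> t \<in> P"
        by (elim bexE conjE)
      have "i \<in> ?S" using sub'(2) F(2) by blast
      then obtain m' where m': "maxl R m'" "i = core R m'" by blast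
      have "i \<noteq> P" using sub'(2) P(2) by blast
      then have "core R m' \<noteq> core R m" using m m' by simp
      from core_comaximal[OF dcc m'(1) m(1) this] obtain q p where qp: "q \<in> i" "p \<in> P" "\<one> = q \<oplus> p"
        using m m' by blast
      have qk: "q \<in> carrier R" "p \<in> carrier R"
        using left_idealD(1)[OF sub[OF \<open>i \<in> ?S\<close>] qp(1)] Pl(1)[OF qp(2)] by simp_all
      have "t \<otimes> q \<in> j" if j: "j \<in> insert i F'" for j
      proof (cases "j = i")
        case True
        then show ?thesis using left_idealD(4)[OF sub[OF \<open>i \<in> ?S\<close>] t(1) qp(1)] by simp
      next
        case False
        then have jF: "j \<in> F'" using j by simp
        then have "j \<in> ?S" using sub'(1) F(2) by blast
        then obtain n where n: "maxl R n" "j = core R n" by blast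
        show ?thesis using core_ideal(2)[OF maxlD(1)[OF n(1)], of t q] t(2)[THEN bspec, OF jF] qk(1) n(2) by simp
      qed
      moreover have "\<one> \<ominus> t \<otimes> q \<in> P"
      proof -
        have "\<one> \<ominus> t \<oplus> t \<otimes> p \<in> P" by (intro Pl(2) Pl(4) t qp(2))
        moreover have "\<one> \<ominus> t \<oplus> t \<otimes> p \<oplus> t \<otimes> q = \<one>"
        proof -
          have "t \<otimes> p \<oplus> t \<otimes> q = t"
            using qp(3) t(1) qk by (metis r_distr a_comm r_one)
          then show ?thesis using t(1) qk by (simp add: a_assoc diff_add)
        qed
        then have "\<one> \<ominus> t \<oplus> t \<otimes> p = \<one> \<ominus> t \<otimes> q"
          using add_eq_iff_diff[of "\<one> \<ominus> t \<oplus> t \<otimes> p" "t \<otimes> q" \<one>] t(1) qk by simp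
        ultimately show ?thesis by simp
      qed
      ultimately show ?case using t(1) qk by (intro bexI[of _ "t \<otimes> q"] conjI ballI) simp_all
    qed
    from this[OF F(1) subset_refl] obtain t where t: "t \<in> carrier R" "\<forall>i\<in>F. t \<in> i" "\<one> \<ominus> t \<in> P"
      by (elim bexE conjE)
    have "t \<in> carrier (regular_module R)" using t(1) by simp
    from F(3)[THEN bspec, THEN mp, OF this t(2)] P(1) have "t \<in> P" by blast
    then have "\<one> \<ominus> t \<oplus> t \<in> P" using t(3) by (intro Pl(2))
    then have "\<one> \<in> P" using t(1) by (simp add: diff_add)
    then have "\<one> \<in> m" using core_sub[OF ring_axioms, of \<one> m] m(2) by simp
    then show False using maxlD(2)[OF m(1)] by simp
  qed
  then show ?thesis using F(1) by (rule finite_subset)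
qed

end

section \<open>Finiteness of modules over an Artin algebra\<close>

locale artin_alg = artin_dual k J + k_algebra k A
  for k :: "('k, 'x) ring_scheme" and J :: "('k, 'j) module" and A :: "('k, 'r) module" (structure) +
  assumes fin_gen_A: "fin_gen k A"
begin

lemma reg_A: "left_module A reg"
  by (rule left_module_regular[OF ring_A])

text \<open>The scalar action stored in the record of A and the one through multiples of the unit
  agree by \<open>scal_mult\<close>; finite generation is moved from the first to the
  second.\<close>

lemma fg_restrict_A: "fin_gen k (res reg)"
proof -
  obtain B where B: "finite B" "generates k A B" using fin_gen_A unfolding fin_gen_iff by (elim exE conjE)
  have "generates k (res reg) B"
  proof (rule generatesI)
    show "B \<subseteq> carrier (res reg)" using generates_subset[OF B(2)] by simp
    fix N x assume N: "submodule N k (res reg)" "B \<subseteq> N"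
      "x \<in> carrier (res reg)"
    note Nf = submodule_facts[OF N(1)]
    have "submodule N k A"
    proof (rule kA.submoduleI)
      show "N \<subseteq> carrier A" using submodule_subset[OF N(1)] by simp
      show "\<zero> \<in> N" using Nf(2) by simp
      show "a \<oplus> b \<in> N" if "a \<in> N" "b \<in> N" for a b using Nf(3)[OF that] by simp
      show sm: "c \<odot> a \<in> N" if "c \<in> carrier k" "a \<in> N" for c a
        using Nf(5)[OF that] Nf(1)[OF that(2)] that(1) by (simp add: scal_mult)
      show "\<ominus> a \<in> N" if a: "a \<in> N" for a
        using sm[of "\<ominus>\<^bsub>k\<^esub> \<one>\<^bsub>k\<^esub>" a] Nf(1)[OF a] a by (simp add: kA.smult_l_minus)
    qed
    then have "N = carrier A" by (rule generatesD[OF B(2) _ N(2)])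
    then show "x \<in> N" using N(3) by simp
  qed
  then show ?thesis using B(1) unfolding fin_gen_iff by (intro exI[of _ B] conjI)
qed

lemma fg_restrict:
  assumes "fg_module A M"
  shows "fg_module k (res M)"
proof -
  note lM = fg_left_module[OF assms] and lk = restrict_left[OF fg_left_module[OF assms]]
  interpret M: left_module A M by (rule lM)
  have "fin_gen A M" using assms by (simp add: fg_module_def)
  then obtain X where X: "finite X" "generates A M X" unfolding fin_gen_iff by (elim exE conjE)
  obtain B where B: "finite B" "generates k (res reg) B"
    using fg_restrict_A unfolding fin_gen_iff by (elim exE conjE)
  let ?G = "(\<lambda>(b, x). b \<odot>\<^bsub>M\<^esub> x) ` (B \<times> X)"
  have BA: "b \<in> carrier A" if "b \<in> B" for b using generates_subset[OF B(2)] that by auto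
  have XM: "x \<in> carrier M" if "x \<in> X" for x using generates_subset[OF X(2)] that by auto
  have "generates k (res M) ?G"
  proof (rule generatesI)
    show "?G \<subseteq> carrier (res M)" using BA XM by auto
    fix N y assume N: "submodule N k (res M)" "?G \<subseteq> N" "y \<in> carrier (res M)"
    note Nf = submodule_facts[OF N(1)]
    \<comment> \<open>The largest A-submodule contained in the k-submodule \<open>N\<close>; it
      contains the generators \<open>X\<close> and is therefore everything.\<close>
    let ?N = "{x \<in> carrier M. \<forall>a\<in>carrier A. a \<odot>\<^bsub>M\<^esub> x \<in> N}"
    have "submodule ?N A M"
    proof (rule M.submoduleI)
      show "\<zero>\<^bsub>M\<^esub> \<in> ?N" using Nf(2) by simp
      show "x \<oplus>\<^bsub>M\<^esub> y \<in> ?N" if "x \<in> ?N" "y \<in> ?N" for x y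
        using that Nf(3) by (simp add: M.smult_r_distr)
      show "a \<odot>\<^bsub>M\<^esub> x \<in> ?N" if "a \<in> carrier A" "x \<in> ?N" for a x
        using that by (simp flip: M.smult_assoc1)
    qed blast
    moreover have "X \<subseteq> ?N"
    proof
      fix x assume x: "x \<in> X"
      have h: "(\<lambda>a. a \<odot>\<^bsub>M\<^esub> x) \<in> module_hom k (res reg) (res M)"
        by (rule hom_restrict_scalars[OF smult_right_hom[OF lM XM[OF x]]])
      have "{a \<in> carrier (res reg). a \<odot>\<^bsub>M\<^esub> x \<in> N} =
          carrier (res reg)"
        by (rule generatesD[OF B(2) hom_vimage_submodule[OF restrict_left[OF reg_A] lk h N(1)]])
          (use BA x N(2) in auto)
      then have "\<forall>a\<in>carrier A. a \<odot>\<^bsub>M\<^esub> x \<in> N" by auto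
      then show "x \<in> ?N" using XM[OF x] by simp
    qed
    ultimately have "?N = carrier M" by (rule generatesD[OF X(2)])
    then have "y \<in> ?N" using N(3) by simp
    then have "\<one> \<odot>\<^bsub>M\<^esub> y \<in> N" using A.one_closed by blast
    then show "y \<in> N" using N(3) by simp
  qed
  moreover have "finite ?G" using X(1) B(1) by simp
  ultimately show ?thesis using lk unfolding fg_module_def fin_gen_iff by blast
qed

lemma fg_from_restrict:
  assumes "left_module A M" "fg_module k (res M)"
  shows "fg_module A M"
proof -
  have "fin_gen k (res M)" using assms(2) by (simp add: fg_module_def)
  then obtain X where X: "finite X" "generates k (res M) X"
    unfolding fin_gen_iff by (elim exE conjE)
  have "generates A M X"
  proof (rule generatesI)
    show "X \<subseteq> carrier M" using generates_subset[OF X(2)] by simp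
    fix N x assume N: "submodule N A M" "X \<subseteq> N" "x \<in> carrier M"
    have "N = carrier (res M)"
      by (rule generatesD[OF X(2) submodule_restrict_scalars[OF assms(1) N(1)] N(2)])
    then show "x \<in> N" using N(3) by simp
  qed
  then show ?thesis using X(1) assms(1) unfolding fg_module_def fin_gen_iff by blast
qed

lemma restrict_carrier_update: "res (M\<lparr>carrier := N\<rparr>) = (res M)\<lparr>carrier := N\<rparr>"
  by (simp add: restrict_scalars_def mk_module_def)

lemma dcc_A:
  assumes "fg_module A M"
  shows "dcc A M"
  unfolding dcc_def
proof (intro allI impI)
  fix I :: "nat \<Rightarrow> _ set" assume I: "\<forall>n. submodule (I n) A M \<and> I (Suc n) \<subseteq> I n"
  note lM = fg_left_module[OF assms]
  have "\<forall>n. submodule (I n) k (res M) \<and> I (Suc n) \<subseteq> I n"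
  proof (intro allI conjI)
    fix n
    show "submodule (I n) k (res M)"
      by (rule submodule_restrict_scalars[OF lM conjunct1[OF I[THEN spec]]])
    show "I (Suc n) \<subseteq> I n" by (rule conjunct2[OF I[THEN spec]])
  qed
  then show "\<exists>n. \<forall>m\<ge>n. I m = I n"
    by (rule dcc_fg[OF dcc_k fg_restrict[OF assms], unfolded dcc_def, THEN spec, THEN mp])
qed

lemma fg_regular_A: "fg_module A reg"
  using reg_A fin_gen_regular[OF ring_A] by (simp add: fg_module_def)

lemma dcc_regular_A: "dcc A reg"
  by (rule dcc_A[OF fg_regular_A])

lemma fg_submodule_A:
  assumes "fg_module A M" "submodule N A M"
  shows "fg_module A (M\<lparr>carrier := N\<rparr>)"
proof (rule fg_from_restrict)
  note lM = fg_left_module[OF assms(1)]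
  show "left_module A (M\<lparr>carrier := N\<rparr>)" by (rule left_module_submodule[OF lM assms(2)])
  show "fg_module k (res (M\<lparr>carrier := N\<rparr>))"
    unfolding restrict_carrier_update
    by (rule fg_submodule[OF k.is_cring dcc_k fg_restrict[OF assms(1)] submodule_restrict_scalars[OF lM assms(2)]])
qed

text \<open>The kernels of the powers of \<open>h\<close> become stationary at some
  \<open>n\<close>. Writing \<open>x\<close> as the image of \<open>y\<close> under the
  \<open>n\<close>-th power, \<open>y\<close> lies in the next kernel and hence in the
  \<open>n\<close>-th one.\<close>

lemma surj_endo_inj:
  assumes M: "fg_module A M" and h: "h \<in> module_hom A M M" "h ` carrier M = carrier M"
    and x: "x \<in> carrier M" "h x = \<zero>\<^bsub>M\<^esub>"
  shows "x = \<zero>\<^bsub>M\<^esub>"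
proof -
  note lM = fg_left_module[OF M]
  interpret M: left_module A M by (rule lM)
  have hn: "h ^^ n \<in> module_hom A M M" for n
    by (induction n) (use hom_ident hom_compose[OF _ h(1)] in \<open>auto simp: o_def id_def\<close>)
  let ?I = "\<lambda>n. ker_set M (h ^^ n) M"
  have sub: "submodule (?I n) k (res M)" for n
    by (rule submodule_restrict_scalars[OF lM ker_set_submodule[OF lM lM hn]])
  have mono: "?I n \<subseteq> ?I (Suc n)" for n
    using hom_zero[OF lM lM h(1)] by (auto simp: ker_set_def)
  have "\<exists>n. \<forall>m. ?I m \<subseteq> ?I n"
    by (rule acc_submodules[where I = ?I, OF k.is_cring dcc_k fg_restrict[OF M] sub mono])
  then obtain n where n: "\<forall>m. ?I m \<subseteq> ?I n" by (rule exE)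
  have surj: "\<exists>y\<in>carrier M. (h ^^ m) y = z" if "z \<in> carrier M" for m z
    using that
  proof (induction m arbitrary: z)
    case 0
    then show ?case by (intro bexI[of _ z]) simp_all
  next
    case (Suc m)
    have "z \<in> h ` carrier M" using Suc.prems h(2) by simp
    then obtain w where w: "w \<in> carrier M" "z = h w" by (rule imageE)
    from Suc.IH[OF w(1)] obtain y where y: "y \<in> carrier M" "(h ^^ m) y = w" by (elim bexE)
    then show ?case using w(2) by (intro bexI[of _ y]) simp_all
  qed
  from surj[OF x(1), of n] obtain y where y: "y \<in> carrier M" "(h ^^ n) y = x" by (elim bexE)
  have "y \<in> ?I (Suc n)" using y x(2) by (simp add: ker_set_def)
  then have "y \<in> ?I n" using n[THEN spec, of "Suc n"] by (rule rev_subsetD)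
  then show ?thesis using y(2) by (simp add: ker_set_def)
qed

end

section \<open>Annihilators and simple modules of a self-injective algebra\<close>

locale self_inj_alg = artin_alg +
  assumes self_inj: "self_injective A"
begin

lemma injective_reg: "injective A reg"
  using self_inj by (simp add: self_injective_def)

lemma extend_hom:
  assumes "fg_module A M" "fg_module A N" "g \<in> module_hom A M N" "inj_on g (carrier M)"
    "f \<in> module_hom A M reg"
  shows "\<exists>h\<in>module_hom A N reg. \<forall>x\<in>carrier M. h (g x) = f x"
  by (rule injective_extend[OF injective_reg assms])

lemma extend_cyclic:
  assumes M: "fg_module A M" and x: "x \<in> carrier M" and z: "z \<in> carrier A"
    and le: "\<And>r. r \<in> carrier A \<Longrightarrow> r \<odot>\<^bsub>M\<^esub> x = \<zero>\<^bsub>M\<^esub> \<Longrightarrow> r \<otimes> z = \<zero>"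
  shows "\<exists>f\<in>module_hom A M reg. f x = z"
proof -
  note lM = fg_left_module[OF M]
  have zr: "z \<in> carrier reg" using z by simp
  have "\<exists>h\<in>module_hom A (M\<lparr>carrier := cyclic A M x\<rparr>) reg. h x = z"
    by (rule cyclic_hom[OF lM x reg_A zr]) (simp add: le)
  then obtain h where h: "h \<in> module_hom A (M\<lparr>carrier := cyclic A M x\<rparr>) reg" "h x = z"
    by (elim bexE)
  note c = submodule_cyclic[OF lM x]
  from extend_hom[OF fg_cyclic[OF lM x] M hom_restrict_dom[OF submodule_subset[OF c(1)] hom_ident] inj_on_id2 h(1)]
  obtain f where f: "f \<in> module_hom A M reg"
    "\<forall>y\<in>carrier (M\<lparr>carrier := cyclic A M x\<rparr>). f y = h y" by (elim bexE)
  have "f x = z" using f(2)[THEN bspec, of x] c(2) h(2) by simp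
  then show ?thesis using f(1) by (intro bexI[of _ f])
qed

text \<open>The assignment of \<open>b\<close> to \<open>a\<close> extends to an endomorphism of the
  left module A, and such an endomorphism is right multiplication by its value at one.\<close>

lemma lann_le_right_multiple:
  assumes "a \<in> carrier A" "b \<in> carrier A" "\<And>r. r \<in> carrier A \<Longrightarrow> r \<otimes> a = \<zero> \<Longrightarrow> r \<otimes> b = \<zero>"
  shows "\<exists>c\<in>carrier A. b = a \<otimes> c"
proof -
  have "\<exists>f\<in>module_hom A reg reg. f a = b"
    by (rule extend_cyclic[OF fg_regular_A]) (use assms in simp_all)
  then obtain f where f: "f \<in> module_hom A reg reg" "f a = b" by (elim bexE)
  have "f a = a \<otimes> f \<one>" using hom_smult[OF f(1), of a "\<one>"] assms(1) by simp
  moreover have "f \<one> \<in> carrier A" using hom_closed[OF f(1), of "\<one>"] by simp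
  ultimately show ?thesis using f(2) by (intro bexI[of _ "f \<one>"]) simp_all
qed

text \<open>If nothing nonzero kills \<open>Q\<close> from the left, then finitely many elements of
  \<open>Q\<close> embed A into a power of A. The embedding splits since A is injective, and
  applying the splitting to the image of one expresses one as a sum of right multiples of elements
  of \<open>Q\<close>.\<close>

lemma right_ideal_left_annihilator:
  assumes sub: "Q \<subseteq> carrier A" and zero: "\<zero> \<in> Q"
    and add: "\<And>x y. x \<in> Q \<Longrightarrow> y \<in> Q \<Longrightarrow> x \<oplus> y \<in> Q"
    and mult: "\<And>x r. x \<in> Q \<Longrightarrow> r \<in> carrier A \<Longrightarrow> x \<otimes> r \<in> Q" and one: "\<one> \<notin> Q"
  shows "\<exists>x\<in>carrier A. x \<noteq> \<zero> \<and> (\<forall>q\<in>Q. x \<otimes> q = \<zero>)"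
proof (rule ccontr)
  assume neg: "\<not> ?thesis"
  have subm: "submodule (lann A reg q) A reg" if "q \<in> Q" for q
    by (rule submodule_lann[OF reg_A]) (use that sub in auto)
  have "\<exists>F. finite F \<and> F \<subseteq> Q \<and> (\<forall>x\<in>carrier reg.
      (\<forall>i\<in>F. x \<in> lann A reg i) \<longrightarrow> (\<forall>i\<in>Q. x \<in> lann A reg i))"
    by (rule dcc_finite_Inter[where N = "lann A reg", OF dcc_regular_A reg_A]) (rule subm)
  then obtain F where F: "finite F" "F \<subseteq> Q" "\<forall>x\<in>carrier reg.
      (\<forall>i\<in>F. x \<in> lann A reg i) \<longrightarrow> (\<forall>i\<in>Q. x \<in> lann A reg i)"
    by (elim exE conjE)
  let ?P = "pow_module F reg"
  have lP: "left_module A ?P" by (rule left_module_pow[OF reg_A])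
  have Fr: "q \<in> carrier reg" if "q \<in> F" for q using that F(2) sub by auto
  let ?g = "\<lambda>r. \<lambda>q\<in>F. r \<odot>\<^bsub>reg\<^esub> q"
  have g: "?g \<in> module_hom A reg ?P"
    by (rule hom_pow[of F "\<lambda>q r. r \<odot>\<^bsub>reg\<^esub> q", OF smult_right_hom[OF reg_A Fr] reg_A])
  have "inj_on ?g (carrier reg)"
    unfolding hom_inj_iff[OF reg_A lP g]
  proof (intro ballI impI)
    fix r assume r: "r \<in> carrier reg" "?g r = \<zero>\<^bsub>?P\<^esub>"
    have "\<forall>i\<in>F. r \<in> lann A reg i"
    proof
      fix i assume "i \<in> F"
      then show "r \<in> lann A reg i" using fun_cong[OF r(2), of i] r(1) by (simp add: lann_iff)
    qed
    from F(3)[THEN bspec, THEN mp, OF r(1) this] have "\<forall>q\<in>Q. r \<otimes> q = \<zero>" by (simp add: lann_iff)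
    then show "r = \<zero>\<^bsub>reg\<^esub>" using neg r(1) by auto
  qed
  from extend_hom[OF fg_regular_A fg_free[OF ring_A F(1)] g this hom_ident]
  obtain h where h: "h \<in> module_hom A ?P reg" "\<forall>x\<in>carrier reg. h (?g x) = x"
    by (elim bexE)
  have one': "\<one> \<in> carrier reg" by simp
  let ?u = "\<lambda>q. unit_vec F reg q"
  have uh: "?u q \<in> module_hom A reg ?P" for q by (rule unit_vec_hom[OF reg_A])
  have g1: "?g \<one> \<in> F \<rightarrow>\<^sub>E carrier reg" using hom_closed[OF g one'] by simp
  have gq: "?g \<one> q = q" if "q \<in> F" for q using that Fr[OF that] by simp
  have uF: "(\<lambda>q. ?u q (?g \<one> q)) \<in> F \<rightarrow> carrier ?P"
  proof
    fix q assume q: "q \<in> F"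
    show "?u q (?g \<one> q) \<in> carrier ?P" unfolding gq[OF q] by (rule hom_closed[OF uh Fr[OF q]])
  qed
  have "\<one> = h (?g \<one>)" using h(2)[THEN bspec, OF one'] by simp
  also have "?g \<one> = (\<Oplus>\<^bsub>?P\<^esub>q\<in>F. ?u q (?g \<one> q))"
    by (rule pow_sum_unit_vec[OF reg_A F(1) g1, symmetric])
  also have "h \<dots> = (\<Oplus>\<^bsub>reg\<^esub>q\<in>F. h (?u q (?g \<one> q)))"
    by (rule hom_finsum[OF lP reg_A h(1) uF])
  finally have one_sum: "\<one> = (\<Oplus>\<^bsub>reg\<^esub>q\<in>F. h (?u q (?g \<one> q)))" .
  interpret reg: left_module A reg by (rule reg_A)
  have sumQ: "finsum reg f S \<in> Q" if "finite S" "S \<subseteq> F" "\<forall>q\<in>S. f q \<in> Q" for f S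
    using that
  proof (induction S)
    case empty
    then show ?case using zero by simp
  next
    case (insert s S)
    have "f \<in> insert s S \<rightarrow> carrier reg" using insert.prems sub by auto
    then have "finsum reg f (insert s S) = f s \<oplus> finsum reg f S"
      using insert.hyps by (simp add: reg.M.finsum_insert Pi_iff)
    then show ?case using insert add by simp
  qed
  have "\<forall>q\<in>F. h (?u q (?g \<one> q)) \<in> Q"
  proof
    fix q assume q: "q \<in> F"
    have qA: "q \<in> carrier A" using Fr[OF q] by simp
    have "?u q q = ?u q (q \<odot>\<^bsub>reg\<^esub> \<one>)" using qA by simp
    also have "\<dots> = q \<odot>\<^bsub>?P\<^esub> ?u q \<one>" by (rule hom_smult[OF uh qA one'])
    finally have "h (?u q q) = q \<odot>\<^bsub>reg\<^esub> h (?u q \<one>)"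
      using hom_smult[OF h(1) qA hom_closed[OF uh one']] by simp
    moreover have "h (?u q \<one>) \<in> carrier A" using hom_closed[OF h(1) hom_closed[OF uh one']] by simp
    ultimately have "h (?u q q) \<in> Q" using mult[of q "h (?u q \<one>)"] F(2) q by auto
    then show "h (?u q (?g \<one> q)) \<in> Q" unfolding gq[OF q] .
  qed
  from sumQ[OF F(1) subset_refl this] show False using one_sum one by simp
qed

text \<open>Send a primitive ideal \<open>Q\<close> to the annihilator of a simple left ideal inside the left
  annihilator of \<open>Q\<close>. By injectivity of \<open>A\<close> this self-map of the finite set of primitive ideals is
  injective, hence onto, so every simple left module embeds into \<open>A\<close>.\<close>

lemma left_ideal_right_annihilator:
  assumes "submodule B A reg" "\<one> \<notin> B"
  shows "\<exists>z\<in>carrier A. z \<noteq> \<zero> \<and> (\<forall>b\<in>B. b \<otimes> z = \<zero>)"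
proof -
  interpret reg: left_module A reg by (rule reg_A)
  let ?S = "core A ` {m. maxl A m}"
  let ?l = "lann A reg"
  have ex: "\<exists>x. x \<in> carrier A \<and> x \<noteq> \<zero> \<and> (\<forall>q\<in>Q. x \<otimes> q = \<zero>) \<and> maxl A (?l x)" if Q: "Q \<in> ?S" for Q
  proof -
    obtain m where m: "maxl A m" "Q = core A m" using Q by blast
    note c = A.core_ideal[OF maxlD(1)[OF m(1)]] and cl = A.left_idealD[OF A.core_ideal(1)[OF maxlD(1)[OF m(1)]]]
    have one: "\<one> \<notin> core A m" using core_sub[OF ring_A, of "\<one>" m] maxlD(2)[OF m(1)] by blast
    have cA: "core A m \<subseteq> carrier A" using cl(1) by blast
    have "\<exists>x\<in>carrier A. x \<noteq> \<zero> \<and> (\<forall>q\<in>core A m. x \<otimes> q = \<zero>)"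
      by (rule right_ideal_left_annihilator[OF cA cl(5) cl(2) c(2) one])
    then obtain y where y: "y \<in> carrier A" "y \<noteq> \<zero>" "\<forall>q\<in>core A m. y \<otimes> q = \<zero>" by (elim bexE conjE)
    have yr: "y \<in> carrier reg" using y(1) by simp
    \<comment> \<open>A minimal nonzero left ideal inside the one generated by \<open>y\<close> is
      simple; all its elements are left multiples of \<open>y\<close> and so still vanish on
      \<open>Q\<close> from the left.\<close>
    let ?T = "{L. submodule L A reg \<and> L \<subseteq> cyclic A reg y \<and> L \<noteq> {\<zero>}}"
    note cy = submodule_cyclic[OF reg_A yr]
    have "cyclic A reg y \<in> ?T" using cy y(2) by blast
    then have "?T \<noteq> {}" by blast
    then have "\<exists>L\<in>?T. \<forall>L'\<in>?T. L' \<subseteq> L \<longrightarrow> L' = L"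
      by (rule dcc_minimal[OF dcc_regular_A]) simp
    then obtain L where L0: "L \<in> ?T" "\<forall>L'\<in>?T. L' \<subseteq> L \<longrightarrow> L' = L" by (elim bexE)
    have L: "submodule L A reg" "L \<subseteq> cyclic A reg y" "L \<noteq> {\<zero>}"
      using L0(1) by simp_all
    have "\<zero> \<in> L" using submodule_zero_mem[OF L(1)] by simp
    then obtain x where x: "x \<in> L" "x \<noteq> \<zero>" using L(3) by blast
    have xA: "x \<in> carrier A" using submodule_mem[OF L(1) x(1)] by simp
    have xr: "x \<in> carrier reg" using xA by simp
    obtain r where r: "r \<in> carrier A" "x = r \<otimes> y" using subsetD[OF L(2) x(1)] unfolding cyclic_def by auto
    have xq: "\<forall>q\<in>Q. x \<otimes> q = \<zero>"
    proof
      fix q assume q: "q \<in> Q"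
      then have "q \<in> carrier A" using cl(1) m(2) by simp
      then have "x \<otimes> q = r \<otimes> (y \<otimes> q)" using r y(1) by (simp add: A.m_assoc)
      then show "x \<otimes> q = \<zero>" using y(3) q m(2) r(1) by simp
    qed
    \<comment> \<open>Every nonzero multiple \<open>c x\<close> generates the simple left ideal
      again, so \<open>x = d c x\<close> for some \<open>d\<close>, and this \<open>d\<close> is the
      required inverse.\<close>
    have "maxl A (?l x)"
      unfolding maxl_def
    proof (intro conjI ballI impI)
      show "submodule (?l x) A reg" by (rule submodule_lann[OF reg_A xr])
      show "\<one> \<notin> ?l x" using x(2) xA by (simp add: lann_iff)
      fix c assume c: "c \<in> carrier A" "c \<notin> ?l x"
      let ?cx = "c \<otimes> x"
      have cx: "?cx \<in> carrier reg" "?cx \<noteq> \<zero>" "?cx \<in> L"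
        using c xA submodule_smult[OF L(1) c(1) x(1)] by (simp_all add: lann_iff)
      note cc = submodule_cyclic[OF reg_A cx(1)]
      have sub: "cyclic A reg ?cx \<subseteq> L" by (rule cyclic_subset[OF L(1) cx(3)])
      have "cyclic A reg ?cx \<in> ?T" using cc cx(2) sub L(2) by blast
      from L0(2)[THEN bspec, THEN mp, OF this sub] have "x \<in> cyclic A reg ?cx" using x(1) by simp
      then obtain d where d: "d \<in> carrier A" "x = d \<otimes> ?cx" unfolding cyclic_def by auto
      have "(\<one> \<ominus> d \<otimes> c) \<otimes> x = x \<ominus> d \<otimes> ?cx"
        using d(1) c(1) xA by (simp add: a_minus_def A.l_distr A.l_minus A.m_assoc)
      also have "\<dots> = x \<ominus> x" using d(2) by simp
      also have "\<dots> = \<zero>" using xA by (simp add: a_minus_def A.r_neg)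
      finally have "\<one> \<ominus> d \<otimes> c \<in> ?l x" using d(1) c(1) by (simp add: lann_iff)
      then show "\<exists>d\<in>carrier A. \<one> \<ominus> d \<otimes> c \<in> ?l x" using d(1) by (intro bexI[of _ d])
    qed
    then show ?thesis using xA x(2) xq by (intro exI[of _ x] conjI)
  qed
  have "\<exists>X. \<forall>Q\<in>?S. X Q \<in> carrier A \<and> X Q \<noteq> \<zero> \<and> (\<forall>q\<in>Q. X Q \<otimes> q = \<zero>) \<and> maxl A (?l (X Q))"
    by (rule bchoice) (rule ballI, rule ex)
  then obtain X where X: "\<forall>Q\<in>?S. X Q \<in> carrier A \<and> X Q \<noteq> \<zero> \<and> (\<forall>q\<in>Q. X Q \<otimes> q = \<zero>) \<and> maxl A (?l (X Q))"
    by (rule exE)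
  let ?s = "\<lambda>Q. core A (?l (X Q))"
  have core_kill: "a \<otimes> x = \<zero>" if "a \<in> core A (?l x)" for a x
    using core_sub[OF ring_A that] by (simp add: lann_iff)
  have "inj_on ?s ?S"
  proof (rule inj_onI, rule ccontr)
    fix Q Q' assume Q: "Q \<in> ?S" "Q' \<in> ?S" "?s Q = ?s Q'" "Q \<noteq> Q'"
    let ?x = "X Q" and ?y = "X Q'"
    have x: "?x \<in> carrier A" "?x \<noteq> \<zero>" "\<forall>q\<in>Q. ?x \<otimes> q = \<zero>" "maxl A (?l ?x)" using X[THEN bspec, OF Q(1)] by simp_all
    have y: "?y \<in> carrier A" "?y \<noteq> \<zero>" "\<forall>q\<in>Q'. ?y \<otimes> q = \<zero>" using X[THEN bspec, OF Q(2)] by simp_all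
    have "\<exists>u\<in>carrier A. u \<odot>\<^bsub>reg\<^esub> ?y \<noteq> \<zero>\<^bsub>reg\<^esub> \<and>
        (\<forall>c\<in>?l ?x. c \<odot>\<^bsub>reg\<^esub> (u \<odot>\<^bsub>reg\<^esub> ?y) = \<zero>\<^bsub>reg\<^esub>)"
    proof (rule A.simple_in_cyclic[OF dcc_regular_A x(4) reg_A])
      show "?y \<in> carrier reg" "?y \<noteq> \<zero>\<^bsub>reg\<^esub>" using y(1,2) by simp_all
      fix a assume "a \<in> ?s Q"
      then have "a \<in> ?s Q'" using Q(3) by simp
      then show "a \<odot>\<^bsub>reg\<^esub> ?y = \<zero>\<^bsub>reg\<^esub>" using core_kill by simp
    qed
    then obtain u where u: "u \<in> carrier A" "u \<otimes> ?y \<noteq> \<zero>" "\<forall>c\<in>?l ?x. c \<otimes> (u \<otimes> ?y) = \<zero>"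
      unfolding regular_module_simps by (elim bexE conjE)
    let ?z = "u \<otimes> ?y"
    have z: "?z \<in> carrier A" using u(1) y(1) by simp
    \<comment> \<open>Equal cores put a copy of the simple ideal of \<open>x\<close> inside the one
      of \<open>y\<close>; injectivity of A turns this embedding into right multiplication.\<close>
    have "\<exists>c\<in>carrier A. ?z = ?x \<otimes> c"
    proof (rule lann_le_right_multiple[OF x(1) z])
      fix r assume "r \<in> carrier A" "r \<otimes> ?x = \<zero>"
      then have "r \<in> ?l ?x" by (simp add: lann_iff)
      then show "r \<otimes> ?z = \<zero>" by (rule u(3)[THEN bspec])
    qed
    then obtain a where a: "a \<in> carrier A" "?z = ?x \<otimes> a" by (elim bexE)
    obtain m where m: "maxl A m" "Q = core A m" using Q(1) by blast
    obtain m' where m': "maxl A m'" "Q' = core A m'" using Q(2) by blast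
    have "core A m \<noteq> core A m'" using Q(4) m(2) m'(2) by simp
    from A.core_comaximal[OF dcc_regular_A m(1) m'(1) this] obtain p q
      where pq: "p \<in> core A m" "q \<in> core A m'" "\<one> = p \<oplus> q" by (elim bexE)
    have pA: "p \<in> carrier A" "q \<in> carrier A" using pq(1,2) by (simp_all add: core_def)
    \<comment> \<open>\<open>z\<close> is both a right multiple of \<open>x\<close> and a left
      multiple of \<open>y\<close>. The first makes \<open>p\<close> kill it, the second makes
      \<open>q\<close> kill it, and \<open>p + q = 1\<close>.\<close>
    have "a \<otimes> p \<in> Q"
      using A.left_idealD(4)[OF A.core_ideal(1)[OF maxlD(1)[OF m(1)]] a(1) pq(1)] m(2) by simp
    then have zp: "?z \<otimes> p = \<zero>" unfolding a(2) using x(1,3) a(1) pA by (simp add: A.m_assoc)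
    have "?y \<otimes> q = \<zero>" using y(3) pq(2) m'(2) by simp
    then have zq: "?z \<otimes> q = \<zero>" using u(1) y(1) pA by (simp add: A.m_assoc)
    have "?z = ?z \<otimes> (p \<oplus> q)" using z by (simp flip: pq(3))
    also have "\<dots> = \<zero>" using z pA zp zq by (simp only: A.r_distr) simp
    finally show False using u(2) by simp
  qed
  moreover have "?s ` ?S \<subseteq> ?S" using X by blast
  \<comment> \<open>An injective self-map of a finite set is onto; this is where the finiteness of
    the set of primitive ideals is needed.\<close>
  ultimately have onto: "?s ` ?S = ?S" using A.finite_cores[OF dcc_regular_A] by (intro endo_inj_surj)
  from maximal_left_ideal_exists[OF ring_A assms] obtain m where m0: "submodule m A reg" "B \<subseteq> m" "\<one> \<notin> m"
    "\<forall>c\<in>carrier A. c \<notin> m \<longrightarrow> (\<exists>d\<in>carrier A. \<one> \<ominus> d \<otimes> c \<in> m)" by (elim exE conjE)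
  have m: "maxl A m" using m0 unfolding maxl_def by (intro conjI)
  \<comment> \<open>So some simple left ideal has the same annihilator as A/m, and
    \<open>simple_in_cyclic\<close> finds a copy of A/m inside it.\<close>
  have "core A m \<in> ?s ` ?S" unfolding onto using m by blast
  then obtain Q where Q: "Q \<in> ?S" "core A m = ?s Q" by blast
  let ?x = "X Q"
  have x: "?x \<in> carrier A" "?x \<noteq> \<zero>" using X[THEN bspec, OF Q(1)] by simp_all
  have "\<exists>u\<in>carrier A. u \<odot>\<^bsub>reg\<^esub> ?x \<noteq> \<zero>\<^bsub>reg\<^esub> \<and>
      (\<forall>c\<in>m. c \<odot>\<^bsub>reg\<^esub> (u \<odot>\<^bsub>reg\<^esub> ?x) = \<zero>\<^bsub>reg\<^esub>)"
  proof (rule A.simple_in_cyclic[OF dcc_regular_A m reg_A])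
    show "?x \<in> carrier reg" "?x \<noteq> \<zero>\<^bsub>reg\<^esub>" using x by simp_all
    fix a assume "a \<in> core A m"
    then have "a \<in> ?s Q" using Q(2) by simp
    then show "a \<odot>\<^bsub>reg\<^esub> ?x = \<zero>\<^bsub>reg\<^esub>" using core_kill by simp
  qed
  then obtain u where u: "u \<in> carrier A" "u \<otimes> ?x \<noteq> \<zero>" "\<forall>c\<in>m. c \<otimes> (u \<otimes> ?x) = \<zero>"
    unfolding regular_module_simps by (elim bexE conjE)
  have "b \<otimes> (u \<otimes> ?x) = \<zero>" if "b \<in> B" for b
    by (rule u(3)[THEN bspec, OF subsetD[OF m0(2) that]])
  then show ?thesis using u(1,2) x(1) by (intro bexI[of _ "u \<otimes> ?x"] conjI ballI) simp_all
qed

text \<open>A nonzero element of A killed by the annihilator of \<open>x\<close> is a legitimate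
  image for \<open>x\<close>, and injectivity extends the map from the cyclic submodule to
  \<open>M\<close>.\<close>

lemma separating_hom:
  assumes M: "fg_module A M" and x: "x \<in> carrier M" "x \<noteq> \<zero>\<^bsub>M\<^esub>"
  shows "\<exists>f\<in>module_hom A M reg. f x \<noteq> \<zero>"
proof -
  note lM = fg_left_module[OF M]
  interpret M: left_module A M by (rule lM)
  have "\<one> \<notin> lann A M x" using x by (simp add: lann_iff)
  from left_ideal_right_annihilator[OF submodule_lann[OF lM x(1)] this] obtain z
    where z: "z \<in> carrier A" "z \<noteq> \<zero>" "\<forall>b\<in>lann A M x. b \<otimes> z = \<zero>" by (elim bexE conjE)
  have "\<exists>f\<in>module_hom A M reg. f x = z"
  proof (rule extend_cyclic[OF M x(1) z(1)])
    fix r assume "r \<in> carrier A" "r \<odot>\<^bsub>M\<^esub> x = \<zero>\<^bsub>M\<^esub>"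
    then show "r \<otimes> z = \<zero>" by (intro z(3)[THEN bspec]) (simp add: lann_iff)
  qed
  then obtain f where "f \<in> module_hom A M reg" "f x = z" by (elim bexE)
  then show ?thesis using z(2) by (intro bexI[of _ f]) simp_all
qed

text \<open>Finitely many functionals embed \<open>I\<close> into a free module by
  \<open>separating_hom\<close>. The embedding splits since \<open>I\<close> is injective, and the
  splitting turns these functionals into a dual basis.\<close>

lemma injective_imp_projective:
  assumes I: "fg_module A I" "injective A I"
  shows "projective A I"
proof -
  note lI = fg_left_module[OF I(1)]
  interpret I: left_module A I by (rule lI)
  let ?H = "module_hom A I reg"
  have sub: "submodule (ker_set I f reg) A I" if "f \<in> ?H" for f
    by (rule ker_set_submodule[OF lI reg_A that])
  have "\<exists>F. finite F \<and> F \<subseteq> ?H \<and> (\<forall>x\<in>carrier I. (\<forall>f\<in>F. x \<in> ker_set I f reg) \<longrightarrow>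
      (\<forall>f\<in>?H. x \<in> ker_set I f reg))"
    by (rule dcc_finite_Inter[where N = "\<lambda>f. ker_set I f reg", OF dcc_A[OF I(1)] lI]) (rule sub)
  then obtain F where F: "finite F" "F \<subseteq> ?H" "\<forall>x\<in>carrier I. (\<forall>f\<in>F. x \<in> ker_set I f reg) \<longrightarrow>
      (\<forall>f\<in>?H. x \<in> ker_set I f reg)" by (elim exE conjE)
  let ?P = "pow_module F reg"
  have lP: "left_module A ?P" by (rule left_module_pow[OF reg_A])
  let ?g = "\<lambda>x. \<lambda>f\<in>F. f x"
  have homF: "f \<in> ?H" if "f \<in> F" for f using that F(2) by blast
  have g: "?g \<in> module_hom A I ?P" by (rule hom_pow[of F "\<lambda>f. f", OF homF lI])
  have "inj_on ?g (carrier I)"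
    unfolding hom_inj_iff[OF lI lP g]
  proof (intro ballI impI, rule ccontr)
    fix x assume x: "x \<in> carrier I" "?g x = \<zero>\<^bsub>?P\<^esub>" "x \<noteq> \<zero>\<^bsub>I\<^esub>"
    have "\<forall>f\<in>F. x \<in> ker_set I f reg"
    proof
      fix f assume "f \<in> F"
      then show "x \<in> ker_set I f reg" using fun_cong[OF x(2), of f] x(1) by (simp add: ker_set_def)
    qed
    from F(3)[THEN bspec, THEN mp, OF x(1) this] have *: "\<forall>f\<in>?H. x \<in> ker_set I f reg" .
    from separating_hom[OF I(1) x(1,3)] obtain f where f: "f \<in> ?H" "f x \<noteq> \<zero>" by (elim bexE)
    show False using *[THEN bspec, OF f(1)] f(2) by (simp add: ker_set_def)
  qed
  from injective_extend[OF I(2,1) fg_free[OF ring_A F(1)] g this hom_ident]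
  obtain s where s: "s \<in> module_hom A ?P I" "\<forall>x\<in>carrier I. s (?g x) = x" by (elim bexE)
  have one: "\<one> \<in> carrier reg" by simp
  let ?u = "unit_vec F reg"
  have uh: "?u f \<in> module_hom A reg ?P" for f by (rule unit_vec_hom[OF reg_A])
  have "dual_basis A I F (\<lambda>f. s (?u f \<one>)) (\<lambda>f. f)"
    unfolding dual_basis_def
  proof (intro conjI ballI)
    show "finite F" by (rule F(1))
    show "(\<lambda>f. s (?u f \<one>)) \<in> F \<rightarrow> carrier I"
      by (intro funcsetI hom_closed[OF s(1)] hom_closed[OF uh one])
    show "f \<in> module_hom A I reg" if "f \<in> F" for f by (rule homF[OF that])
    fix x assume x: "x \<in> carrier I"
    have fx: "f x \<in> carrier A" if "f \<in> F" for f using hom_closed[OF homF[OF that] x] by simp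
    have gx: "?g x \<in> F \<rightarrow>\<^sub>E carrier reg" using hom_closed[OF g x] by simp
    have uF: "(\<lambda>f. ?u f (?g x f)) \<in> F \<rightarrow> carrier ?P"
      by (intro funcsetI hom_closed[OF uh]) (use fx in simp)
    have "x = s (?g x)" using s(2)[THEN bspec, OF x] by simp
    also have "?g x = (\<Oplus>\<^bsub>?P\<^esub>f\<in>F. ?u f (?g x f))" by (rule pow_sum_unit_vec[OF reg_A F(1) gx, symmetric])
    also have "s \<dots> = (\<Oplus>\<^bsub>I\<^esub>f\<in>F. s (?u f (?g x f)))" by (rule hom_finsum[OF lP lI s(1) uF])
    also have "\<dots> = (\<Oplus>\<^bsub>I\<^esub>f\<in>F. f x \<odot>\<^bsub>I\<^esub> s (?u f \<one>))"
    proof (rule I.M.finsum_cong')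
      show "(\<lambda>f. f x \<odot>\<^bsub>I\<^esub> s (?u f \<one>)) \<in> F \<rightarrow> carrier I"
        by (intro funcsetI I.smult_closed fx hom_closed[OF s(1)] hom_closed[OF uh one])
      fix f assume f: "f \<in> F"
      have "?u f (f x \<odot>\<^bsub>reg\<^esub> \<one>) = f x \<odot>\<^bsub>?P\<^esub> ?u f \<one>" by (rule hom_smult[OF uh fx[OF f] one])
      then have "s (?u f (f x)) = f x \<odot>\<^bsub>I\<^esub> s (?u f \<one>)"
        using hom_smult[OF s(1) fx[OF f] hom_closed[OF uh one]] fx[OF f] by simp
      then show "s (?u f (?g x f)) = f x \<odot>\<^bsub>I\<^esub> s (?u f \<one>)" using f by simp
    qed simp
    finally show "(\<Oplus>\<^bsub>I\<^esub>f\<in>F. f x \<odot>\<^bsub>I\<^esub> s (?u f \<one>)) = x" by (rule sym)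
  qed
  then show ?thesis by (rule dual_basis_projective[OF lI])
qed

end

section \<open>Injective envelopes and the Nakayama functor over self-injective algebras\<close>

lemma hom_finsum_fun:
  fixes N (structure)
  assumes "left_module R N" "left_module R M" "\<And>s. s \<in> S \<Longrightarrow> f s \<in> module_hom R M N" "finite S"
  shows "(\<lambda>x. \<Oplus>s\<in>S. f s x) \<in> module_hom R M N"
proof -
  interpret N: left_module R N by fact
  show ?thesis
    using assms(4,3)
  proof (induction S)
    case empty
    show ?case using hom_const_zero[OF assms(1)] by simp
  next
    case (insert s S)
    have S: "f t \<in> module_hom R M N" if "t \<in> S" for t by (rule insert.prems) (use that in simp)
    have s: "f s \<in> module_hom R M N" by (rule insert.prems) simp
    have "(\<lambda>x. f s x \<oplus> (\<Oplus>s\<in>S. f s x)) \<in> module_hom R M N"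
      by (rule hom_sum[OF assms(1) s insert.IH[OF S]])
    moreover have "f s x \<oplus> (\<Oplus>s\<in>S. f s x) = (\<Oplus>s\<in>insert s S. f s x)" if x: "x \<in> carrier M" for x
      using insert.hyps hom_closed[OF s x] hom_closed[OF S x] by (subst N.M.finsum_insert) auto
    ultimately show ?case by (rule hom_cong[OF assms(2)])
  qed
qed

context artin_alg
begin

text \<open>A substitute for decomposing \<open>I\<close>: if N is minimal with N + K = I, lifting I
  -> I/K through N gives an endomorphism \<open>h\<close> that is bijective on N. Then
  \<open>I\<close> is the direct sum of the kernel of \<open>h\<close> and N, and this kernel is a
  projective summand inside K.\<close>

lemma superfluous_no_summand:
  assumes I: "fg_module A I" "projective A I" and K: "submodule K A I"
    and sm: "\<And>X Y. submodule X A I \<Longrightarrow> submodule Y A I \<Longrightarrow> X \<subseteq> K \<Longrightarrow> X \<inter> Y = {\<zero>\<^bsub>I\<^esub>} \<Longrightarrow>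
      X <+>\<^bsub>I\<^esub> Y = carrier I \<Longrightarrow> projective A (I\<lparr>carrier := X\<rparr>) \<Longrightarrow> X = {\<zero>\<^bsub>I\<^esub>}"
  shows "superfluous A I K"
proof (rule superfluousI[OF K])
  note lI = fg_left_module[OF I(1)]
  interpret I: left_module A I by (rule lI)
  note Kf = submodule_facts[OF K]
  fix N0 x0 assume N0: "submodule N0 A I" "\<And>y. y \<in> carrier I \<Longrightarrow> \<exists>n\<in>N0. \<exists>z\<in>K. y = n \<oplus>\<^bsub>I\<^esub> z"
    and x0: "x0 \<in> carrier I"
  let ?T = "{N. submodule N A I \<and> N \<subseteq> N0 \<and> (\<forall>y\<in>carrier I. \<exists>n\<in>N. \<exists>z\<in>K. y = n \<oplus>\<^bsub>I\<^esub> z)}"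
  have "N0 \<in> ?T" using N0 by simp
  then have "?T \<noteq> {}" by blast
  then have "\<exists>N\<in>?T. \<forall>N'\<in>?T. N' \<subseteq> N \<longrightarrow> N' = N" by (rule dcc_minimal[OF dcc_A[OF I(1)]]) simp
  then obtain N where N1: "N \<in> ?T" "\<forall>N'\<in>?T. N' \<subseteq> N \<longrightarrow> N' = N" by (elim bexE)
  have N: "submodule N A I" "N \<subseteq> N0" and Nsum: "\<forall>y\<in>carrier I. \<exists>n\<in>N. \<exists>z\<in>K. y = n \<oplus>\<^bsub>I\<^esub> z"
    using N1(1) by simp_all
  note Nf = submodule_facts[OF N(1)]
  let ?N = "I\<lparr>carrier := N\<rparr>"
  have lN: "left_module A ?N" by (rule left_module_submodule[OF lI N(1)])
  have fgN: "fg_module A ?N" by (rule fg_submodule_A[OF I(1) N(1)])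
  interpret lN: left_module A ?N by (rule lN)
  let ?c = "\<lambda>x. K +>\<^bsub>I\<^esub> x"
  note ch = coset_hom[OF lI K] and cs = coset_surj[OF lI K] and lQ = left_module_quot[OF lI K]
  have fgQ: "fg_module A (quot_module I K)" by (rule fg_surj[OF I(1) lQ ch cs])
  have cN: "?c \<in> module_hom A ?N (quot_module I K)"
    by (rule hom_restrict_dom[OF submodule_subset[OF N(1)] ch])
  have cNs: "?c ` carrier ?N = carrier (quot_module I K)"
  proof
    show "?c ` carrier ?N \<subseteq> carrier (quot_module I K)" using hom_closed[OF cN] by blast
    show "carrier (quot_module I K) \<subseteq> ?c ` carrier ?N"
    proof
      fix q assume "q \<in> carrier (quot_module I K)"
      then have "q \<in> ?c ` carrier I" unfolding cs .
      then obtain y where y: "y \<in> carrier I" "q = ?c y" by (elim imageE) simp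
      from Nsum[THEN bspec, OF y(1)] obtain n z where nz: "n \<in> N" "z \<in> K" "y = n \<oplus>\<^bsub>I\<^esub> z" by (elim bexE)
      have nI: "n \<in> carrier I" "z \<in> carrier I" using Nf(1)[OF nz(1)] Kf(1)[OF nz(2)] .
      have "y \<ominus>\<^bsub>I\<^esub> n = z" using nI nz(3) I.M.add_eq_iff_diff[of z n y] by (simp add: I.M.a_comm)
      then have "?c y = ?c n" using coset_eq_iff[OF lI K y(1) nI(1)] nz(2) by simp
      then show "q \<in> ?c ` carrier ?N" using y(2) nz(1) by simp
    qed
  qed
  \<comment> \<open>\<open>h\<close> moves each element only by an element of
    \<open>K\<close>.\<close>
  obtain h where h: "h \<in> module_hom A I ?N" "\<forall>x\<in>carrier I. ?c (h x) = ?c x"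
    using projective_lift[OF I(2) fgN fgQ cN cNs ch] by (elim bexE)
  have hI: "h \<in> module_hom A I I" by (rule hom_incl[OF h(1) submodule_subset[OF N(1)]])
  have hN: "h x \<in> N" if "x \<in> carrier I" for x using hom_closed[OF h(1) that] by simp
  have xh: "x \<ominus>\<^bsub>I\<^esub> h x \<in> K" if x: "x \<in> carrier I" for x
    using coset_eq_iff[OF lI K x hom_closed[OF hI x]] h(2)[THEN bspec, OF x] by simp
  have "h ` N \<in> ?T"
  proof -
    have "submodule (h ` N) A I" by (rule hom_image_submodule[OF lI lI hI N(1)])
    moreover have "h ` N \<subseteq> N0" using hN Nf(1) N(2) by blast
    moreover have "\<exists>n\<in>h ` N. \<exists>z\<in>K. y = n \<oplus>\<^bsub>I\<^esub> z" if y: "y \<in> carrier I" for y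
    proof -
      from Nsum[THEN bspec, OF y] obtain n z where nz: "n \<in> N" "z \<in> K" "y = n \<oplus>\<^bsub>I\<^esub> z" by (elim bexE)
      have nI: "n \<in> carrier I" "z \<in> carrier I" using Nf(1)[OF nz(1)] Kf(1)[OF nz(2)] .
      have "y = h n \<oplus>\<^bsub>I\<^esub> ((n \<ominus>\<^bsub>I\<^esub> h n) \<oplus>\<^bsub>I\<^esub> z)"
        using nz(3) nI hom_closed[OF hI nI(1)] by (simp add: I.M.add_diff flip: I.M.a_assoc)
      moreover have "(n \<ominus>\<^bsub>I\<^esub> h n) \<oplus>\<^bsub>I\<^esub> z \<in> K" by (rule Kf(3)[OF xh[OF nI(1)] nz(2)])
      ultimately show ?thesis using nz(1) by blast
    qed
    ultimately show ?thesis by simp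
  qed
  moreover have "h ` N \<subseteq> N" using hN Nf(1) by blast
  \<comment> \<open>The image of \<open>N\<close> under \<open>h\<close> still supplements
    \<open>K\<close>, so minimality of \<open>N\<close> forces equality.\<close>
  ultimately have hNN: "h ` N = N" by (rule N1(2)[THEN bspec, THEN mp])
  have hNhom: "h \<in> module_hom A ?N ?N"
    by (rule hom_restrict_dom[OF submodule_subset[OF N(1)] h(1)])
  have hinj: "x = \<zero>\<^bsub>I\<^esub>" if "x \<in> N" "h x = \<zero>\<^bsub>I\<^esub>" for x
    using surj_endo_inj[OF fgN hNhom _ _, of x] that hNN by simp
  have "h \<in> module_iso A ?N ?N"
    by (rule module_isoI[OF hNhom]) (use hom_inj_iff[OF lN lN hNhom] hinj hNN in simp_all)
  from iso_inverseE[OF lN this] obtain v where v: "v \<in> module_iso A ?N ?N"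
    "\<forall>x\<in>carrier ?N. v (h x) = x" "\<forall>x\<in>carrier ?N. h (v x) = x" by (elim bexE conjE)
  let ?X = "ker_set I h I"
  have X: "submodule ?X A I" by (rule ker_set_submodule[OF lI lI hI])
  have vh: "(\<lambda>x. v (h x)) \<in> module_hom A I I"
    by (rule hom_incl[OF hom_compose[OF h(1) iso_hom[OF v(1)]] submodule_subset[OF N(1)]])
  \<comment> \<open>The projection onto the kernel of \<open>h\<close> along \<open>N\<close>, with
    \<open>v\<close> the inverse of \<open>h\<close> on \<open>N\<close>.\<close>
  let ?r = "\<lambda>x. x \<oplus>\<^bsub>I\<^esub> \<ominus>\<^bsub>I\<^esub> v (h x)"
  have r: "?r \<in> module_hom A I I" by (rule hom_sum[OF lI hom_ident hom_uminus[OF lI vh]])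
  have rX: "?r x \<in> ?X" if x: "x \<in> carrier I" for x
  proof -
    have "h (?r x) = h x \<oplus>\<^bsub>I\<^esub> h (\<ominus>\<^bsub>I\<^esub> v (h x))"
      using hom_closed[OF vh x] x by (intro hom_add[OF hI]) simp_all
    also have "h (\<ominus>\<^bsub>I\<^esub> v (h x)) = \<ominus>\<^bsub>I\<^esub> h (v (h x))" by (rule hom_minus[OF lI lI hI hom_closed[OF vh x]])
    also have "h (v (h x)) = h x" using v(3)[THEN bspec, of "h x"] hN[OF x] by simp
    finally show ?thesis using hom_closed[OF r x] hom_closed[OF hI x] by (simp add: ker_set_def I.M.r_neg)
  qed
  have "projective A (I\<lparr>carrier := ?X\<rparr>)"
  proof (rule projective_retract[OF I(2)])
    show "(\<lambda>x. x) \<in> module_hom A (I\<lparr>carrier := ?X\<rparr>) I" by (rule hom_restrict_dom[OF submodule_subset[OF X] hom_ident])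
    show "?r \<in> module_hom A I (I\<lparr>carrier := ?X\<rparr>)" by (rule hom_restrict_cod[OF r]) (use rX in blast)
    fix x assume "x \<in> carrier (I\<lparr>carrier := ?X\<rparr>)"
    then have x: "x \<in> carrier I" "h x = \<zero>\<^bsub>I\<^esub>" by (simp_all add: ker_set_def)
    have "v \<zero>\<^bsub>I\<^esub> = \<zero>\<^bsub>I\<^esub>" using hom_zero[OF lN lN iso_hom[OF v(1)]] by simp
    then show "?r x = x" using x by simp
  qed
  moreover have "?X \<subseteq> K"
  proof
    fix x assume "x \<in> ?X"
    then have x: "x \<in> carrier I" "h x = \<zero>\<^bsub>I\<^esub>" by (simp_all add: ker_set_def)
    then show "x \<in> K" using xh[OF x(1)] by (simp add: I.M.diff_zero_right)
  qed
  moreover have "?X \<inter> N = {\<zero>\<^bsub>I\<^esub>}"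
  proof
    show "?X \<inter> N \<subseteq> {\<zero>\<^bsub>I\<^esub>}" using hinj by (auto simp: ker_set_def)
    show "{\<zero>\<^bsub>I\<^esub>} \<subseteq> ?X \<inter> N" using submodule_zero_mem[OF X] Nf(2) by simp
  qed
  moreover have XN: "x \<in> ?X <+>\<^bsub>I\<^esub> N" if x: "x \<in> carrier I" for x
  proof -
    have "h x \<in> h ` N" unfolding hNN by (rule hN[OF x])
    then obtain n where n: "n \<in> N" "h x = h n" by (elim imageE) simp
    have nI: "n \<in> carrier I" by (rule Nf(1)[OF n(1)])
    have "x \<ominus>\<^bsub>I\<^esub> n \<in> ?X" using hom_diff[OF lI lI hI x nI] n(2) hom_closed[OF hI nI] x nI
      by (simp add: ker_set_def I.M.diff_zero_iff)
    moreover have "x = (x \<ominus>\<^bsub>I\<^esub> n) \<oplus>\<^bsub>I\<^esub> n" using x nI by (simp add: I.M.diff_add)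
    ultimately show ?thesis unfolding mem_set_add using n(1) by blast
  qed
  moreover have "?X <+>\<^bsub>I\<^esub> N = carrier I"
    by (rule submodule_eqI[OF I.submodule_sum[OF X N(1)] XN])
  ultimately have X0: "?X = {\<zero>\<^bsub>I\<^esub>}" by (intro sm[OF X N(1)])
  from XN[OF x0] obtain a n where an: "a \<in> ?X" "n \<in> N" "x0 = a \<oplus>\<^bsub>I\<^esub> n" unfolding mem_set_add by (elim bexE)
  have "x0 = n" using an X0 Nf(1)[OF an(2)] by simp
  then show "x0 \<in> N0" using an(2) N(2) by blast
qed

text \<open>A projective summand of \<open>I\<close> that lies in the image of \<open>e\<close>
  pulls back to a projective summand of \<open>C\<close>, hence is zero.\<close>

lemma superfluous_envelope:
  assumes I: "fg_module A I" "projective A I" and C: "left_module A C"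
    and e: "e \<in> module_hom A C I" "inj_on e (carrier C)" and nps: "no_projective_summands A C"
  shows "superfluous A I (e ` carrier C)"
proof -
  note lI = fg_left_module[OF I(1)]
  interpret I: left_module A I by (rule lI)
  interpret C: left_module A C by (rule C)
  have eC: "submodule (e ` carrier C) A I" by (rule hom_image_submodule[OF C lI e(1) C.submodule_carrier])
  show ?thesis
  proof (rule superfluous_no_summand[OF I eC])
    fix X Y assume X: "submodule X A I" and Y: "submodule Y A I" and XC: "X \<subseteq> e ` carrier C"
      and XY: "X \<inter> Y = {\<zero>\<^bsub>I\<^esub>}" "X <+>\<^bsub>I\<^esub> Y = carrier I" and prj: "projective A (I\<lparr>carrier := X\<rparr>)"
    let ?X = "{c \<in> carrier C. e c \<in> X}" and ?Y = "{c \<in> carrier C. e c \<in> Y}"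
    have X': "submodule ?X A C" and Y': "submodule ?Y A C"
      by (rule hom_vimage_submodule[OF C lI e(1) X], rule hom_vimage_submodule[OF C lI e(1) Y])
    have lX: "left_module A (I\<lparr>carrier := X\<rparr>)" by (rule left_module_submodule[OF lI X])
    have lX': "left_module A (C\<lparr>carrier := ?X\<rparr>)" by (rule left_module_submodule[OF C X'])
    have im: "e ` ?X = X" using XC by blast
    have "e \<in> module_iso A (C\<lparr>carrier := ?X\<rparr>) (I\<lparr>carrier := X\<rparr>)"
    proof (rule module_isoI)
      show "e \<in> module_hom A (C\<lparr>carrier := ?X\<rparr>) (I\<lparr>carrier := X\<rparr>)"
        by (rule hom_restrict_cod[OF hom_restrict_dom[OF submodule_subset[OF X'] e(1)]]) (use im in simp)
      show "inj_on e (carrier (C\<lparr>carrier := ?X\<rparr>))" using e(2) by (auto intro: inj_on_subset)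
      show "e ` carrier (C\<lparr>carrier := ?X\<rparr>) = carrier (I\<lparr>carrier := X\<rparr>)" using im by simp
    qed
    then have "projective A (C\<lparr>carrier := ?X\<rparr>)" by (rule projective_iso[OF prj lX iso_inverse[OF lX']])
    moreover have "?X \<inter> ?Y = {\<zero>\<^bsub>C\<^esub>}"
    proof
      show "?X \<inter> ?Y \<subseteq> {\<zero>\<^bsub>C\<^esub>}"
      proof
        fix c assume c: "c \<in> ?X \<inter> ?Y"
        then have "e c \<in> X \<inter> Y" by simp
        then have "e c = \<zero>\<^bsub>I\<^esub>" unfolding XY(1) by simp
        then show "c \<in> {\<zero>\<^bsub>C\<^esub>}" using hom_inj_iff[OF C lI e(1)] e(2) c by simp
      qed
      show "{\<zero>\<^bsub>C\<^esub>} \<subseteq> ?X \<inter> ?Y" using submodule_zero_mem[OF X'] submodule_zero_mem[OF Y'] by simp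
    qed
    \<comment> \<open>The modular law: as \<open>X\<close> lies in the image of \<open>e\<close>,
      the \<open>Y\<close>-component of an element of the image lies in it as well.\<close>
    moreover have "?X <+>\<^bsub>C\<^esub> ?Y = carrier C"
    proof (rule submodule_eqI[OF C.submodule_sum[OF X' Y']])
      fix c assume c: "c \<in> carrier C"
      have "e c \<in> X <+>\<^bsub>I\<^esub> Y" unfolding XY(2) by (rule hom_closed[OF e(1) c])
      then obtain x y where xy: "x \<in> X" "y \<in> Y" "e c = x \<oplus>\<^bsub>I\<^esub> y" unfolding mem_set_add by (elim bexE)
      obtain a where a: "a \<in> carrier C" "x = e a" using subsetD[OF XC xy(1)] by (elim imageE) simp
      have yI: "y \<in> carrier I" by (rule submodule_mem[OF Y xy(2)])
      have "y \<oplus>\<^bsub>I\<^esub> e a = e c" using xy(3) a(2) yI hom_closed[OF e(1) a(1)] by (simp add: I.M.a_comm)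
      then have "e (c \<ominus>\<^bsub>C\<^esub> a) = y"
        using hom_diff[OF C lI e(1) c a(1)] I.M.add_eq_iff_diff[of y "e a" "e c"] yI hom_closed[OF e(1) a(1)]
          hom_closed[OF e(1) c] by simp
      then have "c \<ominus>\<^bsub>C\<^esub> a \<in> ?Y" "a \<in> ?X" using xy(1,2) a c by simp_all
      moreover have "c = a \<oplus>\<^bsub>C\<^esub> (c \<ominus>\<^bsub>C\<^esub> a)" using c a(1) by (simp add: C.M.add_diff)
      ultimately show "c \<in> ?X <+>\<^bsub>C\<^esub> ?Y" unfolding mem_set_add by blast
    qed
    ultimately have "?X = {\<zero>\<^bsub>C\<^esub>}" using nps X' Y' unfolding no_projective_summands_def by blast
    then have "e ` ?X = {\<zero>\<^bsub>I\<^esub>}" using hom_zero[OF C lI e(1)] by simp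
    then show "X = {\<zero>\<^bsub>I\<^esub>}" using im by simp
  qed
qed

section \<open>Finite generation of Hom modules and duals\<close>

lemma star_eval_hom:
  assumes "x \<in> carrier M"
  shows "(\<lambda>f. f x) \<in> module_hom k (res (star A M)) (res reg)"
proof (rule module_homI)
  fix f assume "f \<in> carrier (res (star A M))"
  then have f: "f \<in> module_hom A M reg" by simp
  have fx: "f x \<in> carrier A" using hom_closed[OF f assms] by simp
  then show "f x \<in> carrier (res reg)" by simp
  show "(f \<oplus>\<^bsub>res (star A M)\<^esub> g) x = f x \<oplus>\<^bsub>res reg\<^esub> g x" for g
    using assms by simp
  show "(c \<odot>\<^bsub>res (star A M)\<^esub> f) x = c \<odot>\<^bsub>res reg\<^esub> f x"
    if "c \<in> carrier k" for c
    using assms fx that by (simp add: mult_scal scal_mult)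
qed

lemma fg_restrict_regular: "fg_module k (res reg)"
  by (rule fg_restrict[OF fg_regular_A])

text \<open>Evaluation at a finite generating set embeds the Hom module into a finite power of A
  over k.\<close>

lemma fg_star:
  assumes M: "fg_module A M"
  shows "fg_module k (res (star A M))"
proof -
  note lM = fg_left_module[OF M]
  have "fin_gen A M" using M by (simp add: fg_module_def)
  then obtain X where X: "finite X" "generates A M X" unfolding fin_gen_iff by (elim exE conjE)
  let ?V = "res (star A M)" and ?R = "res reg"
  have lV: "left_module k ?V" by (rule restrict_right[OF left_module_star[OF lM]])
  have lR: "left_module k ?R" by (rule fg_left_module[OF fg_restrict_regular])
  have XM: "x \<in> carrier M" if "x \<in> X" for x using generates_subset[OF X(2)] that by blast
  let ?g = "\<lambda>f. \<lambda>x\<in>X. f x"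
  have g: "?g \<in> module_hom k ?V (pow_module X ?R)"
    by (rule hom_pow[of X "\<lambda>x f. f x", OF star_eval_hom[OF XM] lV])
  have fgP: "fg_module k (pow_module X ?R)"
    using left_module_pow[OF lR] fin_gen_pow[OF lR X(1)] fg_restrict_regular by (simp add: fg_module_def)
  have "inj_on ?g (carrier ?V)"
    unfolding hom_inj_iff[OF lV fg_left_module[OF fgP] g]
  proof (intro ballI impI)
    fix f assume f0: "f \<in> carrier ?V" and g0: "?g f = \<zero>\<^bsub>pow_module X ?R\<^esub>"
    have f: "f \<in> module_hom A M reg" "f \<in> extensional (carrier M)" using f0 by simp_all
    have "f x = \<zero>\<^bsub>reg\<^esub>" if "x \<in> carrier M" for x
    proof (rule hom_zero_on_generators[OF lM reg_A f(1) X(2) _ that])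
      show "f a = \<zero>\<^bsub>reg\<^esub>" if "a \<in> X" for a using fun_cong[OF g0, of a] that by simp
    qed
    then show "f = \<zero>\<^bsub>?V\<^esub>" using restrict_eqI[OF f(2), of "\<lambda>x. \<zero>"] by simp
  qed
  then show ?thesis by (rule fg_embed[OF k.is_cring dcc_k fgP lV g])
qed

lemma dual_eval_hom:
  assumes "left_module (opp A) V" "v \<in> carrier V"
  shows "(\<lambda>\<phi>. \<phi> v) \<in> module_hom k (res (dual k J A V)) J"
proof (rule module_homI)
  fix \<phi> assume "\<phi> \<in> carrier (res (dual k J A V))"
  then have \<phi>: "\<phi> \<in> module_hom k (res V) J" by simp
  have v: "v \<in> carrier (res V)" using assms(2) by simp
  show "\<phi> v \<in> carrier J" by (rule hom_closed[OF \<phi> v])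
  show "(\<phi> \<oplus>\<^bsub>res (dual k J A V)\<^esub> \<psi>) v = \<phi> v \<oplus>\<^bsub>J\<^esub> \<psi> v" for \<psi> using assms(2) by simp
  show "(c \<odot>\<^bsub>res (dual k J A V)\<^esub> \<phi>) v = c \<odot>\<^bsub>J\<^esub> \<phi> v" if "c \<in> carrier k" for c
    using hom_smult[OF \<phi> that v] assms(2) by simp
qed

text \<open>Evaluation at finitely many k-generators embeds the dual into a power of J; finite
  generation over k then gives it over A.\<close>

lemma fg_dual:
  assumes lV: "left_module (opp A) V" and V: "fg_module k (res V)"
  shows "fg_module A (dual k J A V)"
proof (rule fg_from_restrict)
  show lD: "left_module A (dual k J A V)" by (rule left_module_dual[OF lV left_module_J])
  let ?D = "res (dual k J A V)"
  have lD': "left_module k ?D" by (rule restrict_left[OF lD])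
  have "fin_gen k (res V)" using V by (simp add: fg_module_def)
  then obtain X where X: "finite X" "generates k (res V) X" unfolding fin_gen_iff by (elim exE conjE)
  have XV: "x \<in> carrier V" if "x \<in> X" for x using generates_subset[OF X(2)] that by auto
  let ?g = "\<lambda>\<phi>. \<lambda>x\<in>X. \<phi> x"
  have g: "?g \<in> module_hom k ?D (pow_module X J)"
    by (rule hom_pow[of X "\<lambda>x f. f x", OF dual_eval_hom[OF lV XV] lD'])
  have fgP: "fg_module k (pow_module X J)"
    using left_module_pow[OF left_module_J] fin_gen_pow[OF left_module_J X(1)] fg_J by (simp add: fg_module_def)
  have "inj_on ?g (carrier ?D)"
    unfolding hom_inj_iff[OF lD' fg_left_module[OF fgP] g]
  proof (intro ballI impI)
    fix \<phi> assume f0: "\<phi> \<in> carrier ?D" and g0: "?g \<phi> = \<zero>\<^bsub>pow_module X J\<^esub>"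
    have f: "\<phi> \<in> module_hom k (res V) J" "\<phi> \<in> extensional (carrier V)" using f0 by simp_all
    have "\<phi> x = \<zero>\<^bsub>J\<^esub>" if "x \<in> carrier V" for x
    proof (rule hom_zero_on_generators[OF restrict_right[OF lV] left_module_J f(1) X(2)])
      show "\<phi> a = \<zero>\<^bsub>J\<^esub>" if "a \<in> X" for a using fun_cong[OF g0, of a] that by simp
      show "x \<in> carrier (res V)" using that by simp
    qed
    then show "\<phi> = \<zero>\<^bsub>?D\<^esub>" using restrict_eqI[OF f(2), of "\<lambda>x. \<zero>\<^bsub>J\<^esub>"] by simp
  qed
  then show "fg_module k ?D" by (rule fg_embed[OF k.is_cring dcc_k fgP lD' g])
qed

lemma fg_nakayama: "fg_module A M \<Longrightarrow> fg_module A (nakayama k J A M)"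
  unfolding nakayama_def
  by (rule fg_dual[OF left_module_star[OF fg_left_module] fg_star])

text \<open>A functional on the dual of \<open>P\<close> is determined by its restrictions to the right submodules
  generated by the elements of a dual basis, which turns maps into \<open>\<nu> P\<close> into families of
  functionals with values in \<open>J\<close>.\<close>

lemma injective_nakayama:
  assumes P: "fg_module A P" "projective A P"
  shows "injective A (nakayama k J A P)"
  unfolding injective_def
proof (intro allI impI, elim conjE)
  fix M N :: "('r, 'r list) module" and g f
  assume M: "fg_module A M" and N: "fg_module A N" and g: "g \<in> module_hom A M N" "inj_on g (carrier M)"
    and f: "f \<in> module_hom A M (nakayama k J A P)"
  note lP = fg_left_module[OF P(1)] and lM = fg_left_module[OF M] and lN = fg_left_module[OF N]
  interpret M: left_module A M by (rule lM)
  interpret N: left_module A N by (rule lN)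
  interpret J: left_module k J by (rule left_module_J)
  let ?V = "star A P" and ?R = "res reg"
  have lV: "left_module (opp A) ?V" by (rule left_module_star[OF lP])
  interpret V: left_module "opp A" ?V by (rule lV)
  have lVk: "left_module k (res ?V)" by (rule restrict_right[OF lV])
  have lRk: "left_module k ?R" by (rule fg_left_module[OF fg_restrict_regular])
  interpret Rk: left_module k ?R by (rule lRk)
  interpret Vk: left_module k "res ?V" by (rule lVk)
  obtain S b where db: "dual_basis A P S (\<lambda>a. a) b" by (rule projective_dual_basis[OF P])
  have S: "finite S" "\<And>a. a \<in> S \<Longrightarrow> a \<in> carrier P" "\<And>a. a \<in> S \<Longrightarrow> b a \<in> module_hom A P reg"
    "\<And>x. x \<in> carrier P \<Longrightarrow> (\<Oplus>\<^bsub>P\<^esub>a\<in>S. b a x \<odot>\<^bsub>P\<^esub> a) = x"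
    using db by (auto simp: dual_basis_def)
  let ?F = "\<lambda>a. \<lambda>x\<in>carrier P. b a x"
  have F: "?F a \<in> carrier ?V" if "a \<in> S" for a by (rule starI[OF lP S(3)[OF that]])
  have va: "v a \<in> carrier A" if "v \<in> carrier ?V" "a \<in> S" for v a
    using hom_closed[OF starD(1)[OF that(1)] S(2)[OF that(2)]] by simp
  have vF: "v a \<odot>\<^bsub>?V\<^esub> ?F a \<in> carrier ?V" if "v \<in> carrier ?V" "a \<in> S" for v a
    using V.smult_closed[of "v a" "?F a"] va[OF that] F[OF that(2)] by simp
  \<comment> \<open>The coordinate functionals of a dual basis of \<open>P\<close> generate the
    right module Hom(P,A), with coefficients the values of \<open>v\<close> at the basis.\<close>
  have expand: "v = (\<Oplus>\<^bsub>res ?V\<^esub>a\<in>S. v a \<odot>\<^bsub>?V\<^esub> ?F a)" if v: "v \<in> carrier ?V" for v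
  proof (rule star_eqI[OF v])
    have pi: "(\<lambda>a. v a \<odot>\<^bsub>?V\<^esub> ?F a) \<in> S \<rightarrow> carrier (res ?V)"
      using vF[OF v] by (intro funcsetI) simp
    show "(\<Oplus>\<^bsub>res ?V\<^esub>a\<in>S. v a \<odot>\<^bsub>?V\<^esub> ?F a) \<in> carrier ?V"
      using Vk.M.finsum_closed[OF pi] by (simp only: restrict_scalars_simps)
    fix x assume x: "x \<in> carrier P"
    have bx: "b a x \<in> carrier A" if "a \<in> S" for a using hom_closed[OF S(3)[OF that] x] by simp
    have "(\<Oplus>\<^bsub>res ?V\<^esub>a\<in>S. v a \<odot>\<^bsub>?V\<^esub> ?F a) x = (\<Oplus>\<^bsub>?R\<^esub>a\<in>S. (v a \<odot>\<^bsub>?V\<^esub> ?F a) x)"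
      by (rule hom_finsum[OF lVk lRk star_eval_hom[OF x] pi])
    also have "\<dots> = (\<Oplus>\<^bsub>?R\<^esub>a\<in>S. v (b a x \<odot>\<^bsub>P\<^esub> a))"
    proof (rule Rk.M.finsum_cong')
      show "(\<lambda>a. v (b a x \<odot>\<^bsub>P\<^esub> a)) \<in> S \<rightarrow> carrier ?R"
        using bx S(2) va[OF v] hom_smult[OF starD(1)[OF v]] by (intro funcsetI) simp
      show "(v a \<odot>\<^bsub>?V\<^esub> ?F a) x = v (b a x \<odot>\<^bsub>P\<^esub> a)" if "a \<in> S" for a
        using hom_smult[OF starD(1)[OF v] bx[OF that] S(2)[OF that]] x by simp
    qed simp
    also have "\<dots> = v (\<Oplus>\<^bsub>P\<^esub>a\<in>S. b a x \<odot>\<^bsub>P\<^esub> a)"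
    proof -
      interpret P: left_module A P by (rule lP)
      interpret reg: left_module A reg by (rule reg_A)
      have "v (\<Oplus>\<^bsub>P\<^esub>a\<in>S. b a x \<odot>\<^bsub>P\<^esub> a) = (\<Oplus>\<^bsub>reg\<^esub>a\<in>S. v (b a x \<odot>\<^bsub>P\<^esub> a))"
        by (rule hom_finsum[OF lP reg_A starD(1)[OF v]]) (use bx S(2) in auto)
      also have "\<dots> = (\<Oplus>\<^bsub>?R\<^esub>a\<in>S. v (b a x \<odot>\<^bsub>P\<^esub> a))"
      proof -
        \<comment> \<open>The two sums are taken in different module records that share their
          addition, which needs an induction to be exploited.\<close>
        have eq: "finsum reg w T = finsum ?R w T" if "finite T" "w \<in> T \<rightarrow> carrier A" for w T
          using that
        proof (induction T)
          case (insert t T)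
          then show ?case by (simp add: reg.M.finsum_insert Rk.M.finsum_insert Pi_iff)
        qed simp
        have "v (b a x \<odot>\<^bsub>P\<^esub> a) \<in> carrier A" if "a \<in> S" for a
          using hom_closed[OF starD(1)[OF v] P.smult_closed[OF bx[OF that] S(2)[OF that]]] by (simp only: regular_module_simps)
        then have "(\<lambda>a. v (b a x \<odot>\<^bsub>P\<^esub> a)) \<in> S \<rightarrow> carrier A" by (rule funcsetI)
        then show ?thesis by (rule eq[OF S(1)])
      qed
      finally show ?thesis by (rule sym)
    qed
    also have "\<dots> = v x" by (simp add: S(4)[OF x])
    finally show "v x = (\<Oplus>\<^bsub>res ?V\<^esub>a\<in>S. v a \<odot>\<^bsub>?V\<^esub> ?F a) x" by (rule sym)
  qed
  have fD: "f m \<in> carrier (dual k J A ?V)" if "m \<in> carrier M" for m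
    using hom_closed[OF f that] unfolding nakayama_def .
  have f': "f \<in> module_hom A M (dual k J A ?V)" using f unfolding nakayama_def .
  \<comment> \<open>For each basis element, evaluation at its coordinate functional is a k-linear
    map from \<open>M\<close> to J, and J is injective over k.\<close>
  have "\<forall>a\<in>S. \<exists>c. c \<in> module_hom k (res N) J \<and>
      (\<forall>m\<in>carrier (res M). c (g m) = f m (?F a))"
  proof
    fix a assume a: "a \<in> S"
    have "(\<lambda>m. f m (?F a)) \<in> module_hom k (res M) J"
      by (rule hom_compose[OF hom_restrict_scalars[OF f'] dual_eval_hom[OF lV F[OF a]]])
    moreover have "inj_on g (carrier (res M))" using g(2) by simp
    ultimately have "\<exists>h\<in>module_hom k (res N) J. \<forall>m\<in>carrier (res M). h (g m) = f m (?F a)"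
      by (intro injective_extend[OF injective_J fg_restrict[OF M] fg_restrict[OF N] hom_restrict_scalars[OF g(1)]])
    then show "\<exists>c. c \<in> module_hom k (res N) J \<and>
      (\<forall>m\<in>carrier (res M). c (g m) = f m (?F a))" unfolding Bex_def .
  qed
  then have "\<exists>c. \<forall>a\<in>S. c a \<in> module_hom k (res N) J \<and>
      (\<forall>m\<in>carrier (res M). c a (g m) = f m (?F a))" by (rule bchoice)
  then obtain c where c: "\<forall>a\<in>S. c a \<in> module_hom k (res N) J \<and>
      (\<forall>m\<in>carrier (res M). c a (g m) = f m (?F a))" by (rule exE)
  have c1: "c a \<in> module_hom k (res N) J" and c2: "\<And>m. m \<in> carrier M \<Longrightarrow> c a (g m) = f m (?F a)"
    if "a \<in> S" for a using c[THEN bspec, OF that] by simp_all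
  \<comment> \<open>Forced by \<open>expand\<close>: an A-linear map into nu P has at
    \<open>v\<close> the value obtained by summing its coordinates at the multiples of
    \<open>n\<close> by \<open>v a\<close>.\<close>
  let ?H = "\<lambda>n. \<lambda>v\<in>carrier ?V. \<Oplus>\<^bsub>J\<^esub>a\<in>S. c a (v a \<odot>\<^bsub>N\<^esub> n)"
  have cc: "c a (r \<odot>\<^bsub>N\<^esub> n) \<in> carrier J" if "a \<in> S" "r \<in> carrier A" "n \<in> carrier N" for a r n
    using hom_closed[OF c1[OF that(1)], of "r \<odot>\<^bsub>N\<^esub> n"] that(2,3) by simp
  have H: "?H \<in> module_hom A N (dual k J A ?V)"
  proof (rule module_homI)
    fix n assume n: "n \<in> carrier N"
    have "(\<lambda>v. c a (v a \<odot>\<^bsub>N\<^esub> n)) \<in> module_hom k (res ?V) J" if a: "a \<in> S" for a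
      by (rule hom_compose[OF hom_compose[OF star_eval_hom[OF S(2)[OF a]]
            hom_restrict_scalars[OF smult_right_hom[OF lN n]]] c1[OF a]])
    from hom_finsum_fun[OF left_module_J lVk this S(1)]
    show "?H n \<in> carrier (dual k J A ?V)" by (rule dualI[OF lV])
    fix n' assume n': "n' \<in> carrier N"
    show "?H (n \<oplus>\<^bsub>N\<^esub> n') = ?H n \<oplus>\<^bsub>dual k J A ?V\<^esub> ?H n'"
      unfolding dual_simps
    proof (rule restrict_ext)
      fix v assume v: "v \<in> carrier ?V"
      have "(\<Oplus>\<^bsub>J\<^esub>a\<in>S. c a (v a \<odot>\<^bsub>N\<^esub> (n \<oplus>\<^bsub>N\<^esub> n'))) = (\<Oplus>\<^bsub>J\<^esub>a\<in>S. c a (v a \<odot>\<^bsub>N\<^esub> n) \<oplus>\<^bsub>J\<^esub> c a (v a \<odot>\<^bsub>N\<^esub> n'))"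
      proof (rule J.M.finsum_cong')
        show "(\<lambda>a. c a (v a \<odot>\<^bsub>N\<^esub> n) \<oplus>\<^bsub>J\<^esub> c a (v a \<odot>\<^bsub>N\<^esub> n')) \<in> S \<rightarrow> carrier J"
          using cc va[OF v] n n' by (intro funcsetI J.M.a_closed) simp_all
        fix a assume a: "a \<in> S"
        show "c a (v a \<odot>\<^bsub>N\<^esub> (n \<oplus>\<^bsub>N\<^esub> n')) = c a (v a \<odot>\<^bsub>N\<^esub> n) \<oplus>\<^bsub>J\<^esub> c a (v a \<odot>\<^bsub>N\<^esub> n')"
          using hom_add[OF c1[OF a], of "v a \<odot>\<^bsub>N\<^esub> n" "v a \<odot>\<^bsub>N\<^esub> n'"] va[OF v a] n n' by (simp add: N.smult_r_distr)
      qed simp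
      also have "\<dots> = (\<Oplus>\<^bsub>J\<^esub>a\<in>S. c a (v a \<odot>\<^bsub>N\<^esub> n)) \<oplus>\<^bsub>J\<^esub> (\<Oplus>\<^bsub>J\<^esub>a\<in>S. c a (v a \<odot>\<^bsub>N\<^esub> n'))"
        by (rule J.M.finsum_addf) (intro funcsetI cc va[OF v] n n'; assumption)+
      finally show "(\<Oplus>\<^bsub>J\<^esub>a\<in>S. c a (v a \<odot>\<^bsub>N\<^esub> (n \<oplus>\<^bsub>N\<^esub> n'))) = ?H n v \<oplus>\<^bsub>J\<^esub> ?H n' v"
        unfolding restrict_apply'[OF v] .
    qed
  next
    fix r n assume r: "r \<in> carrier A" and n: "n \<in> carrier N"
    show "?H (r \<odot>\<^bsub>N\<^esub> n) = r \<odot>\<^bsub>dual k J A ?V\<^esub> ?H n"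
      unfolding dual_simps
    proof (rule restrict_ext)
      fix v assume v: "v \<in> carrier ?V"
      have rv: "r \<odot>\<^bsub>?V\<^esub> v \<in> carrier ?V" using V.smult_closed[of r v] r v by simp
      have "?H n (r \<odot>\<^bsub>?V\<^esub> v) = (\<Oplus>\<^bsub>J\<^esub>a\<in>S. c a ((r \<odot>\<^bsub>?V\<^esub> v) a \<odot>\<^bsub>N\<^esub> n))" by (rule restrict_apply'[OF rv])
      also have "\<dots> = (\<Oplus>\<^bsub>J\<^esub>a\<in>S. c a (v a \<odot>\<^bsub>N\<^esub> (r \<odot>\<^bsub>N\<^esub> n)))"
      proof (rule J.M.finsum_cong')
        show "(\<lambda>a. c a (v a \<odot>\<^bsub>N\<^esub> (r \<odot>\<^bsub>N\<^esub> n))) \<in> S \<rightarrow> carrier J"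
          by (intro funcsetI cc va[OF v] N.smult_closed r n)
        show "c a ((r \<odot>\<^bsub>?V\<^esub> v) a \<odot>\<^bsub>N\<^esub> n) = c a (v a \<odot>\<^bsub>N\<^esub> (r \<odot>\<^bsub>N\<^esub> n))" if "a \<in> S" for a
          using S(2)[OF that] va[OF v that] r n by (simp add: N.smult_assoc1)
      qed simp
      finally show "(\<Oplus>\<^bsub>J\<^esub>a\<in>S. c a (v a \<odot>\<^bsub>N\<^esub> (r \<odot>\<^bsub>N\<^esub> n))) = ?H n (r \<odot>\<^bsub>?V\<^esub> v)" by (rule sym)
    qed
  qed
  have "?H (g m) = f m" if m: "m \<in> carrier M" for m
  proof (rule restrict_eqI[OF dualD(2)[OF fD[OF m]]])
    fix v assume v: "v \<in> carrier ?V"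
    have pi: "(\<lambda>a. v a \<odot>\<^bsub>?V\<^esub> ?F a) \<in> S \<rightarrow> carrier (res ?V)"
      using vF[OF v] by (intro funcsetI) simp
    have "f m v = f m (\<Oplus>\<^bsub>res ?V\<^esub>a\<in>S. v a \<odot>\<^bsub>?V\<^esub> ?F a)" by (simp only: expand[OF v, symmetric])
    also have "\<dots> = (\<Oplus>\<^bsub>J\<^esub>a\<in>S. f m (v a \<odot>\<^bsub>?V\<^esub> ?F a))"
      by (rule hom_finsum[OF lVk left_module_J dualD(1)[OF fD[OF m]] pi])
    also have "\<dots> = (\<Oplus>\<^bsub>J\<^esub>a\<in>S. c a (v a \<odot>\<^bsub>N\<^esub> g m))"
    proof (rule J.M.finsum_cong')
      show "(\<lambda>a. c a (v a \<odot>\<^bsub>N\<^esub> g m)) \<in> S \<rightarrow> carrier J"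
        by (intro funcsetI cc va[OF v] hom_closed[OF g(1) m])
      fix a assume a: "a \<in> S"
      have "c a (v a \<odot>\<^bsub>N\<^esub> g m) = c a (g (v a \<odot>\<^bsub>M\<^esub> m))" using hom_smult[OF g(1) va[OF v a] m] by simp
      also have "\<dots> = f (v a \<odot>\<^bsub>M\<^esub> m) (?F a)" by (rule c2[OF a M.smult_closed[OF va[OF v a] m]])
      also have "\<dots> = (v a \<odot>\<^bsub>dual k J A ?V\<^esub> f m) (?F a)" using hom_smult[OF f' va[OF v a] m] by (simp only:)
      also have "\<dots> = f m (v a \<odot>\<^bsub>?V\<^esub> ?F a)" unfolding dual_simps by (rule restrict_apply'[OF F[OF a]])
      finally show "f m (v a \<odot>\<^bsub>?V\<^esub> ?F a) = c a (v a \<odot>\<^bsub>N\<^esub> g m)" by (rule sym)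
    qed simp
    finally show "(\<Oplus>\<^bsub>J\<^esub>a\<in>S. c a (v a \<odot>\<^bsub>N\<^esub> g m)) = f m v" by (rule sym)
  qed
  then show "\<exists>h\<in>module_hom A N (nakayama k J A P). \<forall>x\<in>carrier M. h (g x) = f x"
    unfolding nakayama_def by (intro bexI[OF _ H] ballI)
qed

end

section \<open>The Nakayama functor on syzygies and projective covers\<close>

context self_inj_alg
begin

lemma star_extend:
  assumes M: "fg_module A M" and N: "fg_module A N" and g: "g \<in> module_hom A M N" "inj_on g (carrier M)"
    and f: "f \<in> module_hom A M reg"
  shows "\<exists>f'\<in>carrier (star A N). \<forall>x\<in>carrier M. f' (g x) = f x"
proof -
  from extend_hom[OF M N g f] obtain h where h: "h \<in> module_hom A N reg"
    "\<forall>x\<in>carrier M. h (g x) = f x" by (elim bexE)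
  have "(\<lambda>y\<in>carrier N. h y) (g x) = f x" if x: "x \<in> carrier M" for x
    using h(2)[THEN bspec, OF x] hom_closed[OF g(1) x] by (simp only: restrict_apply')
  then show ?thesis by (intro bexI[OF _ starI[OF fg_left_module[OF N] h(1)]] ballI)
qed

text \<open>Since A is injective, Hom(I,A) -> Hom(P0,A) -> Hom(K,A) -> 0 is exact, where K is the
  kernel of \<open>p\<close>. Applying the duality identifies nu K with the functionals that kill
  the image of Hom(I,A).\<close>

lemma nakayama_syzygy_iso:
  assumes P0: "fg_module A P0" and C: "fg_module A C" and I: "fg_module A I"
    and p: "p \<in> module_hom A P0 C" "p ` carrier P0 = carrier C"
    and e: "e \<in> module_hom A C I" "inj_on e (carrier C)"
  shows "nakayama_map A (ker_module P0 p C) (\<lambda>x. x) P0 \<in>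
    module_iso A (nakayama k J A (ker_module P0 p C)) (ar_ker J P0 (\<lambda>x. e (p x)) I)"
proof -
  let ?K = "ker_module P0 p C" and ?\<iota> = "\<lambda>x. x"
  let ?N = "nakayama_map A ?K ?\<iota> P0"
  note lP = fg_left_module[OF P0] and lC = fg_left_module[OF C] and lI = fg_left_module[OF I]
  note lK = left_module_ker[OF lP lC p(1)]
  note c = hom_compose[OF p(1) e(1)]
  have sub: "submodule (ker_set P0 p C) A P0" by (rule ker_set_submodule[OF lP lC p(1)])
  have Kin: "x \<in> carrier P0" "p x = \<zero>\<^bsub>C\<^esub>" if "x \<in> carrier ?K" for x using that by (simp_all add: ker_set_def)
  have \<iota>: "?\<iota> \<in> module_hom A ?K P0" by (intro module_homI) (auto simp: ker_set_def)
  have fgK: "fg_module A ?K" unfolding ker_module_def by (rule fg_submodule_A[OF P0 sub])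
  have lsP: "left_module (opp A) (star A P0)" and lsK: "left_module (opp A) (star A ?K)"
    by (rule left_module_star[OF lP], rule left_module_star[OF lK])
  have rP: "left_module k (res (star A P0))" and rK: "left_module k (res (star A ?K))"
    by (rule restrict_right[OF lsP], rule restrict_right[OF lsK])
  note pb = pullback_star_hom[OF lK lP \<iota>]
  note pbc = pullback_star_hom[OF lP lI c]
  interpret C: left_module A C by (rule lC)
  interpret I: left_module A I by (rule lI)
  \<comment> \<open>Exactness at the right end: maps from the syzygy extend to P0.\<close>
  have pb_surj: "\<exists>f\<in>carrier (star A P0). pullback ?K ?\<iota> f = g" if g: "g \<in> carrier (star A ?K)" for g
  proof -
    have "inj_on ?\<iota> (carrier ?K)" by simp
    from star_extend[OF fgK P0 \<iota> this starD(1)[OF g]] obtain f where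
      f: "f \<in> carrier (star A P0)" "\<forall>x\<in>carrier ?K. f x = g x" by (elim bexE)
    have "pullback ?K ?\<iota> f = g"
      unfolding pullback_def by (rule restrict_eqI[OF starD(2)[OF g]]) (rule f(2)[THEN bspec])
    then show ?thesis by (intro bexI[OF _ f(1)])
  qed
  have Nap: "?N \<alpha> f = \<alpha> (pullback ?K ?\<iota> f)" if "f \<in> carrier (star A P0)" for \<alpha> f
    unfolding nakayama_map_def pullback_def[of "star A P0"] using that by (rule restrict_apply')
  have Nhom: "?N \<in> module_hom A (nakayama k J A ?K) (nakayama k J A P0)" by (rule nakayama_map_hom[OF lK lP \<iota>])
  \<comment> \<open>Exactness in the middle: a map that vanishes on the syzygy factors through
    \<open>C\<close>, and from there extends along \<open>e\<close> to \<open>I\<close>.\<close>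
  have \<phi>_zero: "\<phi> f = \<zero>\<^bsub>J\<^esub>"
    if \<phi>: "\<phi> \<in> carrier (ar_ker J P0 (\<lambda>x. e (p x)) I)" and f: "f \<in> carrier (star A P0)"
      and 0: "\<And>x. x \<in> carrier ?K \<Longrightarrow> f x = \<zero>" for \<phi> f
  proof -
    have kz: "f x = \<zero>\<^bsub>reg\<^esub>" if "x \<in> carrier P0" "p x = \<zero>\<^bsub>C\<^esub>" for x
      using 0[of x] that by (simp add: ker_set_def)
    have "\<exists>h\<in>module_hom A (C\<lparr>carrier := p ` carrier P0\<rparr>) reg. \<forall>x\<in>carrier P0. h (p x) = f x"
      by (rule hom_factor[OF lP lC reg_A p(1) starD(1)[OF f]]) (rule kz)
    then obtain h where
      h: "h \<in> module_hom A (C\<lparr>carrier := p ` carrier P0\<rparr>) reg" "\<forall>x\<in>carrier P0. h (p x) = f x"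
      by (elim bexE)
    have h': "h \<in> module_hom A C reg" using h(1) unfolding p(2) by simp
    from star_extend[OF C I e h'] obtain g where
      g: "g \<in> carrier (star A I)" "\<forall>x\<in>carrier C. g (e x) = h x" by (elim bexE)
    have "pullback P0 (\<lambda>x. e (p x)) g = f"
      unfolding pullback_def
    proof (rule restrict_eqI[OF starD(2)[OF f]])
      fix x assume x: "x \<in> carrier P0"
      show "g (e (p x)) = f x" using g(2)[THEN bspec, OF hom_closed[OF p(1) x]] h(2)[THEN bspec, OF x] by (rule trans)
    qed
    then show ?thesis using \<phi> g(1) unfolding ar_ker_mem by blast
  qed
  show ?thesis
  proof (rule module_isoI)
    show "?N \<in> module_hom A (nakayama k J A ?K) (ar_ker J P0 (\<lambda>x. e (p x)) I)"
      unfolding ar_ker_def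
    proof (rule hom_restrict_cod[OF Nhom], rule image_subsetI)
      fix \<alpha> assume \<alpha>: "\<alpha> \<in> carrier (nakayama k J A ?K)"
      then have \<alpha>h: "\<alpha> \<in> module_hom k (res (star A ?K)) J" unfolding nakayama_def by (rule dualD)
      have "?N \<alpha> (pullback P0 (\<lambda>x. e (p x)) f) = \<zero>\<^bsub>J\<^esub>" if f: "f \<in> carrier (star A I)" for f
      proof -
        have "?N \<alpha> (pullback P0 (\<lambda>x. e (p x)) f) = \<alpha> (pullback ?K ?\<iota> (pullback P0 (\<lambda>x. e (p x)) f))"
          by (rule Nap[OF hom_closed[OF pbc f]])
        also have "pullback ?K ?\<iota> (pullback P0 (\<lambda>x. e (p x)) f) = \<zero>\<^bsub>res (star A ?K)\<^esub>"
          unfolding pullback_def restrict_scalars_simps star_simps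
          by (rule restrict_ext)
            (simp add: Kin hom_zero[OF lC lI e(1)] hom_zero[OF lI reg_A starD(1)[OF f]] del: ker_module_carrier)
        also have "\<alpha> \<dots> = \<zero>\<^bsub>J\<^esub>" by (rule hom_zero[OF rK left_module_J \<alpha>h])
        finally show ?thesis .
      qed
      then show "?N \<alpha> \<in> {\<phi> \<in> carrier (nakayama k J A P0).
          \<forall>f\<in>carrier (star A I). \<phi> (pullback P0 (\<lambda>x. e (p x)) f) = \<zero>\<^bsub>J\<^esub>}"
        using hom_closed[OF Nhom \<alpha>] by blast
    qed
    show "inj_on ?N (carrier (nakayama k J A ?K))"
    proof (rule inj_onI)
      fix \<alpha> \<beta> assume *: "\<alpha> \<in> carrier (nakayama k J A ?K)" "\<beta> \<in> carrier (nakayama k J A ?K)" "?N \<alpha> = ?N \<beta>"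
      show "\<alpha> = \<beta>"
      proof (rule dual_eqI[OF *(1,2)[unfolded nakayama_def]])
        fix g assume "g \<in> carrier (star A ?K)"
        from pb_surj[OF this] obtain f where f: "f \<in> carrier (star A P0)" "pullback ?K ?\<iota> f = g" by (elim bexE)
        show "\<alpha> g = \<beta> g" using fun_cong[OF *(3), of f] unfolding Nap[OF f(1)] f(2) .
      qed
    qed
    show "?N ` carrier (nakayama k J A ?K) = carrier (ar_ker J P0 (\<lambda>x. e (p x)) I)"
    proof
      show "?N ` carrier (nakayama k J A ?K) \<subseteq> carrier (ar_ker J P0 (\<lambda>x. e (p x)) I)"
        using hom_closed[OF \<open>?N \<in> module_hom A (nakayama k J A ?K) (ar_ker J P0 (\<lambda>x. e (p x)) I)\<close>] by (rule image_subsetI)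
      show "carrier (ar_ker J P0 (\<lambda>x. e (p x)) I) \<subseteq> ?N ` carrier (nakayama k J A ?K)"
      proof
        fix \<phi> assume \<phi>: "\<phi> \<in> carrier (ar_ker J P0 (\<lambda>x. e (p x)) I)"
        then have \<phi>\<nu>: "\<phi> \<in> carrier (dual k J A (star A P0))" unfolding ar_ker_mem nakayama_def by (rule conjunct1)
        note \<phi>h = dualD(1)[OF \<phi>\<nu>]
        have kc: "\<phi> f = \<zero>\<^bsub>J\<^esub>"
          if "f \<in> carrier (res (star A P0))" "pullback ?K ?\<iota> f = \<zero>\<^bsub>res (star A ?K)\<^esub>" for f
        proof (rule \<phi>_zero[OF \<phi>])
          show "f \<in> carrier (star A P0)" using that(1) by (simp only: restrict_scalars_simps)
          show "f x = \<zero>" if "x \<in> carrier ?K" for x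
            using fun_cong[OF \<open>pullback ?K ?\<iota> f = _\<close>, of x]
            unfolding pullback_def restrict_scalars_simps star_simps restrict_apply'[OF that] .
        qed
        have "\<exists>h\<in>module_hom k ((res (star A ?K))\<lparr>carrier :=
              pullback ?K ?\<iota> ` carrier (res (star A P0))\<rparr>) J.
          \<forall>f\<in>carrier (res (star A P0)). h (pullback ?K ?\<iota> f) = \<phi> f"
          by (rule hom_factor[OF rP rK left_module_J hom_restrict_scalars_opp[OF pb] \<phi>h]) (rule kc)
        then obtain h where
          h: "h \<in> module_hom k ((res (star A ?K))\<lparr>carrier :=
              pullback ?K ?\<iota> ` carrier (res (star A P0))\<rparr>) J"
          "\<forall>f\<in>carrier (res (star A P0)). h (pullback ?K ?\<iota> f) = \<phi> f" by (elim bexE)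
        have img: "pullback ?K ?\<iota> ` carrier (res (star A P0)) = carrier (res (star A ?K))"
          unfolding restrict_scalars_simps
        proof
          show "pullback ?K ?\<iota> ` carrier (star A P0) \<subseteq> carrier (star A ?K)"
            using hom_closed[OF pb] by (rule image_subsetI)
          show "carrier (star A ?K) \<subseteq> pullback ?K ?\<iota> ` carrier (star A P0)"
          proof
            fix g assume "g \<in> carrier (star A ?K)"
            from pb_surj[OF this] obtain f where "f \<in> carrier (star A P0)" "pullback ?K ?\<iota> f = g" by (elim bexE)
            then show "g \<in> pullback ?K ?\<iota> ` carrier (star A P0)" by (intro image_eqI[of _ _ f]) (rule sym)
          qed
        qed
        have upd: "W\<lparr>carrier := carrier W\<rparr> = W" for W :: "('k, _) module" by simp
        have h1: "h \<in> module_hom k (res (star A ?K)) J" using h(1) unfolding img upd .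
        let ?\<alpha> = "\<lambda>g\<in>carrier (star A ?K). h g"
        have "?\<alpha> \<in> carrier (nakayama k J A ?K)" unfolding nakayama_def by (rule dualI[OF lsK h1])
        moreover have "?N ?\<alpha> = \<phi>"
          unfolding nakayama_map_def pullback_def[of "star A P0"]
        proof (rule restrict_eqI[OF dualD(2)[OF \<phi>\<nu>]])
          fix f assume f: "f \<in> carrier (star A P0)"
          show "?\<alpha> (pullback ?K ?\<iota> f) = \<phi> f"
            unfolding restrict_apply'[OF hom_closed[OF pb f]]
            by (rule h(2)[THEN bspec]) (simp only: restrict_scalars_simps f)
        qed
        ultimately show "\<phi> \<in> ?N ` carrier (nakayama k J A ?K)" by (intro image_eqI[of _ _ ?\<alpha>]) (rule sym)
      qed
    qed
  qed
qed

text \<open>A surjection becomes injective under Hom(-,A), and functionals into J extend along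
  injections.\<close>

lemma nakayama_map_surj:
  assumes P: "fg_module A P" and M: "fg_module A M" and p: "p \<in> module_hom A P M" "p ` carrier P = carrier M"
  shows "nakayama_map A P p M ` carrier (nakayama k J A P) = carrier (nakayama k J A M)"
proof
  note lP = fg_left_module[OF P] and lM = fg_left_module[OF M]
  note pb = pullback_star_hom[OF lP lM p(1)]
  note sP = left_module_star[OF lP]
  show "nakayama_map A P p M ` carrier (nakayama k J A P) \<subseteq> carrier (nakayama k J A M)"
    using hom_closed[OF nakayama_map_hom[OF lP lM p(1)]] by (rule image_subsetI)
  show "carrier (nakayama k J A M) \<subseteq> nakayama_map A P p M ` carrier (nakayama k J A P)"
  proof
    fix \<alpha> assume "\<alpha> \<in> carrier (nakayama k J A M)"
    then have \<alpha>: "\<alpha> \<in> carrier (dual k J A (star A M))" by (simp only: nakayama_def)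
    have inj: "inj_on (pullback P p) (carrier (res (star A M)))"
      unfolding restrict_scalars_simps
    proof (rule inj_onI)
      fix f g assume *: "f \<in> carrier (star A M)" "g \<in> carrier (star A M)" "pullback P p f = pullback P p g"
      show "f = g"
      proof (rule star_eqI[OF *(1,2)])
        fix y assume "y \<in> carrier M"
        then have "y \<in> p ` carrier P" by (simp only: p(2))
        then obtain x where x: "x \<in> carrier P" "y = p x" by (elim imageE)
        show "f y = g y" using fun_cong[OF *(3), of x] unfolding pullback_def restrict_apply'[OF x(1)] x(2) .
      qed
    qed
    from injective_extend[OF injective_J fg_star[OF M] fg_star[OF P] hom_restrict_scalars_opp[OF pb] inj dualD(1)[OF \<alpha>]]
    obtain h where h: "h \<in> module_hom k (res (star A P)) J"
      "\<forall>f\<in>carrier (res (star A M)). h (pullback P p f) = \<alpha> f" by (elim bexE)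
    let ?\<beta> = "\<lambda>g\<in>carrier (star A P). h g"
    have "?\<beta> \<in> carrier (nakayama k J A P)" unfolding nakayama_def by (rule dualI[OF sP h(1)])
    moreover have "nakayama_map A P p M ?\<beta> = \<alpha>"
      unfolding nakayama_map_def pullback_def[of "star A M"]
    proof (rule restrict_eqI[OF dualD(2)[OF \<alpha>]])
      fix f assume f: "f \<in> carrier (star A M)"
      show "?\<beta> (pullback P p f) = \<alpha> f"
        unfolding restrict_apply'[OF hom_closed[OF pb f]]
        by (rule h(2)[THEN bspec]) (simp only: restrict_scalars_simps f)
    qed
    ultimately show "\<alpha> \<in> nakayama_map A P p M ` carrier (nakayama k J A P)"
      by (intro image_eqI[of _ _ ?\<beta>]) (rule sym)
  qed
qed

text \<open>If f(K) were all of f(P), then K and the kernel of \<open>f\<close> would span P, so the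
  kernel would be P. Hence A/f(K) has a nonzero class f(y), and a map to A that separates it is, on
  A, right multiplication by some \<open>r\<close>.\<close>

lemma superfluous_hom_separated:
  assumes P: "fg_module A P" and K: "superfluous A P K"
    and f: "f \<in> module_hom A P reg" and x: "x \<in> carrier P" "f x \<noteq> \<zero>"
  shows "\<exists>r\<in>carrier A. (\<forall>z\<in>K. f z \<otimes> r = \<zero>) \<and> (\<exists>y\<in>carrier P. f y \<otimes> r \<noteq> \<zero>)"
proof -
  note lP = fg_left_module[OF P]
  interpret P: left_module A P by (rule lP)
  note Ks = superfluous_submodule[OF K]
  have B: "submodule (f ` K) A reg" by (rule hom_image_submodule[OF lP reg_A f Ks])
  have "\<exists>y\<in>carrier P. f y \<notin> f ` K"
  proof (rule ccontr)
    assume no: "\<not> ?thesis"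
    have kf: "submodule (ker_set P f reg) A P" by (rule ker_set_submodule[OF lP reg_A f])
    have "\<exists>n\<in>ker_set P f reg. \<exists>z\<in>K. y = n \<oplus>\<^bsub>P\<^esub> z" if y: "y \<in> carrier P" for y
    proof -
      have "f y \<in> f ` K" using no y by blast
      then obtain z where z: "z \<in> K" "f y = f z" by (elim imageE)
      have zP: "z \<in> carrier P" by (rule submodule_mem[OF Ks z(1)])
      have fz: "f z \<in> carrier A" using hom_closed[OF f zP] by simp
      have "f (y \<ominus>\<^bsub>P\<^esub> z) = f y \<ominus>\<^bsub>reg\<^esub> f z" by (rule hom_diff[OF lP reg_A f y zP])
      also have "\<dots> = \<zero>"
        using fz z(2) by (simp add: a_minus_def ring_A A.r_neg)
      finally have "y \<ominus>\<^bsub>P\<^esub> z \<in> ker_set P f reg" using y zP by (simp add: ker_set_def)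
      moreover have "y = (y \<ominus>\<^bsub>P\<^esub> z) \<oplus>\<^bsub>P\<^esub> z" using P.M.diff_add[OF y zP] by (rule sym)
      ultimately show ?thesis using z(1) by blast
    qed
    from superfluousD[OF K lP kf this] have "x \<in> ker_set P f reg" using x(1) by simp
    then show False using x(2) by (simp add: ker_set_def)
  qed
  then obtain y where y: "y \<in> carrier P" "f y \<notin> f ` K" by (elim bexE)
  let ?Q = "quot_module reg (f ` K)" and ?c = "\<lambda>a. f ` K +>\<^bsub>reg\<^esub> a"
  note ch = coset_hom[OF reg_A B] and lQ = left_module_quot[OF reg_A B]
  have fgQ: "fg_module A ?Q" by (rule fg_surj[OF fg_regular_A lQ ch coset_surj[OF reg_A B]])
  have fy: "f y \<in> carrier reg" by (rule hom_closed[OF f y(1)])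
  have "?c (f y) \<noteq> \<zero>\<^bsub>?Q\<^esub>" using coset_zero_iff[OF reg_A B fy] y(2) by simp
  from separating_hom[OF fgQ hom_closed[OF ch fy] this] obtain g where
    g: "g \<in> module_hom A ?Q reg" "g (?c (f y)) \<noteq> \<zero>" by (elim bexE)
  let ?r = "g (?c \<one>)"
  have gc: "(\<lambda>a. g (?c a)) \<in> module_hom A reg reg" by (rule hom_compose[OF ch g(1)])
  have r: "?r \<in> carrier A" using hom_closed[OF gc, of "\<one>"] by simp
  have ga: "g (?c a) = a \<otimes> ?r" if a: "a \<in> carrier A" for a
    using hom_smult[OF gc a, of "\<one>"] a by simp
  show ?thesis
  proof (intro bexI[OF _ r] conjI ballI)
    fix z assume z: "z \<in> K"
    have fz: "f z \<in> carrier reg" by (rule hom_closed[OF f submodule_mem[OF Ks z]])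
    have "?c (f z) = \<zero>\<^bsub>?Q\<^esub>" using coset_zero_iff[OF reg_A B fz] z by blast
    then have "g (?c (f z)) = \<zero>\<^bsub>reg\<^esub>" by (simp only: hom_zero[OF lQ reg_A g(1)])
    then show "f z \<otimes> ?r = \<zero>" using ga[of "f z"] fz by simp
  next
    show "\<exists>y\<in>carrier P. f y \<otimes> ?r \<noteq> \<zero>"
      using ga[of "f y"] fy g(2) by (intro bexI[OF _ y(1)]) simp
  qed
qed

text \<open>A submodule N that together with the kernel spans nu P has zero annihilator in Hom(P,A);
  the double annihilator property over J then makes N everything. Projectivity of nu P goes through
  its injectivity.\<close>

lemma nakayama_cover:
  assumes cov: "projective_cover A P p M" and M: "left_module A M"
  shows "projective_cover A (nakayama k J A P) (nakayama_map A P p M) (nakayama k J A M)"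
proof -
  note P = projective_coverD[OF cov] and fgM = projective_cover_fg[OF cov M]
  let ?\<nu>P = "nakayama k J A P" and ?\<nu>p = "nakayama_map A P p M" and ?V = "star A P"
  let ?k\<nu> = "ker_set ?\<nu>P ?\<nu>p (nakayama k J A M)"
  note l\<nu>P = left_module_nakayama[OF P(6) left_module_J] and l\<nu>M = left_module_nakayama[OF M left_module_J]
  note \<nu>p = nakayama_map_hom[OF P(6) M P(3), where J = J]
  note lV = left_module_star[OF P(6)]
  note rV = restrict_right[OF lV]
  note pb = pullback_star_hom[OF P(6) M P(3)]
  interpret V: left_module "opp A" ?V by (rule lV)
  interpret \<nu>: left_module A ?\<nu>P by (rule l\<nu>P)
  interpret J: left_module k J by (rule left_module_J)
  have fg\<nu>: "fg_module A ?\<nu>P" by (rule fg_nakayama[OF P(1)])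
  have "superfluous A ?\<nu>P ?k\<nu>"
  proof (rule superfluousI[OF ker_set_submodule[OF l\<nu>P l\<nu>M \<nu>p]])
    fix N \<phi> assume N: "submodule N A ?\<nu>P"
      and sum: "\<And>\<psi>. \<psi> \<in> carrier ?\<nu>P \<Longrightarrow> \<exists>n\<in>N. \<exists>z\<in>?k\<nu>. \<psi> = n \<oplus>\<^bsub>?\<nu>P\<^esub> z"
      and \<phi>: "\<phi> \<in> carrier ?\<nu>P"
    have mem: "\<psi> \<in> carrier (dual k J A ?V)" if "\<psi> \<in> carrier ?\<nu>P" for \<psi> using that by (simp only: nakayama_def)
    have NV: "\<psi> \<in> carrier (dual k J A ?V)" if "\<psi> \<in> N" for \<psi> by (rule mem[OF submodule_mem[OF N that]])
    \<comment> \<open>After multiplying \<open>f\<close> by a suitable \<open>r\<close> the map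
      factors through \<open>p\<close>. Then not only N but also the kernel of nu p kills it, so all
      of nu P does, against \<open>cogenerator\<close>.\<close>
    have sep: "f = \<zero>\<^bsub>?V\<^esub>" if f: "f \<in> carrier ?V" and ann: "\<And>\<psi>. \<psi> \<in> N \<Longrightarrow> \<psi> f = \<zero>\<^bsub>J\<^esub>" for f
    proof (rule ccontr)
      assume ne: "f \<noteq> \<zero>\<^bsub>?V\<^esub>"
      have "\<exists>x\<in>carrier P. f x \<noteq> \<zero>"
      proof (rule ccontr)
        assume "\<not> ?thesis"
        then have "f x = \<zero>" if "x \<in> carrier P" for x using that by blast
        then have "f = \<zero>\<^bsub>?V\<^esub>" unfolding star_simps by (intro sym[OF restrict_eqI[OF starD(2)[OF f]]]) (rule sym)
        then show False using ne by simp
      qed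
      then obtain x where x: "x \<in> carrier P" "f x \<noteq> \<zero>" by (elim bexE)
      from superfluous_hom_separated[OF P(1,5) starD(1)[OF f] x] obtain r y where
        r: "r \<in> carrier A" "\<forall>z\<in>ker_set P p M. f z \<otimes> r = \<zero>" and y: "y \<in> carrier P" "f y \<otimes> r \<noteq> \<zero>"
        by (elim bexE conjE)
      let ?fr = "r \<odot>\<^bsub>?V\<^esub> f"
      have fr: "?fr \<in> carrier ?V" by (rule V.smult_closed[OF _ f]) (simp only: opp_simps r(1))
      have frx: "?fr z = f z \<otimes> r" if "z \<in> carrier P" for z unfolding star_simps using that by (rule restrict_apply')
      have kz: "?fr z = \<zero>\<^bsub>reg\<^esub>" if "z \<in> carrier P" "p z = \<zero>\<^bsub>M\<^esub>" for z
        using frx[OF that(1)] r(2)[THEN bspec, of z] that unfolding ker_set_def by simp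
      have "\<exists>h\<in>module_hom A (M\<lparr>carrier := p ` carrier P\<rparr>) reg. \<forall>z\<in>carrier P. h (p z) = ?fr z"
        by (rule hom_factor[OF P(6) M reg_A P(3) starD(1)[OF fr]]) (rule kz)
      then obtain h where
        h: "h \<in> module_hom A (M\<lparr>carrier := p ` carrier P\<rparr>) reg" "\<forall>z\<in>carrier P. h (p z) = ?fr z"
        by (elim bexE)
      have h1: "h \<in> module_hom A M reg" using h(1) unfolding P(4) by simp
      let ?h = "\<lambda>m\<in>carrier M. h m"
      have hs: "?h \<in> carrier (star A M)" by (rule starI[OF M h1])
      have pbh: "pullback P p ?h = ?fr"
        unfolding pullback_def
      proof (rule restrict_eqI[OF starD(2)[OF fr]])
        fix z assume z: "z \<in> carrier P"
        show "?h (p z) = ?fr z" unfolding restrict_apply'[OF hom_closed[OF P(3) z]] by (rule h(2)[THEN bspec, OF z])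
      qed
      \<comment> \<open>The summand from \<open>N\<close> vanishes because \<open>N\<close> is
        stable under \<open>r\<close>; the other one because the map is a pullback along
        \<open>p\<close>.\<close>
      have kill: "\<psi> ?fr = \<zero>\<^bsub>J\<^esub>" if \<psi>: "\<psi> \<in> carrier ?\<nu>P" for \<psi>
      proof -
        from sum[OF \<psi>] obtain n z where n: "n \<in> N" and z: "z \<in> ?k\<nu>" and eq: "\<psi> = n \<oplus>\<^bsub>?\<nu>P\<^esub> z" by (elim bexE)
        have rn: "r \<odot>\<^bsub>?\<nu>P\<^esub> n \<in> N" by (rule submodule_smult[OF N r(1) n])
        have "n ?fr = (r \<odot>\<^bsub>?\<nu>P\<^esub> n) f" unfolding nakayama_def dual_simps restrict_apply'[OF f] ..
        also have "\<dots> = \<zero>\<^bsub>J\<^esub>" by (rule ann[OF rn])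
        finally have 1: "n ?fr = \<zero>\<^bsub>J\<^esub>" .
        have "?\<nu>p z ?h = z ?fr"
          unfolding nakayama_map_def pullback_def[of "star A M"] restrict_apply'[OF hs] pbh ..
        moreover have "?\<nu>p z = \<zero>\<^bsub>nakayama k J A M\<^esub>" using z by (simp add: ker_set_def)
        ultimately have 2: "z ?fr = \<zero>\<^bsub>J\<^esub>"
          unfolding nakayama_def dual_simps using restrict_apply'[OF hs, of "\<lambda>_. \<zero>\<^bsub>J\<^esub>"] by (simp only:)
        have "\<psi> ?fr = n ?fr \<oplus>\<^bsub>J\<^esub> z ?fr"
          unfolding eq nakayama_def dual_simps using fr by (rule restrict_apply')
        then show ?thesis unfolding 1 2 by simp
      qed
      have "?fr \<noteq> \<zero>\<^bsub>res ?V\<^esub>"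
      proof
        assume "?fr = \<zero>\<^bsub>res ?V\<^esub>"
        from fun_cong[OF this, of y] have "?fr y = \<zero>" using y(1) by (simp only: restrict_scalars_simps star_simps restrict_apply')
        then show False using y frx by simp
      qed
      moreover have "?fr \<in> carrier (res ?V)" using fr by (simp only: restrict_scalars_simps)
      ultimately obtain \<psi> where \<psi>: "\<psi> \<in> module_hom k (res ?V) J" "\<psi> ?fr \<noteq> \<zero>\<^bsub>J\<^esub>"
        using cogenerator[OF fg_star[OF P(1)], of ?fr] by (elim impE meta_impE bexE) auto
      have "(\<lambda>v\<in>carrier ?V. \<psi> v) \<in> carrier ?\<nu>P" unfolding nakayama_def by (rule dualI[OF lV \<psi>(1)])
      from kill[OF this] show False using \<psi>(2) unfolding restrict_apply'[OF fr] by simp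
    qed
    let ?D = "res ?\<nu>P"
    have rD: "left_module k ?D" by (rule restrict_left[OF l\<nu>P])
    interpret D: left_module k ?D by (rule rD)
    \<comment> \<open>The double annihilator expresses \<open>\<phi>\<close> as a k-combination of
      members of \<open>N\<close>, and \<open>N\<close> is also a k-submodule.\<close>
    have "\<exists>F c. finite F \<and> F \<subseteq> N \<and> c \<in> F \<rightarrow> carrier k \<and>
        (\<forall>v\<in>carrier (res ?V). \<phi> v = (\<Oplus>\<^bsub>J\<^esub>\<psi>\<in>F. c \<psi> \<odot>\<^bsub>J\<^esub> \<psi> v))"
    proof (rule double_annihilator[OF fg_star[OF P(1)] _ dualD(1)[OF mem[OF \<phi>]]])
      show "\<psi> \<in> module_hom k (res ?V) J" if "\<psi> \<in> N" for \<psi> by (rule dualD(1)[OF NV[OF that]])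
      fix v assume v: "v \<in> carrier (res ?V)" and 0: "\<forall>\<psi>\<in>N. \<psi> v = \<zero>\<^bsub>J\<^esub>"
      have "v = \<zero>\<^bsub>?V\<^esub>"
        by (rule sep) (use v in \<open>simp only: restrict_scalars_simps\<close>, rule 0[THEN bspec])
      then have "v = \<zero>\<^bsub>res ?V\<^esub>" by (simp only: restrict_scalars_simps)
      then show "\<phi> v = \<zero>\<^bsub>J\<^esub>" using hom_zero[OF rV left_module_J dualD(1)[OF mem[OF \<phi>]]] by (simp only:)
    qed
    then obtain F c where F: "finite F" "F \<subseteq> N" "c \<in> F \<rightarrow> carrier k"
      "\<forall>v\<in>carrier (res ?V). \<phi> v = (\<Oplus>\<^bsub>J\<^esub>\<psi>\<in>F. c \<psi> \<odot>\<^bsub>J\<^esub> \<psi> v)" by (elim exE conjE)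
    let ?s = "\<Oplus>\<^bsub>?D\<^esub>\<psi>\<in>F. c \<psi> \<odot>\<^bsub>?D\<^esub> \<psi>"
    have Nk: "submodule N k ?D" by (rule submodule_restrict_scalars[OF l\<nu>P N])
    have inN: "(\<lambda>\<psi>. c \<psi> \<odot>\<^bsub>?D\<^esub> \<psi>) \<in> F \<rightarrow> N"
    proof
      fix \<psi> assume "\<psi> \<in> F"
      then show "c \<psi> \<odot>\<^bsub>?D\<^esub> \<psi> \<in> N"
        by (intro submodule_smult[OF Nk funcset_mem[OF F(3)] subsetD[OF F(2)]])
    qed
    have sN: "?s \<in> N" by (rule submodule_finsum[OF rD Nk inN])
    have "\<phi> = ?s"
    proof (rule dual_eqI[OF mem[OF \<phi>] NV[OF sN]])
      fix v assume v: "v \<in> carrier ?V"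
      note ev = dual_eval_hom[OF lV v, folded nakayama_def]
      have "?s v = (\<Oplus>\<^bsub>J\<^esub>\<psi>\<in>F. (c \<psi> \<odot>\<^bsub>?D\<^esub> \<psi>) v)"
        by (rule hom_finsum[OF rD left_module_J ev]) (rule funcsetI, rule submodule_mem[OF Nk funcset_mem[OF inN]])
      also have "\<dots> = (\<Oplus>\<^bsub>J\<^esub>\<psi>\<in>F. c \<psi> \<odot>\<^bsub>J\<^esub> \<psi> v)"
      proof (rule J.M.finsum_cong')
        have FN: "\<psi> \<in> carrier ?D" if "\<psi> \<in> F" for \<psi> by (rule submodule_mem[OF Nk subsetD[OF F(2) that]])
        show "(\<lambda>\<psi>. c \<psi> \<odot>\<^bsub>J\<^esub> \<psi> v) \<in> F \<rightarrow> carrier J"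
          by (intro funcsetI J.smult_closed funcset_mem[OF F(3)] hom_closed[OF ev FN])
        show "(c \<psi> \<odot>\<^bsub>?D\<^esub> \<psi>) v = c \<psi> \<odot>\<^bsub>J\<^esub> \<psi> v" if "\<psi> \<in> F" for \<psi>
          by (rule hom_smult[OF ev funcset_mem[OF F(3) that] FN[OF that]])
      qed simp
      also have "\<dots> = \<phi> v" by (rule F(4)[THEN bspec, symmetric]) (simp only: restrict_scalars_simps v)
      finally show "\<phi> v = ?s v" by (rule sym)
    qed
    then show "\<phi> \<in> N" using sN by simp
  qed
  moreover have "projective A ?\<nu>P" by (rule injective_imp_projective[OF fg\<nu> injective_nakayama[OF P(1,2)]])
  ultimately show ?thesis
    unfolding projective_cover_def using fg\<nu> \<nu>p nakayama_map_surj[OF P(1) fgM P(3,4)] by (intro conjI)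
qed

end

section \<open>The triangular matrix algebra\<close>

definition prod_module :: "('r, 'm) module \<Rightarrow> ('r, 'n) module \<Rightarrow> ('r, 'm \<times> 'n) module" where
  "prod_module M N = mk_module (carrier M \<times> carrier N) (\<zero>\<^bsub>M\<^esub>, \<zero>\<^bsub>N\<^esub>)
     (\<lambda>(x, y) (x', y'). (x \<oplus>\<^bsub>M\<^esub> x', y \<oplus>\<^bsub>N\<^esub> y')) (\<lambda>r (x, y). (r \<odot>\<^bsub>M\<^esub> x, r \<odot>\<^bsub>N\<^esub> y))"

lemma prod_module_simps [simp]:
  "carrier (prod_module M N) = carrier M \<times> carrier N" "\<zero>\<^bsub>prod_module M N\<^esub> = (\<zero>\<^bsub>M\<^esub>, \<zero>\<^bsub>N\<^esub>)"
  "(x, y) \<oplus>\<^bsub>prod_module M N\<^esub> (x', y') = (x \<oplus>\<^bsub>M\<^esub> x', y \<oplus>\<^bsub>N\<^esub> y')"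
  "r \<odot>\<^bsub>prod_module M N\<^esub> (x, y) = (r \<odot>\<^bsub>M\<^esub> x, r \<odot>\<^bsub>N\<^esub> y)"
  by (simp_all add: prod_module_def)

lemma left_module_prod:
  assumes "left_module R M" "left_module R N"
  shows "left_module R (prod_module M N)"
proof -
  interpret M: left_module R M by fact
  interpret N: left_module R N by fact
  show ?thesis
  proof (rule left_moduleI)
    fix x assume "x \<in> carrier (prod_module M N)"
    then show "\<exists>y\<in>carrier (prod_module M N). y \<oplus>\<^bsub>prod_module M N\<^esub> x = \<zero>\<^bsub>prod_module M N\<^esub>"
      by (intro bexI[of _ "(\<ominus>\<^bsub>M\<^esub> fst x, \<ominus>\<^bsub>N\<^esub> snd x)"]) (auto simp: M.M.l_neg N.M.l_neg)
  qed (auto simp: M.R.ring_axioms M.M.a_ac N.M.a_ac M.smult_l_distr N.smult_l_distr M.smult_r_distr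
      N.smult_r_distr M.smult_assoc1 N.smult_assoc1)
qed

lemma T2_simps [simp]:
  "carrier (T2 A) = carrier A \<times> carrier A \<times> carrier A"
  "(x, y, z) \<otimes>\<^bsub>T2 A\<^esub> (x', y', z') = (x \<otimes>\<^bsub>A\<^esub> x', x \<otimes>\<^bsub>A\<^esub> y' \<oplus>\<^bsub>A\<^esub> y \<otimes>\<^bsub>A\<^esub> z', z \<otimes>\<^bsub>A\<^esub> z')"
  "\<one>\<^bsub>T2 A\<^esub> = (\<one>\<^bsub>A\<^esub>, \<zero>\<^bsub>A\<^esub>, \<one>\<^bsub>A\<^esub>)" "\<zero>\<^bsub>T2 A\<^esub> = (\<zero>\<^bsub>A\<^esub>, \<zero>\<^bsub>A\<^esub>, \<zero>\<^bsub>A\<^esub>)"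
  "(x, y, z) \<oplus>\<^bsub>T2 A\<^esub> (x', y', z') = (x \<oplus>\<^bsub>A\<^esub> x', y \<oplus>\<^bsub>A\<^esub> y', z \<oplus>\<^bsub>A\<^esub> z')"
  "c \<odot>\<^bsub>T2 A\<^esub> (x, y, z) = (c \<odot>\<^bsub>A\<^esub> x, c \<odot>\<^bsub>A\<^esub> y, c \<odot>\<^bsub>A\<^esub> z)"
  by (simp_all add: T2_def)

lemma mor_to_T2_simps [simp]:
  "carrier (mor_to_T2 (X, f, Y)) = carrier Y \<times> carrier X"
  "\<zero>\<^bsub>mor_to_T2 (X, f, Y)\<^esub> = (\<zero>\<^bsub>Y\<^esub>, \<zero>\<^bsub>X\<^esub>)"
  "(b, a) \<oplus>\<^bsub>mor_to_T2 (X, f, Y)\<^esub> (b', a') = (b \<oplus>\<^bsub>Y\<^esub> b', a \<oplus>\<^bsub>X\<^esub> a')"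
  "(x, y, z) \<odot>\<^bsub>mor_to_T2 (X, f, Y)\<^esub> (b, a) = (x \<odot>\<^bsub>Y\<^esub> b \<oplus>\<^bsub>Y\<^esub> y \<odot>\<^bsub>Y\<^esub> f a, z \<odot>\<^bsub>X\<^esub> a)"
  by (simp_all add: mor_to_T2_def)

lemma ring_T2:
  assumes "ring A"
  shows "ring (T2 A)"
proof -
  interpret A: ring A by fact
  show ?thesis
  proof (rule ringI)
    show "abelian_group (T2 A)"
    proof (rule abelian_groupI)
      fix x assume "x \<in> carrier (T2 A)"
      then show "\<exists>y\<in>carrier (T2 A). y \<oplus>\<^bsub>T2 A\<^esub> x = \<zero>\<^bsub>T2 A\<^esub>"
        by (intro bexI[of _ "(\<ominus>\<^bsub>A\<^esub> fst x, \<ominus>\<^bsub>A\<^esub> fst (snd x), \<ominus>\<^bsub>A\<^esub> snd (snd x))"]) (auto simp: A.l_neg)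
    qed (auto simp: A.a_ac)
    show "Group.monoid (T2 A)"
      by (rule monoidI) (auto simp: A.m_assoc A.l_distr A.r_distr A.a_ac)
  qed (auto simp: A.l_distr A.r_distr A.a_ac)
qed

lemma left_module_mor_to_T2:
  assumes "left_module A X" "left_module A Y" "f \<in> module_hom A X Y"
  shows "left_module (T2 A) (mor_to_T2 (X, f, Y))"
proof -
  interpret X: left_module A X by fact
  interpret Y: left_module A Y by fact
  note f = hom_facts[OF assms(3)]
  show ?thesis
  proof (rule left_moduleI)
    fix x assume "x \<in> carrier (mor_to_T2 (X, f, Y))"
    then show "\<exists>y\<in>carrier (mor_to_T2 (X, f, Y)). y \<oplus>\<^bsub>mor_to_T2 (X, f, Y)\<^esub> x = \<zero>\<^bsub>mor_to_T2 (X, f, Y)\<^esub>"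
      by (intro bexI[of _ "(\<ominus>\<^bsub>Y\<^esub> fst x, \<ominus>\<^bsub>X\<^esub> snd x)"]) (auto simp: X.M.l_neg Y.M.l_neg)
  qed (auto simp: ring_T2[OF X.R.ring_axioms] f X.M.a_ac Y.M.a_ac X.smult_l_distr Y.smult_l_distr
      X.smult_r_distr Y.smult_r_distr X.smult_assoc1 Y.smult_assoc1)
qed

lemma k_algebra_T2:
  assumes "k_algebra k A"
  shows "k_algebra k (T2 A)"
proof -
  interpret k_algebra k A by fact
  show ?thesis
  proof (rule k_algebra.intro)
    show "cring k" by (rule cring_k)
    show "ring (T2 A)" by (rule ring_T2[OF ring_A])
    show "module k (T2 A)"
      by (rule moduleI, rule cring_k, rule ring.is_abelian_group[OF ring_T2[OF ring_A]])
        (auto simp: kA.smult_l_distr kA.smult_r_distr kA.smult_assoc1)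
  qed (auto simp: smult_mult mult_smult kA.smult_r_distr)
qed

text \<open>The coproduct of the projective objects \<open>id : U \<rightarrow> U\<close> and \<open>0 \<rightarrow> W\<close>.\<close>

definition proj_mor :: "('r, 'u) module \<Rightarrow> ('r, 'w) module \<Rightarrow> ('r \<times> 'r \<times> 'r, ('u \<times> 'w) \<times> 'u) module" where
  "proj_mor U W = mor_to_T2 (U, \<lambda>u. (u, \<zero>\<^bsub>W\<^esub>), prod_module U W)"

lemma proj_mor_simps [simp]:
  "carrier (proj_mor U W) = (carrier U \<times> carrier W) \<times> carrier U"
  "\<zero>\<^bsub>proj_mor U W\<^esub> = ((\<zero>\<^bsub>U\<^esub>, \<zero>\<^bsub>W\<^esub>), \<zero>\<^bsub>U\<^esub>)"
  "((a, b), u) \<oplus>\<^bsub>proj_mor U W\<^esub> ((a', b'), u') = ((a \<oplus>\<^bsub>U\<^esub> a', b \<oplus>\<^bsub>W\<^esub> b'), u \<oplus>\<^bsub>U\<^esub> u')"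
  by (simp_all add: proj_mor_def)

lemma inj_left_hom:
  assumes "left_module A W"
  shows "(\<lambda>u. (u, \<zero>\<^bsub>W\<^esub>)) \<in> module_hom A U (prod_module U W)"
proof -
  interpret left_module A W by fact
  show ?thesis by (rule module_homI) simp_all
qed

lemma left_module_proj_mor:
  assumes "left_module A U" "left_module A W"
  shows "left_module (T2 A) (proj_mor U W)"
  unfolding proj_mor_def
  by (rule left_module_mor_to_T2[OF assms(1) left_module_prod[OF assms] inj_left_hom[OF assms(2)]])

lemma proj_mor_smult:
  assumes "left_module A U" "left_module A W" "x \<in> carrier A" "y \<in> carrier A" "z \<in> carrier A"
    "a \<in> carrier U" "b \<in> carrier W" "u \<in> carrier U"
  shows "(x, y, z) \<odot>\<^bsub>proj_mor U W\<^esub> ((a, b), u) = ((x \<odot>\<^bsub>U\<^esub> a \<oplus>\<^bsub>U\<^esub> y \<odot>\<^bsub>U\<^esub> u, x \<odot>\<^bsub>W\<^esub> b), z \<odot>\<^bsub>U\<^esub> u)"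
proof -
  interpret U: left_module A U by fact
  interpret W: left_module A W by fact
  show ?thesis using assms(3-) by (simp add: proj_mor_def)
qed

text \<open>The left regular module of \<open>T2 A\<close> is the sum of its columns, which
  correspond to the objects 0 -> A and id : A -> A. \<open>upper_map\<close> goes into the first
  column and \<open>lower_map\<close> into the second.\<close>

definition upper_map :: "('r, 'x) ring_scheme \<Rightarrow> ('w \<Rightarrow> 'r) \<Rightarrow> ('u \<times> 'w) \<times> 'u \<Rightarrow> 'r \<times> 'r \<times> 'r" where
  "upper_map A h = (\<lambda>((a, b), u). (h b, \<zero>\<^bsub>A\<^esub>, \<zero>\<^bsub>A\<^esub>))"

definition lower_map :: "('r, 'x) ring_scheme \<Rightarrow> ('u \<Rightarrow> 'r) \<Rightarrow> ('u \<times> 'w) \<times> 'u \<Rightarrow> 'r \<times> 'r \<times> 'r" where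
  "lower_map A g = (\<lambda>((a, b), u). (\<zero>\<^bsub>A\<^esub>, g a, g u))"

lemma upper_map_simps [simp]: "upper_map A h ((a, b), u) = (h b, \<zero>\<^bsub>A\<^esub>, \<zero>\<^bsub>A\<^esub>)"
  and lower_map_simps [simp]: "lower_map A g ((a, b), u) = (\<zero>\<^bsub>A\<^esub>, g a, g u)"
  by (simp_all add: upper_map_def lower_map_def)

lemma
  assumes U: "left_module A U" and W: "left_module A W"
  shows upper_map_hom: "h \<in> module_hom A W (regular_module A) \<Longrightarrow>
      upper_map A h \<in> module_hom (T2 A) (proj_mor U W) (regular_module (T2 A))"
    and lower_map_hom: "g \<in> module_hom A U (regular_module A) \<Longrightarrow>
      lower_map A g \<in> module_hom (T2 A) (proj_mor U W) (regular_module (T2 A))"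
proof -
  interpret U: left_module A U by fact
  interpret W: left_module A W by fact
  show "upper_map A h \<in> module_hom (T2 A) (proj_mor U W) (regular_module (T2 A))"
    if "h \<in> module_hom A W (regular_module A)"
    using hom_facts[OF that] by (intro module_homI) (auto simp: proj_mor_smult[OF U W])
  show "lower_map A g \<in> module_hom (T2 A) (proj_mor U W) (regular_module (T2 A))"
    if "g \<in> module_hom A U (regular_module A)"
    using hom_facts[OF that] by (intro module_homI) (auto simp: proj_mor_smult[OF U W])
qed

lemma finsum_proj_mor:
  fixes A :: "('k, 'r) module"
  assumes U: "left_module A U" and W: "left_module A W" and S: "finite S"
    and f: "a \<in> S \<rightarrow> carrier U" "b \<in> S \<rightarrow> carrier W" "u \<in> S \<rightarrow> carrier U"
  shows "(\<Oplus>\<^bsub>proj_mor U W\<^esub>s\<in>S. ((a s, b s), u s)) =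
    ((\<Oplus>\<^bsub>U\<^esub>s\<in>S. a s, \<Oplus>\<^bsub>W\<^esub>s\<in>S. b s), \<Oplus>\<^bsub>U\<^esub>s\<in>S. u s)"
proof -
  interpret U: left_module A U by fact
  interpret W: left_module A W by fact
  interpret Q: left_module "T2 A" "proj_mor U W" by (rule left_module_proj_mor[OF U W])
  show ?thesis
    using S f
  proof (induction S)
    case (insert s S)
    have "(\<lambda>s. ((a s, b s), u s)) \<in> S \<rightarrow> carrier (proj_mor U W)"
      using insert.prems by (auto simp: Pi_iff)
    then show ?case
      using insert by (simp add: Q.M.finsum_insert U.M.finsum_insert W.M.finsum_insert Pi_iff)
  qed simp
qed

lemma proj_mor_projective:
  fixes U (structure)
  assumes U: "fg_module A U" "projective A U" and W: "fg_module A W" "projective A W"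
  shows "fg_module (T2 A) (proj_mor U W)" "projective (T2 A) (proj_mor U W)"
proof -
  note lU = fg_left_module[OF U(1)] and lW = fg_left_module[OF W(1)]
  note lQ = left_module_proj_mor[OF lU lW]
  interpret U: left_module A U by (rule lU)
  interpret W: left_module A W by (rule lW)
  interpret Q: left_module "T2 A" "proj_mor U W" by (rule lQ)
  obtain S f where Sf: "dual_basis A U S (\<lambda>a. a) f" by (rule projective_dual_basis[OF U])
  obtain R g where Rg: "dual_basis A W R (\<lambda>a. a) g" by (rule projective_dual_basis[OF W])
  have S: "finite S" "\<And>s. s \<in> S \<Longrightarrow> s \<in> carrier U" "\<And>s. s \<in> S \<Longrightarrow> f s \<in> module_hom A U (regular_module A)"
    "\<And>x. x \<in> carrier U \<Longrightarrow> (\<Oplus>s\<in>S. f s x \<odot> s) = x"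
    using Sf by (auto simp: dual_basis_def)
  have R: "finite R" "\<And>s. s \<in> R \<Longrightarrow> s \<in> carrier W" "\<And>s. s \<in> R \<Longrightarrow> g s \<in> module_hom A W (regular_module A)"
    "\<And>x. x \<in> carrier W \<Longrightarrow> (\<Oplus>\<^bsub>W\<^esub>s\<in>R. g s x \<odot>\<^bsub>W\<^esub> s) = x"
    using Rg by (auto simp: dual_basis_def)
  have fc: "f s x \<in> carrier A" if "s \<in> S" "x \<in> carrier U" for s x using hom_closed[OF S(3)[OF that(1)] that(2)] by simp
  have gc: "g s x \<in> carrier A" if "s \<in> R" "x \<in> carrier W" for s x using hom_closed[OF R(3)[OF that(1)] that(2)] by simp
  \<comment> \<open>Generators of U are placed in the lower entry only: the matrix unit in the
    corner carries them to the upper copy of U as well.\<close>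
  let ?a = "case_sum (\<lambda>s. ((\<zero>, \<zero>\<^bsub>W\<^esub>), s)) (\<lambda>r. ((\<zero>, r), \<zero>))"
  let ?h = "case_sum (\<lambda>s. lower_map A (f s)) (\<lambda>r. upper_map A (g r))"
  have "dual_basis (T2 A) (proj_mor U W) (S <+> R) ?a ?h"
    unfolding dual_basis_def
  proof (intro conjI ballI)
    show "finite (S <+> R)" using S(1) R(1) by simp
    show "?a \<in> S <+> R \<rightarrow> carrier (proj_mor U W)" using S(2) R(2) by (auto split: sum.split)
    show "?h s \<in> module_hom (T2 A) (proj_mor U W) (regular_module (T2 A))" if "s \<in> S <+> R" for s
      using that lower_map_hom[OF lU lW S(3)] upper_map_hom[OF lU lW R(3)] by auto
    fix q assume "q \<in> carrier (proj_mor U W)"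
    then obtain a b u where q: "q = ((a, b), u)" "a \<in> carrier U" "b \<in> carrier W" "u \<in> carrier U" by auto
    let ?F = "\<lambda>s. ?h s q \<odot>\<^bsub>proj_mor U W\<^esub> ?a s"
    have 1: "?F (Inl s) = ((f s a \<odot> s, \<zero>\<^bsub>W\<^esub>), f s u \<odot> s)" if "s \<in> S" for s
      using that q fc S(2) by (simp add: proj_mor_smult[OF lU lW])
    have 2: "?F (Inr r) = ((\<zero>, g r b \<odot>\<^bsub>W\<^esub> r), \<zero>)" if "r \<in> R" for r
      using that q gc R(2) by (simp add: proj_mor_smult[OF lU lW])
    have F1: "?F \<in> Inl ` S \<rightarrow> carrier (proj_mor U W)"
    proof (rule funcsetI, elim imageE, hypsubst)
      fix s assume "s \<in> S"
      then show "?F (Inl s) \<in> carrier (proj_mor U W)" using 1 fc S(2) q by simp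
    qed
    have F2: "?F \<in> Inr ` R \<rightarrow> carrier (proj_mor U W)"
    proof (rule funcsetI, elim imageE, hypsubst)
      fix s assume "s \<in> R"
      then show "?F (Inr s) \<in> carrier (proj_mor U W)" using 2 gc R(2) q by simp
    qed
    have "finsum (proj_mor U W) ?F (S <+> R) =
        finsum (proj_mor U W) ?F (Inl ` S) \<oplus>\<^bsub>proj_mor U W\<^esub> finsum (proj_mor U W) ?F (Inr ` R)"
      unfolding Plus_def by (rule Q.M.finsum_Un_disjoint) (use S(1) R(1) F1 F2 in auto)
    also have "finsum (proj_mor U W) ?F (Inl ` S) = (\<Oplus>\<^bsub>proj_mor U W\<^esub>s\<in>S. ?F (Inl s))"
      by (rule Q.M.finsum_reindex[OF F1]) simp
    also have "\<dots> = (\<Oplus>\<^bsub>proj_mor U W\<^esub>s\<in>S. ((f s a \<odot> s, \<zero>\<^bsub>W\<^esub>), f s u \<odot> s))"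
      by (rule Q.M.finsum_cong'[OF refl _ 1]) (use fc S(2) q in auto)
    also have "\<dots> = ((\<Oplus>s\<in>S. f s a \<odot> s, \<Oplus>\<^bsub>W\<^esub>s\<in>S. \<zero>\<^bsub>W\<^esub>), \<Oplus>s\<in>S. f s u \<odot> s)"
      by (rule finsum_proj_mor[OF lU lW S(1)]) (use fc S(2) q in auto)
    also have "finsum (proj_mor U W) ?F (Inr ` R) = (\<Oplus>\<^bsub>proj_mor U W\<^esub>r\<in>R. ?F (Inr r))"
      by (rule Q.M.finsum_reindex[OF F2]) simp
    also have "\<dots> = (\<Oplus>\<^bsub>proj_mor U W\<^esub>r\<in>R. ((\<zero>, g r b \<odot>\<^bsub>W\<^esub> r), \<zero>))"
      by (rule Q.M.finsum_cong'[OF refl _ 2]) (use gc R(2) q in auto)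
    also have "\<dots> = ((\<Oplus>r\<in>R. \<zero>, \<Oplus>\<^bsub>W\<^esub>r\<in>R. g r b \<odot>\<^bsub>W\<^esub> r), \<Oplus>r\<in>R. \<zero>)"
      by (rule finsum_proj_mor[OF lU lW R(1)]) (use gc R(2) q in auto)
    finally show "finsum (proj_mor U W) ?F (S <+> R) = q"
      using q by (simp add: S(4) R(4))
  qed
  then show "fg_module (T2 A) (proj_mor U W)" "projective (T2 A) (proj_mor U W)"
    by (rule dual_basis_fg[OF lQ], rule dual_basis_projective[OF lQ])
qed

lemma proj_mor_cover:
  fixes B (structure) and A :: "('k, 'r) module"
  assumes X: "left_module A X" and B: "left_module A B" and s: "s \<in> module_hom A X B"
    and cov: "projective_cover A U t X" and W: "fg_module A W" "projective A W" and w: "w \<in> module_hom A W B"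
    and onto: "\<And>b. b \<in> carrier B \<Longrightarrow> \<exists>x\<in>carrier X. \<exists>y\<in>carrier W. b = s x \<oplus> w y"
    and sf: "superfluous A W {y \<in> carrier W. w y \<in> s ` carrier X}"
  shows "projective_cover (T2 A) (proj_mor U W) (\<lambda>((a, b), u). (s (t a) \<oplus> w b, t u)) (mor_to_T2 (X, s, B))"
proof -
  note U = projective_coverD[OF cov]
  note lW = fg_left_module[OF W(1)]
  let ?Q = "proj_mor U W" and ?q = "\<lambda>((a, b), u). (s (t a) \<oplus> w b, t u)" and ?M = "mor_to_T2 (X, s, B)"
  interpret U: left_module A U by (rule U(6))
  interpret W: left_module A W by (rule lW)
  interpret X: left_module A X by (rule X)
  interpret B: left_module A B by (rule B)
  note lQ = left_module_proj_mor[OF U(6) lW] and lM = left_module_mor_to_T2[OF X B s]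
  note sm = proj_mor_smult[OF U(6) lW]
  note tf = hom_facts[OF U(3)] and wf = hom_facts[OF w] and sf' = hom_facts[OF s]
  have q: "?q \<in> module_hom (T2 A) ?Q ?M"
  proof (rule module_homI)
    fix m m' assume "m \<in> carrier ?Q" "m' \<in> carrier ?Q"
    then show "?q (m \<oplus>\<^bsub>?Q\<^esub> m') = ?q m \<oplus>\<^bsub>?M\<^esub> ?q m'"
      by (auto simp: tf wf sf' B.M.a_ac)
  next
    fix r m assume "r \<in> carrier (T2 A)" "m \<in> carrier ?Q"
    then show "?q (r \<odot>\<^bsub>?Q\<^esub> m) = r \<odot>\<^bsub>?M\<^esub> ?q m"
      by (auto simp: sm tf wf sf' B.M.a_ac B.smult_r_distr)
  qed (auto simp: tf wf sf')
  have "?q ` carrier ?Q = carrier ?M"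
  proof
    show "?q ` carrier ?Q \<subseteq> carrier ?M" using hom_closed[OF q] by (rule image_subsetI)
    show "carrier ?M \<subseteq> ?q ` carrier ?Q"
    proof
      fix m assume "m \<in> carrier ?M"
      then obtain b x where m: "m = (b, x)" "b \<in> carrier B" "x \<in> carrier X" by auto
      from onto[OF m(2)] obtain x' y where y: "x' \<in> carrier X" "y \<in> carrier W" "b = s x' \<oplus> w y" by (elim bexE)
      obtain a where a: "a \<in> carrier U" "x' = t a" using y(1) unfolding U(4)[symmetric] by (elim imageE)
      obtain u where u: "u \<in> carrier U" "x = t u" using m(3) unfolding U(4)[symmetric] by (elim imageE)
      show "m \<in> ?q ` carrier ?Q"
        by (rule image_eqI[of _ _ "((a, y), u)"]) (use m y a u in auto)
    qed
  qed
  moreover have "superfluous (T2 A) ?Q (ker_set ?Q ?q ?M)"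
  proof (rule superfluousI[OF ker_set_submodule[OF lQ lM q]])
    fix N m assume N: "submodule N (T2 A) ?Q"
      and sum: "\<And>y. y \<in> carrier ?Q \<Longrightarrow> \<exists>n\<in>N. \<exists>z\<in>ker_set ?Q ?q ?M. y = n \<oplus>\<^bsub>?Q\<^esub> z"
      and m: "m \<in> carrier ?Q"
    let ?oU = "\<zero>\<^bsub>U\<^esub>" and ?oW = "\<zero>\<^bsub>W\<^esub>"
    note Nsm = submodule_smult[OF N]
    \<comment> \<open>The diagonal idempotents and the corner unit extract components without
      leaving \<open>N\<close>, which reduces the question to U and W separately.\<close>
    have low: "((?oU, ?oW), u) \<in> N" if "((a, b), u) \<in> N" for a b u
    proof -
      have "((a, b), u) \<in> carrier ?Q" by (rule submodule_mem[OF N that])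
      then show ?thesis using Nsm[OF _ that, of "(\<zero>\<^bsub>A\<^esub>, \<zero>\<^bsub>A\<^esub>, \<one>\<^bsub>A\<^esub>)"] by (simp add: sm)
    qed
    have sU: "submodule {u \<in> carrier U. ((?oU, ?oW), u) \<in> N} A U"
    proof (rule U.submoduleI)
      show "?oU \<in> {u \<in> carrier U. ((?oU, ?oW), u) \<in> N}" using submodule_zero_mem[OF N] by simp
      show "a \<oplus>\<^bsub>U\<^esub> b \<in> {u \<in> carrier U. ((?oU, ?oW), u) \<in> N}"
        if "a \<in> {u \<in> carrier U. ((?oU, ?oW), u) \<in> N}" "b \<in> {u \<in> carrier U. ((?oU, ?oW), u) \<in> N}" for a b
        using submodule_add[OF N, of "((?oU, ?oW), a)" "((?oU, ?oW), b)"] that by simp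
      show "r \<odot>\<^bsub>U\<^esub> a \<in> {u \<in> carrier U. ((?oU, ?oW), u) \<in> N}"
        if "r \<in> carrier A" "a \<in> {u \<in> carrier U. ((?oU, ?oW), u) \<in> N}" for r a
        using Nsm[of "(\<zero>\<^bsub>A\<^esub>, \<zero>\<^bsub>A\<^esub>, r)" "((?oU, ?oW), a)"] that by (simp add: sm)
    qed blast
    have "{u \<in> carrier U. ((?oU, ?oW), u) \<in> N} = carrier U"
    proof (rule superfluousD[OF U(5) U(6) sU])
      fix u assume u: "u \<in> carrier U"
      obtain n z where n: "n \<in> N" and z: "z \<in> ker_set ?Q ?q ?M" and eq: "((?oU, ?oW), u) = n \<oplus>\<^bsub>?Q\<^esub> z"
        using sum[of "((?oU, ?oW), u)"] u by auto
      obtain a b v where nn: "n = ((a, b), v)" by (metis surj_pair)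
      obtain a' b' v' where zz: "z = ((a', b'), v')" by (metis surj_pair)
      show "\<exists>n\<in>{u \<in> carrier U. ((?oU, ?oW), u) \<in> N}. \<exists>z\<in>ker_set U t X. u = n \<oplus>\<^bsub>U\<^esub> z"
        using low[of a b v] n z eq submodule_mem[OF N n] unfolding nn zz
        by (intro bexI[of _ v] bexI[of _ v']) (auto simp: ker_set_def)
    qed
    then have lowN: "((?oU, ?oW), u) \<in> N" if "u \<in> carrier U" for u using that by blast
    \<comment> \<open>The upper copy of U is the image of the lower one under the corner
      unit.\<close>
    have leftN: "((u, ?oW), ?oU) \<in> N" if "u \<in> carrier U" for u
      using Nsm[OF _ lowN[OF that], of "(\<zero>\<^bsub>A\<^esub>, \<one>\<^bsub>A\<^esub>, \<zero>\<^bsub>A\<^esub>)"] that by (simp add: sm)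
    have up: "((?oU, b), ?oU) \<in> N" if n: "((a, b), u) \<in> N" for a b u
    proof -
      have c: "a \<in> carrier U" "b \<in> carrier W" "u \<in> carrier U" using submodule_mem[OF N n] by simp_all
      have 1: "((a, b), ?oU) \<in> N"
        using Nsm[OF _ n, of "(\<one>\<^bsub>A\<^esub>, \<zero>\<^bsub>A\<^esub>, \<zero>\<^bsub>A\<^esub>)"] c by (simp add: sm)
      have "((a, b), ?oU) \<oplus>\<^bsub>?Q\<^esub> ((\<ominus>\<^bsub>U\<^esub> a, ?oW), ?oU) \<in> N"
        by (rule submodule_add[OF N 1 leftN]) (use c in simp)
      then show ?thesis using c by (simp add: U.M.r_neg)
    qed
    have sW: "submodule {b \<in> carrier W. ((?oU, b), ?oU) \<in> N} A W"
    proof (rule W.submoduleI)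
      show "?oW \<in> {b \<in> carrier W. ((?oU, b), ?oU) \<in> N}" using submodule_zero_mem[OF N] by simp
      show "a \<oplus>\<^bsub>W\<^esub> b \<in> {b \<in> carrier W. ((?oU, b), ?oU) \<in> N}"
        if "a \<in> {b \<in> carrier W. ((?oU, b), ?oU) \<in> N}" "b \<in> {b \<in> carrier W. ((?oU, b), ?oU) \<in> N}" for a b
        using submodule_add[OF N, of "((?oU, a), ?oU)" "((?oU, b), ?oU)"] that by simp
      show "r \<odot>\<^bsub>W\<^esub> a \<in> {b \<in> carrier W. ((?oU, b), ?oU) \<in> N}"
        if "r \<in> carrier A" "a \<in> {b \<in> carrier W. ((?oU, b), ?oU) \<in> N}" for r a
        using Nsm[of "(r, \<zero>\<^bsub>A\<^esub>, \<zero>\<^bsub>A\<^esub>)" "((?oU, a), ?oU)"] that by (simp add: sm)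
    qed blast
    have "{b \<in> carrier W. ((?oU, b), ?oU) \<in> N} = carrier W"
    proof (rule superfluousD[OF sf lW sW])
      fix y assume y: "y \<in> carrier W"
      obtain n z where n: "n \<in> N" and z: "z \<in> ker_set ?Q ?q ?M" and eq: "((?oU, y), ?oU) = n \<oplus>\<^bsub>?Q\<^esub> z"
        using sum[of "((?oU, y), ?oU)"] y by auto
      obtain a b v where nn: "n = ((a, b), v)" by (metis surj_pair)
      obtain a' b' v' where zz: "z = ((a', b'), v')" by (metis surj_pair)
      have z': "a' \<in> carrier U" "b' \<in> carrier W" "s (t a') \<oplus> w b' = \<zero>" using z unfolding zz ker_set_def by auto
      have "w b' = \<ominus> s (t a')"
        using z' by (intro B.M.minus_equality[symmetric]) (simp_all add: tf wf sf' B.M.a_comm)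
      also have "\<dots> = s (\<ominus>\<^bsub>X\<^esub> t a')" using z'(1) tf by (simp add: hom_minus[OF X B s])
      finally have "w b' \<in> s ` carrier X" using z'(1) tf by blast
      then show "\<exists>n\<in>{b \<in> carrier W. ((?oU, b), ?oU) \<in> N}. \<exists>z\<in>{y \<in> carrier W. w y \<in> s ` carrier X}. y = n \<oplus>\<^bsub>W\<^esub> z"
        using up[of a b v] n z' eq submodule_mem[OF N n] unfolding nn zz
        by (intro bexI[of _ b] bexI[of _ b']) auto
    qed
    then have upN: "((?oU, b), ?oU) \<in> N" if "b \<in> carrier W" for b using that by blast
    obtain a b u where mm: "m = ((a, b), u)" "a \<in> carrier U" "b \<in> carrier W" "u \<in> carrier U" using m by auto
    have "(((a, ?oW), ?oU) \<oplus>\<^bsub>?Q\<^esub> ((?oU, b), ?oU)) \<oplus>\<^bsub>?Q\<^esub> ((?oU, ?oW), u) \<in> N"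
      by (intro submodule_add[OF N] leftN upN lowN mm)
    then show "m \<in> N" using mm by simp
  qed
  ultimately show ?thesis
    unfolding projective_cover_def using proj_mor_projective[OF U(1,2) W] q by (intro conjI)
qed

lemma T2_mult_components [simp]:
  "fst (u \<otimes>\<^bsub>T2 A\<^esub> (r, s, t)) = fst u \<otimes>\<^bsub>A\<^esub> r"
  "fst (snd (u \<otimes>\<^bsub>T2 A\<^esub> (r, s, t))) = fst u \<otimes>\<^bsub>A\<^esub> s \<oplus>\<^bsub>A\<^esub> fst (snd u) \<otimes>\<^bsub>A\<^esub> t"
  "snd (snd (u \<otimes>\<^bsub>T2 A\<^esub> (r, s, t))) = snd (snd u) \<otimes>\<^bsub>A\<^esub> t"
  "fst ((r, s, t) \<otimes>\<^bsub>T2 A\<^esub> u) = r \<otimes>\<^bsub>A\<^esub> fst u"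
  "fst (snd ((r, s, t) \<otimes>\<^bsub>T2 A\<^esub> u)) = r \<otimes>\<^bsub>A\<^esub> fst (snd u) \<oplus>\<^bsub>A\<^esub> s \<otimes>\<^bsub>A\<^esub> snd (snd u)"
  "snd (snd ((r, s, t) \<otimes>\<^bsub>T2 A\<^esub> u)) = t \<otimes>\<^bsub>A\<^esub> snd (snd u)"
  by (cases u; simp)+

lemma T2_add_components [simp]:
  "fst (u \<oplus>\<^bsub>T2 A\<^esub> v) = fst u \<oplus>\<^bsub>A\<^esub> fst v"
  "fst (snd (u \<oplus>\<^bsub>T2 A\<^esub> v)) = fst (snd u) \<oplus>\<^bsub>A\<^esub> fst (snd v)"
  "snd (snd (u \<oplus>\<^bsub>T2 A\<^esub> v)) = snd (snd u) \<oplus>\<^bsub>A\<^esub> snd (snd v)"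
  by (cases u; cases v; simp)+

lemma T2_eqI: "fst u = fst v \<Longrightarrow> fst (snd u) = fst (snd v) \<Longrightarrow> snd (snd u) = snd (snd v) \<Longrightarrow> u = v"
  by (cases u; cases v; simp)

lemma star_T2_closed:
  assumes "f \<in> carrier (star (T2 A) Q)" "q \<in> carrier Q"
  shows "fst (f q) \<in> carrier A" "fst (snd (f q)) \<in> carrier A" "snd (snd (f q)) \<in> carrier A"
proof -
  have "f q \<in> carrier (T2 A)" using hom_closed[OF starD(1)[OF assms(1)] assms(2)] by simp
  then show "fst (f q) \<in> carrier A" "fst (snd (f q)) \<in> carrier A" "snd (snd (f q)) \<in> carrier A" by auto
qed

text \<open>Linearity under the matrix units leaves three free data: maps x and y from W to A and a
  map z from U to A, with ((a, b), u) sent to (x b, z a + y b, z u).\<close>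

lemma star_proj_mor_apply:
  fixes U (structure)
  assumes U: "left_module A U" and W: "left_module A W" and f: "f \<in> carrier (star (T2 A) (proj_mor U W))"
    and q: "a \<in> carrier U" "b \<in> carrier W" "u \<in> carrier U"
  shows "f ((a, b), u) = (fst (f ((\<zero>, b), \<zero>)),
    snd (snd (f ((\<zero>, \<zero>\<^bsub>W\<^esub>), a))) \<oplus>\<^bsub>A\<^esub> fst (snd (f ((\<zero>, b), \<zero>))),
    snd (snd (f ((\<zero>, \<zero>\<^bsub>W\<^esub>), u))))"
proof -
  interpret U: left_module A U by fact
  interpret W: left_module A W by fact
  let ?Q = "proj_mor U W" and ?oU = "\<zero>" and ?oW = "\<zero>\<^bsub>W\<^esub>" and ?o = "\<zero>\<^bsub>A\<^esub>" and ?i = "\<one>\<^bsub>A\<^esub>"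
  note c = star_T2_closed[OF f]
  note sm = proj_mor_smult[OF U W]
  have fadd: "f (x \<oplus>\<^bsub>?Q\<^esub> y) = f x \<oplus>\<^bsub>T2 A\<^esub> f y" if "x \<in> carrier ?Q" "y \<in> carrier ?Q" for x y
    using hom_add[OF starD(1)[OF f] that] by simp
  have fsm: "f (r \<odot>\<^bsub>?Q\<^esub> x) = r \<otimes>\<^bsub>T2 A\<^esub> f x" if "r \<in> carrier (T2 A)" "x \<in> carrier ?Q" for r x
    using hom_smult[OF starD(1)[OF f] that] by simp
  have low: "f ((?oU, ?oW), v) = (?o, ?o, ?i) \<otimes>\<^bsub>T2 A\<^esub> f ((?oU, ?oW), v)" if "v \<in> carrier U" for v
    using fsm[of "(?o, ?o, ?i)" "((?oU, ?oW), v)"] that by (simp add: sm)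
  have left: "f ((a, ?oW), ?oU) = (?o, ?i, ?o) \<otimes>\<^bsub>T2 A\<^esub> f ((?oU, ?oW), a)"
    using fsm[of "(?o, ?i, ?o)" "((?oU, ?oW), a)"] q by (simp add: sm)
  have up: "f ((?oU, b), ?oU) = (?i, ?o, ?o) \<otimes>\<^bsub>T2 A\<^esub> f ((?oU, b), ?oU)"
    using fsm[of "(?i, ?o, ?o)" "((?oU, b), ?oU)"] q by (simp add: sm)
  have low': "fst (f ((?oU, ?oW), v)) = ?o" "fst (snd (f ((?oU, ?oW), v))) = ?o" if "v \<in> carrier U" for v
    using arg_cong[OF low[OF that], of fst] arg_cong[OF low[OF that], of "\<lambda>x. fst (snd x)"]
      c[of "((?oU, ?oW), v)"] that by simp_all
  have up': "snd (snd (f ((?oU, b), ?oU))) = ?o"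
    using arg_cong[OF up, of "\<lambda>x. snd (snd x)"] c[of "((?oU, b), ?oU)"] q by simp
  have "f ((a, b), u) = f (((a, ?oW), ?oU) \<oplus>\<^bsub>?Q\<^esub> ((?oU, b), ?oU) \<oplus>\<^bsub>?Q\<^esub> ((?oU, ?oW), u))"
    using q by simp
  also have "\<dots> = f ((a, ?oW), ?oU) \<oplus>\<^bsub>T2 A\<^esub> f ((?oU, b), ?oU) \<oplus>\<^bsub>T2 A\<^esub> f ((?oU, ?oW), u)"
  proof -
    interpret Q: left_module "T2 A" ?Q by (rule left_module_proj_mor[OF U W])
    have "((a, ?oW), ?oU) \<in> carrier ?Q" "((?oU, b), ?oU) \<in> carrier ?Q" "((?oU, ?oW), u) \<in> carrier ?Q"
      using q by simp_all
    then show ?thesis by (simp only: fadd Q.M.a_closed)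
  qed
  also have "\<dots> = (fst (f ((?oU, b), ?oU)), snd (snd (f ((?oU, ?oW), a))) \<oplus>\<^bsub>A\<^esub> fst (snd (f ((?oU, b), ?oU))),
      snd (snd (f ((?oU, ?oW), u))))"
    unfolding left using q c[of "((?oU, ?oW), u)"] c[of "((?oU, ?oW), a)"] c[of "((?oU, b), ?oU)"]
    by (intro T2_eqI) (simp_all add: low' up')
  finally show ?thesis .
qed

lemma inj_right_hom:
  assumes "left_module A U"
  shows "(\<lambda>w. (\<zero>\<^bsub>U\<^esub>, w)) \<in> module_hom A W (prod_module U W)"
proof -
  interpret left_module A U by fact
  show ?thesis by (rule module_homI) simp_all
qed

text \<open>The parameter \<open>j\<close> is specialised to the inclusion of W and to the graph of
  a map from U to W, which produce the coordinates used in \<open>T2_to_mor_ar_ker\<close>.\<close>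

lemma star_upper_hom:
  fixes U (structure) and A :: "('k, 'r) module"
  assumes U: "left_module A U" and W: "left_module A W"
    and f: "f \<in> carrier (star (T2 A) (proj_mor U W))" and j: "j \<in> module_hom A X (prod_module U W)"
  shows "(\<lambda>x. fst (f (j x, \<zero>))) \<in> module_hom A X (regular_module A)" (is ?fst)
    and "(\<lambda>x. fst (snd (f (j x, \<zero>)))) \<in> module_hom A X (regular_module A)" (is ?snd)
proof -
  interpret U: left_module A U by (rule U)
  interpret W: left_module A W by (rule W)
  have jc: "j x \<in> carrier U \<times> carrier W" if "x \<in> carrier X" for x using hom_closed[OF j that] by simp
  then have q: "(j x, \<zero>) \<in> carrier (proj_mor U W)" if "x \<in> carrier X" for x using that by simp
  note c = star_T2_closed[OF f q]
  have add: "f (j (x \<oplus>\<^bsub>X\<^esub> y), \<zero>) = f (j x, \<zero>) \<oplus>\<^bsub>T2 A\<^esub> f (j y, \<zero>)"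
    if "x \<in> carrier X" "y \<in> carrier X" for x y
    using hom_add[OF starD(1)[OF f] q[OF that(1)] q[OF that(2)]] hom_add[OF j that] jc[OF that(1)] jc[OF that(2)]
    by (cases "j x"; cases "j y") simp
  have smult: "f (j (r \<odot>\<^bsub>X\<^esub> x), \<zero>) = (r, \<zero>\<^bsub>A\<^esub>, \<zero>\<^bsub>A\<^esub>) \<otimes>\<^bsub>T2 A\<^esub> f (j x, \<zero>)"
    if "r \<in> carrier A" "x \<in> carrier X" for r x
    using hom_smult[OF starD(1)[OF f] _ q[OF that(2)], of "(r, \<zero>\<^bsub>A\<^esub>, \<zero>\<^bsub>A\<^esub>)"] hom_smult[OF j that] jc[OF that(2)] that(1)
    by (cases "j x") (simp add: proj_mor_smult[OF U W])
  show ?fst by (rule module_homI) (simp_all add: add smult c)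
  show ?snd by (rule module_homI) (simp_all add: add smult c)
qed

context k_algebra
begin

text \<open>In the coordinates (x, y, z) of \<open>star_proj_mor_apply\<close>, a pullback along
  \<open>d\<close> of data (x', y', z') has first entry x' c, second -z' + y' c and third z' p.
  Modulo these, x is a map on P0 up to maps through \<open>c\<close>, and the pair (y, z) is
  determined by z + y p, as \<open>c p = 0\<close>. So the two idempotent parts of the translate are
  functionals on Hom(P0,A) killing maps through \<open>c\<close>, and functionals on
  Hom(P1,A).\<close>

lemma T2_to_mor_ar_ker:
  fixes P1 :: "('r, 'd) module" and P0 :: "('r, 'e) module" and I :: "('r, 'i) module"
  assumes P1: "left_module A P1" and P0: "left_module A P0" and I: "left_module A I" and J: "left_module k J"
    and p: "p \<in> module_hom A P1 P0" and c: "c \<in> module_hom A P0 I"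
    and cp: "\<And>x. x \<in> carrier P1 \<Longrightarrow> c (p x) = \<zero>\<^bsub>I\<^esub>"
    and d: "(\<lambda>((a, b), u). ((p a \<ominus>\<^bsub>P0\<^esub> b, c b), p u)) \<in> module_hom (T2 A) (proj_mor P1 P0) (proj_mor P0 I)"
  shows "mor_isomorphic A
    (T2_to_mor A (k_algebra.ar_ker k (T2 A) J (proj_mor P1 P0) (\<lambda>((a, b), u). ((p a \<ominus>\<^bsub>P0\<^esub> b, c b), p u)) (proj_mor P0 I)))
    (nakayama k J A P1, nakayama_map A P1 p P0, ar_ker J P0 c I)"
proof -
  interpret T: k_algebra k "T2 A" by (rule k_algebra_T2) (rule k_algebra_axioms)
  interpret P1: left_module A P1 by (rule P1)
  interpret P0: left_module A P0 by (rule P0)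
  interpret I: left_module A I by (rule I)
  interpret J: left_module k J by (rule J)
  let ?Q1 = "proj_mor P1 P0" and ?Q0 = "proj_mor P0 I" and ?d = "\<lambda>((a, b), u). ((p a \<ominus>\<^bsub>P0\<^esub> b, c b), p u)"
  let ?T = "T2 A" and ?V = "star (T2 A) (proj_mor P1 P0)" and ?VV = "star (T2 A) (proj_mor P0 I)"
  let ?Y = "T.ar_ker J ?Q1 ?d ?Q0" and ?o = "\<zero>" and ?i = "\<one>"
  let ?o1 = "\<zero>\<^bsub>P1\<^esub>" and ?oz = "\<zero>\<^bsub>P0\<^esub>" and ?oI = "\<zero>\<^bsub>I\<^esub>"
  note lQ1 = left_module_proj_mor[OF P1 P0] and lQ0 = left_module_proj_mor[OF P0 I]
  note sm = proj_mor_smult[OF P1 P0]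
  note lV = left_module_star[OF lQ1] and lS1 = left_module_star[OF P1] and lS0 = left_module_star[OF P0]
  interpret V: left_module "opp (T2 A)" ?V by (rule lV)
  have Q1E: "\<exists>a b u. q = ((a, b), u) \<and> a \<in> carrier P1 \<and> b \<in> carrier P0 \<and> u \<in> carrier P1" if "q \<in> carrier ?Q1" for q
    using that by auto
  note pc = hom_closed[OF p] and cc = hom_closed[OF c] and p0 = hom_zero[OF P1 P0 p]
  have Vadd: "(f \<oplus>\<^bsub>?V\<^esub> g) q = f q \<oplus>\<^bsub>?T\<^esub> g q" if "q \<in> carrier ?Q1" for f g q
    unfolding star_simps using that by (rule restrict_apply')
  have Vsm: "(r \<odot>\<^bsub>?V\<^esub> f) q = f q \<otimes>\<^bsub>?T\<^esub> r" if "q \<in> carrier ?Q1" for f r q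
    unfolding star_simps using that by (rule restrict_apply')
  have Vsc: "r \<odot>\<^bsub>?V\<^esub> f \<in> carrier ?V" if "r \<in> carrier ?T" "f \<in> carrier ?V" for r f
    using V.smult_closed[of r f] that by (simp only: opp_simps)
  have pb_d: "pullback ?Q1 ?d F \<in> carrier ?V" if "F \<in> carrier ?VV" for F
    by (rule hom_closed[OF pullback_star_hom[OF lQ1 lQ0 d] that])

  \<comment> \<open>\<open>X\<close> and \<open>G\<close> insert a map on P0 as first coordinate and
    a map on P1 as third coordinate; \<open>\<chi>\<close> and \<open>\<kappa>\<close> are left
    inverse to them.\<close>
  define X where "X h = restrict (upper_map A h) (carrier ?Q1)" for h
  define G where "G g = restrict (lower_map A g) (carrier ?Q1)" for g
  define \<chi> where "\<chi> f = (\<lambda>b\<in>carrier P0. fst (f ((?o1, b), ?o1)))" for f :: "('d \<times> 'e) \<times> 'd \<Rightarrow> 'r \<times> 'r \<times> 'r"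
  \<comment> \<open>Evaluating on the graph of \<open>p\<close> reads off z + y p, the combination
    of coordinates that survives modulo pullbacks along \<open>d\<close>.\<close>
  define \<kappa> where "\<kappa> f = (\<lambda>x\<in>carrier P1. fst (snd (f ((x, p x), ?o1))))" for f :: "('d \<times> 'e) \<times> 'd \<Rightarrow> 'r \<times> 'r \<times> 'r"
  have Xap: "X h ((a, b), u) = (h b, ?o, ?o)" if "a \<in> carrier P1" "b \<in> carrier P0" "u \<in> carrier P1" for h a b u
    using that by (simp add: X_def)
  have Gap: "G g ((a, b), u) = (?o, g a, g u)" if "a \<in> carrier P1" "b \<in> carrier P0" "u \<in> carrier P1" for g a b u
    using that by (simp add: G_def)
  have \<chi>ap: "\<chi> f b = fst (f ((?o1, b), ?o1))" if "b \<in> carrier P0" for f b using that by (simp add: \<chi>_def)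
  have \<kappa>ap: "\<kappa> f x = fst (snd (f ((x, p x), ?o1)))" if "x \<in> carrier P1" for f x using that by (simp add: \<kappa>_def)
  have XV: "X h \<in> carrier ?V" if "h \<in> carrier (star A P0)" for h
    unfolding X_def by (rule starI[OF lQ1 upper_map_hom[OF P1 P0 starD(1)[OF that]]])
  have GV: "G g \<in> carrier ?V" if "g \<in> carrier (star A P1)" for g
    unfolding G_def by (rule starI[OF lQ1 lower_map_hom[OF P1 P0 starD(1)[OF that]]])
  have s0c: "h b \<in> carrier A" if "h \<in> carrier (star A P0)" "b \<in> carrier P0" for h b
    using hom_closed[OF starD(1)[OF that(1)] that(2)] by simp
  have s1c: "g b \<in> carrier A" if "g \<in> carrier (star A P1)" "b \<in> carrier P1" for g b
    using hom_closed[OF starD(1)[OF that(1)] that(2)] by simp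
  note jr = inj_right_hom[OF P1, of P0] and jI = inj_right_hom[OF P0, of I]
  have jp: "(\<lambda>x. (x, p x)) \<in> module_hom A P1 (prod_module P1 P0)"
    using hom_facts[OF p] by (intro module_homI) simp_all
  have \<chi>V: "\<chi> f \<in> carrier (star A P0)" if "f \<in> carrier ?V" for f
    unfolding \<chi>_def by (rule starI[OF P0 star_upper_hom(1)[OF P1 P0 that jr]])
  have \<kappa>V: "\<kappa> f \<in> carrier (star A P1)" if "f \<in> carrier ?V" for f
    unfolding \<kappa>_def by (rule starI[OF P1 star_upper_hom(2)[OF P1 P0 that jp]])
  have scalT: "s \<odot>\<^bsub>?T\<^esub> \<one>\<^bsub>?T\<^esub> = (scal s, ?o, scal s)" if "s \<in> carrier k" for s
    using that by (simp add: kA.smult_r_null)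
  have V_eqI: "f = g" if "f \<in> carrier ?V" "g \<in> carrier ?V"
    "\<And>a b u. a \<in> carrier P1 \<Longrightarrow> b \<in> carrier P0 \<Longrightarrow> u \<in> carrier P1 \<Longrightarrow> f ((a, b), u) = g ((a, b), u)" for f g
  proof (rule star_eqI[OF that(1,2)])
    fix q assume "q \<in> carrier ?Q1"
    then show "f q = g q" using Q1E that(3) by blast
  qed
  have Gadd: "G (g \<oplus>\<^bsub>star A P1\<^esub> g') = G g \<oplus>\<^bsub>?V\<^esub> G g'"
    if g: "g \<in> carrier (star A P1)" "g' \<in> carrier (star A P1)" for g g'
  proof (rule V_eqI[OF GV V.M.a_closed[OF GV GV]])
    show "g \<oplus>\<^bsub>star A P1\<^esub> g' \<in> carrier (star A P1)"
      using g by (rule abelian_monoid.a_closed[OF abelian_group.axioms(1)[OF left_module.axioms(2)[OF lS1]]])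
    fix a b u assume q: "a \<in> carrier P1" "b \<in> carrier P0" "u \<in> carrier P1"
    have "(G g \<oplus>\<^bsub>?V\<^esub> G g') ((a, b), u) = G g ((a, b), u) \<oplus>\<^bsub>?T\<^esub> G g' ((a, b), u)" by (rule Vadd) (simp add: q)
    then show "G (g \<oplus>\<^bsub>star A P1\<^esub> g') ((a, b), u) = (G g \<oplus>\<^bsub>?V\<^esub> G g') ((a, b), u)"
      using q by (simp only: Gap[OF q]) simp
  qed fact+
  have Xadd: "X (g \<oplus>\<^bsub>star A P0\<^esub> g') = X g \<oplus>\<^bsub>?V\<^esub> X g'"
    if g: "g \<in> carrier (star A P0)" "g' \<in> carrier (star A P0)" for g g'
  proof (rule V_eqI[OF XV V.M.a_closed[OF XV XV]])
    show "g \<oplus>\<^bsub>star A P0\<^esub> g' \<in> carrier (star A P0)"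
      using g by (rule abelian_monoid.a_closed[OF abelian_group.axioms(1)[OF left_module.axioms(2)[OF lS0]]])
    fix a b u assume q: "a \<in> carrier P1" "b \<in> carrier P0" "u \<in> carrier P1"
    have "(X g \<oplus>\<^bsub>?V\<^esub> X g') ((a, b), u) = X g ((a, b), u) \<oplus>\<^bsub>?T\<^esub> X g' ((a, b), u)" by (rule Vadd) (simp add: q)
    then show "X (g \<oplus>\<^bsub>star A P0\<^esub> g') ((a, b), u) = (X g \<oplus>\<^bsub>?V\<^esub> X g') ((a, b), u)"
      using q by (simp only: Xap[OF q]) simp
  qed fact+
  have S1s: "r \<odot>\<^bsub>star A P1\<^esub> g \<in> carrier (star A P1)" if "r \<in> carrier A" "g \<in> carrier (star A P1)" for r g
    using left_module.smult_closed[OF lS1, of r g] that by (simp only: opp_simps)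
  have S0s: "r \<odot>\<^bsub>star A P0\<^esub> g \<in> carrier (star A P0)" if "r \<in> carrier A" "g \<in> carrier (star A P0)" for r g
    using left_module.smult_closed[OF lS0, of r g] that by (simp only: opp_simps)
  have Gsm: "G (r \<odot>\<^bsub>star A P1\<^esub> g) = (s, ?o, r) \<odot>\<^bsub>?V\<^esub> G g"
    if g: "g \<in> carrier (star A P1)" and r: "r \<in> carrier A" and s: "s \<in> carrier A" for g r s
  proof (rule V_eqI[OF GV[OF S1s[OF r g]] Vsc[OF _ GV[OF g]]])
    show "(s, ?o, r) \<in> carrier ?T" using r s by simp
    fix a b u assume q: "a \<in> carrier P1" "b \<in> carrier P0" "u \<in> carrier P1"
    have "((s, ?o, r) \<odot>\<^bsub>?V\<^esub> G g) ((a, b), u) = G g ((a, b), u) \<otimes>\<^bsub>?T\<^esub> (s, ?o, r)" by (rule Vsm) (simp add: q)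
    then show "G (r \<odot>\<^bsub>star A P1\<^esub> g) ((a, b), u) = ((s, ?o, r) \<odot>\<^bsub>?V\<^esub> G g) ((a, b), u)"
      using q r s s1c[OF g] by (simp only: Gap[OF q]) simp
  qed
  have Xsm: "X (r \<odot>\<^bsub>star A P0\<^esub> h) = (r, ?o, s) \<odot>\<^bsub>?V\<^esub> X h"
    if h: "h \<in> carrier (star A P0)" and r: "r \<in> carrier A" and s: "s \<in> carrier A" for h r s
  proof (rule V_eqI[OF XV[OF S0s[OF r h]] Vsc[OF _ XV[OF h]]])
    show "(r, ?o, s) \<in> carrier ?T" using r s by simp
    fix a b u assume q: "a \<in> carrier P1" "b \<in> carrier P0" "u \<in> carrier P1"
    have "((r, ?o, s) \<odot>\<^bsub>?V\<^esub> X h) ((a, b), u) = X h ((a, b), u) \<otimes>\<^bsub>?T\<^esub> (r, ?o, s)" by (rule Vsm) (simp add: q)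
    then show "X (r \<odot>\<^bsub>star A P0\<^esub> h) ((a, b), u) = ((r, ?o, s) \<odot>\<^bsub>?V\<^esub> X h) ((a, b), u)"
      using q r s s0c[OF h] by (simp only: Xap[OF q]) simp
  qed
  have Ghom: "G \<in> module_hom k (res (star A P1)) (restrict_scalars ?T ?V)"
  proof (rule module_homI; unfold restrict_scalars_simps)
    show "G (s \<odot> \<one> \<odot>\<^bsub>star A P1\<^esub> g) = (s \<odot>\<^bsub>?T\<^esub> \<one>\<^bsub>?T\<^esub>) \<odot>\<^bsub>?V\<^esub> G g"
      if "s \<in> carrier k" "g \<in> carrier (star A P1)" for s g
      unfolding scalT[OF that(1)] by (rule Gsm[OF that(2)]) (use that(1) in simp_all)
  qed (rule GV Gadd, assumption+)+
  have Xhom: "X \<in> module_hom k (res (star A P0)) (restrict_scalars ?T ?V)"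
  proof (rule module_homI; unfold restrict_scalars_simps)
    show "X (s \<odot> \<one> \<odot>\<^bsub>star A P0\<^esub> g) = (s \<odot>\<^bsub>?T\<^esub> \<one>\<^bsub>?T\<^esub>) \<odot>\<^bsub>?V\<^esub> X g"
      if "s \<in> carrier k" "g \<in> carrier (star A P0)" for s g
      unfolding scalT[OF that(1)] by (rule Xsm[OF that(2)]) (use that(1) in simp_all)
  qed (rule XV Xadd, assumption+)+
  have \<chi>sm: "\<chi> ((r, s, t) \<odot>\<^bsub>?V\<^esub> f) = r \<odot>\<^bsub>star A P0\<^esub> \<chi> f" for r s t f
    unfolding \<chi>_def star_simps(4)[where A = A and M = P0] by (rule restrict_ext) (simp add: Vsm del: star_simps)
  have \<kappa>sm: "\<kappa> ((r, ?o, t) \<odot>\<^bsub>?V\<^esub> f) = t \<odot>\<^bsub>star A P1\<^esub> \<kappa> f"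
    if f: "f \<in> carrier ?V" and t: "t \<in> carrier A" for r t f
    unfolding \<kappa>_def star_simps(4)[where A = A and M = P1]
  proof (rule restrict_ext)
    fix x assume x: "x \<in> carrier P1"
    have q: "((x, p x), ?o1) \<in> carrier ?Q1" using x pc by simp
    show "fst (snd (((r, ?o, t) \<odot>\<^bsub>?V\<^esub> f) ((x, p x), ?o1))) =
        (\<lambda>x\<in>carrier P1. fst (snd (f ((x, p x), ?o1)))) x \<otimes> t"
      unfolding Vsm[OF q] restrict_apply'[OF x] using star_T2_closed[OF f q] t by simp
  qed
  have \<chi>hom: "\<chi> \<in> module_hom k (restrict_scalars ?T ?V) (res (star A P0))"
  proof (rule module_homI; unfold restrict_scalars_simps)
    show "\<chi> (s \<odot>\<^bsub>?T\<^esub> \<one>\<^bsub>?T\<^esub> \<odot>\<^bsub>?V\<^esub> f) = (s \<odot> \<one>) \<odot>\<^bsub>star A P0\<^esub> \<chi> f"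
      if "s \<in> carrier k" "f \<in> carrier ?V" for s f
      unfolding scalT[OF that(1)] by (rule \<chi>sm)
    show "\<chi> (f \<oplus>\<^bsub>?V\<^esub> g) = \<chi> f \<oplus>\<^bsub>star A P0\<^esub> \<chi> g" if "f \<in> carrier ?V" "g \<in> carrier ?V" for f g
      unfolding \<chi>_def star_simps(3)[where A = A and M = P0] by (rule restrict_ext) (simp add: Vadd del: star_simps)
  qed (rule \<chi>V, assumption)
  have \<kappa>hom: "\<kappa> \<in> module_hom k (restrict_scalars ?T ?V) (res (star A P1))"
  proof (rule module_homI; unfold restrict_scalars_simps)
    show "\<kappa> (s \<odot>\<^bsub>?T\<^esub> \<one>\<^bsub>?T\<^esub> \<odot>\<^bsub>?V\<^esub> f) = (s \<odot> \<one>) \<odot>\<^bsub>star A P1\<^esub> \<kappa> f"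
      if "s \<in> carrier k" "f \<in> carrier ?V" for s f
      unfolding scalT[OF that(1)] by (rule \<kappa>sm[OF that(2)]) (use that(1) in simp)
    show "\<kappa> (f \<oplus>\<^bsub>?V\<^esub> g) = \<kappa> f \<oplus>\<^bsub>star A P1\<^esub> \<kappa> g" if "f \<in> carrier ?V" "g \<in> carrier ?V" for f g
      unfolding \<kappa>_def star_simps(3)[where A = A and M = P1] by (rule restrict_ext) (simp add: Vadd pc del: star_simps)
  qed (rule \<kappa>V, assumption)
  have \<chi>X: "\<chi> (X h) = h" if h: "h \<in> carrier (star A P0)" for h
    unfolding \<chi>_def by (rule restrict_eqI[OF starD(2)[OF h]]) (simp add: Xap)
  have \<kappa>G: "\<kappa> (G g) = g" if g: "g \<in> carrier (star A P1)" for g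
    unfolding \<kappa>_def by (rule restrict_eqI[OF starD(2)[OF g]]) (simp add: Gap pc)

  have X\<chi>: "(?i, ?o, ?o) \<odot>\<^bsub>?V\<^esub> f = X (\<chi> f)" if f: "f \<in> carrier ?V" for f
  proof (rule V_eqI[OF Vsc[OF _ f] XV[OF \<chi>V[OF f]]])
    fix a b u assume q: "a \<in> carrier P1" "b \<in> carrier P0" "u \<in> carrier P1"
    then have qc: "((a, b), u) \<in> carrier ?Q1" by simp
    show "((?i, ?o, ?o) \<odot>\<^bsub>?V\<^esub> f) ((a, b), u) = X (\<chi> f) ((a, b), u)"
      unfolding Vsm[OF qc] Xap[OF q] \<chi>ap[OF q(2)]
      using star_T2_closed[OF f qc] arg_cong[OF star_proj_mor_apply[OF P1 P0 f q], of fst]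
      by (intro T2_eqI) simp_all
  qed simp
  \<comment> \<open>The relation that eliminates the second coordinate: it comes from minus
    \<open>y\<close> on the lower copy of P0. The sign is opposite to that of \<open>b\<close> in
    \<open>d\<close>.\<close>
  have pullback_lower: "\<exists>F\<in>carrier ?VV. \<forall>a\<in>carrier P1. \<forall>b\<in>carrier P0. \<forall>u\<in>carrier P1.
      pullback ?Q1 ?d F ((a, b), u) = (?o, y b \<ominus> y (p a), \<ominus> y (p u))"
    if y: "y \<in> carrier (star A P0)" for y
  proof -
    note reg = left_module_regular[OF ring_A]
    let ?F = "\<lambda>q\<in>carrier ?Q0. lower_map A (\<lambda>x. \<ominus>\<^bsub>reg\<^esub> y x) q"
    have F: "?F \<in> carrier ?VV" by (rule starI[OF lQ0 lower_map_hom[OF P0 I hom_uminus[OF reg starD(1)[OF y]]]])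
    have "pullback ?Q1 ?d ?F ((a, b), u) = (?o, y b \<ominus> y (p a), \<ominus> y (p u))"
      if q: "a \<in> carrier P1" "b \<in> carrier P0" "u \<in> carrier P1" for a b u
    proof -
      have yc: "y b \<in> carrier A" "y (p a) \<in> carrier A" "y (p u) \<in> carrier A" using s0c[OF y] q pc by simp_all
      have "y (p a \<ominus>\<^bsub>P0\<^esub> b) = y (p a) \<ominus>\<^bsub>reg\<^esub> y b"
        by (rule hom_diff[OF P0 reg starD(1)[OF y] pc[OF q(1)] q(2)])
      also have "\<dots> = y (p a) \<ominus> y b" using yc by (simp add: a_minus_def ring_A)
      finally have "\<ominus> y (p a \<ominus>\<^bsub>P0\<^esub> b) = y b \<ominus> y (p a)" using A.minus_diff yc by simp
      moreover have "y (p a \<ominus>\<^bsub>P0\<^esub> b) \<in> carrier A" using s0c[OF y] pc q by simp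
      ultimately show ?thesis using q pc cc yc by (simp add: pullback_def ring_A)
    qed
    then show ?thesis by (intro bexI[OF _ F] ballI)
  qed

  have Ymem: "\<phi> \<in> carrier (dual k J ?T ?V)" "\<And>F. F \<in> carrier ?VV \<Longrightarrow> \<phi> (pullback ?Q1 ?d F) = \<zero>\<^bsub>J\<^esub>"
    if "\<phi> \<in> carrier ?Y" for \<phi>
    using that unfolding T.ar_ker_mem nakayama_def by (blast, blast)
  have YI: "\<phi> \<in> carrier ?Y"
    if "\<phi> \<in> carrier (dual k J ?T ?V)" "\<And>F. F \<in> carrier ?VV \<Longrightarrow> \<phi> (pullback ?Q1 ?d F) = \<zero>\<^bsub>J\<^esub>" for \<phi>
    using that unfolding T.ar_ker_mem nakayama_def by blast
  have lY: "left_module ?T ?Y" by (rule T.left_module_ar_ker[OF lQ1 lQ0 d J])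
  interpret Y: left_module ?T ?Y by (rule lY)
  have Yadd: "add ?Y = add (dual k J ?T ?V)" and Ysm: "smult ?Y = smult (dual k J ?T ?V)"
    by (simp_all add: T.ar_ker_def nakayama_def)
  have Yap: "(r \<odot>\<^bsub>?Y\<^esub> \<phi>) f = \<phi> (r \<odot>\<^bsub>?V\<^esub> f)" if "f \<in> carrier ?V" for r \<phi> f
    unfolding Ysm dual_simps using that by (rule restrict_apply')
  have Yaap: "(\<phi> \<oplus>\<^bsub>?Y\<^esub> \<psi>) f = \<phi> f \<oplus>\<^bsub>J\<^esub> \<psi> f" if "f \<in> carrier ?V" for \<phi> \<psi> f
    unfolding Yadd dual_simps using that by (rule restrict_apply')
  have \<phi>add: "\<phi> (f \<oplus>\<^bsub>?V\<^esub> g) = \<phi> f \<oplus>\<^bsub>J\<^esub> \<phi> g"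
    if "\<phi> \<in> carrier ?Y" "f \<in> carrier ?V" "g \<in> carrier ?V" for \<phi> f g
    using hom_add[OF dualD(1)[OF Ymem(1)[OF that(1)]], of f g] that(2,3) by (simp only: restrict_scalars_simps)
  have \<phi>c: "\<phi> f \<in> carrier J" if "\<phi> \<in> carrier ?Y" "f \<in> carrier ?V" for \<phi> f
    using hom_closed[OF dualD(1)[OF Ymem(1)[OF that(1)]], of f] that(2) by (simp only: restrict_scalars_simps)

  \<comment> \<open>The two parts of the translate cut out by the diagonal idempotents: functionals
    depending only on the second column of a map, respectively only on the first.\<close>
  define E1 where "E1 = (\<lambda>\<phi>. (?o, ?o, ?i) \<odot>\<^bsub>?Y\<^esub> \<phi>) ` carrier ?Y"
  define E0 where "E0 = (\<lambda>\<phi>. (?i, ?o, ?o) \<odot>\<^bsub>?Y\<^esub> \<phi>) ` carrier ?Y"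
  have idem: "\<phi> \<in> carrier ?Y" "\<epsilon> \<odot>\<^bsub>?Y\<^esub> \<phi> = \<phi>"
    if \<phi>: "\<phi> \<in> (\<lambda>\<phi>. \<epsilon> \<odot>\<^bsub>?Y\<^esub> \<phi>) ` carrier ?Y" and \<epsilon>: "\<epsilon> \<in> carrier ?T" "\<epsilon> \<otimes>\<^bsub>?T\<^esub> \<epsilon> = \<epsilon>" for \<phi> \<epsilon>
  proof -
    from \<phi> obtain \<psi> where \<psi>: "\<psi> \<in> carrier ?Y" "\<phi> = \<epsilon> \<odot>\<^bsub>?Y\<^esub> \<psi>" by (elim imageE)
    show "\<phi> \<in> carrier ?Y" unfolding \<psi>(2) by (rule Y.smult_closed[OF \<epsilon>(1) \<psi>(1)])
    show "\<epsilon> \<odot>\<^bsub>?Y\<^esub> \<phi> = \<phi>"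
      unfolding \<psi>(2) Y.smult_assoc1[OF \<epsilon>(1,1) \<psi>(1), symmetric] \<epsilon>(2) ..
  qed
  have E1E: "\<phi> \<in> carrier ?Y" "(?o, ?o, ?i) \<odot>\<^bsub>?Y\<^esub> \<phi> = \<phi>" if "\<phi> \<in> E1" for \<phi>
    by (rule idem[OF that[unfolded E1_def]]; simp)+
  have E0E: "\<phi> \<in> carrier ?Y" "(?i, ?o, ?o) \<odot>\<^bsub>?Y\<^esub> \<phi> = \<phi>" if "\<phi> \<in> E0" for \<phi>
    by (rule idem[OF that[unfolded E0_def]]; simp)+
  \<comment> \<open>The second column of \<open>f\<close> differs from \<open>G (\<kappa> f)\<close>
    by a pullback along \<open>d\<close>, which \<open>\<phi>\<close> kills.\<close>
  have \<phi>E1: "\<phi> f = \<phi> (G (\<kappa> f))" if \<phi>: "\<phi> \<in> E1" and f: "f \<in> carrier ?V" for \<phi> f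
  proof -
    let ?y = "\<lambda>b\<in>carrier P0. fst (snd (f ((?o1, b), ?o1)))"
    have y: "?y \<in> carrier (star A P0)"
      by (rule starI[OF P0 star_upper_hom(2)[OF P1 P0 f jr]])
    from pullback_lower[OF y] obtain F where F: "F \<in> carrier ?VV"
      "\<forall>a\<in>carrier P1. \<forall>b\<in>carrier P0. \<forall>u\<in>carrier P1.
        pullback ?Q1 ?d F ((a, b), u) = (?o, ?y b \<ominus> ?y (p a), \<ominus> ?y (p u))" by (elim bexE)
    have e: "(?o, ?o, ?i) \<odot>\<^bsub>?V\<^esub> f = G (\<kappa> f) \<oplus>\<^bsub>?V\<^esub> pullback ?Q1 ?d F"
    proof (rule V_eqI[OF Vsc[OF _ f] V.M.a_closed[OF GV[OF \<kappa>V[OF f]] pb_d[OF F(1)]]])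
      fix a b u assume q: "a \<in> carrier P1" "b \<in> carrier P0" "u \<in> carrier P1"
      then have qc: "((a, b), u) \<in> carrier ?Q1" by simp
      let ?z = "\<lambda>v. snd (snd (f ((?o1, ?oz), v)))"
      have zc: "?z v \<in> carrier A" if "v \<in> carrier P1" for v using star_T2_closed(3)[OF f, of "((?o1, ?oz), v)"] that by simp
      have yc: "?y v \<in> carrier A" if "v \<in> carrier P0" for v by (rule s0c[OF y that])
      have ap: "f ((a, b), u) = (fst (f ((?o1, b), ?o1)), ?z a \<oplus> ?y b, ?z u)"
        if "a \<in> carrier P1" "b \<in> carrier P0" "u \<in> carrier P1" for a b u
        using star_proj_mor_apply[OF P1 P0 f that] that(2) by simp
      have \<kappa>z: "\<kappa> f v = ?z v \<oplus> ?y (p v)" if "v \<in> carrier P1" for v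
        unfolding \<kappa>ap[OF that] using ap[of v "p v" ?o1] that pc by simp
      have 1: "((?o, ?o, ?i) \<odot>\<^bsub>?V\<^esub> f) ((a, b), u) = (?o, ?z a \<oplus> ?y b, ?z u)"
        unfolding Vsm[OF qc] ap[OF q] using star_T2_closed(1)[OF f, of "((?o1, b), ?o1)"] q zc[OF q(1)] zc[OF q(3)] yc[OF q(2)]
        by (simp del: restrict_apply)
      have 2: "(G (\<kappa> f) \<oplus>\<^bsub>?V\<^esub> pullback ?Q1 ?d F) ((a, b), u) =
          (?o, ?z a \<oplus> ?y (p a) \<oplus> (?y b \<ominus> ?y (p a)), ?z u \<oplus> ?y (p u) \<oplus> \<ominus> ?y (p u))"
        unfolding Vadd[OF qc] Gap[OF q] F(2)[THEN bspec, OF q(1), THEN bspec, OF q(2), THEN bspec, OF q(3)]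
          \<kappa>z[OF q(1)] \<kappa>z[OF q(3)] T2_simps by simp
      have yp: "?y (p a) \<in> carrier A" "?y (p u) \<in> carrier A" "?y b \<in> carrier A" using yc pc q by blast+
      have "?z a \<oplus> ?y (p a) \<oplus> (?y b \<ominus> ?y (p a)) = ?z a \<oplus> ?y b"
        using A.add_diff[OF yp(3,1)] A.a_assoc[OF zc[OF q(1)] yp(1) A.minus_closed[OF yp(3,1)]] by (simp only:)
      moreover have "?z u \<oplus> ?y (p u) \<oplus> \<ominus> ?y (p u) = ?z u"
        using A.a_assoc[OF zc[OF q(3)] yp(2) A.a_inv_closed[OF yp(2)]] A.r_neg[OF yp(2)] A.r_zero[OF zc[OF q(3)]] by (simp only:)
      ultimately show "((?o, ?o, ?i) \<odot>\<^bsub>?V\<^esub> f) ((a, b), u) = (G (\<kappa> f) \<oplus>\<^bsub>?V\<^esub> pullback ?Q1 ?d F) ((a, b), u)"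
        unfolding 1 2 by (simp only:)
    qed simp
    have "\<phi> f = \<phi> ((?o, ?o, ?i) \<odot>\<^bsub>?V\<^esub> f)" using Yap[OF f, of "(?o, ?o, ?i)" \<phi>] E1E(2)[OF \<phi>] by (simp only:)
    also have "\<dots> = \<phi> (G (\<kappa> f)) \<oplus>\<^bsub>J\<^esub> \<phi> (pullback ?Q1 ?d F)"
      unfolding e by (rule \<phi>add[OF E1E(1)[OF \<phi>] GV[OF \<kappa>V[OF f]] pb_d[OF F(1)]])
    also have "\<dots> = \<phi> (G (\<kappa> f))"
      using Ymem(2)[OF E1E(1)[OF \<phi>] F(1)] \<phi>c[OF E1E(1)[OF \<phi>] GV[OF \<kappa>V[OF f]]] by simp
    finally show ?thesis .
  qed
  have \<phi>E0: "\<phi> f = \<phi> (X (\<chi> f))" if \<phi>: "\<phi> \<in> E0" and f: "f \<in> carrier ?V" for \<phi> f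
    using Yap[OF f, of "(?i, ?o, ?o)" \<phi>] E0E(2)[OF \<phi>] X\<chi>[OF f] by (simp only:)

  let ?h1 = "\<lambda>\<phi>. \<lambda>g\<in>carrier (star A P1). \<phi> (G g)" and ?h0 = "\<lambda>\<phi>. \<lambda>h\<in>carrier (star A P0). \<phi> (X h)"
  let ?g1 = "\<lambda>\<beta>. \<lambda>f\<in>carrier ?V. \<beta> (\<kappa> f)" and ?g0 = "\<lambda>\<alpha>. \<lambda>f\<in>carrier ?V. \<alpha> (\<chi> f)"
  let ?M1 = "mk_module E1 \<zero>\<^bsub>?Y\<^esub> (add ?Y) (\<lambda>r \<phi>. (?o, ?o, r) \<odot>\<^bsub>?Y\<^esub> \<phi>)"
  let ?M0 = "mk_module E0 \<zero>\<^bsub>?Y\<^esub> (add ?Y) (\<lambda>r \<phi>. (r, ?o, ?o) \<odot>\<^bsub>?Y\<^esub> \<phi>)"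
  have iso1: "?h1 \<in> module_iso A ?M1 (nakayama k J A P1)"
  proof (rule module_isoI'[where g = ?g1])
    show "?h1 \<in> module_hom A ?M1 (nakayama k J A P1)"
    proof (rule module_homI; unfold mk_module_simps nakayama_def)
      fix \<phi> assume \<phi>: "\<phi> \<in> E1"
      show "?h1 \<phi> \<in> carrier (dual k J A (star A P1))"
        by (rule dualI[OF lS1 hom_compose[OF Ghom dualD(1)[OF Ymem(1)[OF E1E(1)[OF \<phi>]]]]])
      show "?h1 (\<phi> \<oplus>\<^bsub>?Y\<^esub> \<psi>) = ?h1 \<phi> \<oplus>\<^bsub>dual k J A (star A P1)\<^esub> ?h1 \<psi>" if "\<psi> \<in> E1" for \<psi>
        unfolding dual_simps by (rule restrict_ext) (simp only: Yaap[OF GV] restrict_apply')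
      show "?h1 ((?o, ?o, r) \<odot>\<^bsub>?Y\<^esub> \<phi>) = r \<odot>\<^bsub>dual k J A (star A P1)\<^esub> ?h1 \<phi>" if r: "r \<in> carrier A" for r
        unfolding dual_simps
      proof (rule restrict_ext)
        fix g assume g: "g \<in> carrier (star A P1)"
        show "((?o, ?o, r) \<odot>\<^bsub>?Y\<^esub> \<phi>) (G g) = ?h1 \<phi> (r \<odot>\<^bsub>star A P1\<^esub> g)"
          unfolding Yap[OF GV[OF g]] restrict_apply'[OF S1s[OF r g]] Gsm[OF g r A.zero_closed] ..
      qed
    qed
  next
    fix \<beta> assume "\<beta> \<in> carrier (nakayama k J A P1)"
    then have \<beta>: "\<beta> \<in> carrier (dual k J A (star A P1))" by (simp only: nakayama_def)
    have gd: "?g1 \<beta> \<in> carrier (dual k J ?T ?V)" by (rule T.dualI[OF lV hom_compose[OF \<kappa>hom dualD(1)[OF \<beta>]]])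
    have gY: "?g1 \<beta> \<in> carrier ?Y"
    proof (rule YI[OF gd])
      fix F assume F: "F \<in> carrier ?VV"
      have "F \<zero>\<^bsub>?Q0\<^esub> = \<zero>\<^bsub>?T\<^esub>" using hom_zero[OF lQ0 left_module_regular[OF T.ring_A] starD(1)[OF F]] by simp
      then have F0: "F ((?oz, ?oI), ?oz) = (?o, ?o, ?o)" by simp
      \<comment> \<open>On the graph of \<open>p\<close> the map \<open>d\<close> vanishes: its
        first entry is \<open>p x\<close> minus \<open>p x\<close>, its second is
        \<open>c (p x) = 0\<close>, and its lower entry is \<open>p\<close> of zero.\<close>
      have "\<kappa> (pullback ?Q1 ?d F) = \<zero>\<^bsub>star A P1\<^esub>"
        unfolding \<kappa>_def star_simps
        by (rule restrict_ext) (simp add: pullback_def pc cp p0 F0 P0.M.r_neg a_minus_def)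
      then show "?g1 \<beta> (pullback ?Q1 ?d F) = \<zero>\<^bsub>J\<^esub>"
        unfolding restrict_apply'[OF pb_d[OF F]]
        using hom_zero[OF restrict_right[OF lS1] J dualD(1)[OF \<beta>]] by (simp only: restrict_scalars_simps)
    qed
    have "(?o, ?o, ?i) \<odot>\<^bsub>?Y\<^esub> ?g1 \<beta> = ?g1 \<beta>"
    proof (rule dual_eqI[OF Ymem(1)[OF Y.smult_closed[OF _ gY]] gd])
      fix f assume f: "f \<in> carrier ?V"
      have fe: "(?o, ?o, ?i) \<odot>\<^bsub>?V\<^esub> f \<in> carrier ?V" by (rule Vsc[OF _ f]) simp
      have "\<kappa> ((?o, ?o, ?i) \<odot>\<^bsub>?V\<^esub> f) = \<kappa> f"
        unfolding \<kappa>sm[OF f A.one_closed]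
        using left_module.smult_one[OF lS1 \<kappa>V[OF f]] by (simp only: opp_simps)
      then show "((?o, ?o, ?i) \<odot>\<^bsub>?Y\<^esub> ?g1 \<beta>) f = ?g1 \<beta> f"
        unfolding Yap[OF f] restrict_apply'[OF fe] restrict_apply'[OF f] by (simp only:)
    qed simp
    then show "?g1 \<beta> \<in> carrier ?M1" unfolding mk_module_simps E1_def
      by (intro image_eqI[OF _ gY]) (rule sym)
    show "?h1 (?g1 \<beta>) = \<beta>"
    proof (rule restrict_eqI[OF dualD(2)[OF \<beta>]])
      fix g assume g: "g \<in> carrier (star A P1)"
      show "?g1 \<beta> (G g) = \<beta> g" unfolding restrict_apply'[OF GV[OF g]] \<kappa>G[OF g] ..
    qed
  next
    fix \<phi> assume "\<phi> \<in> carrier ?M1"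
    then have \<phi>: "\<phi> \<in> E1" by (simp only: mk_module_simps)
    show "?g1 (?h1 \<phi>) = \<phi>"
    proof (rule restrict_eqI[OF dualD(2)[OF Ymem(1)[OF E1E(1)[OF \<phi>]]]])
      fix f assume f: "f \<in> carrier ?V"
      show "?h1 \<phi> (\<kappa> f) = \<phi> f" unfolding restrict_apply'[OF \<kappa>V[OF f]] by (rule \<phi>E1[OF \<phi> f, symmetric])
    qed
  qed
  have iso0: "?h0 \<in> module_iso A ?M0 (ar_ker J P0 c I)"
  proof (rule module_isoI'[where g = ?g0])
    show "?h0 \<in> module_hom A ?M0 (ar_ker J P0 c I)"
    proof (rule module_homI; unfold mk_module_simps)
      fix \<phi> assume \<phi>: "\<phi> \<in> E0"
      have "?h0 \<phi> (pullback P0 c g) = \<zero>\<^bsub>J\<^esub>" if g: "g \<in> carrier (star A I)" for g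
      proof -
        note gc = hom_closed[OF pullback_star_hom[OF P0 I c] g]
        let ?F = "\<lambda>q\<in>carrier ?Q0. upper_map A g q"
        have F: "?F \<in> carrier ?VV" by (rule starI[OF lQ0 upper_map_hom[OF P0 I starD(1)[OF g]]])
        \<comment> \<open>In the first coordinate the pullbacks along \<open>d\<close> are exactly
          the maps that factor through \<open>c\<close>; this inclusion makes \<open>?h0\<close>
          land in \<open>ar_ker\<close>, the converse below serves its inverse.\<close>
        have "X (pullback P0 c g) = pullback ?Q1 ?d ?F"
          by (rule V_eqI[OF XV[OF gc] pb_d[OF F]]) (simp add: Xap pullback_def pc cc)
        then show ?thesis unfolding restrict_apply'[OF gc] using Ymem(2)[OF E0E(1)[OF \<phi>] F] by (simp only:)
      qed
      moreover have "?h0 \<phi> \<in> carrier (nakayama k J A P0)"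
        unfolding nakayama_def by (rule dualI[OF lS0 hom_compose[OF Xhom dualD(1)[OF Ymem(1)[OF E0E(1)[OF \<phi>]]]]])
      ultimately show "?h0 \<phi> \<in> carrier (ar_ker J P0 c I)" unfolding ar_ker_mem by blast
      have ops: "add (ar_ker J P0 c I) = add (dual k J A (star A P0))" "smult (ar_ker J P0 c I) = smult (dual k J A (star A P0))"
        by (simp_all add: ar_ker_def nakayama_def)
      show "?h0 (\<phi> \<oplus>\<^bsub>?Y\<^esub> \<psi>) = ?h0 \<phi> \<oplus>\<^bsub>ar_ker J P0 c I\<^esub> ?h0 \<psi>" if "\<psi> \<in> E0" for \<psi>
        unfolding ops dual_simps by (rule restrict_ext) (simp only: Yaap[OF XV] restrict_apply')
      show "?h0 ((r, ?o, ?o) \<odot>\<^bsub>?Y\<^esub> \<phi>) = r \<odot>\<^bsub>ar_ker J P0 c I\<^esub> ?h0 \<phi>" if r: "r \<in> carrier A" for r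
        unfolding ops dual_simps
      proof (rule restrict_ext)
        fix g assume g: "g \<in> carrier (star A P0)"
        show "((r, ?o, ?o) \<odot>\<^bsub>?Y\<^esub> \<phi>) (X g) = ?h0 \<phi> (r \<odot>\<^bsub>star A P0\<^esub> g)"
          unfolding Yap[OF XV[OF g]] restrict_apply'[OF S0s[OF r g]] Xsm[OF g r A.zero_closed] ..
      qed
    qed
  next
    fix \<alpha> assume Z: "\<alpha> \<in> carrier (ar_ker J P0 c I)"
    then have \<alpha>: "\<alpha> \<in> carrier (dual k J A (star A P0))" unfolding ar_ker_mem nakayama_def by blast
    have gd: "?g0 \<alpha> \<in> carrier (dual k J ?T ?V)" by (rule T.dualI[OF lV hom_compose[OF \<chi>hom dualD(1)[OF \<alpha>]]])
    have gY: "?g0 \<alpha> \<in> carrier ?Y"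
    proof (rule YI[OF gd])
      fix F assume F: "F \<in> carrier ?VV"
      let ?x = "\<lambda>i\<in>carrier I. fst (F ((?oz, i), ?oz))"
      have x: "?x \<in> carrier (star A I)"
        by (rule starI[OF I star_upper_hom(1)[OF P0 I F jI]])
      have "\<chi> (pullback ?Q1 ?d F) = pullback P0 c ?x"
        unfolding \<chi>_def pullback_def[of P0]
      proof (rule restrict_ext)
        fix b assume b: "b \<in> carrier P0"
        have "fst (pullback ?Q1 ?d F ((?o1, b), ?o1)) = fst (F ((p ?o1 \<ominus>\<^bsub>P0\<^esub> b, c b), p ?o1))"
          using b by (simp add: pullback_def)
        also have "\<dots> = fst (F ((?oz, c b), ?oz))"
          using arg_cong[OF star_proj_mor_apply[OF P0 I F, of "p ?o1 \<ominus>\<^bsub>P0\<^esub> b" "c b" "p ?o1"], of fst] b cc pc by simp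
        finally show "fst (pullback ?Q1 ?d F ((?o1, b), ?o1)) = ?x (c b)" using cc[OF b] by simp
      qed
      then show "?g0 \<alpha> (pullback ?Q1 ?d F) = \<zero>\<^bsub>J\<^esub>"
        unfolding restrict_apply'[OF pb_d[OF F]] using Z x unfolding ar_ker_mem by simp
    qed
    have "(?i, ?o, ?o) \<odot>\<^bsub>?Y\<^esub> ?g0 \<alpha> = ?g0 \<alpha>"
    proof (rule dual_eqI[OF Ymem(1)[OF Y.smult_closed[OF _ gY]] gd])
      fix f assume f: "f \<in> carrier ?V"
      have fe: "(?i, ?o, ?o) \<odot>\<^bsub>?V\<^esub> f \<in> carrier ?V" by (rule Vsc[OF _ f]) simp
      have "\<chi> ((?i, ?o, ?o) \<odot>\<^bsub>?V\<^esub> f) = \<chi> f"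
        unfolding \<chi>sm using left_module.smult_one[OF lS0 \<chi>V[OF f]] by (simp only: opp_simps)
      then show "((?i, ?o, ?o) \<odot>\<^bsub>?Y\<^esub> ?g0 \<alpha>) f = ?g0 \<alpha> f"
        unfolding Yap[OF f] restrict_apply'[OF fe] restrict_apply'[OF f] by (simp only:)
    qed simp
    then show "?g0 \<alpha> \<in> carrier ?M0" unfolding mk_module_simps E0_def
      by (intro image_eqI[OF _ gY]) (rule sym)
    show "?h0 (?g0 \<alpha>) = \<alpha>"
    proof (rule restrict_eqI[OF dualD(2)[OF \<alpha>]])
      fix g assume g: "g \<in> carrier (star A P0)"
      show "?g0 \<alpha> (X g) = \<alpha> g" unfolding restrict_apply'[OF XV[OF g]] \<chi>X[OF g] ..
    qed
  next
    fix \<phi> assume "\<phi> \<in> carrier ?M0"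
    then have \<phi>: "\<phi> \<in> E0" by (simp only: mk_module_simps)
    show "?g0 (?h0 \<phi>) = \<phi>"
    proof (rule restrict_eqI[OF dualD(2)[OF Ymem(1)[OF E0E(1)[OF \<phi>]]]])
      fix f assume f: "f \<in> carrier ?V"
      show "?h0 \<phi> (\<chi> f) = \<phi> f" unfolding restrict_apply'[OF \<chi>V[OF f]] by (rule \<phi>E0[OF \<phi> f, symmetric])
    qed
  qed
  have "nakayama_map A P1 p P0 (?h1 \<phi>) = ?h0 ((?o, ?i, ?o) \<odot>\<^bsub>?Y\<^esub> \<phi>)" if \<phi>: "\<phi> \<in> E1" for \<phi>
    unfolding nakayama_map_def pullback_def[of "star A P0"]
  proof (rule restrict_ext)
    fix h assume h: "h \<in> carrier (star A P0)"
    note hp = hom_closed[OF pullback_star_hom[OF P1 P0 p] h]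
    from pullback_lower[OF h] obtain F where F: "F \<in> carrier ?VV"
      "\<forall>a\<in>carrier P1. \<forall>b\<in>carrier P0. \<forall>u\<in>carrier P1.
        pullback ?Q1 ?d F ((a, b), u) = (?o, h b \<ominus> h (p a), \<ominus> h (p u))" by (elim bexE)
    \<comment> \<open>The corner unit moves \<open>h\<close> from the first to the second
      coordinate, where \<open>pullback_lower\<close> replaces it by \<open>h\<close> after
      \<open>p\<close> in the third. This is how nu p appears as the structure map.\<close>
    have e: "(?o, ?i, ?o) \<odot>\<^bsub>?V\<^esub> X h = G (pullback P1 p h) \<oplus>\<^bsub>?V\<^esub> pullback ?Q1 ?d F"
    proof (rule V_eqI[OF Vsc[OF _ XV[OF h]] V.M.a_closed[OF GV[OF hp] pb_d[OF F(1)]]])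
      fix a b u assume q: "a \<in> carrier P1" "b \<in> carrier P0" "u \<in> carrier P1"
      then have qc: "((a, b), u) \<in> carrier ?Q1" by simp
      show "((?o, ?i, ?o) \<odot>\<^bsub>?V\<^esub> X h) ((a, b), u) = (G (pullback P1 p h) \<oplus>\<^bsub>?V\<^esub> pullback ?Q1 ?d F) ((a, b), u)"
        unfolding Vsm[OF qc] Vadd[OF qc] Gap[OF q] Xap[OF q]
          F(2)[THEN bspec, OF q(1), THEN bspec, OF q(2), THEN bspec, OF q(3)]
        using q s0c[OF h] pc by (simp add: pullback_def A.r_neg A.add_diff)
    qed simp
    have "((?o, ?i, ?o) \<odot>\<^bsub>?Y\<^esub> \<phi>) (X h) = \<phi> (G (pullback P1 p h)) \<oplus>\<^bsub>J\<^esub> \<phi> (pullback ?Q1 ?d F)"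
      unfolding Yap[OF XV[OF h]] e by (rule \<phi>add[OF E1E(1)[OF \<phi>] GV[OF hp] pb_d[OF F(1)]])
    also have "\<dots> = \<phi> (G (pullback P1 p h))"
      using Ymem(2)[OF E1E(1)[OF \<phi>] F(1)] \<phi>c[OF E1E(1)[OF \<phi>] GV[OF hp]] by simp
    finally show "?h1 \<phi> (pullback P1 p h) = ((?o, ?i, ?o) \<odot>\<^bsub>?Y\<^esub> \<phi>) (X h)"
      unfolding restrict_apply'[OF hp] by (rule sym)
  qed
  then have "\<forall>\<phi>\<in>carrier ?M1. nakayama_map A P1 p P0 (?h1 \<phi>) = ?h0 ((?o, ?i, ?o) \<odot>\<^bsub>?Y\<^esub> \<phi>)"
    by (simp only: mk_module_simps) blast
  then show ?thesis
    unfolding T2_to_mor_def mor_isomorphic_def prod.case E1_def[symmetric] E0_def[symmetric]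
    by (intro bexI[OF _ iso1] bexI[OF _ iso0])
qed

end

section \<open>The translate of an injective envelope\<close>

lemma mor_isomorphicI:
  "h1 \<in> module_iso R X X' \<Longrightarrow> h2 \<in> module_iso R Y Y' \<Longrightarrow> \<forall>x\<in>carrier X. g (h1 x) = h2 (f x) \<Longrightarrow>
    mor_isomorphic R (X, f, Y) (X', g, Y')"
  unfolding mor_isomorphic_def by blast

lemma mor_isomorphic_trans:
  assumes "mor_isomorphic A X Y" "mor_isomorphic A Y Z"
  shows "mor_isomorphic A X Z"
proof -
  obtain X1 f X2 Y1 g Y2 Z1 h Z2 where e: "X = (X1, f, X2)" "Y = (Y1, g, Y2)" "Z = (Z1, h, Z2)"
    by (metis surj_pair)
  from assms(1)[unfolded e mor_isomorphic_def prod.case] obtain a b where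
    a: "a \<in> module_iso A X1 Y1" "b \<in> module_iso A X2 Y2" "\<forall>x\<in>carrier X1. g (a x) = b (f x)" by (elim bexE)
  from assms(2)[unfolded e mor_isomorphic_def prod.case] obtain a' b' where
    a': "a' \<in> module_iso A Y1 Z1" "b' \<in> module_iso A Y2 Z2" "\<forall>x\<in>carrier Y1. h (a' x) = b' (g x)" by (elim bexE)
  have "h (a' (a x)) = b' (b (f x))" if x: "x \<in> carrier X1" for x
    using a'(3)[THEN bspec, OF hom_closed[OF iso_hom[OF a(1)] x]] a(3)[THEN bspec, OF x] by simp
  then show ?thesis
    unfolding e mor_isomorphic_def prod.case
    by (intro bexI[OF _ iso_compose[OF a(1) a'(1)]] bexI[OF _ iso_compose[OF a(2) a'(2)]] ballI)
qed

text \<open>One isomorphism of modules over \<open>T2 A\<close> serves on both idempotent parts, and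
  it commutes with the corner unit.\<close>

lemma mor_isomorphic_T2_to_mor:
  fixes A (structure)
  assumes A: "ring A" and X: "left_module (T2 A) X" and u: "u \<in> module_iso (T2 A) X Y"
  shows "mor_isomorphic A (T2_to_mor A X) (T2_to_mor A Y)"
proof -
  interpret A: ring A by fact
  interpret X: left_module "T2 A" X by fact
  note uh = iso_hom[OF u]
  have iso: "u \<in> module_iso A (mk_module ((\<lambda>x. \<epsilon> \<odot>\<^bsub>X\<^esub> x) ` carrier X) \<zero>\<^bsub>X\<^esub> (add X) (\<lambda>r x. \<iota> r \<odot>\<^bsub>X\<^esub> x))
      (mk_module ((\<lambda>x. \<epsilon> \<odot>\<^bsub>Y\<^esub> x) ` carrier Y) \<zero>\<^bsub>Y\<^esub> (add Y) (\<lambda>r x. \<iota> r \<odot>\<^bsub>Y\<^esub> x))"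
    if \<epsilon>: "\<epsilon> \<in> carrier (T2 A)" and \<iota>: "\<And>r. r \<in> carrier A \<Longrightarrow> \<iota> r \<in> carrier (T2 A)" for \<epsilon> \<iota>
  proof (rule module_isoI)
    let ?E = "(\<lambda>x. \<epsilon> \<odot>\<^bsub>X\<^esub> x) ` carrier X"
    have E: "x \<in> carrier X" if "x \<in> ?E" for x using that X.smult_closed[OF \<epsilon>] by blast
    have ue: "u (\<epsilon> \<odot>\<^bsub>X\<^esub> x) = \<epsilon> \<odot>\<^bsub>Y\<^esub> u x" if "x \<in> carrier X" for x by (rule hom_smult[OF uh \<epsilon> that])
    have im: "u ` ?E = (\<lambda>x. \<epsilon> \<odot>\<^bsub>Y\<^esub> x) ` carrier Y"
    proof -
      have "u ` ?E = (\<lambda>x. \<epsilon> \<odot>\<^bsub>Y\<^esub> u x) ` carrier X" unfolding image_image by (rule image_cong[OF refl ue])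
      also have "\<dots> = (\<lambda>x. \<epsilon> \<odot>\<^bsub>Y\<^esub> x) ` carrier Y" unfolding iso_surj[OF u, symmetric] image_image ..
      finally show ?thesis .
    qed
    then show "u ` carrier (mk_module ?E \<zero>\<^bsub>X\<^esub> (add X) (\<lambda>r x. \<iota> r \<odot>\<^bsub>X\<^esub> x)) =
        carrier (mk_module ((\<lambda>x. \<epsilon> \<odot>\<^bsub>Y\<^esub> x) ` carrier Y) \<zero>\<^bsub>Y\<^esub> (add Y) (\<lambda>r x. \<iota> r \<odot>\<^bsub>Y\<^esub> x))"
      by simp
    show "inj_on u (carrier (mk_module ?E \<zero>\<^bsub>X\<^esub> (add X) (\<lambda>r x. \<iota> r \<odot>\<^bsub>X\<^esub> x)))"
      unfolding mk_module_simps by (rule inj_on_subset[OF iso_inj[OF u]]) (rule subsetI, rule E)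
    show "u \<in> module_hom A (mk_module ?E \<zero>\<^bsub>X\<^esub> (add X) (\<lambda>r x. \<iota> r \<odot>\<^bsub>X\<^esub> x))
        (mk_module ((\<lambda>x. \<epsilon> \<odot>\<^bsub>Y\<^esub> x) ` carrier Y) \<zero>\<^bsub>Y\<^esub> (add Y) (\<lambda>r x. \<iota> r \<odot>\<^bsub>Y\<^esub> x))"
    proof (rule module_homI; unfold mk_module_simps)
      show "u x \<in> (\<lambda>x. \<epsilon> \<odot>\<^bsub>Y\<^esub> x) ` carrier Y" if "x \<in> ?E" for x
        using imageI[OF that, of u] unfolding im .
      show "u (x \<oplus>\<^bsub>X\<^esub> y) = u x \<oplus>\<^bsub>Y\<^esub> u y" if "x \<in> ?E" "y \<in> ?E" for x y
        by (rule hom_add[OF uh E[OF that(1)] E[OF that(2)]])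
      show "u (\<iota> r \<odot>\<^bsub>X\<^esub> x) = \<iota> r \<odot>\<^bsub>Y\<^esub> u x" if "r \<in> carrier A" "x \<in> ?E" for r x
        by (rule hom_smult[OF uh \<iota>[OF that(1)] E[OF that(2)]])
    qed
  qed
  have "u ((\<zero>, \<one>, \<zero>) \<odot>\<^bsub>X\<^esub> x) = (\<zero>, \<one>, \<zero>) \<odot>\<^bsub>Y\<^esub> u x"
    if "x \<in> (\<lambda>x. (\<zero>, \<zero>, \<one>) \<odot>\<^bsub>X\<^esub> x) ` carrier X" for x
  proof -
    from that have "x \<in> carrier X" by (elim imageE) (simp add: X.smult_closed)
    then show ?thesis by (intro hom_smult[OF uh]) simp_all
  qed
  then have comm: "\<forall>x\<in>(\<lambda>x. (\<zero>, \<zero>, \<one>) \<odot>\<^bsub>X\<^esub> x) ` carrier X.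
      (\<zero>, \<one>, \<zero>) \<odot>\<^bsub>Y\<^esub> u x = u ((\<zero>, \<one>, \<zero>) \<odot>\<^bsub>X\<^esub> x)"
    by (intro ballI) (rule sym)
  have 1: "(\<zero>, \<zero>, \<one>) \<in> carrier (T2 A)" "(\<one>, \<zero>, \<zero>) \<in> carrier (T2 A)"
    and 2: "\<And>r. r \<in> carrier A \<Longrightarrow> (\<zero>, \<zero>, r) \<in> carrier (T2 A)"
    "\<And>r. r \<in> carrier A \<Longrightarrow> (r, \<zero>, \<zero>) \<in> carrier (T2 A)"
    by simp_all
  show ?thesis
    unfolding T2_to_mor_def mor_isomorphic_def prod.case mk_module_simps
    by (rule bexI[where x = u], rule bexI[where x = u], rule comm)
      (rule iso[OF 1(2)], rule 2(2), assumption, rule iso[OF 1(1)], rule 2(1), assumption)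
qed

text \<open>Two applications of \<open>proj_mor_cover\<close>: first to C -> I, then to the kernel
  of that cover, recognised as the inclusion of the syzygy into P0.\<close>

lemma mor_presentation:
  fixes A :: "('k, 'r) module"
  assumes C: "left_module A C" and I: "fg_module A I" "projective A I" and e: "e \<in> module_hom A C I"
    and sf: "superfluous A I (e ` carrier C)"
    and cov0: "projective_cover A P0 p0 C" and cov1: "projective_cover A P1 p (ker_module P0 p0 C)"
  shows "min_proj_presentation (T2 A) (proj_mor P1 P0) (\<lambda>((a, b), u). ((p a \<ominus>\<^bsub>P0\<^esub> b, e (p0 b)), p u))
    (proj_mor P0 I) (\<lambda>((x, y), u). (e (p0 x) \<oplus>\<^bsub>I\<^esub> y, p0 u)) (mor_to_T2 (C, e, I))"
proof -
  let ?K = "ker_module P0 p0 C" and ?Q0 = "proj_mor P0 I" and ?Q1 = "proj_mor P1 P0"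
    and ?q = "\<lambda>((x, y), u). (e (p0 x) \<oplus>\<^bsub>I\<^esub> y, p0 u)" and ?d = "\<lambda>((a, b), u). ((p a \<ominus>\<^bsub>P0\<^esub> b, e (p0 b)), p u)"
    and ?M = "mor_to_T2 (C, e, I)"
  note P0 = projective_coverD[OF cov0] and P1 = projective_coverD[OF cov1]
  note lI = fg_left_module[OF I(1)]
  note lK = left_module_ker[OF P0(6) C P0(3)]
  interpret C: left_module A C by (rule C)
  interpret P0: left_module A P0 by (rule P0(6))
  interpret P1: left_module A P1 by (rule P1(6))
  interpret I: left_module A I by (rule lI)
  have Kin: "x \<in> carrier P0" "p0 x = \<zero>\<^bsub>C\<^esub>" if "x \<in> carrier ?K" for x using that by (simp_all add: ker_set_def)
  have incl: "(\<lambda>x. x) \<in> module_hom A ?K P0" by (rule module_homI) (simp_all add: Kin del: ker_module_carrier)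
  have cov0': "projective_cover (T2 A) ?Q0 ?q ?M"
  proof (rule proj_mor_cover[OF C lI e cov0 I hom_ident])
    show "\<exists>x\<in>carrier C. \<exists>y\<in>carrier I. b = e x \<oplus>\<^bsub>I\<^esub> y" if "b \<in> carrier I" for b
      using that by (intro bexI[of _ "\<zero>\<^bsub>C\<^esub>"] bexI[of _ b]) (simp_all add: hom_zero[OF C lI e])
    have "{y \<in> carrier I. y \<in> e ` carrier C} = e ` carrier C" using hom_closed[OF e] by blast
    then show "superfluous A I {y \<in> carrier I. y \<in> e ` carrier C}" using sf by simp
  qed
  \<comment> \<open>An element of the kernel has second entry minus \<open>e (p0 x)\<close>, with
    \<open>x\<close> free in P0, and lower entry in the syzygy; so the kernel is the object Omega(C)
    -> P0.\<close>
  let ?N = "mor_to_T2 (?K, (\<lambda>x. x), P0)" and ?i = "\<lambda>(x, u). ((x, \<ominus>\<^bsub>I\<^esub> e (p0 x)), u)"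
  \<comment> \<open>The cokernel of the inclusion of the syzygy is covered by P0 with a minus sign.
    It cancels the sign in \<open>?i\<close>, so that \<open>d\<close> has the plain entry
    \<open>e (p0 b)\<close>.\<close>
  have min: "(\<lambda>b. \<ominus>\<^bsub>P0\<^esub> b) \<in> module_hom A P0 P0" by (rule hom_uminus[OF P0(6) hom_ident])
  have cov1': "projective_cover (T2 A) ?Q1 (\<lambda>((a, b), u). (p a \<oplus>\<^bsub>P0\<^esub> \<ominus>\<^bsub>P0\<^esub> b, p u)) ?N"
  proof (rule proj_mor_cover[OF lK P0(6) incl cov1 P0(1,2) min])
    show "\<exists>x\<in>carrier ?K. \<exists>y\<in>carrier P0. b = x \<oplus>\<^bsub>P0\<^esub> \<ominus>\<^bsub>P0\<^esub> y" if "b \<in> carrier P0" for b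
      using that by (intro bexI[of _ "\<zero>\<^bsub>P0\<^esub>"] bexI[of _ "\<ominus>\<^bsub>P0\<^esub> b"])
        (simp_all add: ker_set_def hom_zero[OF P0(6) C P0(3)])
    have "{y \<in> carrier P0. \<ominus>\<^bsub>P0\<^esub> y \<in> (\<lambda>x. x) ` carrier ?K} = ker_set P0 p0 C"
    proof -
      have "p0 (\<ominus>\<^bsub>P0\<^esub> y) = \<zero>\<^bsub>C\<^esub> \<longleftrightarrow> p0 y = \<zero>\<^bsub>C\<^esub>" if "y \<in> carrier P0" for y
        using that hom_closed[OF P0(3) that] C.M.minus_minus[of "p0 y"]
        by (auto simp: hom_minus[OF P0(6) C P0(3)])
      then show ?thesis by (auto simp: ker_set_def)
    qed
    then show "superfluous A P0 {y \<in> carrier P0. \<ominus>\<^bsub>P0\<^esub> y \<in> (\<lambda>x. x) ` carrier ?K}" using P0(5) by simp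
  qed
  note lQ0 = left_module_proj_mor[OF P0(6) lI] and lM = left_module_mor_to_T2[OF C lI e]
  have lKQ: "left_module (T2 A) (ker_module ?Q0 ?q ?M)"
    by (rule left_module_ker[OF lQ0 lM projective_coverD(3)[OF cov0']])
  have lN: "left_module (T2 A) ?N" by (rule left_module_mor_to_T2[OF lK P0(6) incl])
  note pf = hom_facts[OF P0(3)] and ef = hom_facts[OF e]
  have iso: "?i \<in> module_iso (T2 A) ?N (ker_module ?Q0 ?q ?M)"
  proof (rule module_isoI'[where g = "\<lambda>((x, y), u). (x, u)"])
    show "?i \<in> module_hom (T2 A) ?N (ker_module ?Q0 ?q ?M)"
    proof (rule module_homI)
      show "?i m \<in> carrier (ker_module ?Q0 ?q ?M)" if "m \<in> carrier ?N" for m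
        using that pf ef by (auto simp: ker_set_def I.M.r_neg)
      show "?i (m \<oplus>\<^bsub>?N\<^esub> m') = ?i m \<oplus>\<^bsub>ker_module ?Q0 ?q ?M\<^esub> ?i m'" if "m \<in> carrier ?N" "m' \<in> carrier ?N" for m m'
        using that pf ef by (auto simp: ker_set_def I.M.minus_add I.M.a_comm)
      show "?i (r \<odot>\<^bsub>?N\<^esub> m) = r \<odot>\<^bsub>ker_module ?Q0 ?q ?M\<^esub> ?i m" if "r \<in> carrier (T2 A)" "m \<in> carrier ?N" for r m
        using that pf ef
        by (auto simp: ker_set_def proj_mor_smult[OF P0(6) lI] I.smult_r_minus)
    qed
    fix m assume "m \<in> carrier (ker_module ?Q0 ?q ?M)"
    then obtain x y u where m: "m = ((x, y), u)" "x \<in> carrier P0" "y \<in> carrier I" "u \<in> carrier P0"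
      "e (p0 x) \<oplus>\<^bsub>I\<^esub> y = \<zero>\<^bsub>I\<^esub>" "p0 u = \<zero>\<^bsub>C\<^esub>" by (auto simp: ker_set_def)
    have "\<ominus>\<^bsub>I\<^esub> e (p0 x) = y"
      using m pf ef by (intro I.M.minus_equality) (simp_all add: I.M.a_comm)
    then show "?i ((\<lambda>((x, y), u). (x, u)) m) = m" using m by simp
    show "(\<lambda>((x, y), u). (x, u)) m \<in> carrier ?N" using m by (simp add: ker_set_def)
  next
    show "(\<lambda>((x, y), u). (x, u)) (?i m) = m" for m by (cases m) simp
  qed
  have "projective_cover (T2 A) ?Q1 ?d (ker_module ?Q0 ?q ?M)"
  proof (rule projective_cover_cong[OF projective_cover_target[OF cov1' lN lKQ iso]])
    fix m assume "m \<in> carrier ?Q1"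
    then obtain a b u where m: "m = ((a, b), u)" "a \<in> carrier P1" "b \<in> carrier P0" "u \<in> carrier P1" by auto
    have pa: "p a \<in> carrier P0" "p0 (p a) = \<zero>\<^bsub>C\<^esub>" using Kin[OF hom_closed[OF P1(3) m(2)]] by blast+
    have "p0 (p a \<ominus>\<^bsub>P0\<^esub> b) = p0 (p a) \<ominus>\<^bsub>C\<^esub> p0 b" by (rule hom_diff[OF P0(6) C P0(3) pa(1) m(3)])
    also have "\<dots> = \<ominus>\<^bsub>C\<^esub> p0 b" using pa(2) pf(1)[OF m(3)] by (simp add: a_minus_def)
    finally have "\<ominus>\<^bsub>I\<^esub> e (p0 (p a \<ominus>\<^bsub>P0\<^esub> b)) = e (p0 b)"
      using pf(1)[OF m(3)] ef(1) by (simp add: hom_minus[OF C lI e])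
    then show "?d m = ?i ((\<lambda>((a, b), u). (p a \<oplus>\<^bsub>P0\<^esub> \<ominus>\<^bsub>P0\<^esub> b, p u)) m)"
      unfolding m(1) by (simp add: a_minus_def)
  qed
  with cov0' show ?thesis unfolding min_proj_presentation_def by (rule conjI)
qed

context self_inj_alg
begin

lemma min_presentation_cosyzygy:
  assumes C: "left_module A C" and nps: "no_projective_summands A C" and env: "injective_envelope A C e I"
    and cov: "projective_cover A P0 p0 C"
  shows "min_proj_presentation A P0 (\<lambda>x. e (p0 x)) I (\<lambda>x. e ` carrier C +>\<^bsub>I\<^esub> x) (quot_module I (e ` carrier C))"
    and "projective A I" and "superfluous A I (e ` carrier C)" and "submodule (e ` carrier C) A I"
proof -
  have I: "fg_module A I" "injective A I" and e: "e \<in> module_hom A C I" "inj_on e (carrier C)"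
    using env by (simp_all add: injective_envelope_def)
  note lI = fg_left_module[OF I(1)]
  interpret C: left_module A C by (rule C)
  show pI: "projective A I" by (rule injective_imp_projective[OF I])
  show sf: "superfluous A I (e ` carrier C)" by (rule superfluous_envelope[OF I(1) pI C e nps])
  then show sub: "submodule (e ` carrier C) A I" by (rule superfluous_submodule)
  let ?q = "\<lambda>x. e ` carrier C +>\<^bsub>I\<^esub> x" and ?W = "quot_module I (e ` carrier C)"
  have ker: "ker_set I ?q ?W = e ` carrier C"
    using coset_zero_iff[OF lI sub] submodule_subset[OF sub] by (auto simp: ker_set_def)
  have c1: "projective_cover A I ?q ?W"
    unfolding projective_cover_def ker
    using I(1) pI coset_hom[OF lI sub] coset_surj[OF lI sub] sf by (intro conjI)
  have lker: "left_module A (ker_module I ?q ?W)"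
    by (rule left_module_ker[OF lI left_module_quot[OF lI sub] coset_hom[OF lI sub]])
  have "e \<in> module_iso A C (ker_module I ?q ?W)"
  proof (rule module_isoI[OF _ e(2)])
    show "e \<in> module_hom A C (ker_module I ?q ?W)"
      unfolding ker_module_def ker by (rule hom_restrict_cod[OF e(1)]) simp
    show "e ` carrier C = carrier (ker_module I ?q ?W)" unfolding ker_module_carrier ker ..
  qed
  from c1 projective_cover_target[OF cov C lker this]
  show "min_proj_presentation A P0 (\<lambda>x. e (p0 x)) I ?q ?W" unfolding min_proj_presentation_def by (rule conjI)
qed

text \<open>Functoriality for P1 -> Omega(C) -> P0: it identifies the structure map into nu P0 with
  nu of the cover of the syzygy.\<close>

lemma nakayama_map_syzygy:
  assumes \<beta>: "p \<in> module_hom A P1 (ker_module P0 p0 C)" and lm: "left_module A P1" "left_module A P0" "left_module A C"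
    "p0 \<in> module_hom A P0 C"
  shows "nakayama_map A (ker_module P0 p0 C) (\<lambda>x. x) P0 (nakayama_map A P1 p (ker_module P0 p0 C) \<beta>) = nakayama_map A P1 p P0 \<beta>"
  unfolding nakayama_map_def pullback_def[of "star A P0"]
proof (rule restrict_ext)
  let ?K = "ker_module P0 p0 C"
  fix f assume f: "f \<in> carrier (star A P0)"
  have \<iota>: "(\<lambda>x. x) \<in> module_hom A ?K P0" by (intro module_homI) (auto simp: ker_set_def)
  note fK = hom_closed[OF pullback_star_hom[OF left_module_ker[OF lm(2-4)] lm(2) \<iota>] f]
  have "pullback P1 p (pullback ?K (\<lambda>x. x) f) = pullback P1 p f"
    unfolding pullback_def by (rule restrict_ext) (rule restrict_apply'[OF hom_closed[OF assms(1)]])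
  then show "pullback (star A ?K) (pullback P1 p) \<beta> (pullback ?K (\<lambda>x. x) f) = \<beta> (pullback P1 p f)"
    unfolding pullback_def[of "star A ?K"] restrict_apply'[OF fK] by (simp only:)
qed

text \<open>Composes three isomorphisms: from the chosen presentation to the explicit one, from
  functionals over \<open>T2 A\<close> to pairs over A, and from the kernel inside nu P0 to nu of
  the syzygy.\<close>

lemma mor_ar_translate_envelope:
  assumes C: "fg_module A C" and nps: "no_projective_summands A C" and env: "injective_envelope A C e I"
    and cov0: "projective_cover A P0 p0 C" and cov1: "projective_cover A P1 p (ker_module P0 p0 C)"
  shows "mor_isomorphic A (mor_ar_translate k J A (C, e, I))
    (nakayama k J A P1, nakayama_map A P1 p (ker_module P0 p0 C), nakayama k J A (ker_module P0 p0 C))"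
proof -
  let ?K = "ker_module P0 p0 C" and ?M = "mor_to_T2 (C, e, I)"
  let ?d = "\<lambda>((a, b), u). ((p a \<ominus>\<^bsub>P0\<^esub> b, e (p0 b)), p u)"
  have I: "fg_module A I" and e: "e \<in> module_hom A C I" "inj_on e (carrier C)"
    using env by (simp_all add: injective_envelope_def)
  note P0 = projective_coverD[OF cov0] and P1 = projective_coverD[OF cov1]
  note lC = fg_left_module[OF C] and lI = fg_left_module[OF I]
  note lK = left_module_ker[OF P0(6) lC P0(3)]
  note min = min_presentation_cosyzygy[OF lC nps env cov0]
  have Kin: "x \<in> carrier P0" "p0 x = \<zero>\<^bsub>C\<^esub>" if "x \<in> carrier ?K" for x using that by (simp_all add: ker_set_def)
  interpret T: k_algebra k "T2 A" by (rule k_algebra_T2) (rule k_algebra_axioms)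
  note lM = left_module_mor_to_T2[OF lC lI e(1)]
  have pres: "min_proj_presentation (T2 A) (proj_mor P1 P0) ?d (proj_mor P0 I) (\<lambda>((x, y), u). (e (p0 x) \<oplus>\<^bsub>I\<^esub> y, p0 u)) ?M"
    by (rule mor_presentation[OF lC I min(2) e(1) min(3) cov0 cov1])
  have d: "?d \<in> module_hom (T2 A) (proj_mor P1 P0) (proj_mor P0 I)"
    using projective_coverD(3)[OF min_proj_presentationD(2)[OF pres]] unfolding ker_module_def
    by (rule hom_incl) (auto simp: ker_set_def)
  note lQ = left_module_proj_mor[OF P1(6) P0(6)] left_module_proj_mor[OF P0(6) lI]
  note lY = T.left_module_ar_ker[OF lQ d left_module_J]
  from T.ar_translate_iso[OF pres lM left_module_J] obtain u where
    u: "u \<in> module_iso (T2 A) (T.ar_ker J (proj_mor P1 P0) ?d (proj_mor P0 I)) (ar_translate k J (T2 A) ?M)" by (elim exE)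
  from iso_inverseE[OF lY u] obtain v where
    v: "v \<in> module_iso (T2 A) (ar_translate k J (T2 A) ?M) (T.ar_ker J (proj_mor P1 P0) ?d (proj_mor P0 I))" by (elim bexE)
  note ltr = T.left_module_ar_translate[OF pres lM left_module_J]
  have 1: "mor_isomorphic A (mor_ar_translate k J A (C, e, I))
      (T2_to_mor A (T.ar_ker J (proj_mor P1 P0) ?d (proj_mor P0 I)))"
    unfolding mor_ar_translate_def by (rule mor_isomorphic_T2_to_mor[OF ring_A ltr v])
  have p': "p \<in> module_hom A P1 P0" using P1(3) unfolding ker_module_def by (rule hom_incl) (auto simp: ker_set_def)
  have ep: "e (p0 (p x)) = \<zero>\<^bsub>I\<^esub>" if "x \<in> carrier P1" for x
    using Kin(2)[OF hom_closed[OF P1(3) that]] hom_zero[OF lC lI e(1)] by simp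
  have 2: "mor_isomorphic A (T2_to_mor A (T.ar_ker J (proj_mor P1 P0) ?d (proj_mor P0 I)))
      (nakayama k J A P1, nakayama_map A P1 p P0, ar_ker J P0 (\<lambda>x. e (p0 x)) I)"
    by (rule T2_to_mor_ar_ker[OF P1(6) P0(6) lI left_module_J p' hom_compose[OF P0(3) e(1)] ep d])
  note \<theta> = nakayama_syzygy_iso[OF P0(1) C I P0(3,4) e]
  let ?\<theta> = "nakayama_map A ?K (\<lambda>x. x) P0"
  from iso_inverseE[OF left_module_nakayama[OF lK left_module_J] \<theta>] obtain \<eta> where
    \<eta>: "\<eta> \<in> module_iso A (ar_ker J P0 (\<lambda>x. e (p0 x)) I) (nakayama k J A ?K)"
      "(\<forall>x\<in>carrier (nakayama k J A ?K). \<eta> (?\<theta> x) = x) \<and> (\<forall>y\<in>carrier (ar_ker J P0 (\<lambda>x. e (p0 x)) I). ?\<theta> (\<eta> y) = y)"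
    by (elim bexE)
  have "nakayama_map A P1 p ?K \<beta> = \<eta> (nakayama_map A P1 p P0 \<beta>)" if \<beta>: "\<beta> \<in> carrier (nakayama k J A P1)" for \<beta>
    unfolding nakayama_map_syzygy[OF P1(3,6) P0(6) lC P0(3), symmetric]
    using \<eta>(2)[THEN conjunct1, THEN bspec, OF hom_closed[OF nakayama_map_hom[OF P1(6) lK P1(3)] \<beta>]] by (rule sym)
  then have 3: "mor_isomorphic A (nakayama k J A P1, nakayama_map A P1 p P0, ar_ker J P0 (\<lambda>x. e (p0 x)) I)
      (nakayama k J A P1, nakayama_map A P1 p ?K, nakayama k J A ?K)"
    unfolding mor_isomorphic_def prod.case by (intro bexI[OF _ iso_ident] bexI[OF _ \<eta>(1)] ballI)
  show ?thesis by (rule mor_isomorphic_trans[OF mor_isomorphic_trans[OF 1 2] 3])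
qed

text \<open>Both nu Omega(C) and the translate of the cosyzygy are the same \<open>ar_ker\<close>
  inside nu P0, and nu P1 covers the first by \<open>nakayama_cover\<close>; uniqueness of covers
  does the rest.\<close>

lemma nakayama_syzygy_ar_translate:
  assumes C: "fg_module A C" and nps: "no_projective_summands A C" and env: "injective_envelope A C e I"
    and cov0: "projective_cover A P0 p0 C" and cov1: "projective_cover A P1 p (ker_module P0 p0 C)"
    and cov: "projective_cover A P q (ar_translate k J A (quot_module I (e ` carrier C)))"
  shows "mor_isomorphic A
    (nakayama k J A P1, nakayama_map A P1 p (ker_module P0 p0 C), nakayama k J A (ker_module P0 p0 C))
    (P, q, ar_translate k J A (quot_module I (e ` carrier C)))"
proof -
  let ?K = "ker_module P0 p0 C" and ?tr = "ar_translate k J A (quot_module I (e ` carrier C))"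
  have I: "fg_module A I" and e: "e \<in> module_hom A C I" "inj_on e (carrier C)"
    using env by (simp_all add: injective_envelope_def)
  note P0 = projective_coverD[OF cov0] and P1 = projective_coverD[OF cov1]
  note lC = fg_left_module[OF C] and lI = fg_left_module[OF I]
  note lK = left_module_ker[OF P0(6) lC P0(3)]
  note min = min_presentation_cosyzygy[OF lC nps env cov0]
  from ar_translate_iso[OF min(1) left_module_quot[OF lI min(4)] left_module_J] obtain w where
    w: "w \<in> module_iso A (ar_ker J P0 (\<lambda>x. e (p0 x)) I) ?tr" by (elim exE)
  note i = iso_compose[OF nakayama_syzygy_iso[OF P0(1) C I P0(3,4) e] w]
  note ltr = left_module_ar_translate[OF min(1) left_module_quot[OF lI min(4)] left_module_J]
  from projective_cover_unique[OF nakayama_cover[OF cov1 lK] cov left_module_nakayama[OF lK left_module_J] ltr i]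
  obtain u where u: "u \<in> module_iso A (nakayama k J A P1) P"
    "\<forall>x\<in>carrier (nakayama k J A P1). q (u x) =
      w (nakayama_map A ?K (\<lambda>x. x) P0 (nakayama_map A P1 p ?K x))" by (elim bexE)
  show ?thesis by (rule mor_isomorphicI[OF u(1) i]) (rule u(2))
qed

end

theorem proposition2p3:
  fixes k :: "'k ring" and J :: "('k, 'j) module" and \<Lambda> :: "('k, 'r) module"
    and C :: "('r, 'c) module" and I :: "('r, 'i) module" and e :: "'c \<Rightarrow> 'i"
    and P0 :: "('r, 'p0) module" and p0 :: "'p0 \<Rightarrow> 'c"
    and P1 :: "('r, 'p1) module" and \<pi> :: "'p1 \<Rightarrow> 'p0"
    and \<Omega>C :: "('r, 'p0) module" and \<Omega>invC :: "('r, 'i set) module"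
  assumes "artin_algebra k \<Lambda>" and "dualizing_module k J" and "self_injective \<Lambda>"
    and "fg_module \<Lambda> C" and "no_projective_summands \<Lambda> C"
    and "injective_envelope \<Lambda> C e I" and "\<Omega>invC = quot_module I (e ` carrier C)"
    and "projective_cover \<Lambda> P0 p0 C" and "\<Omega>C = ker_module P0 p0 C"
    and "projective_cover \<Lambda> P1 \<pi> \<Omega>C"
  shows "mor_isomorphic \<Lambda> (mor_ar_translate k J \<Lambda> (C, e, I))
           (nakayama k J \<Lambda> P1, nakayama_map \<Lambda> P1 \<pi> \<Omega>C, nakayama k J \<Lambda> \<Omega>C) \<and>
         (\<forall>(P :: ('r, 'p) module) p. projective_cover \<Lambda> P p (ar_translate k J \<Lambda> \<Omega>invC) \<longrightarrow>
           mor_isomorphic \<Lambda> (mor_ar_translate k J \<Lambda> (C, e, I))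
             (P, p, ar_translate k J \<Lambda> \<Omega>invC))"
proof -
  have "self_inj_alg k J \<Lambda>"
    using assms(1-3)
    by (auto simp: artin_algebra_def artinian_cring_def self_inj_alg_def self_inj_alg_axioms_def artin_alg_def
        artin_alg_axioms_def artin_dual_def k_algebra_def)
  then interpret self_inj_alg k J \<Lambda> .
  note cov = assms(10)[unfolded assms(9)]
  have iso: "mor_isomorphic \<Lambda> (mor_ar_translate k J \<Lambda> (C, e, I))
      (nakayama k J \<Lambda> P1, nakayama_map \<Lambda> P1 \<pi> (ker_module P0 p0 C), nakayama k J \<Lambda> (ker_module P0 p0 C))"
    by (rule mor_ar_translate_envelope[OF assms(4-6,8) cov])
  show ?thesis
    unfolding assms(7,9)
    by (intro conjI allI impI iso mor_isomorphic_trans[OF iso nakayama_syzygy_ar_translate[OF assms(4-6,8) cov]])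
qed

end
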